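(* Let $(M^3,g,V)$ be an ALH static system with infinity $\widehat\Sigma=S^2$ and horizon boundary $\partial M=\bigsqcup_{j=1}^J\partial_jM$, such that $\chi(\partial_jM)\le0$ for $j\in\{2,\dots,J\}$ and all horizons have the same surface gravity, $\kappa_j=\kappa$ for each $j\in\{1,\dots,J\}$. Then the metric $$\mathrm g=V^2d\theta^2+g,\qquad\theta\in S^1(\lambda),$$ is smooth only if $\lambda=\kappa^{-1}\le(\sqrt3)^{-1}$. In particular, $(M^3,g,V)$ does not yield (through $\mathrm g$) a Poincaré-Einstein filling of $(S^2\times S^1(\lambda),\,d\theta^2+\widehat g)$ for any $\lambda>(\sqrt3)^{-1}$.
   Context: **ALH static system.** An asymptotically locally hyperbolic (ALH) static system $(M^3,g,V)$ is a connected, non-compact Riemannian manifold $(M^3,g)$ with a positive potential function $V\in C^\infty(M^3)$ such that: (1) $D^2V=V\,\mathrm{Ric}+3V g$ and $\Delta_g V=3V$ on $M^3$ ($D^2V$ is the Hessian). (2) There are a closed oriented surface $(\widehat\Sigma^2,\widehat g)$ of constant Gauss curvature $\widehat k\in\{1,0,-1\}$ (the infinity), a compact set $K_0\subset M^3$, and a diffeomorphism $\widehat\Sigma\times(\rho_0,\infty)\to M^3\setminus K_0$ under which $g=\overline g+q$ with $\overline g=(\widehat k+\rho^2)^{-1}d\rho^2+\rho^2\widehat g$, where $|q|_{\overline g}+|\overline\nabla q|_{\overline g}+|\overline\nabla^2q|_{\overline g}+|\overline\nabla^3q|_{\overline g}=O(\rho^{-\alpha})$ for some $\alpha>2$, and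 $V=\sqrt{\widehat k+\rho^2}+o_1(\rho^{-1})$ (the error and its first derivative, measured in $\overline g$, are $o(\rho^{-1})$). (3) $M^3$ has compact $C^\infty$ boundary $\partial M=\bigsqcup_{j=1}^J\partial_j M$ ($J\ge 1$) with connected components $\partial_j M$ (horizons), $V$ extends smoothly to $0$ on $\partial M$, and $\partial M=\{V=0\}$ is a regular level set of $V$. $\widehat\Sigma=S^2$ means the infinity is the round unit sphere ($\widehat k=1$). The surface gravity $\kappa_j=\frac{\partial V}{\partial\nu}|_{\partial_jM}$ ($\nu$ the unit normal pointing into $M$) is a positive constant on $\partial_jM$ by the static equations. $S^1(\lambda)$ is the circle of length $2\pi\lambda$, with coordinate $\theta\in[0,2\pi\lambda]$. The metric $\mathrm g$ satisfies $\mathrm{Ric}(\mathrm g)=-3\mathrm g$ where $V>0$ and in general has conical singularities at $\{V=0\}$. "Smooth" refers to smoothness of $\mathrm g$ on the 4-manifold obtained from $S^1(\lambda)\times M$ by collapsing the circle factor over $\partial M$ (so that a neighborhood of each horizon becomes $D^2\times\partial_jM$). A Poincaré-Einstein filling of a closed Riemannian 3-manifold $(N,h)$ is a smooth conformally compact Einstein 4-manifold, $\mathrm{Ric}(\mathrm g)=-3\mathrm g$, whose conformal infinity is the conformal class of $(N,h)$. *)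

theory Defs
  imports "HOL-Analysis.Analysis" "HOL-Homology.Homology"
begin

section \<open>Smooth maps on open subsets of Euclidean spaces and half-spaces\<close>

text \<open>Derivatives are taken within \<open>S\<close>, so that one-sided derivatives are meant at the boundary
  points of a relatively open subset \<open>S\<close> of a closed half-space; for the sets used below
  the derivative within \<open>S\<close> is unique.\<close>

definition dd :: "'e::euclidean_space set \<Rightarrow> ('e \<Rightarrow> 'f::real_normed_vector) \<Rightarrow> 'e \<Rightarrow> 'e \<Rightarrow> 'f" where
  "dd S f x = frechet_derivative f (at x within S)"

primrec Ck_on :: "nat \<Rightarrow> 'e::euclidean_space set \<Rightarrow> ('e \<Rightarrow> 'f::real_normed_vector) \<Rightarrow> bool" where
  "Ck_on 0 S f \<longleftrightarrow> continuous_on S f"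
| "Ck_on (Suc k) S f \<longleftrightarrow> f differentiable_on S \<and> (\<forall>b\<in>Basis. Ck_on k S (\<lambda>x. dd S f x b))"

definition smooth_on :: "'e::euclidean_space set \<Rightarrow> ('e \<Rightarrow> 'f::real_normed_vector) \<Rightarrow> bool" where
  "smooth_on S f \<longleftrightarrow> (\<forall>k. Ck_on k S f)"

section \<open>Smooth manifolds with boundary\<close>

text \<open>A chart is a pair of its domain and its coordinate map. Atlases need not be maximal.\<close>

record ('a, 'e) mfd =
  mtop :: "'a topology"
  atlas :: "('a set \<times> ('a \<Rightarrow> 'e)) set"

definition is_chart :: "'a topology \<Rightarrow> 'a set \<Rightarrow> ('a \<Rightarrow> 'e::euclidean_space) \<Rightarrow> bool" where
  "is_chart T U \<phi> \<longleftrightarrow>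
     openin T U \<and> homeomorphic_map (subtopology T U) (top_of_set (\<phi> ` U)) \<phi> \<and>
     (open (\<phi> ` U) \<or> (\<exists>b\<in>Basis. openin (top_of_set {x. 0 \<le> x \<bullet> b}) (\<phi> ` U)))"

definition smooth_manifold :: "('a, 'e::euclidean_space) mfd \<Rightarrow> bool" where
  "smooth_manifold M \<longleftrightarrow>
     Hausdorff_space (mtop M) \<and> second_countable (mtop M) \<and>
     (\<Union>(U, \<phi>)\<in>atlas M. U) = topspace (mtop M) \<and>
     (\<forall>(U, \<phi>)\<in>atlas M. is_chart (mtop M) U \<phi>) \<and>
     (\<forall>(U, \<phi>)\<in>atlas M. \<forall>(W, \<psi>)\<in>atlas M. smooth_on (\<phi> ` (U \<inter> W)) (\<psi> \<circ> inv_into U \<phi>))"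

definition bdry :: "('a, 'e::euclidean_space) mfd \<Rightarrow> 'a set" where
  "bdry M = {p. \<exists>(U, \<phi>)\<in>atlas M. p \<in> U \<and> \<phi> p \<notin> interior (\<phi> ` U)}"

definition closed_manifold :: "('a, 'e::euclidean_space) mfd \<Rightarrow> bool" where
  "closed_manifold M \<longleftrightarrow>
     smooth_manifold M \<and> bdry M = {} \<and> compact_space (mtop M) \<and> connected_space (mtop M)"

definition smooth_map ::
  "('a, 'e::euclidean_space) mfd \<Rightarrow> ('b, 'f::euclidean_space) mfd \<Rightarrow> ('a \<Rightarrow> 'b) \<Rightarrow> bool" where
  "smooth_map M N F \<longleftrightarrow>
     continuous_map (mtop M) (mtop N) F \<and>
     (\<forall>(U, \<phi>)\<in>atlas M. \<forall>(W, \<psi>)\<in>atlas N.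
        smooth_on (\<phi> ` {p \<in> U. F p \<in> W}) (\<psi> \<circ> F \<circ> inv_into U \<phi>))"

definition smooth_fun :: "('a, 'e::euclidean_space) mfd \<Rightarrow> ('a \<Rightarrow> real) \<Rightarrow> bool" where
  "smooth_fun M f \<longleftrightarrow> (\<forall>(U, \<phi>)\<in>atlas M. smooth_on (\<phi> ` U) (f \<circ> inv_into U \<phi>))"

definition diffeo ::
  "('a, 'e::euclidean_space) mfd \<Rightarrow> ('b, 'f::euclidean_space) mfd \<Rightarrow> ('a \<Rightarrow> 'b) \<Rightarrow> bool" where
  "diffeo M N F \<longleftrightarrow>
     bij_betw F (topspace (mtop M)) (topspace (mtop N)) \<and> smooth_map M N F \<and>
     smooth_map N M (inv_into (topspace (mtop M)) F)"

definition open_submfd :: "('a, 'e) mfd \<Rightarrow> 'a set \<Rightarrow> ('a, 'e) mfd" where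
  "open_submfd M W = \<lparr>mtop = subtopology (mtop M) W, atlas = (\<lambda>(U, \<phi>). (U \<inter> W, \<phi>)) ` atlas M\<rparr>"

definition open_embedding ::
  "('a, 'e::euclidean_space) mfd \<Rightarrow> ('b, 'f::euclidean_space) mfd \<Rightarrow> ('a \<Rightarrow> 'b) \<Rightarrow> bool" where
  "open_embedding M N F \<longleftrightarrow>
     openin (mtop N) (F ` topspace (mtop M)) \<and>
     diffeo M (open_submfd N (F ` topspace (mtop M))) F"

definition inner_mfd :: "('a, 'e::euclidean_space) mfd \<Rightarrow> ('a, 'e) mfd" where
  "inner_mfd M = open_submfd M (topspace (mtop M) - bdry M)"

text \<open>The boundary as a manifold: boundary charts of \<open>M\<close> restricted to the boundary, with the face
  \<open>{x. x \<bullet> b = 0}\<close> of the half-space identified with the lower-dimensional model space \<open>'f\<close> by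
  an arbitrary linear isomorphism.\<close>

definition bdry_mfd :: "('a, 'e::euclidean_space) mfd \<Rightarrow> ('a, 'f::euclidean_space) mfd" where
  "bdry_mfd M =
     \<lparr>mtop = subtopology (mtop M) (bdry M),
      atlas = {(U \<inter> bdry M, L \<circ> \<phi>) | U \<phi> L. (U, \<phi>) \<in> atlas M \<and>
        (\<exists>b\<in>Basis. openin (top_of_set {x. 0 \<le> x \<bullet> b}) (\<phi> ` U) \<and>
                   linear L \<and> bij_betw L {x. x \<bullet> b = 0} UNIV)}\<rparr>"

definition prod_mfd :: "('a, 'e) mfd \<Rightarrow> ('b, 'f) mfd \<Rightarrow> ('a \<times> 'b, 'e \<times> 'f) mfd" where
  "prod_mfd M N =
     \<lparr>mtop = prod_topology (mtop M) (mtop N),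
      atlas = {(U \<times> W, map_prod \<phi> \<psi>) | U \<phi> W \<psi>. (U, \<phi>) \<in> atlas M \<and> (W, \<psi>) \<in> atlas N}\<rparr>"

definition euclidean_mfd :: "'e::euclidean_space set \<Rightarrow> ('e, 'e) mfd" where
  "euclidean_mfd S = \<lparr>mtop = top_of_set S, atlas = {(S, \<lambda>x. x)}\<rparr>"

text \<open>\<open>S\<^sup>1(lam)\<close>: the circle of radius (not length) \<open>lam\<close>, whose charts are the local inverses of
  \<open>\<theta> \<mapsto> lam cis(\<theta>/lam)\<close>.\<close>

definition circle_pt :: "real \<Rightarrow> real \<Rightarrow> complex" where
  "circle_pt lam \<theta> = of_real lam * cis (\<theta> / lam)"

definition circle :: "real \<Rightarrow> (complex, real) mfd" where
  "circle lam =
     \<lparr>mtop = top_of_set (sphere 0 lam),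
      atlas = range (\<lambda>a. (sphere 0 lam - {circle_pt lam a},
                          inv_into {a<..<a + 2 * pi * lam} (circle_pt lam)))\<rparr>"

text \<open>The unit sphere with the two stereographic projections.\<close>

definition sphere2 :: "(real^3, real^2) mfd" where
  "sphere2 =
     \<lparr>mtop = top_of_set (sphere 0 1),
      atlas = (\<lambda>s. (sphere 0 1 - {axis 3 s},
                    \<lambda>x. (1 / (1 - s * x $ 3)) *\<^sub>R vector [x $ 1, x $ 2])) ` {1, - 1}\<rparr>"

text \<open>\<open>tmap U \<phi> \<psi> F p\<close> is the differential of \<open>F\<close> at \<open>p\<close> in the charts \<open>(U, \<phi>)\<close> at \<open>p\<close> and
  \<open>\<psi>\<close> at \<open>F p\<close>.\<close>

definition tmap :: "'a set \<Rightarrow> ('a \<Rightarrow> 'e::euclidean_space) \<Rightarrow> ('b \<Rightarrow> 'f::euclidean_space) \<Rightarrow>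
    ('a \<Rightarrow> 'b) \<Rightarrow> 'a \<Rightarrow> 'e \<Rightarrow> 'f" where
  "tmap U \<phi> \<psi> F p = dd (\<phi> ` U) (\<psi> \<circ> F \<circ> inv_into U \<phi>) (\<phi> p)"

definition orientable :: "('a, real^'n) mfd \<Rightarrow> bool" where
  "orientable M \<longleftrightarrow>
     (\<exists>A. smooth_manifold (M\<lparr>atlas := atlas M \<union> A\<rparr>) \<and>
          (\<Union>(U, \<phi>)\<in>A. U) = topspace (mtop M) \<and>
          (\<forall>(U, \<phi>)\<in>A. \<forall>(W, \<psi>)\<in>A. \<forall>p\<in>U \<inter> W. 0 < det (matrix (tmap U \<phi> \<psi> id p))))"

section \<open>Euler characteristic\<close>

text \<open>Homology groups are multiplicative groups in the library; the rank is the largest number of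
  linearly independent elements over the integers.\<close>

definition int_independent :: "('a, 'b) monoid_scheme \<Rightarrow> 'a set \<Rightarrow> bool" where
  "int_independent G B \<longleftrightarrow>
     finite B \<and> B \<subseteq> carrier G \<and>
     (\<forall>c :: 'a \<Rightarrow> int. finprod G (\<lambda>b. b [^]\<^bsub>G\<^esub> c b) B = \<one>\<^bsub>G\<^esub> \<longrightarrow> (\<forall>b\<in>B. c b = 0))"

definition abelian_rank :: "('a, 'b) monoid_scheme \<Rightarrow> nat" where
  "abelian_rank G = Sup {card B | B. int_independent G B}"

definition betti :: "nat \<Rightarrow> 'a topology \<Rightarrow> nat" where
  "betti p T = abelian_rank (homology_group (int p) T)"

definition euler_characteristic :: "'a topology \<Rightarrow> int" where
  "euler_characteristic T = (\<Sum>p | betti p T \<noteq> 0. (- 1) ^ p * int (betti p T))"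

section \<open>Tensor calculus in a coordinate domain\<close>

text \<open>In this section \<open>S\<close> is the image of a chart and \<open>G x\<close> is the metric at \<open>x \<in> S\<close>, as a
  bilinear form on the model space. \<open>sharp\<close> raises an index.\<close>

definition sharp :: "('e \<Rightarrow> 'e \<Rightarrow> real) \<Rightarrow> ('e \<Rightarrow> real) \<Rightarrow> 'e" where
  "sharp B \<alpha> = (THE a. \<forall>w. B a w = \<alpha> w)"

definition ginv :: "('e::euclidean_space \<Rightarrow> 'e \<Rightarrow> real) \<Rightarrow> 'e \<Rightarrow> 'e \<Rightarrow> real" where
  "ginv B k l = sharp B (\<lambda>w. w \<bullet> k) \<bullet> l"

definition christoffel ::
  "'e::euclidean_space set \<Rightarrow> ('e \<Rightarrow> 'e \<Rightarrow> 'e \<Rightarrow> real) \<Rightarrow> 'e \<Rightarrow> 'e \<Rightarrow> 'e \<Rightarrow> 'e" where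
  "christoffel S G x u v =
     sharp (G x) (\<lambda>w. (dd S (\<lambda>y. G y v w) x u + dd S (\<lambda>y. G y u w) x v
                       - dd S (\<lambda>y. G y u v) x w) / 2)"

text \<open>\<open>riem S G x u v w\<close> is \<open>R(u,v)w = \<nabla>\<^sub>u \<nabla>\<^sub>v w - \<nabla>\<^sub>v \<nabla>\<^sub>u w\<close> for constant fields
  \<open>u, v, w\<close>; \<open>Ric(v,w)\<close> is the trace of \<open>u \<mapsto> R(u,v)w\<close>.\<close>

definition riem ::
  "'e::euclidean_space set \<Rightarrow> ('e \<Rightarrow> 'e \<Rightarrow> 'e \<Rightarrow> real) \<Rightarrow> 'e \<Rightarrow> 'e \<Rightarrow> 'e \<Rightarrow> 'e \<Rightarrow> 'e" where
  "riem S G x u v w =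
     dd S (\<lambda>y. christoffel S G y v w) x u - dd S (\<lambda>y. christoffel S G y u w) x v
     + christoffel S G x u (christoffel S G x v w) - christoffel S G x v (christoffel S G x u w)"

definition ricci ::
  "'e::euclidean_space set \<Rightarrow> ('e \<Rightarrow> 'e \<Rightarrow> 'e \<Rightarrow> real) \<Rightarrow> 'e \<Rightarrow> 'e \<Rightarrow> 'e \<Rightarrow> real" where
  "ricci S G x v w = (\<Sum>b\<in>Basis. riem S G x b v w \<bullet> b)"

text \<open>A covariant \<open>k\<close>-tensor field is a function of a point and a list of \<open>k\<close> vectors; \<open>nabla\<close> is the
  Levi-Civita derivative, with the direction of differentiation as the first argument.\<close>

fun nabla :: "'e::euclidean_space set \<Rightarrow> ('e \<Rightarrow> 'e \<Rightarrow> 'e \<Rightarrow> real) \<Rightarrow>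
    ('e \<Rightarrow> 'e list \<Rightarrow> real) \<Rightarrow> 'e \<Rightarrow> 'e list \<Rightarrow> real" where
  "nabla S G T x [] = 0"
| "nabla S G T x (w # vs) =
     dd S (\<lambda>y. T y vs) x w - (\<Sum>m<length vs. T x (vs[m := christoffel S G x w (vs ! m)]))"

definition tnorm ::
  "('e::euclidean_space \<Rightarrow> 'e \<Rightarrow> real) \<Rightarrow> nat \<Rightarrow> ('e list \<Rightarrow> real) \<Rightarrow> real" where
  "tnorm B k T =
     sqrt (\<Sum>I | set I \<subseteq> Basis \<and> length I = k. \<Sum>J | set J \<subseteq> Basis \<and> length J = k.
             (\<Prod>m<k. ginv B (I ! m) (J ! m)) * T I * T J)"

definition hess :: "'e::euclidean_space set \<Rightarrow> ('e \<Rightarrow> 'e \<Rightarrow> 'e \<Rightarrow> real) \<Rightarrow> ('e \<Rightarrow> real) \<Rightarrow>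
    'e \<Rightarrow> 'e \<Rightarrow> 'e \<Rightarrow> real" where
  "hess S G f x u v = nabla S G (nabla S G (\<lambda>y _. f y)) x [u, v]"

definition laplacian :: "'e::euclidean_space set \<Rightarrow> ('e \<Rightarrow> 'e \<Rightarrow> 'e \<Rightarrow> real) \<Rightarrow> ('e \<Rightarrow> real) \<Rightarrow>
    'e \<Rightarrow> real" where
  "laplacian S G f x = (\<Sum>k\<in>Basis. \<Sum>l\<in>Basis. ginv (G x) k l * hess S G f x k l)"

section \<open>Riemannian metrics\<close>

text \<open>\<open>g \<phi> p u v\<close> is the value at \<open>p\<close> on the tangent vectors with components \<open>u, v\<close> in the
  chart \<open>\<phi>\<close>. It is relevant only for charts \<open>(U, \<phi>)\<close> of the atlas and \<open>p \<in> U\<close>. Compatibility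
  between the charts is part of \<open>continuous_metric\<close>.\<close>

type_synonym ('a, 'e) metric_field = "('a \<Rightarrow> 'e) \<Rightarrow> 'a \<Rightarrow> 'e \<Rightarrow> 'e \<Rightarrow> real"

definition loc :: "'a set \<Rightarrow> ('a \<Rightarrow> 'e) \<Rightarrow> ('a, 'e) metric_field \<Rightarrow> 'e \<Rightarrow> 'e \<Rightarrow> 'e \<Rightarrow> real" where
  "loc U \<phi> g x = g \<phi> (inv_into U \<phi> x)"

text \<open>\<open>is_pullback M N F h g\<close> says \<open>g = F\<^sup>* h\<close>.\<close>

definition is_pullback :: "('a, 'e::euclidean_space) mfd \<Rightarrow> ('b, 'f::euclidean_space) mfd \<Rightarrow>
    ('a \<Rightarrow> 'b) \<Rightarrow> ('b, 'f) metric_field \<Rightarrow> ('a, 'e) metric_field \<Rightarrow> bool" where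
  "is_pullback M N F h g \<longleftrightarrow>
     (\<forall>(U, \<phi>)\<in>atlas M. \<forall>(W, \<psi>)\<in>atlas N. \<forall>p\<in>U. F p \<in> W \<longrightarrow>
        (\<forall>u v. g \<phi> p u v = h \<psi> (F p) (tmap U \<phi> \<psi> F p u) (tmap U \<phi> \<psi> F p v)))"

definition Ck_metric :: "nat \<Rightarrow> ('a, 'e::euclidean_space) mfd \<Rightarrow> ('a, 'e) metric_field \<Rightarrow> bool" where
  "Ck_metric k M g \<longleftrightarrow>
     (\<forall>(U, \<phi>)\<in>atlas M. \<forall>p\<in>U.
        bilinear (g \<phi> p) \<and> (\<forall>u v. g \<phi> p u v = g \<phi> p v u) \<and> (\<forall>u. u \<noteq> 0 \<longrightarrow> 0 < g \<phi> p u u)) \<and>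
     is_pullback M M id g g \<and>
     (\<forall>(U, \<phi>)\<in>atlas M. \<forall>u v. Ck_on k (\<phi> ` U) (\<lambda>x. loc U \<phi> g x u v))"

definition riemannian_metric ::
  "('a, 'e::euclidean_space) mfd \<Rightarrow> ('a, 'e) metric_field \<Rightarrow> bool" where
  "riemannian_metric M g \<longleftrightarrow> (\<forall>k. Ck_metric k M g)"

definition flat_metric :: "('a, 'e::euclidean_space) metric_field" where
  "flat_metric \<phi> p u v = u \<bullet> v"

definition round_metric :: "('a, real^2) metric_field" where
  "round_metric \<phi> p u v = 4 / (1 + (norm (\<phi> p))\<^sup>2)\<^sup>2 * (u \<bullet> v)"

text \<open>The form \<open>a g + b h\<close> on a product, with functions \<open>a, b\<close> on the product. For a product chart
  \<open>map_prod \<phi> \<psi>\<close> the two chart arguments below are \<open>\<phi>\<close> and \<open>\<psi>\<close>.\<close>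

definition product_metric :: "('a \<times> 'b \<Rightarrow> real) \<Rightarrow> ('a, 'e) metric_field \<Rightarrow>
    ('a \<times> 'b \<Rightarrow> real) \<Rightarrow> ('b, 'f) metric_field \<Rightarrow> ('a \<times> 'b, 'e \<times> 'f) metric_field" where
  "product_metric a g b h \<omega> p u v =
     a p * g (\<lambda>s. fst (\<omega> (s, snd p))) (fst p) (fst u) (fst v) +
     b p * h (\<lambda>t. snd (\<omega> (fst p, t))) (snd p) (snd u) (snd v)"

definition einstein ::
  "real \<Rightarrow> ('a, 'e::euclidean_space) mfd \<Rightarrow> ('a, 'e) metric_field \<Rightarrow> bool" where
  "einstein c M g \<longleftrightarrow>
     (\<forall>(U, \<phi>)\<in>atlas M. \<forall>p\<in>U. \<forall>u v.
        ricci (\<phi> ` U) (loc U \<phi> g) (\<phi> p) u v = c * g \<phi> p u v)"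

definition gauss_curvature :: "('a, real^2) mfd \<Rightarrow> ('a, real^2) metric_field \<Rightarrow> real \<Rightarrow> bool" where
  "gauss_curvature M g k \<longleftrightarrow>
     (\<forall>(U, \<phi>)\<in>atlas M. \<forall>p\<in>U. \<forall>u v.
        g \<phi> p (riem (\<phi> ` U) (loc U \<phi> g) (\<phi> p) u v v) u =
        k * (g \<phi> p u u * g \<phi> p v v - (g \<phi> p u v)\<^sup>2))"

text \<open>\<open>r\<close> is a boundary defining function: the boundary is the regular level set \<open>r = 0\<close>.\<close>

definition defines_bdry :: "('a, 'e::euclidean_space) mfd \<Rightarrow> ('a \<Rightarrow> real) \<Rightarrow> bool" where
  "defines_bdry M r \<longleftrightarrow>
     smooth_fun M r \<and>
     (\<forall>p\<in>topspace (mtop M) - bdry M. 0 < r p) \<and> (\<forall>p\<in>bdry M. r p = 0) \<and>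
     (\<forall>(U, \<phi>)\<in>atlas M. \<forall>p\<in>U \<inter> bdry M. \<exists>u. dd (\<phi> ` U) (r \<circ> inv_into U \<phi>) (\<phi> p) u \<noteq> 0)"

definition inward_unit_normal :: "('a, 'e::euclidean_space) metric_field \<Rightarrow> 'a set \<Rightarrow> ('a \<Rightarrow> 'e) \<Rightarrow>
    'a \<Rightarrow> 'e \<Rightarrow> bool" where
  "inward_unit_normal g U \<phi> p \<nu> \<longleftrightarrow>
     (\<exists>b\<in>Basis. openin (top_of_set {x. 0 \<le> x \<bullet> b}) (\<phi> ` U) \<and> \<phi> p \<bullet> b = 0 \<and> 0 < \<nu> \<bullet> b \<and>
        (\<forall>w. w \<bullet> b = 0 \<longrightarrow> g \<phi> p \<nu> w = 0) \<and> g \<phi> p \<nu> \<nu> = 1)"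

definition has_surface_gravity :: "('a, 'e::euclidean_space) mfd \<Rightarrow> ('a, 'e) metric_field \<Rightarrow>
    ('a \<Rightarrow> real) \<Rightarrow> 'a set \<Rightarrow> real \<Rightarrow> bool" where
  "has_surface_gravity M g V C \<kappa> \<longleftrightarrow>
     (\<forall>p\<in>C. \<forall>(U, \<phi>)\<in>atlas M. \<forall>\<nu>. p \<in> U \<and> inward_unit_normal g U \<phi> p \<nu> \<longrightarrow>
        dd (\<phi> ` U) (V \<circ> inv_into U \<phi>) (\<phi> p) \<nu> = \<kappa>)"

section \<open>Asymptotically locally hyperbolic static systems\<close>

definition end_mfd :: "('s, real^2) mfd \<Rightarrow> real \<Rightarrow> ('s \<times> real, (real^2) \<times> real) mfd" where
  "end_mfd Sig \<rho>\<^sub>0 = prod_mfd Sig (euclidean_mfd {\<rho>\<^sub>0<..})"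

definition gbar :: "('s, real^2) metric_field \<Rightarrow> real \<Rightarrow> ('s \<times> real, (real^2) \<times> real) metric_field"
  where "gbar gS k = product_metric (\<lambda>x. (snd x)\<^sup>2) gS (\<lambda>x. 1 / (k + (snd x)\<^sup>2)) flat_metric"

text \<open>The pointwise norm, with respect to \<open>gbar\<close>, of the \<open>m\<close>-th covariant derivative of a covariant
  \<open>r\<close>-tensor field given in the chart \<open>(U, \<phi>)\<close> by \<open>T\<close>.\<close>

definition gbar_norm :: "('s, real^2) metric_field \<Rightarrow> real \<Rightarrow> ('s \<times> real) set \<Rightarrow>
    ('s \<times> real \<Rightarrow> (real^2) \<times> real) \<Rightarrow> nat \<Rightarrow> nat \<Rightarrow>
    ((real^2) \<times> real \<Rightarrow> ((real^2) \<times> real) list \<Rightarrow> real) \<Rightarrow> 's \<times> real \<Rightarrow> real" where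
  "gbar_norm gS k U \<phi> m r T p =
     tnorm (gbar gS k \<phi> p) (m + r) ((nabla (\<phi> ` U) (loc U \<phi> (gbar gS k)) ^^ m) T (\<phi> p))"

definition ALH_end :: "('a, real^3) mfd \<Rightarrow> ('a, real^3) metric_field \<Rightarrow> ('a \<Rightarrow> real) \<Rightarrow>
    ('s, real^2) mfd \<Rightarrow> ('s, real^2) metric_field \<Rightarrow> real \<Rightarrow> bool" where
  "ALH_end M g V Sig gS k \<longleftrightarrow>
     (\<exists>K\<^sub>0 \<rho>\<^sub>0 \<Phi> gE \<alpha>.
        compactin (mtop M) K\<^sub>0 \<and> 0 \<le> \<rho>\<^sub>0 \<and> 0 \<le> k + \<rho>\<^sub>0\<^sup>2 \<and> 2 < \<alpha> \<and>
        diffeo (end_mfd Sig \<rho>\<^sub>0) (open_submfd M (topspace (mtop M) - K\<^sub>0)) \<Phi> \<and>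
        is_pullback (end_mfd Sig \<rho>\<^sub>0) M \<Phi> g gE \<and>
        (\<forall>m\<le>3. \<exists>C \<rho>\<^sub>1. \<forall>(U, \<phi>)\<in>atlas (end_mfd Sig \<rho>\<^sub>0). \<forall>p\<in>U. \<rho>\<^sub>1 \<le> snd p \<longrightarrow>
           gbar_norm gS k U \<phi> m 2
             (\<lambda>x vs. loc U \<phi> gE x (vs ! 0) (vs ! 1) - loc U \<phi> (gbar gS k) x (vs ! 0) (vs ! 1)) p
           \<le> C * snd p powr (- \<alpha>)) \<and>
        (\<forall>m\<le>1. \<forall>\<epsilon>>0. \<exists>\<rho>\<^sub>1. \<forall>(U, \<phi>)\<in>atlas (end_mfd Sig \<rho>\<^sub>0). \<forall>p\<in>U. \<rho>\<^sub>1 \<le> snd p \<longrightarrow>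
           gbar_norm gS k U \<phi> m 0
             (\<lambda>x _. V (\<Phi> (inv_into U \<phi> x)) - sqrt (k + (snd (inv_into U \<phi> x))\<^sup>2)) p
           \<le> \<epsilon> / snd p))"

text \<open>\<open>M\<close> denotes the manifold together with its horizon boundary, so that \<open>V > 0\<close> on the
  interior only; the horizons are \<open>H 1, \<dots>, H J\<close>.\<close>

locale ALH_static_system =
  fixes M :: "('a, real^3) mfd" and g :: "('a, real^3) metric_field" and V :: "'a \<Rightarrow> real"
    and Sig :: "('s, real^2) mfd" and gS :: "('s, real^2) metric_field" and k :: real
    and J :: nat and H :: "nat \<Rightarrow> 'a set"
  assumes manifold: "smooth_manifold M"
    and connected: "connected_space (mtop M)"
    and noncompact: "\<not> compact_space (mtop M)"
    and metric: "riemannian_metric M g"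
    and static_hess: "\<forall>(U, \<phi>)\<in>atlas M. \<forall>p\<in>U. \<forall>u v.
      hess (\<phi> ` U) (loc U \<phi> g) (V \<circ> inv_into U \<phi>) (\<phi> p) u v =
      V p * ricci (\<phi> ` U) (loc U \<phi> g) (\<phi> p) u v + 3 * V p * g \<phi> p u v"
    and static_laplacian: "\<forall>(U, \<phi>)\<in>atlas M. \<forall>p\<in>U.
      laplacian (\<phi> ` U) (loc U \<phi> g) (V \<circ> inv_into U \<phi>) (\<phi> p) = 3 * V p"
    and infinity: "closed_manifold Sig" "orientable Sig" "riemannian_metric Sig gS"
    and infinity_curvature: "k \<in> {1, 0, - 1}" "gauss_curvature Sig gS k"
    and asymptotics: "ALH_end M g V Sig gS k"
    and bdry_compact: "compactin (mtop M) (bdry M)"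
    and horizons: "1 \<le> J"
      "bij_betw H {1..J} (connected_components_of (subtopology (mtop M) (bdry M)))"
    and potential: "defines_bdry M V"

section \<open>Collapsing the circle over the horizons\<close>

text \<open>\<open>X\<close> is a smooth 4-manifold obtained from \<open>S\<^sup>1(lam) \<times> M\<close> by collapsing the circle factor over the
  boundary of \<open>M\<close>, with quotient map \<open>\<pi>\<close>. Over the interior of \<open>M\<close> the smooth structure is that of
  the product; near each boundary component \<open>C\<close> it is that of (disc) \<open>\<times> C\<close>, via polar coordinates
  on the disc and some collar \<open>c\<close> of \<open>C\<close> in \<open>M\<close>.\<close>

definition circle_collapse ::
  "real \<Rightarrow> ('a, real^3) mfd \<Rightarrow> ('x, real^4) mfd \<Rightarrow> (complex \<times> 'a \<Rightarrow> 'x) \<Rightarrow> bool" where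
  "circle_collapse lam M X \<pi> \<longleftrightarrow>
     smooth_manifold X \<and> bdry X = {} \<and>
     quotient_map (prod_topology (mtop (circle lam)) (mtop M)) (mtop X) \<pi> \<and>
     (\<forall>s\<in>sphere 0 lam. \<forall>t\<in>sphere 0 lam. \<forall>p\<in>topspace (mtop M). \<forall>q\<in>topspace (mtop M).
        \<pi> (s, p) = \<pi> (t, q) \<longleftrightarrow> p = q \<and> (s = t \<or> p \<in> bdry M)) \<and>
     open_embedding (prod_mfd (circle lam) (inner_mfd M)) X \<pi> \<and>
     (\<forall>C\<in>connected_components_of (subtopology (mtop M) (bdry M)).
        \<exists>\<epsilon>>0. \<exists>c \<Psi>.
          open_embedding
            (prod_mfd (euclidean_mfd {0..<\<epsilon>}) (open_submfd (bdry_mfd M :: ('a, real^2) mfd) C)) M c \<and>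
          (\<forall>p\<in>C. c (0, p) = p) \<and>
          open_embedding
            (prod_mfd (euclidean_mfd (ball (0::complex) \<epsilon>))
              (open_submfd (bdry_mfd M :: ('a, real^2) mfd) C)) X \<Psi> \<and>
          (\<forall>r\<in>{0..<\<epsilon>}. \<forall>t. \<forall>p\<in>C. \<Psi> (of_real r * cis t, p) = \<pi> (of_real lam * cis t, c (r, p))))"

text \<open>\<open>G\<close> is \<open>V\<^sup>2 d\<theta>\<^sup>2 + g\<close> over the interior of \<open>M\<close>.\<close>

definition is_static_metric :: "real \<Rightarrow> ('a, real^3) mfd \<Rightarrow> ('a, real^3) metric_field \<Rightarrow>
    ('a \<Rightarrow> real) \<Rightarrow> ('x, real^4) mfd \<Rightarrow> (complex \<times> 'a \<Rightarrow> 'x) \<Rightarrow> ('x, real^4) metric_field \<Rightarrow> bool" where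
  "is_static_metric lam M g V X \<pi> G \<longleftrightarrow>
     is_pullback (prod_mfd (circle lam) (inner_mfd M)) X \<pi> G
       (product_metric (\<lambda>x. (V (snd x))\<^sup>2) flat_metric (\<lambda>_. 1) g)"

definition static_metric_smooth :: "real \<Rightarrow> ('a, real^3) mfd \<Rightarrow> ('a, real^3) metric_field \<Rightarrow>
    ('a \<Rightarrow> real) \<Rightarrow> ('x, real^4) mfd \<Rightarrow> (complex \<times> 'a \<Rightarrow> 'x) \<Rightarrow> bool" where
  "static_metric_smooth lam M g V X \<pi> \<longleftrightarrow>
     (\<exists>G. riemannian_metric X G \<and> is_static_metric lam M g V X \<pi> G)"

section \<open>Poincare-Einstein fillings\<close>

text \<open>The compactification \<open>Y\<close> is taken, without loss of generality, on the disjoint union of \<open>X\<close>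
  and \<open>N\<close>, so that its interior is \<open>X\<close> and its boundary is \<open>N\<close>. The compactified metric \<open>Gc\<close>,
  equal to \<open>r\<^sup>2 G\<close> on \<open>X\<close>, is only required to be continuous up to the boundary; hence every
  filling with a more regular compactification is covered. The restriction of \<open>Gc\<close> to \<open>N\<close> is
  \<open>f h\<close> for a positive function \<open>f\<close>.\<close>

definition poincare_einstein_filling :: "('x, real^4) mfd \<Rightarrow> ('x, real^4) metric_field \<Rightarrow>
    ('n, 'f::euclidean_space) mfd \<Rightarrow> ('n, 'f) metric_field \<Rightarrow> bool" where
  "poincare_einstein_filling X G N h \<longleftrightarrow>
     DIM('f) = 3 \<and> closed_manifold N \<and> riemannian_metric N h \<and>
     smooth_manifold X \<and> bdry X = {} \<and> riemannian_metric X G \<and> einstein (- 3) X G \<and>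
     (\<exists>(Y :: ('x + 'n, real^4) mfd) r Gc f.
        smooth_manifold Y \<and> compact_space (mtop Y) \<and>
        open_embedding X Y Inl \<and> Inl ` topspace (mtop X) = topspace (mtop Y) - bdry Y \<and>
        diffeo N (bdry_mfd Y :: ('x + 'n, 'f) mfd) Inr \<and>
        defines_bdry Y r \<and> Ck_metric 0 Y Gc \<and>
        is_pullback X Y Inl Gc (\<lambda>\<phi> p u v. (r (Inl p))\<^sup>2 * G \<phi> p u v) \<and>
        (\<forall>p\<in>topspace (mtop N). 0 < f p) \<and>
        is_pullback N Y Inr Gc (\<lambda>\<phi> p u v. f p * h \<phi> p u v))"

end

theory Submission
  imports Defs
begin

text \<open>Let \<open>W\<close> be the squared gradient of \<open>V\<close>; it equals \<open>\<kappa>\<^sup>2\<close> on the horizons, and \<open>W - V\<^sup>2 + 1\<close> tends to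
  \<open>0\<close> at infinity. Suppose \<open>\<kappa>\<^sup>2 < 3\<close>. On a Kottler space with parameters \<open>k\<close> and \<open>m\<close> one has
  \<open>V\<^sup>2 = k + r\<^sup>2 - 2 m / r\<close> and \<open>W = (r + m / r\<^sup>2)\<^sup>2\<close>, so that \<open>W\<close> is a function \<open>w\<close> of \<open>V\<^sup>2\<close>, which solves
  \<open>3 (w' - 1) (w' - 3) = 4 w w''\<close>. By Bochner's formula a static potential cannot satisfy
  \<open>W \<le> w(V\<^sup>2) - c\<close>, \<open>c > 0\<close>, with equality at an interior point where \<open>W > 0\<close>. For
  \<open>\<kappa>\<^sup>2 / 3 < k < 1\<close> the comparison also has no contact on the horizons and near infinity, hence it persists
  when \<open>m\<close> is lowered from infinity to \<open>0\<close>. As \<open>w \<rightarrow> 0\<close> at \<open>V\<^sup>2 = k\<close> when \<open>m \<rightarrow> 0\<close>, the gradient of \<open>V\<close>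
  vanishes wherever \<open>\<kappa>\<^sup>2 / 3 < V\<^sup>2 < 1\<close>. So \<open>V\<close> is locally constant on this nonempty region, and a level
  set of \<open>V\<close> in it is open and closed, against the connectedness of \<open>M\<close>. Hence \<open>\<kappa> \<ge> \<surd>3\<close>.

  If the metric extends smoothly over a horizon, then at the centre of a normal disc its radial part is the
  squared length of the radial vector of the collar, while its angular part is the limit of
  \<open>(lam V / r)\<^sup>2\<close>. Continuity of the extension at the centre makes them equal, i.e. \<open>lam \<kappa> = 1\<close>.\<close>

section \<open>Differentiation in open sets\<close>

text \<open>The equation for w is the equality case of the second-order condition at a contact
  point: there the Hessian has the gradient as an eigenvector, and equality means that its other two
  eigenvalues coincide, as on a Kottler space. At a contact with w - c all terms of the condition
  are those of w, except that W = w - c < w stands in the product 4 W w''; as w'' > 0, the condition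
  fails strictly. Comparing with w itself (c = 0) would give no contradiction, so a margin c > 0 has
  to be available at both ends of M as well. At infinity every member of the family satisfies w
  \<ge> V^2 - k, while W is V^2 - 1 up to an error tending to 0: the room is 1 - k. On the horizons
  every member satisfies w \<ge> 3 k, with equality for the horizon radius sqrt (k / 3): the room is
  3 k - \<kappa>^2. Both are positive exactly when \<kappa>^2 / 3 < k < 1, and such k exist only for
  \<kappa>^2 < 3; this is the origin of the constant sqrt 3. The descent can start at infinite mass
  because w^3 is bounded below by a multiple of m^2, uniformly in V.\<close>

lemma has_derivative_dd:
  "f differentiable_on S \<Longrightarrow> x \<in> S \<Longrightarrow> (f has_derivative dd S f x) (at x within S)"
  unfolding dd_def differentiable_on_def using frechet_derivative_works by blast

lemma linear_dd: "f differentiable_on S \<Longrightarrow> x \<in> S \<Longrightarrow> linear (dd S f x)"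
  using has_derivative_dd has_derivative_linear by blast

lemma has_derivative_dd_open:
  "f differentiable_on S \<Longrightarrow> open S \<Longrightarrow> x \<in> S \<Longrightarrow> (f has_derivative dd S f x) (at x)"
  using has_derivative_dd by (metis at_within_open)

lemma dd_unique:
  assumes "open S" "x \<in> S" "(f has_derivative F) (at x)"
  shows "dd S f x = F"
  unfolding dd_def using assms by (metis at_within_open frechet_derivative_at)

text \<open>At a point of the open set \<open>T\<close> both filters reduce to the full
  neighbourhood filter. This is the passage from a chart image, which may have boundary points, to
  an open subset of it.\<close>

lemma dd_local:
  assumes T: "open T" "x \<in> T" "T \<subseteq> S" and eq: "\<And>y. y \<in> T \<Longrightarrow> f y = g y"
  shows "dd S f x = dd T g x"
proof -
  have "x \<in> interior S"
    using T by (meson interior_maximal subsetD)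
  then have "at x within S = at x" "at x within T = at x"
    using T at_within_interior at_within_open by blast+
  moreover have "(f has_derivative F) (at x) \<longleftrightarrow> (g has_derivative F) (at x)" for F
    using has_derivative_transform_within_open[of f F x UNIV T g]
      has_derivative_transform_within_open[of g F x UNIV T f] T eq by auto
  ultimately show ?thesis
    unfolding dd_def frechet_derivative_def by simp
qed

lemma dd_cong: "(\<And>y. y \<in> S \<Longrightarrow> f y = g y) \<Longrightarrow> x \<in> S \<Longrightarrow> dd S f x = dd S g x"
proof -
  assume eq: "\<And>y. y \<in> S \<Longrightarrow> f y = g y" and x: "x \<in> S"
  have "(f has_derivative F) (at x within S) \<longleftrightarrow> (g has_derivative F) (at x within S)" for F
    using has_derivative_transform[of x S g f F] has_derivative_transform[of x S f g F] x eq by auto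
  then show ?thesis
    unfolding dd_def frechet_derivative_def by simp
qed

section \<open>Calculus with the regularity classes \<open>Ck_on\<close> and with \<open>dd\<close>
  on open sets\<close>

lemma Ck_on_cong:
  "(\<And>x. x \<in> S \<Longrightarrow> f x = g x) \<Longrightarrow> Ck_on k S f \<longleftrightarrow> Ck_on k S g"
proof (induction k arbitrary: f g)
  case 0
  then show ?case by (simp cong: continuous_on_cong)
next
  case (Suc k)
  have "Ck_on k S (\<lambda>x. dd S f x b) \<longleftrightarrow> Ck_on k S (\<lambda>x. dd S g x b)" for b
    by (rule Suc.IH) (simp add: dd_cong[OF Suc.prems])
  moreover have "f differentiable_on S \<longleftrightarrow> g differentiable_on S"
    using Suc.prems unfolding differentiable_on_def
    by (metis differentiable_transform_within zero_less_one)
  ultimately show ?case by simp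
qed

lemma Ck_on_open_subset:
  "Ck_on k S f \<Longrightarrow> open T \<Longrightarrow> T \<subseteq> S \<Longrightarrow> Ck_on k T f"
proof (induction k arbitrary: f)
  case 0
  then show ?case by (auto intro: continuous_on_subset)
next
  case (Suc k)
  have "Ck_on k T (\<lambda>x. dd T f x b)" if "b \<in> Basis" for b
  proof -
    have "Ck_on k T (\<lambda>x. dd S f x b)"
      using Suc that by simp
    moreover have "dd S f x b = dd T f x b" if "x \<in> T" for x
      by (subst dd_local[OF Suc.prems(2) that Suc.prems(3) refl]) simp
    ultimately show ?thesis
      by (subst Ck_on_cong[where g = "\<lambda>x. dd S f x b"]) auto
  qed
  moreover have "f differentiable_on T"
    using Suc.prems by (auto intro: differentiable_on_subset)
  ultimately show ?case by simp
qed

lemma smooth_on_open_subset: "smooth_on S f \<Longrightarrow> open T \<Longrightarrow> T \<subseteq> S \<Longrightarrow> smooth_on T f"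
  unfolding smooth_on_def using Ck_on_open_subset by blast

lemma Ck_on_const: "Ck_on k S (\<lambda>x. c)" if "open S" for c :: "'b::real_normed_vector"
proof (induction k arbitrary: c)
  case (Suc k)
  have "dd S (\<lambda>x. c) x = (\<lambda>_. 0)" if "x \<in> S" for x
    by (rule dd_unique) (use \<open>open S\<close> that in auto)
  then have "Ck_on k S (\<lambda>x. dd S (\<lambda>x. c) x b)" for b
    by (subst Ck_on_cong[where g = "\<lambda>x. 0"]) (auto simp: Suc.IH)
  then show ?case by simp
qed simp

lemma dd_add:
  assumes "open S" "x \<in> S" "f differentiable_on S" "g differentiable_on S"
  shows "dd S (\<lambda>y. f y + g y) x u = dd S f x u + dd S g x u"
proof -
  have "((\<lambda>y. f y + g y) has_derivative (\<lambda>u. dd S f x u + dd S g x u)) (at x)"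
    using assms by (intro has_derivative_add has_derivative_dd_open)
  then show ?thesis using assms dd_unique by (metis (no_types, lifting))
qed

lemma dd_diff:
  assumes "open S" "x \<in> S" "f differentiable_on S" "g differentiable_on S"
  shows "dd S (\<lambda>y. f y - g y) x u = dd S f x u - dd S g x u"
proof -
  have "((\<lambda>y. f y - g y) has_derivative (\<lambda>u. dd S f x u - dd S g x u)) (at x)"
    using assms by (intro has_derivative_diff has_derivative_dd_open)
  then show ?thesis using assms dd_unique by (metis (no_types, lifting))
qed

lemma dd_scaleR:
  assumes "open S" "x \<in> S" "f differentiable_on S"
  shows "dd S (\<lambda>y. c *\<^sub>R f y) x u = c *\<^sub>R dd S f x u"
proof -
  have "((\<lambda>y. c *\<^sub>R f y) has_derivative (\<lambda>u. c *\<^sub>R dd S f x u)) (at x)"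
    using assms by (intro has_derivative_scaleR_right has_derivative_dd_open)
  then show ?thesis using assms dd_unique by (metis (no_types, lifting))
qed

lemma dd_cmult:
  assumes "open S" "x \<in> S" "f differentiable_on S"
  shows "dd S (\<lambda>y. c * f y :: real) x u = c * dd S f x u"
  using dd_scaleR[OF assms, of c u] by simp

lemma dd_sum:
  assumes "open S" "x \<in> S" "finite I" "\<And>i. i \<in> I \<Longrightarrow> f i differentiable_on S"
  shows "dd S (\<lambda>y. \<Sum>i\<in>I. f i y) x u = (\<Sum>i\<in>I. dd S (f i) x u)"
proof -
  have "((\<lambda>y. \<Sum>i\<in>I. f i y) has_derivative (\<lambda>u. \<Sum>i\<in>I. dd S (f i) x u)) (at x)"
    using assms by (intro has_derivative_sum has_derivative_dd_open)
  then show ?thesis using assms dd_unique by (metis (no_types, lifting))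
qed

lemma Ck_on_add:
  assumes "open S"
  shows "Ck_on k S f \<Longrightarrow> Ck_on k S g \<Longrightarrow> Ck_on k S (\<lambda>x. f x + g x)"
proof (induction k arbitrary: f g)
  case 0
  then show ?case by (auto intro: continuous_on_add)
next
  case (Suc k)
  have "Ck_on k S (\<lambda>x. dd S (\<lambda>x. f x + g x) x b)" if "b \<in> Basis" for b
    by (subst Ck_on_cong[where g = "\<lambda>x. dd S f x b + dd S g x b"])
      (use Suc that assms in \<open>auto simp: dd_add\<close>)
  then show ?case
    using Suc.prems by (auto intro: differentiable_on_add)
qed

lemma Ck_on_scaleR:
  assumes "open S"
  shows "Ck_on k S f \<Longrightarrow> Ck_on k S (\<lambda>x. c *\<^sub>R f x)"
proof (induction k arbitrary: f)
  case 0
  then show ?case by (auto intro: continuous_intros)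
next
  case (Suc k)
  have "Ck_on k S (\<lambda>x. dd S (\<lambda>x. c *\<^sub>R f x) x b)" if "b \<in> Basis" for b
    by (subst Ck_on_cong[where g = "\<lambda>x. c *\<^sub>R dd S f x b"])
      (use Suc that assms in \<open>auto simp: dd_scaleR\<close>)
  moreover have "(\<lambda>x. c *\<^sub>R f x) differentiable_on S"
    using Suc.prems by (auto simp: differentiable_on_def)
  ultimately show ?case by simp
qed

lemma Ck_on_sum:
  assumes "open S" "finite I" "\<And>i. i \<in> I \<Longrightarrow> Ck_on k S (f i)"
  shows "Ck_on k S (\<lambda>x. \<Sum>i\<in>I. f i x)"
  using assms(2,3) by (induction I rule: finite_induct) (auto intro: Ck_on_const Ck_on_add assms(1))

lemma dd_expand:
  assumes "f differentiable_on S" "x \<in> S"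
  shows "dd S f x u = (\<Sum>b\<in>Basis. (u \<bullet> b) *\<^sub>R dd S f x b)"
proof -
  interpret linear "dd S f x" using assms by (rule linear_dd)
  have "dd S f x u = dd S f x (\<Sum>b\<in>Basis. (u \<bullet> b) *\<^sub>R b)"
    by (simp add: euclidean_representation)
  also have "\<dots> = (\<Sum>b\<in>Basis. (u \<bullet> b) *\<^sub>R dd S f x b)"
    by (simp add: sum scaleR)
  finally show ?thesis .
qed

lemma smooth_on_differentiable: "smooth_on S f \<Longrightarrow> f differentiable_on S"
  unfolding smooth_on_def by (metis Ck_on.simps(2))

lemma Ck_on_dd:
  assumes "Ck_on (Suc k) S f" "open S"
  shows "Ck_on k S (\<lambda>x. dd S f x u)"
proof (subst Ck_on_cong)
  show "dd S f x u = (\<Sum>b\<in>Basis. (u \<bullet> b) *\<^sub>R dd S f x b)" if "x \<in> S" for x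
    using assms that by (intro dd_expand) auto
  show "Ck_on k S (\<lambda>x. \<Sum>b\<in>Basis. (u \<bullet> b) *\<^sub>R dd S f x b)"
    using assms by (intro Ck_on_sum Ck_on_scaleR) auto
qed

lemma smooth_on_dd: "smooth_on S f \<Longrightarrow> open S \<Longrightarrow> smooth_on S (\<lambda>x. dd S f x u)"
  unfolding smooth_on_def using Ck_on_dd by blast

lemma continuous_on_dd:
  assumes "Ck_on (Suc 0) S f"
  shows "continuous_on S (\<lambda>x. dd S f x u)"
proof (rule continuous_on_eq)
  show "continuous_on S (\<lambda>x. \<Sum>b\<in>Basis. (u \<bullet> b) *\<^sub>R dd S f x b)"
    using assms by (intro continuous_intros) auto
  show "(\<Sum>b\<in>Basis. (u \<bullet> b) *\<^sub>R dd S f x b) = dd S f x u" if "x \<in> S" for x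
    using assms that by (intro dd_expand[symmetric]) auto
qed

section \<open>Symmetry of second derivatives\<close>

lemma DERIV_along_line:
  assumes "f differentiable_on S" "open S" "x + s *\<^sub>R u \<in> S"
  shows "((\<lambda>s. f (x + s *\<^sub>R u)) has_real_derivative dd S f (x + s *\<^sub>R u) u) (at s)"
proof -
  have "((\<lambda>s. f (x + s *\<^sub>R u)) has_derivative (\<lambda>h. dd S f (x + s *\<^sub>R u) (h *\<^sub>R u))) (at s)"
    by (rule has_derivative_compose[where f = "\<lambda>s. x + s *\<^sub>R u" and g = f, simplified])
      (auto intro!: derivative_eq_intros has_derivative_dd_open assms)
  moreover have "dd S f (x + s *\<^sub>R u) (h *\<^sub>R u) = dd S f (x + s *\<^sub>R u) u * h" for h
    using linear_dd[OF assms(1,3)] by (simp add: linear_scale)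
  ultimately show ?thesis
    by (simp add: has_field_derivative_def)
qed

text \<open>Schwarz's theorem: the second difference of \<open>f\<close> over a small parallelogram
  is symmetric in \<open>u\<close> and \<open>v\<close>, and two applications of the mean value
  theorem, in either order, express it by one or the other mixed derivative at a nearby point.
  Continuity then excludes a gap between the two.\<close>

lemma dd_commute:
  fixes f :: "'e::euclidean_space \<Rightarrow> real"
  assumes S: "open S" "x \<in> S" and f: "Ck_on (Suc (Suc 0)) S f"
  shows "dd S (\<lambda>y. dd S f y u) x v = dd S (\<lambda>y. dd S f y v) x u"
proof (rule ccontr)
  let ?A = "\<lambda>y. dd S (\<lambda>y. dd S f y u) y v" and ?B = "\<lambda>y. dd S (\<lambda>y. dd S f y v) y u"
  assume ne: "?A x \<noteq> ?B x"
  have fd: "f differentiable_on S" using f by simp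
  have C1: "Ck_on (Suc 0) S (\<lambda>y. dd S f y w)" for w
    using f S(1) by (rule Ck_on_dd)
  have dd: "(\<lambda>y. dd S f y w) differentiable_on S" for w
    using C1 by simp
  have cA: "continuous_on S ?A" and cB: "continuous_on S ?B"
    using continuous_on_dd[OF C1] by auto
  define e where "e = \<bar>?A x - ?B x\<bar> / 2"
  have "e > 0" using ne by (simp add: e_def)
  obtain d where d: "d > 0" "ball x d \<subseteq> S"
    "\<And>y. y \<in> ball x d \<Longrightarrow> dist (?A y) (?A x) < e" "\<And>y. y \<in> ball x d \<Longrightarrow> dist (?B y) (?B x) < e"
  proof -
    obtain d0 where d0: "d0 > 0" "ball x d0 \<subseteq> S" using S open_contains_ball by blast
    obtain d1 where d1: "d1 > 0" "\<And>y. y \<in> S \<Longrightarrow> dist y x < d1 \<Longrightarrow> dist (?A y) (?A x) < e"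
      using cA \<open>x \<in> S\<close> \<open>e > 0\<close> unfolding continuous_on_iff by meson
    obtain d2 where d2: "d2 > 0" "\<And>y. y \<in> S \<Longrightarrow> dist y x < d2 \<Longrightarrow> dist (?B y) (?B x) < e"
      using cB \<open>x \<in> S\<close> \<open>e > 0\<close> unfolding continuous_on_iff by meson
    show thesis
      by (rule that[of "min d0 (min d1 d2)"]) (use d0 d1 d2 in \<open>auto simp: dist_commute subset_iff\<close>)
  qed
  \<comment> \<open>Half the size at which the parallelogram spanned by \<open>h *\<^sub>R u\<close>
    and \<open>h *\<^sub>R v\<close> could reach the boundary of the ball; the summand 1 covers
    \<open>u = v = 0\<close>.\<close>
  define h where "h = d / (2 * (norm u + norm v + 1))"
  have "h > 0" using \<open>d > 0\<close> by (simp add: h_def add_nonneg_pos)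
  have inS: "x + s *\<^sub>R u + t *\<^sub>R v \<in> ball x d" if "0 \<le> s" "s \<le> h" "0 \<le> t" "t \<le> h" for s t
  proof -
    have "norm (s *\<^sub>R u + t *\<^sub>R v) \<le> s * norm u + t * norm v"
      using that by (metis abs_of_nonneg norm_scaleR norm_triangle_ineq)
    also have "\<dots> \<le> h * norm u + h * norm v"
      using that by (intro add_mono mult_right_mono) auto
    also have "\<dots> < h * (2 * (norm u + norm v + 1))"
      using \<open>h > 0\<close> by (simp add: algebra_simps add_pos_nonneg add_nonneg_pos)
    also have "\<dots> = d"
      unfolding h_def by (simp add: add_nonneg_eq_0_iff add_nonneg_pos pos_add_strict)
    finally have "norm (s *\<^sub>R u + t *\<^sub>R v) < d" .
    then show ?thesis using norm_minus_cancel[of "s *\<^sub>R u + t *\<^sub>R v"]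
      by (simp add: dist_norm algebra_simps)
  qed
  define \<Delta> where "\<Delta> = f (x + h *\<^sub>R u + h *\<^sub>R v) - f (x + h *\<^sub>R u) - f (x + h *\<^sub>R v) + f x"
  have aux: "\<exists>s t. 0 \<le> s \<and> s \<le> h \<and> 0 \<le> t \<and> t \<le> h \<and>
      D = h * h * dd S (\<lambda>y. dd S f y a) (x + s *\<^sub>R a + t *\<^sub>R b) b"
    if in': "\<And>s t. 0 \<le> s \<Longrightarrow> s \<le> h \<Longrightarrow> 0 \<le> t \<Longrightarrow> t \<le> h \<Longrightarrow> x + s *\<^sub>R a + t *\<^sub>R b \<in> S"
      and D: "D = f (x + h *\<^sub>R a + h *\<^sub>R b) - f (x + h *\<^sub>R a) - f (x + h *\<^sub>R b) + f x" for a b D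
  proof -
    let ?p = "\<lambda>s. f (x + h *\<^sub>R b + s *\<^sub>R a) - f (x + s *\<^sub>R a)"
    have "\<exists>s>0. s < h \<and> ?p h - ?p 0 =
        (h - 0) * (dd S f (x + h *\<^sub>R b + s *\<^sub>R a) a - dd S f (x + s *\<^sub>R a) a)"
    proof (rule MVT2[OF \<open>h > 0\<close>])
      fix s assume s: "0 \<le> s" "s \<le> h"
      have "x + h *\<^sub>R b + s *\<^sub>R a \<in> S" "x + s *\<^sub>R a \<in> S"
        using in'[OF s, of h] in'[OF s, of 0] \<open>h > 0\<close> by (auto simp: add_ac)
      then show "(?p has_real_derivative
          dd S f (x + h *\<^sub>R b + s *\<^sub>R a) a - dd S f (x + s *\<^sub>R a) a) (at s)"
        by (intro DERIV_diff DERIV_along_line fd S)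
    qed
    then obtain s where s: "0 < s" "s < h" and
      e1: "?p h - ?p 0 = h * (dd S f (x + h *\<^sub>R b + s *\<^sub>R a) a - dd S f (x + s *\<^sub>R a) a)"
      by auto
    let ?q = "\<lambda>t. dd S f (x + s *\<^sub>R a + t *\<^sub>R b) a"
    have "\<exists>t>0. t < h \<and> ?q h - ?q 0 = (h - 0) * dd S (\<lambda>y. dd S f y a) (x + s *\<^sub>R a + t *\<^sub>R b) b"
      by (rule MVT2[OF \<open>h > 0\<close>]) (use s in' in \<open>intro DERIV_along_line dd S; auto\<close>)
    then obtain t where t: "0 < t" "t < h"
      "?q h - ?q 0 = h * dd S (\<lambda>y. dd S f y a) (x + s *\<^sub>R a + t *\<^sub>R b) b"
      by auto
    have "D = ?p h - ?p 0" unfolding D by (simp add: algebra_simps)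
    also have "\<dots> = h * (?q h - ?q 0)" using e1 by (simp add: add_ac)
    finally have "D = h * (h * dd S (\<lambda>y. dd S f y a) (x + s *\<^sub>R a + t *\<^sub>R b) b)"
      using t(3) by simp
    then show ?thesis using s t
      by (intro exI[of _ s] exI[of _ t]) simp
  qed
  obtain s t where st: "0 \<le> s" "s \<le> h" "0 \<le> t" "t \<le> h" "\<Delta> = h * h * ?A (x + s *\<^sub>R u + t *\<^sub>R v)"
    using aux[of u v \<Delta>] inS d(2) \<Delta>_def by blast
  have "x + s *\<^sub>R v + t *\<^sub>R u \<in> S" if "0 \<le> s" "s \<le> h" "0 \<le> t" "t \<le> h" for s t
    using inS[of t s] that d(2) by (auto simp: add_ac)
  moreover have "\<Delta> = f (x + h *\<^sub>R v + h *\<^sub>R u) - f (x + h *\<^sub>R v) - f (x + h *\<^sub>R u) + f x"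
    by (simp add: \<Delta>_def add_ac)
  ultimately obtain s' t' where st': "0 \<le> s'" "s' \<le> h" "0 \<le> t'" "t' \<le> h"
    "\<Delta> = h * h * ?B (x + s' *\<^sub>R v + t' *\<^sub>R u)"
    using aux[of v u \<Delta>] by blast
  have "?A (x + s *\<^sub>R u + t *\<^sub>R v) = ?B (x + s' *\<^sub>R v + t' *\<^sub>R u)"
    using st(5) st'(5) \<open>h > 0\<close> by simp
  moreover have "dist (?A (x + s *\<^sub>R u + t *\<^sub>R v)) (?A x) < e"
    using d(3) inS st by blast
  moreover have "dist (?B (x + s' *\<^sub>R v + t' *\<^sub>R u)) (?B x) < e"
    using d(4) inS[of t' s'] st' by (simp add: add_ac)
  ultimately have "dist (?A x) (?B x) < e + e"
    using dist_triangle_less_add[of "?A x" "?A (x + s *\<^sub>R u + t *\<^sub>R v)" e "?B x" e]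
    by (simp add: dist_commute)
  then show False by (simp add: e_def dist_real_def)
qed

section \<open>Leibniz rule for linear forms depending on a point\<close>

lemma dd_linear_in_parameter:
  assumes "open S" "x \<in> S" "\<And>y. y \<in> S \<Longrightarrow> linear (T y)" "\<And>w. (\<lambda>y. T y w) differentiable_on S"
  shows "linear (\<lambda>w. dd S (\<lambda>y. T y w) x u)"
proof (rule linearI)
  fix a b c
  have "dd S (\<lambda>y. T y (a + b)) x = dd S (\<lambda>y. T y a + T y b) x"
    by (rule dd_cong) (use assms in \<open>auto simp: linear_add\<close>)
  then show "dd S (\<lambda>y. T y (a + b)) x u = dd S (\<lambda>y. T y a) x u + dd S (\<lambda>y. T y b) x u"
    using assms by (simp add: dd_add)
  have "dd S (\<lambda>y. T y (c *\<^sub>R a)) x = dd S (\<lambda>y. c *\<^sub>R T y a) x"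
    by (rule dd_cong) (use assms in \<open>auto simp: linear_scale\<close>)
  then show "dd S (\<lambda>y. T y (c *\<^sub>R a)) x u = c *\<^sub>R dd S (\<lambda>y. T y a) x u"
    using assms by (simp add: dd_scaleR)
qed

text \<open>Only the components \<open>T y w\<close> for fixed \<open>w\<close> are known to be
  differentiable, so \<open>X y\<close> is expanded in the basis and the product rule is applied to
  each term. Nearly every covariant computation below is an instance.\<close>

lemma has_derivative_apply:
  fixes T :: "'e::euclidean_space \<Rightarrow> 'f::euclidean_space \<Rightarrow> real"
  assumes "open S" "x \<in> S" "\<And>y. y \<in> S \<Longrightarrow> linear (T y)" "\<And>w. (\<lambda>y. T y w) differentiable_on S"
    and X: "X differentiable_on S"
  shows "((\<lambda>y. T y (X y)) has_derivative
           (\<lambda>u. dd S (\<lambda>y. T y (X x)) x u + T x (dd S X x u))) (at x)"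
proof -
  have ex: "T y w = (\<Sum>b\<in>Basis. (w \<bullet> b) * T y b)" if "y \<in> S" for y w
  proof -
    have "T y w = T y (\<Sum>b\<in>Basis. (w \<bullet> b) *\<^sub>R b)" by (simp add: euclidean_representation)
    also have "\<dots> = (\<Sum>b\<in>Basis. (w \<bullet> b) * T y b)"
      using assms(3)[OF that] by (simp add: linear_sum linear_scale)
    finally show ?thesis .
  qed
  have Xd: "(X has_derivative dd S X x) (at x)"
    using X assms by (intro has_derivative_dd_open)
  have Td: "((\<lambda>y. T y b) has_derivative dd S (\<lambda>y. T y b) x) (at x)" for b
    using assms by (intro has_derivative_dd_open)
  have "((\<lambda>y. \<Sum>b\<in>Basis. (X y \<bullet> b) * T y b) has_derivative
      (\<lambda>u. \<Sum>b\<in>Basis. (X x \<bullet> b) * dd S (\<lambda>y. T y b) x u + (dd S X x u \<bullet> b) * T x b)) (at x)"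
    by (intro has_derivative_sum has_derivative_mult has_derivative_inner_left Xd Td)
  also have "(\<lambda>u. \<Sum>b\<in>Basis. (X x \<bullet> b) * dd S (\<lambda>y. T y b) x u + (dd S X x u \<bullet> b) * T x b) =
      (\<lambda>u. dd S (\<lambda>y. T y (X x)) x u + T x (dd S X x u))"
  proof
    fix u
    have lin: "linear (\<lambda>w. dd S (\<lambda>y. T y w) x u)"
      using assms by (intro dd_linear_in_parameter)
    have "dd S (\<lambda>y. T y (X x)) x u = dd S (\<lambda>y. T y (\<Sum>b\<in>Basis. (X x \<bullet> b) *\<^sub>R b)) x u"
      by (simp add: euclidean_representation)
    also have "\<dots> = (\<Sum>b\<in>Basis. (X x \<bullet> b) * dd S (\<lambda>y. T y b) x u)"
      using linear_sum[OF lin, of "\<lambda>b. (X x \<bullet> b) *\<^sub>R b" Basis] linear_scale[OF lin] by simp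
    finally show "(\<Sum>b\<in>Basis. (X x \<bullet> b) * dd S (\<lambda>y. T y b) x u + (dd S X x u \<bullet> b) * T x b) =
      dd S (\<lambda>y. T y (X x)) x u + T x (dd S X x u)"
      using ex[OF assms(2), of "dd S X x u"] by (simp add: sum.distrib)
  qed
  finally show ?thesis
    by (rule has_derivative_transform_within_open[OF _ assms(1,2)]) (use ex in simp)
qed

lemma dd_apply:
  fixes T :: "'e::euclidean_space \<Rightarrow> 'f::euclidean_space \<Rightarrow> real"
  assumes "open S" "x \<in> S" "\<And>y. y \<in> S \<Longrightarrow> linear (T y)" "\<And>w. (\<lambda>y. T y w) differentiable_on S"
    and X: "X differentiable_on S"
  shows "dd S (\<lambda>y. T y (X y)) x u = dd S (\<lambda>y. T y (X x)) x u + T x (dd S X x u)"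
  using dd_unique[OF assms(1,2) has_derivative_apply[OF assms]] by simp

lemma differentiable_on_apply:
  fixes T :: "'e::euclidean_space \<Rightarrow> 'f::euclidean_space \<Rightarrow> real"
  assumes "open S" "\<And>y. y \<in> S \<Longrightarrow> linear (T y)" "\<And>w. (\<lambda>y. T y w) differentiable_on S"
    and X: "X differentiable_on S"
  shows "(\<lambda>y. T y (X y)) differentiable_on S"
  unfolding differentiable_on_def differentiable_def
  using has_derivative_apply[OF assms(1) _ assms(2,3) X] assms(1) by (metis at_within_open)

section \<open>Raising an index\<close>

definition inner_form :: "('e::euclidean_space \<Rightarrow> 'e \<Rightarrow> real) \<Rightarrow> bool" where
  "inner_form B \<longleftrightarrow> bilinear B \<and> (\<forall>u v. B u v = B v u) \<and> (\<forall>u. u \<noteq> 0 \<longrightarrow> 0 < B u u)"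

lemma inner_formD:
  assumes "inner_form B"
  shows "linear (B u)" "linear (\<lambda>u. B u v)" "B u v = B v u" "u \<noteq> 0 \<Longrightarrow> 0 < B u u"
  using assms unfolding inner_form_def bilinear_def by auto

lemma inner_form_nonneg: "inner_form B \<Longrightarrow> 0 \<le> B u u"
  by (cases "u = 0") (auto simp: inner_formD(4) less_imp_le linear_0[OF inner_formD(1)])

lemma inner_form_eqI:
  assumes "inner_form B" "\<And>w. B a w = B b w"
  shows "a = b"
proof (rule ccontr)
  assume "a \<noteq> b"
  then have "0 < B (a - b) (a - b)" using inner_formD(4)[OF assms(1)] by simp
  then show False
    using assms(2) linear_diff[OF inner_formD(2)[OF assms(1)]] by simp
qed

text \<open>\<open>sharp\<close> is a definite description, so existence and uniqueness are needed:
  sending \<open>a\<close> to the Euclidean representative of \<open>B a\<close> is injective by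
  positivity, hence onto by dimension.\<close>

lemma sharp_works:
  fixes B :: "'e::euclidean_space \<Rightarrow> 'e \<Rightarrow> real"
  assumes B: "inner_form B" and \<alpha>: "linear \<alpha>"
  shows "B (sharp B \<alpha>) w = \<alpha> w"
proof -
  define F where "F a = (\<Sum>b\<in>Basis. B a b *\<^sub>R b)" for a
  have Fb: "F a \<bullet> w = B a w" for a w
  proof -
    have "B a w = B a (\<Sum>b\<in>Basis. (w \<bullet> b) *\<^sub>R b)" by (simp add: euclidean_representation)
    also have "\<dots> = F a \<bullet> w"
      by (simp add: linear_sum[OF inner_formD(1)[OF B]] linear_scale[OF inner_formD(1)[OF B]]
        F_def inner_sum_left inner_commute[of w] mult.commute)
    finally show ?thesis by simp
  qed
  have "linear F"
    unfolding F_def by (rule linearI)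
      (simp_all add: linear_add[OF inner_formD(2)[OF B]] linear_scale[OF inner_formD(2)[OF B]]
        scaleR_left_distrib sum.distrib scaleR_sum_right)
  moreover have "inj F"
    by (rule injI) (metis Fb inner_form_eqI[OF B])
  ultimately have "surj F" by (rule linear_injective_imp_surjective) simp
  then obtain a where a: "F a = (\<Sum>b\<in>Basis. \<alpha> b *\<^sub>R b)" by (metis surjD)
  have "B a w = \<alpha> w" for w
  proof -
    have "\<alpha> w = \<alpha> (\<Sum>b\<in>Basis. (w \<bullet> b) *\<^sub>R b)" by (simp add: euclidean_representation)
    also have "\<dots> = (\<Sum>b\<in>Basis. (w \<bullet> b) * \<alpha> b)"
      by (simp add: linear_sum[OF \<alpha>] linear_scale[OF \<alpha>])
    also have "\<dots> = F a \<bullet> w"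
      by (simp add: a inner_sum_left inner_commute[of w] mult.commute)
    finally show ?thesis by (simp add: Fb)
  qed
  then have "\<exists>!a. \<forall>w. B a w = \<alpha> w"
    using inner_form_eqI[OF B] by metis
  from theI'[OF this] show ?thesis
    unfolding sharp_def by blast
qed

lemma sharp_unique:
  assumes "inner_form B" "linear \<alpha>" "\<And>w. B a w = \<alpha> w"
  shows "sharp B \<alpha> = a"
  by (rule inner_form_eqI[OF assms(1)]) (simp add: sharp_works assms)

section \<open>Dependence of a raised index on parameters\<close>

definition gram :: "(real^3 \<Rightarrow> real^3 \<Rightarrow> real) \<Rightarrow> real^3^3" where
  "gram B = (\<chi> i j. B (axis i 1) (axis j 1))"

lemma gram_mult:
  assumes "inner_form B"
  shows "(gram B *v a) $ i = B a (axis i 1)"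
proof -
  have "B a (axis i 1) = B (\<Sum>j\<in>UNIV. a $ j *s axis j 1) (axis i 1)"
    by (simp add: basis_expansion)
  also have "\<dots> = (\<Sum>j\<in>UNIV. a $ j * B (axis j 1) (axis i 1))"
    by (simp add: linear_sum[OF inner_formD(2)[OF assms]] linear_scale[OF inner_formD(2)[OF assms]]
      scalar_mult_eq_scaleR)
  also have "\<dots> = (\<Sum>j\<in>UNIV. B (axis i 1) (axis j 1) * a $ j)"
    by (rule sum.cong[OF refl]) (simp add: inner_formD(3)[OF assms, of _ "axis i 1"] mult.commute)
  finally show ?thesis
    by (simp add: gram_def matrix_vector_mult_def)
qed

lemma det_gram_nonzero:
  assumes "inner_form B"
  shows "det (gram B) \<noteq> 0"
proof -
  have "a = 0" if "gram B *v a = 0" for a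
  proof (rule inner_form_eqI[OF assms])
    fix w
    have 0: "B a (axis i 1) = 0" for i using gram_mult[OF assms, of a i] that by simp
    have "B a w = B a (\<Sum>j\<in>UNIV. w $ j *s axis j 1)" by (simp add: basis_expansion)
    also have "\<dots> = 0"
      by (simp add: linear_sum[OF inner_formD(1)[OF assms]] linear_scale[OF inner_formD(1)[OF assms]]
        scalar_mult_eq_scaleR 0)
    finally show "B a w = B 0 w" using linear_0[OF inner_formD(2)[OF assms]] by simp
  qed
  then show ?thesis
    by (metis invertible_det_nz matrix_left_invertible_ker invertible_left_inverse)
qed

text \<open>An explicit rational formula for the definite description; continuity and
  differentiability of \<open>sharp\<close> in a parameter are read off from it.\<close>

lemma sharp_cramer:
  assumes "inner_form B" "linear \<alpha>"
  shows "sharp B \<alpha> = (\<chi> k. det (\<chi> i j. if j = k then \<alpha> (axis i 1) else B (axis i 1) (axis j 1)) /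
                        det (gram B))"
proof -
  have "gram B *v sharp B \<alpha> = (\<chi> i. \<alpha> (axis i 1))"
    by (simp add: vec_eq_iff gram_mult assms sharp_works)
  then show ?thesis
    unfolding cramer[OF det_gram_nonzero[OF assms(1)]]
    by (simp only: gram_def vec_lambda_beta)
qed

lemma differentiable_on_vec3:
  fixes f :: "'e::real_normed_vector \<Rightarrow> real^3"
  assumes "\<And>k. (\<lambda>x. f x $ k) differentiable_on S"
  shows "f differentiable_on S"
  unfolding differentiable_on_def
proof
  fix x assume "x \<in> S"
  then have "(\<lambda>x. f x \<bullet> i) differentiable (at x within S)" if "i \<in> Basis" for i
    using that assms unfolding differentiable_on_def by (auto simp: Basis_vec_def inner_axis)
  then show "f differentiable (at x within S)"
    using differentiable_componentwise_within by blast
qed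

lemma differentiable_on_divide:
  fixes f g :: "'e::real_normed_vector \<Rightarrow> real"
  assumes "f differentiable_on S" "g differentiable_on S" "\<And>x. x \<in> S \<Longrightarrow> g x \<noteq> 0"
  shows "(\<lambda>x. f x / g x) differentiable_on S"
  using assms unfolding differentiable_on_def by auto

lemma sharp_differentiable_on:
  fixes G :: "'e::real_normed_vector \<Rightarrow> real^3 \<Rightarrow> real^3 \<Rightarrow> real"
  assumes "\<And>x. x \<in> S \<Longrightarrow> inner_form (G x)" "\<And>x. x \<in> S \<Longrightarrow> linear (\<alpha> x)"
    "\<And>u v. (\<lambda>x. G x u v) differentiable_on S" "\<And>w. (\<lambda>x. \<alpha> x w) differentiable_on S"
  shows "(\<lambda>x. sharp (G x) (\<alpha> x)) differentiable_on S"
proof -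
  have if_diff: "(\<lambda>x. if P then f x else g x) differentiable_on S"
    if "f differentiable_on S" "g differentiable_on S" for P and f g :: "'e \<Rightarrow> real"
    using that by (cases P) auto
  have "(\<lambda>x. \<chi> k. det (\<chi> i j. if j = k then \<alpha> x (axis i 1) else G x (axis i 1) (axis j 1)) /
                        det (gram (G x))) differentiable_on S" (is "?f differentiable_on S")
  proof (rule differentiable_on_vec3)
    fix k :: 3
    have "(\<lambda>x. det (\<chi> i j. if j = k then \<alpha> x (axis i 1) else G x (axis i 1) (axis j 1)) /
                        det (gram (G x))) differentiable_on S"
    proof (intro differentiable_on_divide)
      show "(\<lambda>x. det (\<chi> i j. if j = k then \<alpha> x (axis i 1) else G x (axis i 1) (axis j 1))) differentiable_on S"
        unfolding det_3
        by (simp only: vec_lambda_beta) (intro differentiable_on_add differentiable_on_diff differentiable_on_mult if_diff assms(3,4))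
      show "(\<lambda>x. det (gram (G x))) differentiable_on S"
        unfolding det_3 gram_def
        by (simp only: vec_lambda_beta) (intro differentiable_on_add differentiable_on_diff differentiable_on_mult if_diff assms(3,4))
      show "det (gram (G x)) \<noteq> 0" if "x \<in> S" for x
        using det_gram_nonzero[OF assms(1)[OF that]] by simp
    qed
    then show "(\<lambda>x. ?f x $ k) differentiable_on S" by (simp only: vec_lambda_beta)
  qed
  then have f: "?f differentiable (at x within S)" if "x \<in> S" for x
    using that by (simp only: differentiable_on_def)
  show ?thesis
    unfolding differentiable_on_def
  proof
    fix x assume x: "x \<in> S"
    show "(\<lambda>x. sharp (G x) (\<alpha> x)) differentiable (at x within S)"
      by (rule differentiable_transform_within[OF f[OF x] zero_less_one x])
        (simp only: sharp_cramer assms(1,2))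
  qed
qed

lemma sharp_continuous_on:
  fixes G :: "'e::real_normed_vector \<Rightarrow> real^3 \<Rightarrow> real^3 \<Rightarrow> real"
  assumes "\<And>x. x \<in> S \<Longrightarrow> inner_form (G x)" "\<And>x. x \<in> S \<Longrightarrow> linear (\<alpha> x)"
    "\<And>u v. continuous_on S (\<lambda>x. G x u v)" "\<And>w. continuous_on S (\<lambda>x. \<alpha> x w)"
  shows "continuous_on S (\<lambda>x. sharp (G x) (\<alpha> x))"
proof -
  have if_cont: "continuous_on S (\<lambda>x. if P then f x else g x)"
    if "continuous_on S f" "continuous_on S g" for P and f g :: "'e \<Rightarrow> real"
    using that by (cases P) auto
  have "continuous_on S (\<lambda>x. \<chi> k. det (\<chi> i j. if j = k then \<alpha> x (axis i 1) else G x (axis i 1) (axis j 1)) /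
                        det (gram (G x)))"
  proof (rule continuous_on_vec_lambda)
    fix k :: 3
    show "continuous_on S (\<lambda>x. det (\<chi> i j. if j = k then \<alpha> x (axis i 1) else G x (axis i 1) (axis j 1)) /
                        det (gram (G x)))"
    proof (intro continuous_on_divide)
      show "continuous_on S (\<lambda>x. det (\<chi> i j. if j = k then \<alpha> x (axis i 1) else G x (axis i 1) (axis j 1)))"
        unfolding det_3
        by (simp only: vec_lambda_beta) (intro continuous_on_add continuous_on_diff continuous_on_mult if_cont assms(3,4))
      show "continuous_on S (\<lambda>x. det (gram (G x)))"
        unfolding det_3 gram_def
        by (simp only: vec_lambda_beta) (intro continuous_on_add continuous_on_diff continuous_on_mult if_cont assms(3,4))
      show "\<forall>x\<in>S. det (gram (G x)) \<noteq> 0"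
        using det_gram_nonzero[OF assms(1)] by simp
    qed
  qed
  then show ?thesis
    by (rule continuous_on_eq) (simp only: sharp_cramer assms(1,2))
qed

section \<open>Orthonormal frames and traces\<close>

lemma ex_inner_perp:
  fixes B :: "real^3 \<Rightarrow> real^3 \<Rightarrow> real"
  assumes B: "inner_form B"
  shows "\<exists>e. B e e = 1 \<and> B e a = 0 \<and> B e b = 0"
proof -
  have "dim {a, b} \<le> card {a, b}" by (rule dim_le_card) (auto simp: span_superset)
  also have "\<dots> \<le> 2" by (cases "a = b") auto
  finally have "dim {a, b} < DIM(real^3)" by simp
  then have "span {a, b} \<noteq> UNIV" by (metis dim_eq_full nat_neq_iff)
  then obtain n where n: "n \<noteq> 0" "n \<bullet> a = 0" "n \<bullet> b = 0"
    using span_not_univ_subset_hyperplane[of "{a, b}"] span_base by blast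
  \<comment> \<open>Raising the Euclidean normal \<open>n\<close> turns Euclidean orthogonality to
    \<open>a\<close> and \<open>b\<close> into orthogonality with respect to
    \<open>B\<close>.\<close>
  define s where "s = sharp B (\<lambda>w. n \<bullet> w)"
  have s: "B s w = n \<bullet> w" for w
    unfolding s_def by (rule sharp_works[OF B]) (rule bounded_linear.linear[OF bounded_linear_inner_right])
  have "s \<noteq> 0" using s[of n] n(1) linear_0[OF inner_formD(2)[OF B]] by auto
  then have p: "0 < B s s" using inner_formD(4)[OF B] by blast
  define e where "e = (1 / sqrt (B s s)) *\<^sub>R s"
  have "B e e = 1" using p
    by (simp add: e_def linear_scale[OF inner_formD(2)[OF B]] linear_scale[OF inner_formD(1)[OF B]]
        field_simps flip: real_sqrt_mult)
  moreover have "B e a = 0" "B e b = 0"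
    by (simp_all add: e_def linear_scale[OF inner_formD(2)[OF B]] s n)
  ultimately show ?thesis by blast
qed

text \<open>The index runs over the naturals below 3, so that the direction of the gradient can be
  placed at index 0. The expansion of every vector is recorded together with orthonormality.\<close>

definition frame :: "(real^3 \<Rightarrow> real^3 \<Rightarrow> real) \<Rightarrow> (nat \<Rightarrow> real^3) \<Rightarrow> bool" where
  "frame B e \<longleftrightarrow> (\<forall>i<3. \<forall>j<3. B (e i) (e j) = (if i = j then 1 else 0)) \<and>
     (\<forall>u. u = (\<Sum>i<3. B u (e i) *\<^sub>R e i))"

lemma ex_frame:
  fixes B :: "real^3 \<Rightarrow> real^3 \<Rightarrow> real"
  assumes B: "inner_form B" and e1: "B e1 e1 = 1"
  shows "\<exists>e. frame B e \<and> e 0 = e1"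
proof -
  obtain e2 where e2: "B e2 e2 = 1" "B e2 e1 = 0" using ex_inner_perp[OF B] by blast
  obtain e3 where e3: "B e3 e3 = 1" "B e3 e1 = 0" "B e3 e2 = 0" using ex_inner_perp[OF B] by blast
  note sym = inner_formD(3)[OF B]
  note lin = linear_add[OF inner_formD(2)[OF B]] linear_scale[OF inner_formD(2)[OF B]]
    linear_diff[OF inner_formD(2)[OF B]] linear_0[OF inner_formD(2)[OF B]]
  define F where "F x = x $ 1 *\<^sub>R e1 + x $ 2 *\<^sub>R e2 + x $ 3 *\<^sub>R e3" for x :: "real^3"
  have F: "B (F x) e1 = x $ 1" "B (F x) e2 = x $ 2" "B (F x) e3 = x $ 3" for x
    using e1 e2 e3 sym[of e1 e2] sym[of e1 e3] sym[of e2 e3] by (simp_all add: F_def lin)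
  have "linear F" unfolding F_def by (rule linearI) (simp_all add: algebra_simps)
  moreover have "inj F"
  proof (rule injI)
    fix x y assume "F x = F y"
    then have "x $ 1 = y $ 1" "x $ 2 = y $ 2" "x $ 3 = y $ 3"
      using F[of x] F[of y] by simp_all
    then show "x = y" by (simp add: vec_eq_iff forall_3)
  qed
  ultimately have "surj F" by (rule linear_injective_imp_surjective) simp
  have ex: "u = B u e1 *\<^sub>R e1 + B u e2 *\<^sub>R e2 + B u e3 *\<^sub>R e3" for u
  proof -
    obtain x where "u = F x" using \<open>surj F\<close> by (metis surjD)
    then show ?thesis using F[of x] by (simp add: F_def)
  qed
  define e where "e i = (if i = 0 then e1 else if i = 1 then e2 else e3)" for i :: nat
  have "frame B e"
    unfolding frame_def
  proof (intro conjI allI impI)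
    fix i j :: nat assume "i < 3" "j < 3"
    then have "i = 0 \<or> i = 1 \<or> i = 2" "j = 0 \<or> j = 1 \<or> j = 2" by auto
    then show "B (e i) (e j) = (if i = j then 1 else 0)"
      using e1 e2 e3 sym[of e1 e2] sym[of e1 e3] sym[of e2 e3] by (auto simp: e_def)
  next
    fix u show "u = (\<Sum>i<3. B u (e i) *\<^sub>R e i)"
      using ex[of u] by (simp add: e_def eval_nat_numeral)
  qed
  then show ?thesis by (auto simp: e_def)
qed

lemma sharp_inner_frame:
  assumes "inner_form B" "frame B e"
  shows "sharp B (\<lambda>w. w \<bullet> k) = (\<Sum>i<3. (e i \<bullet> k) *\<^sub>R e i)"
proof (rule sharp_unique[OF assms(1)])
  show "linear (\<lambda>w. w \<bullet> k)" by (rule bounded_linear.linear[OF bounded_linear_inner_left])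
  fix w
  have "w \<bullet> k = (\<Sum>i<3. B w (e i) *\<^sub>R e i) \<bullet> k"
    using assms(2) unfolding frame_def by metis
  then show "B (\<Sum>i<3. (e i \<bullet> k) *\<^sub>R e i) w = w \<bullet> k"
    by (simp add: linear_sum[OF inner_formD(1)[OF assms(1)]] linear_scale[OF inner_formD(1)[OF assms(1)]]
      inner_sum_left inner_formD(3)[OF assms(1), of _ w] mult.commute)
qed

text \<open>The Laplacian and the Ricci tensor are defined by coordinate traces, whereas the
  eigenvalue estimate needs an orthonormal frame; a trace taken with the inverse metric is
  independent of this choice.\<close>

lemma trace_frame:
  assumes "inner_form B" "frame B e" and T: "\<And>u. linear (T u)" "\<And>v. linear (\<lambda>u. T u v)"
  shows "(\<Sum>k\<in>Basis. T k (sharp B (\<lambda>w. w \<bullet> k))) = (\<Sum>i<3. T (e i) (e i) :: real)"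
proof -
  have "(\<Sum>k\<in>Basis. T k (sharp B (\<lambda>w. w \<bullet> k))) = (\<Sum>k\<in>Basis. \<Sum>i<3. (e i \<bullet> k) * T k (e i))"
    by (simp add: sharp_inner_frame[OF assms(1,2)] linear_sum[OF T(1)] linear_scale[OF T(1)])
  also have "\<dots> = (\<Sum>i<3. T (\<Sum>k\<in>Basis. (e i \<bullet> k) *\<^sub>R k) (e i))"
    by (subst sum.swap) (simp add: linear_sum[OF T(2)] linear_scale[OF T(2)])
  finally show ?thesis by (simp add: euclidean_representation)
qed

lemma trace_inner_frame:
  assumes "inner_form B" "frame B e" and T: "linear T"
  shows "(\<Sum>b\<in>Basis. T b \<bullet> b) = (\<Sum>i<3. B (T (e i)) (e i))"
proof -
  have "(\<Sum>b\<in>Basis. T b \<bullet> b) = (\<Sum>b\<in>Basis. B (T b) (sharp B (\<lambda>w. w \<bullet> b)))"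
    by (rule sum.cong[OF refl])
      (subst inner_formD(3)[OF assms(1)], subst sharp_works[OF assms(1)],
        auto intro: bounded_linear.linear[OF bounded_linear_inner_left])
  also have "\<dots> = (\<Sum>i<3. B (T (e i)) (e i))"
    using assms by (intro trace_frame) (auto simp: inner_formD(1)
      intro: linear_compose[OF T inner_formD(2), unfolded o_def])
  finally show ?thesis .
qed

lemma trace_ginv:
  assumes "\<And>u. linear (T u)"
  shows "(\<Sum>k\<in>Basis. \<Sum>l\<in>Basis. ginv B k l * T k l) = (\<Sum>k\<in>Basis. T k (sharp B (\<lambda>w. w \<bullet> k)) :: real)"
proof (rule sum.cong[OF refl])
  fix k :: 'a
  let ?s = "sharp B (\<lambda>w. w \<bullet> k)"
  have "T k ?s = T k (\<Sum>l\<in>Basis. (?s \<bullet> l) *\<^sub>R l)" by (simp add: euclidean_representation)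
  then show "(\<Sum>l\<in>Basis. ginv B k l * T k l) = T k ?s"
    by (simp add: linear_sum[OF assms] linear_scale[OF assms] ginv_def)
qed

section \<open>Coordinate calculus of a metric\<close>

lemma hess_eq:
  "hess S G f x u v = dd S (\<lambda>y. dd S f y v) x u - dd S f x (christoffel S G x u v)"
proof -
  have "nabla S G (\<lambda>y _. f y) y [w] = dd S f y w" for y w by simp
  then have "nabla S G (\<lambda>y _. f y) = (\<lambda>y ws. case ws of [] \<Rightarrow> 0 | w # vs \<Rightarrow>
      dd S f y w - (\<Sum>m<length vs. f y))"
    by (intro ext) (simp split: list.split)
  then show ?thesis by (simp add: hess_def)
qed

text \<open>Restricted to open sets, where iterated derivatives can be commuted; it will be applied
  to the interior of a chart image.\<close>

locale coordinate_metric =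
  fixes S :: "(real^3) set" and G :: "real^3 \<Rightarrow> real^3 \<Rightarrow> real^3 \<Rightarrow> real"
  assumes open_S: "open S"
    and inner_G: "x \<in> S \<Longrightarrow> inner_form (G x)"
    and smooth_G: "smooth_on S (\<lambda>x. G x u v)"
begin

lemmas G_sym = inner_formD(3)[OF inner_G]
lemmas G_lin1 = inner_formD(2)[OF inner_G]
lemmas G_lin2 = inner_formD(1)[OF inner_G]

abbreviation \<Gamma> where "\<Gamma> \<equiv> christoffel S G"

abbreviation dG where "dG x u v w \<equiv> dd S (\<lambda>y. G y v w) x u"

lemma diff_G: "(\<lambda>y. G y v w) differentiable_on S"
  by (rule smooth_on_differentiable[OF smooth_G])

lemma diff_dG: "(\<lambda>y. dG y u v w) differentiable_on S"
  by (rule smooth_on_differentiable[OF smooth_on_dd[OF smooth_G open_S]])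

lemma dG_lin:
  assumes "x \<in> S"
  shows "linear (\<lambda>u. dG x u v w)" "linear (\<lambda>v. dG x u v w)" "linear (\<lambda>w. dG x u v w)"
  using assms G_lin1 G_lin2 open_S
  by (auto intro!: dd_linear_in_parameter linear_dd diff_G)

lemma dG_sym: "x \<in> S \<Longrightarrow> dG x u v w = dG x u w v"
  by (subst dd_cong[of S "\<lambda>y. G y v w" "\<lambda>y. G y w v"]) (auto simp: G_sym)

lemma christoffel_covector_linear:
  assumes "x \<in> S"
  shows "linear (\<lambda>w. (dG x u v w + dG x v u w - dG x w u v) / 2)"
  by (rule linearI)
    (simp_all add: linear_add[OF dG_lin(3)[OF assms]] linear_add[OF dG_lin(1)[OF assms]]
      linear_scale[OF dG_lin(3)[OF assms]] linear_scale[OF dG_lin(1)[OF assms]] field_simps)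

lemma G_christoffel:
  "x \<in> S \<Longrightarrow> G x (\<Gamma> x u v) w = (dG x u v w + dG x v u w - dG x w u v) / 2"
  unfolding christoffel_def
  by (rule sharp_works[OF inner_G christoffel_covector_linear])

lemma christoffel_sym: "x \<in> S \<Longrightarrow> \<Gamma> x u v = \<Gamma> x v u"
proof (rule inner_form_eqI[OF inner_G])
  fix w assume x: "x \<in> S"
  show "G x (\<Gamma> x u v) w = G x (\<Gamma> x v u) w"
    using dG_sym[OF x, of u v w] by (simp add: G_christoffel[OF x])
qed

lemma christoffel_lin2: "x \<in> S \<Longrightarrow> linear (\<Gamma> x u)"
  by (rule linearI; rule inner_form_eqI[OF inner_G])
    (auto simp: G_christoffel linear_add[OF G_lin1] linear_scale[OF G_lin1]
      linear_add[OF dG_lin(1)] linear_add[OF dG_lin(2)] linear_add[OF dG_lin(3)]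
      linear_scale[OF dG_lin(1)] linear_scale[OF dG_lin(2)] linear_scale[OF dG_lin(3)] field_simps)

lemma christoffel_lin1: "x \<in> S \<Longrightarrow> linear (\<lambda>u. \<Gamma> x u v)"
  by (subst christoffel_sym) (auto simp: christoffel_lin2)

lemma diff_christoffel: "(\<lambda>y. \<Gamma> y u v) differentiable_on S"
  unfolding christoffel_def
proof (rule sharp_differentiable_on)
  fix w
  have "(\<lambda>x. inverse 2 * (dG x u v w + dG x v u w - dG x w u v)) differentiable_on S"
    by (intro differentiable_on_mult differentiable_on_add differentiable_on_diff diff_dG) simp
  then show "(\<lambda>x. (dG x u v w + dG x v u w - dG x w u v) / 2) differentiable_on S"
    by (simp add: field_simps)
qed (auto intro: inner_G christoffel_covector_linear diff_G)

lemma metric_compatible: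
  assumes x: "x \<in> S"
  shows "dG x u v w = G x (\<Gamma> x u v) w + G x v (\<Gamma> x u w)"
  using G_sym[OF x, of v "\<Gamma> x u w"] dG_sym[OF x, of v w u]
  by (simp add: G_christoffel[OF x] field_simps)

lemma riem_lin1:
  assumes "x \<in> S"
  shows "linear (\<lambda>u. riem S G x u v w)"
proof -
  have l: "linear (\<lambda>u. dd S (\<lambda>y. \<Gamma> y v w) x u)" "linear (\<lambda>u. dd S (\<lambda>y. \<Gamma> y u w) x v)"
    using assms open_S christoffel_lin1
    by (auto intro!: linear_dd dd_linear_in_parameter diff_christoffel)
  show ?thesis
    unfolding riem_def
    by (rule linearI) (simp_all add: linear_add[OF l(1)] linear_add[OF l(2)] linear_scale[OF l(1)]
      linear_scale[OF l(2)] linear_add[OF christoffel_lin1[OF assms]] linear_scale[OF christoffel_lin1[OF assms]]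
      linear_add[OF christoffel_lin2[OF assms]] linear_scale[OF christoffel_lin2[OF assms]] algebra_simps)
qed

lemma riem_lin3:
  assumes "x \<in> S"
  shows "linear (riem S G x u v)"
proof -
  have l: "linear (\<lambda>w. dd S (\<lambda>y. \<Gamma> y v w) x u)" for u v
    using assms open_S christoffel_lin2
    by (auto intro!: linear_dd dd_linear_in_parameter diff_christoffel)
  show ?thesis
    unfolding riem_def
    by (rule linearI) (simp_all add: linear_add[OF l] linear_scale[OF l]
      linear_add[OF christoffel_lin2[OF assms]] linear_scale[OF christoffel_lin2[OF assms]] algebra_simps)
qed

lemma dd_G_apply:
  assumes "x \<in> S" "X differentiable_on S"
  shows "dd S (\<lambda>y. G y (X y) w) x u = dG x u (X x) w + G x (dd S X x u) w"
  using dd_apply[where T = "\<lambda>y a. G y a w" and X = X, OF open_S assms(1) G_lin1 diff_G assms(2)] .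

text \<open>Two metric derivatives of the function \<open>G y w w\<close> with constant
  \<open>w\<close>: its mixed partial derivatives agree, and the terms symmetric in \<open>u\<close>
  and \<open>v\<close> drop out of the difference, leaving the curvature.\<close>

lemma riem_skew_diag:
  assumes x: "x \<in> S"
  shows "G x (riem S G x u v w) w = 0"
proof -
  have half: "dG y v w w = 2 * G y (\<Gamma> y v w) w" if "y \<in> S" for y v
    using metric_compatible[OF that] G_sym[OF that] by simp
  have "dd S (\<lambda>y. dG y v w w) x u = 2 * (G x (\<Gamma> x u (\<Gamma> x v w)) w + G x (\<Gamma> x v w) (\<Gamma> x u w)
      + G x (dd S (\<lambda>y. \<Gamma> y v w) x u) w)" for u v
  proof -
    have d: "(\<lambda>y. G y (\<Gamma> y v w) w) differentiable_on S"
      using differentiable_on_apply[where T = "\<lambda>y a. G y a w", OF open_S G_lin1 diff_G diff_christoffel] .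
    have "dd S (\<lambda>y. dG y v w w) x u = dd S (\<lambda>y. 2 * G y (\<Gamma> y v w) w) x u"
      by (subst dd_cong[of S "\<lambda>y. dG y v w w" "\<lambda>y. 2 * G y (\<Gamma> y v w) w"]) (auto simp: half x)
    also have "\<dots> = 2 * dd S (\<lambda>y. G y (\<Gamma> y v w) w) x u"
      by (rule dd_cmult[OF open_S x d])
    also have "dd S (\<lambda>y. G y (\<Gamma> y v w) w) x u =
        dG x u (\<Gamma> x v w) w + G x (dd S (\<lambda>y. \<Gamma> y v w) x u) w"
      by (rule dd_G_apply[OF x diff_christoffel])
    also have "dG x u (\<Gamma> x v w) w = G x (\<Gamma> x u (\<Gamma> x v w)) w + G x (\<Gamma> x v w) (\<Gamma> x u w)"
      by (rule metric_compatible[OF x])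
    finally show ?thesis by simp
  qed
  moreover have "dd S (\<lambda>y. dG y v w w) x u = dd S (\<lambda>y. dG y u w w) x v"
    by (rule dd_commute[OF open_S x]) (use smooth_G in \<open>simp add: smooth_on_def del: Ck_on.simps\<close>)
  ultimately have "G x (\<Gamma> x u (\<Gamma> x v w)) w + G x (dd S (\<lambda>y. \<Gamma> y v w) x u) w =
      G x (\<Gamma> x v (\<Gamma> x u w)) w + G x (dd S (\<lambda>y. \<Gamma> y u w) x v) w"
    using G_sym[OF x, of "\<Gamma> x v w" "\<Gamma> x u w"] by simp
  then show ?thesis
    unfolding riem_def
    by (simp add: linear_add[OF G_lin1[OF x]] linear_diff[OF G_lin1[OF x]])
qed

lemma riem_skew:
  assumes x: "x \<in> S"
  shows "G x (riem S G x u v w) z = - G x (riem S G x u v z) w"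
  using riem_skew_diag[OF x, of u v "w + z"] riem_skew_diag[OF x, of u v w] riem_skew_diag[OF x, of u v z]
  by (simp add: linear_add[OF riem_lin3[OF x]] linear_add[OF G_lin1[OF x]] linear_add[OF G_lin2[OF x]])

lemma ricci_frame:
  assumes "x \<in> S" "frame (G x) e"
  shows "ricci S G x v w = (\<Sum>i<3. G x (riem S G x (e i) v w) (e i))"
  unfolding ricci_def by (rule trace_inner_frame[OF inner_G[OF assms(1)] assms(2) riem_lin1[OF assms(1)]])

end

section \<open>Gradient, Hessian and Bochner's formula\<close>

locale coordinate_potential = coordinate_metric +
  fixes f :: "real^3 \<Rightarrow> real"
  assumes smooth_f: "smooth_on S f"
begin

abbreviation "df \<equiv> dd S f"
abbreviation "Hs \<equiv> hess S G f"

definition grad :: "real^3 \<Rightarrow> real^3" where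
  "grad x = sharp (G x) (df x)"

definition sq :: "real^3 \<Rightarrow> real" where
  "sq x = df x (grad x)"

text \<open>The covariant derivative of the Hessian in the direction \<open>u\<close>, evaluated on
  constant fields \<open>v\<close> and \<open>w\<close>.\<close>

definition nabla_hess :: "real^3 \<Rightarrow> real^3 \<Rightarrow> real^3 \<Rightarrow> real^3 \<Rightarrow> real" where
  "nabla_hess x u v w = dd S (\<lambda>y. Hs y v w) x u - Hs x (\<Gamma> x u v) w - Hs x v (\<Gamma> x u w)"

lemma diff_f: "f differentiable_on S"
  by (rule smooth_on_differentiable[OF smooth_f])

lemma smooth_df: "smooth_on S (\<lambda>y. df y u)"
  by (rule smooth_on_dd[OF smooth_f open_S])

lemma diff_df: "(\<lambda>y. df y u) differentiable_on S"
  by (rule smooth_on_differentiable[OF smooth_df])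

lemma diff_ddf: "(\<lambda>y. dd S (\<lambda>z. df z v) y u) differentiable_on S"
  by (rule smooth_on_differentiable[OF smooth_on_dd[OF smooth_df open_S]])

lemma df_lin: "x \<in> S \<Longrightarrow> linear (df x)"
  by (rule linear_dd[OF diff_f])

lemma G_grad: "x \<in> S \<Longrightarrow> G x (grad x) w = df x w"
  unfolding grad_def by (rule sharp_works[OF inner_G df_lin])

lemma diff_grad: "grad differentiable_on S"
  unfolding grad_def[abs_def] by (rule sharp_differentiable_on) (auto intro: inner_G df_lin diff_G diff_df)

lemma diff_df_christoffel: "(\<lambda>y. df y (\<Gamma> y u v)) differentiable_on S"
  by (rule differentiable_on_apply[where T = df, OF open_S df_lin diff_df diff_christoffel])

lemma diff_hess: "(\<lambda>y. Hs y u v) differentiable_on S"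
  unfolding hess_eq by (intro differentiable_on_diff diff_ddf diff_df_christoffel)

lemma ddf_sym: "x \<in> S \<Longrightarrow> dd S (\<lambda>y. df y v) x u = dd S (\<lambda>y. df y u) x v"
  by (rule dd_commute[OF open_S]) (use smooth_f in \<open>auto simp add: smooth_on_def simp del: Ck_on.simps\<close>)

lemma hess_sym: "x \<in> S \<Longrightarrow> Hs x u v = Hs x v u"
  by (simp add: hess_eq ddf_sym[of x v u] christoffel_sym[of x u v])

lemma hess_lin1:
  assumes "x \<in> S"
  shows "linear (\<lambda>u. Hs x u v)"
proof -
  have l: "linear (\<lambda>u. dd S (\<lambda>y. df y v) x u)"
    using assms by (intro linear_dd diff_df)
  show ?thesis
    unfolding hess_eq
    by (rule linearI) (simp_all add: linear_add[OF l] linear_scale[OF l]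
      linear_add[OF christoffel_lin1[OF assms]] linear_scale[OF christoffel_lin1[OF assms]]
      linear_add[OF df_lin[OF assms]] linear_scale[OF df_lin[OF assms]] algebra_simps)
qed

lemma hess_lin2: "x \<in> S \<Longrightarrow> linear (Hs x u)"
proof -
  assume x: "x \<in> S"
  then have "Hs x u = (\<lambda>v. Hs x v u)" using hess_sym by auto
  then show ?thesis using hess_lin1[OF x, of u] by simp
qed

text \<open>The vector on the left is the covariant derivative of the gradient; the identity comes
  from differentiating \<open>G y (grad y) w = df y w\<close>.\<close>

lemma G_nabla_grad:
  assumes x: "x \<in> S"
  shows "G x (dd S grad x u + \<Gamma> x u (grad x)) w = Hs x u w"
proof -
  have "dd S (\<lambda>y. df y w) x u = dd S (\<lambda>y. G y (grad y) w) x u"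
    by (subst dd_cong[of S "\<lambda>y. df y w" "\<lambda>y. G y (grad y) w"]) (auto simp: G_grad x)
  also have "\<dots> = dG x u (grad x) w + G x (dd S grad x u) w"
    by (rule dd_G_apply[OF x diff_grad])
  also have "dG x u (grad x) w = G x (\<Gamma> x u (grad x)) w + df x (\<Gamma> x u w)"
    using metric_compatible[OF x] G_grad[OF x] by simp
  finally show ?thesis
    by (simp add: hess_eq linear_add[OF G_lin1[OF x]])
qed

lemma has_derivative_sq:
  assumes x: "x \<in> S"
  shows "(sq has_derivative (\<lambda>u. 2 * Hs x u (grad x))) (at x)"
proof -
  have "(sq has_derivative (\<lambda>u. dd S (\<lambda>y. df y (grad x)) x u + df x (dd S grad x u))) (at x)"
    unfolding sq_def[abs_def]
    by (rule has_derivative_apply[where T = df, OF open_S x df_lin diff_df diff_grad])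
  moreover have "dd S (\<lambda>y. df y (grad x)) x u + df x (dd S grad x u) = 2 * Hs x u (grad x)" for u
  proof -
    have "df x (dd S grad x u) + df x (\<Gamma> x u (grad x)) = Hs x u (grad x)"
      using G_nabla_grad[OF x, of u "grad x"] G_grad[OF x]
      by (simp add: G_sym[OF x, of _ "grad x"] linear_add[OF df_lin[OF x]])
    then show ?thesis by (simp add: hess_eq)
  qed
  ultimately show ?thesis by simp
qed

text \<open>The Ricci identity for the differential of \<open>f\<close>: the third partial
  derivatives cancel by symmetry, and what the Christoffel terms leave is the curvature applied to
  \<open>w\<close>.\<close>

lemma codazzi:
  assumes x: "x \<in> S"
  shows "nabla_hess x u v w - nabla_hess x v u w = - df x (riem S G x u v w)"
proof -
  have dH: "dd S (\<lambda>y. Hs y v w) x u = dd S (\<lambda>y. dd S (\<lambda>z. df z w) y v) x u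
      - dd S (\<lambda>y. df y (\<Gamma> x v w)) x u - df x (dd S (\<lambda>y. \<Gamma> y v w) x u)" for u v
  proof -
    have "dd S (\<lambda>y. df y (\<Gamma> y v w)) x u =
        dd S (\<lambda>y. df y (\<Gamma> x v w)) x u + df x (dd S (\<lambda>y. \<Gamma> y v w) x u)"
      by (rule dd_apply[where T = df, OF open_S x df_lin diff_df diff_christoffel])
    then show ?thesis
      unfolding hess_eq using dd_diff[OF open_S x diff_ddf diff_df_christoffel] by simp
  qed
  have third: "dd S (\<lambda>y. dd S (\<lambda>z. df z w) y v) x u = dd S (\<lambda>y. dd S (\<lambda>z. df z w) y u) x v"
    by (rule dd_commute[OF open_S x]) (use smooth_df in \<open>simp add: smooth_on_def del: Ck_on.simps\<close>)
  have H: "Hs x u (\<Gamma> x v w) = dd S (\<lambda>y. df y (\<Gamma> x v w)) x u - df x (\<Gamma> x u (\<Gamma> x v w))" for u v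
    by (simp add: hess_eq)
  have "nabla_hess x u v w - nabla_hess x v u w =
      dd S (\<lambda>y. Hs y v w) x u - dd S (\<lambda>y. Hs y u w) x v - Hs x v (\<Gamma> x u w) + Hs x u (\<Gamma> x v w)"
    by (simp add: nabla_hess_def christoffel_sym[OF x, of u v])
  also have "\<dots> = - df x (riem S G x u v w)"
    unfolding dH H third riem_def
    by (simp add: linear_add[OF df_lin[OF x]] linear_diff[OF df_lin[OF x]])
  finally show ?thesis .
qed

lemma nabla_hess_sym: "x \<in> S \<Longrightarrow> nabla_hess x u v w = nabla_hess x u w v"
proof -
  assume x: "x \<in> S"
  have "dd S (\<lambda>y. Hs y v w) x = dd S (\<lambda>y. Hs y w v) x"
    by (rule dd_cong) (auto simp: x hess_sym)
  then show ?thesis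
    by (simp add: nabla_hess_def hess_sym[OF x, of v] hess_sym[OF x, of _ w])
qed

lemma dd_hess_lin: "x \<in> S \<Longrightarrow> linear (\<lambda>w. dd S (\<lambda>y. Hs y v w) x u)"
  "x \<in> S \<Longrightarrow> linear (\<lambda>v. dd S (\<lambda>y. Hs y v w) x u)"
  using open_S hess_lin2 hess_lin1 by (auto intro!: dd_linear_in_parameter diff_hess)

lemma nabla_hess_lin: 
  assumes x: "x \<in> S"
  shows "linear (nabla_hess x u v)" "linear (\<lambda>v. nabla_hess x u v w)"
  unfolding nabla_hess_def
  by (rule linearI, simp_all add: linear_add[OF dd_hess_lin(1)[OF x]] linear_scale[OF dd_hess_lin(1)[OF x]]
      linear_add[OF dd_hess_lin(2)[OF x]] linear_scale[OF dd_hess_lin(2)[OF x]]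
      linear_add[OF hess_lin1[OF x]] linear_scale[OF hess_lin1[OF x]]
      linear_add[OF hess_lin2[OF x]] linear_scale[OF hess_lin2[OF x]]
      linear_add[OF christoffel_lin2[OF x]] linear_scale[OF christoffel_lin2[OF x]] algebra_simps)+

text \<open>Traces commute with covariant derivatives because the metric is parallel. In coordinates
  this means that the derivative of the inverse metric, carried by the fields \<open>s k\<close>,
  cancels against the Christoffel terms of \<open>nabla_hess\<close>.\<close>

lemma trace_nabla_hess:
  assumes x: "x \<in> S" and e: "frame (G x) e"
    and lap: "\<And>y. y \<in> S \<Longrightarrow> laplacian S G f y = l y" and l: "l differentiable_on S"
  shows "(\<Sum>i<3. nabla_hess x w (e i) (e i)) = dd S l x w"
proof -
  define s where "s k y = sharp (G y) (\<lambda>w. w \<bullet> k)" for k y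
  have lin_k: "linear (\<lambda>w. w \<bullet> k)" for k :: "real^3"
    by (rule bounded_linear.linear[OF bounded_linear_inner_left])
  have Gs: "G y (s k y) w = w \<bullet> k" if "y \<in> S" for y k w
    unfolding s_def by (rule sharp_works[OF inner_G[OF that] lin_k])
  have ds: "s k differentiable_on S" for k
    unfolding s_def[abs_def] by (rule sharp_differentiable_on) (auto intro: inner_G lin_k diff_G)
  have s_lin: "s (\<Sum>j\<in>Basis. c j *\<^sub>R j) x = (\<Sum>j\<in>Basis. c j *\<^sub>R s j x)" for c
    by (rule inner_form_eqI[OF inner_G[OF x]])
      (simp add: Gs[OF x] linear_sum[OF G_lin1[OF x]] linear_scale[OF G_lin1[OF x]] inner_sum_right)
  define A where "A = \<Gamma> x w"
  have A: "linear A" unfolding A_def by (rule christoffel_lin2[OF x])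
  \<comment> \<open>Found by differentiating \<open>G y (s k y) v = v \<bullet> k\<close>, whose
    right side does not depend on \<open>y\<close>.\<close>
  have dsk: "dd S (s k) x w = - A (s k x) - (\<Sum>j\<in>Basis. (A j \<bullet> k) *\<^sub>R s j x)" for k
  proof (rule inner_form_eqI[OF inner_G[OF x]])
    fix v
    have "dd S (\<lambda>y. G y (s k y) v) x w = dd S (\<lambda>y. v \<bullet> k) x w"
      by (subst dd_cong[of S "\<lambda>y. G y (s k y) v" "\<lambda>y. v \<bullet> k"]) (auto simp: Gs x)
    also have "\<dots> = 0"
      by (subst dd_unique[OF open_S x, of _ "\<lambda>_. 0"]) auto
    finally have "dG x w (s k x) v + G x (dd S (s k) x w) v = 0"
      using dd_G_apply[OF x ds] by simp
    moreover have "dG x w (s k x) v = G x (A (s k x)) v + A v \<bullet> k"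
      using metric_compatible[OF x] Gs[OF x] by (simp add: A_def)
    moreover have "A v \<bullet> k = (\<Sum>j\<in>Basis. (v \<bullet> j) * (A j \<bullet> k))"
    proof -
      have "A v = A (\<Sum>j\<in>Basis. (v \<bullet> j) *\<^sub>R j)" by (simp add: euclidean_representation)
      then show ?thesis by (simp add: linear_sum[OF A] linear_scale[OF A] inner_sum_left)
    qed
    ultimately show "G x (dd S (s k) x w) v = G x (- A (s k x) - (\<Sum>j\<in>Basis. (A j \<bullet> k) *\<^sub>R s j x)) v"
      by (simp add: linear_diff[OF G_lin1[OF x]] linear_neg[OF G_lin1[OF x]] linear_sum[OF G_lin1[OF x]]
        linear_scale[OF G_lin1[OF x]] Gs[OF x] mult.commute)
  qed
  have lapH: "l y = (\<Sum>k\<in>Basis. Hs y k (s k y))" if "y \<in> S" for y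
    using lap[OF that] trace_ginv[of "Hs y" "G y"] hess_lin2[OF that]
    by (simp add: laplacian_def s_def)
  have dHs: "(\<lambda>y. Hs y k (s k y)) differentiable_on S" for k
    by (rule differentiable_on_apply[where T = "\<lambda>y. Hs y k", OF open_S hess_lin2 diff_hess ds])
  have "dd S l x w = dd S (\<lambda>y. \<Sum>k\<in>Basis. Hs y k (s k y)) x w"
    by (subst dd_cong[of S l "\<lambda>y. \<Sum>k\<in>Basis. Hs y k (s k y)"]) (auto simp: lapH x)
  also have "\<dots> = (\<Sum>k\<in>Basis. dd S (\<lambda>y. Hs y k (s k y)) x w)"
    by (rule dd_sum[OF open_S x]) (auto intro: dHs)
  also have "\<dots> = (\<Sum>k\<in>Basis. dd S (\<lambda>y. Hs y k (s k x)) x w + Hs x k (dd S (s k) x w))"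
    by (intro sum.cong[OF refl]
      dd_apply[where T = "\<lambda>y. Hs y _", OF open_S x hess_lin2 diff_hess ds])
  also have "\<dots> = (\<Sum>k\<in>Basis. nabla_hess x w k (s k x) + Hs x (A k) (s k x)
      - (\<Sum>j\<in>Basis. (A j \<bullet> k) * Hs x k (s j x)))"
    by (simp add: nabla_hess_def dsk linear_diff[OF hess_lin2[OF x]] linear_neg[OF hess_lin2[OF x]]
      linear_sum[OF hess_lin2[OF x]] linear_scale[OF hess_lin2[OF x]] A_def algebra_simps)
  also have "\<dots> = (\<Sum>k\<in>Basis. nabla_hess x w k (s k x)) + (\<Sum>k\<in>Basis. Hs x (A k) (s k x))
      - (\<Sum>k\<in>Basis. \<Sum>j\<in>Basis. (A j \<bullet> k) * Hs x k (s j x))"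
    by (simp add: sum.distrib sum_subtractf)
  also have "(\<Sum>k\<in>Basis. \<Sum>j\<in>Basis. (A j \<bullet> k) * Hs x k (s j x)) = (\<Sum>j\<in>Basis. Hs x (A j) (s j x))"
  proof -
    have "Hs x (A j) v = (\<Sum>k\<in>Basis. (A j \<bullet> k) * Hs x k v)" for j v
    proof -
      have "Hs x (A j) v = Hs x (\<Sum>k\<in>Basis. (A j \<bullet> k) *\<^sub>R k) v" by (simp add: euclidean_representation)
      then show ?thesis by (simp add: linear_sum[OF hess_lin1[OF x]] linear_scale[OF hess_lin1[OF x]])
    qed
    then show ?thesis by (subst sum.swap) simp
  qed
  also have "(\<Sum>k\<in>Basis. nabla_hess x w k (s k x)) = (\<Sum>i<3. nabla_hess x w (e i) (e i))"
    unfolding s_def by (rule trace_frame[OF inner_G[OF x] e nabla_hess_lin[OF x]])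
  finally show ?thesis by simp
qed

lemma trace_hess:
  assumes x: "x \<in> S" and e: "frame (G x) e"
  shows "laplacian S G f x = (\<Sum>i<3. Hs x (e i) (e i))"
  unfolding laplacian_def
  using trace_ginv[of "Hs x" "G x"] trace_frame[OF inner_G[OF x] e, of "Hs x"] hess_lin1[OF x] hess_lin2[OF x]
  by simp

text \<open>The curvature part of Bochner's formula: commuting the derivatives in the divergence of
  the Hessian produces the gradient of the Laplacian, here of \<open>3 * f\<close>, and a Ricci
  term.\<close>

lemma divergence_hess:
  assumes x: "x \<in> S" and e: "frame (G x) e"
    and lap: "\<And>y. y \<in> S \<Longrightarrow> laplacian S G f y = 3 * f y"
  shows "(\<Sum>i<3. nabla_hess x (e i) (e i) (grad x)) = 3 * sq x + ricci S G x (grad x) (grad x)"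
proof -
  have "nabla_hess x (e i) (e i) (grad x) =
      nabla_hess x (grad x) (e i) (e i) + G x (riem S G x (e i) (grad x) (grad x)) (e i)" for i
    using codazzi[OF x, of "e i" "grad x" "e i"] riem_skew[OF x, of "e i" "grad x" "e i" "grad x"]
      G_sym[OF x, of "grad x"] G_grad[OF x]
    by (simp add: nabla_hess_sym[OF x, of "e i" "e i"])
  then have "(\<Sum>i<3. nabla_hess x (e i) (e i) (grad x)) =
      (\<Sum>i<3. nabla_hess x (grad x) (e i) (e i)) + ricci S G x (grad x) (grad x)"
    by (simp add: ricci_frame[OF x e] sum.distrib)
  also have "(\<Sum>i<3. nabla_hess x (grad x) (e i) (e i)) = dd S (\<lambda>y. 3 * f y) x (grad x)"
    by (rule trace_nabla_hess[OF x e lap]) (auto intro: differentiable_on_mult diff_f)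
  also have "\<dots> = 3 * sq x"
    by (simp add: dd_cmult[OF open_S x diff_f] sq_def)
  finally show ?thesis .
qed

lemma dd_hess_grad:
  assumes x: "x \<in> S"
  shows "((\<lambda>y. Hs y u (grad y)) has_derivative
    (\<lambda>w. nabla_hess x w u (grad x) + Hs x (\<Gamma> x w u) (grad x)
      + Hs x u (dd S grad x w + \<Gamma> x w (grad x)))) (at x)"
proof -
  have "((\<lambda>y. Hs y u (grad y)) has_derivative
    (\<lambda>w. dd S (\<lambda>y. Hs y u (grad x)) x w + Hs x u (dd S grad x w))) (at x)"
    by (rule has_derivative_apply[where T = "\<lambda>y. Hs y u", OF open_S x hess_lin2 diff_hess diff_grad])
  then show ?thesis
    by (simp add: nabla_hess_def linear_add[OF hess_lin2[OF x]])
qed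

lemma hess_norm_frame:
  assumes x: "x \<in> S" and e: "frame (G x) e"
  shows "(\<Sum>i<3. Hs x (e i) (dd S grad x (e i) + \<Gamma> x (e i) (grad x))) =
    (\<Sum>i<3. \<Sum>j<3. (Hs x (e i) (e j))\<^sup>2)"
proof (rule sum.cong[OF refl])
  fix i
  let ?n = "dd S grad x (e i) + \<Gamma> x (e i) (grad x)"
  have "?n = (\<Sum>j<3. G x ?n (e j) *\<^sub>R e j)"
    using e unfolding frame_def by blast
  then have n: "?n = (\<Sum>j<3. Hs x (e i) (e j) *\<^sub>R e j)"
    by (simp only: G_nabla_grad[OF x])
  show "Hs x (e i) ?n = (\<Sum>j<3. (Hs x (e i) (e j))\<^sup>2)"
    unfolding n
    by (simp add: linear_sum[OF hess_lin2[OF x]] linear_scale[OF hess_lin2[OF x]] power2_eq_square)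
qed

end

text \<open>The derivative \<open>p'\<close> is differentiated only at 0. If \<open>c\<close> were
  positive, \<open>p'\<close> would be positive just to the right of 0, and \<open>p\<close> would
  exceed its maximum there.\<close>

lemma second_derivative_nonpos_at_max:
  fixes p p' :: "real \<Rightarrow> real"
  assumes d: "d > 0" and p: "\<And>s. \<bar>s\<bar> < d \<Longrightarrow> (p has_real_derivative p' s) (at s)"
    and c: "(p' has_real_derivative c) (at 0)" and max: "\<And>s. \<bar>s\<bar> < d \<Longrightarrow> p s \<le> p 0"
  shows "c \<le> 0"
proof (rule ccontr)
  assume "\<not> c \<le> 0"
  then obtain d' where d': "d' > 0" "\<And>h. h > 0 \<Longrightarrow> h < d' \<Longrightarrow> p' 0 < p' (0 + h)"
    using DERIV_pos_inc_right[OF c] by auto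
  have "p' 0 = 0"
    using DERIV_local_max[OF p[of 0] d] max d by auto
  define h where "h = min d d' / 2"
  have h: "0 < h" "h < d" "h < d'" using d d' by (auto simp: h_def)
  obtain z where z: "0 < z" "z < h" "p h - p 0 = (h - 0) * p' z"
    using MVT2[of 0 h p p'] h p by auto
  have "0 < p' z" using d'(2)[of z] z h \<open>p' 0 = 0\<close> by simp
  then have "p h > p 0" using z h by (smt (verit) mult_pos_pos)
  then show False using max[of h] h by auto
qed

context coordinate_potential
begin

text \<open>At a maximum of \<open>sq - h \<circ> f\<close> the gradient is an eigenvector of the Hessian with eigenvalue
  \<open>h1 / 2\<close>; the other two eigenvalues have sum \<open>3 f - h1 / 2\<close>, which bounds the norm of the Hessian in
  Bochner's formula from below.\<close>

lemma contact_inequality: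
  assumes x: "x \<in> S"
    and lap: "\<And>y. y \<in> S \<Longrightarrow> laplacian S G f y = 3 * f y"
    and static: "\<And>u v. Hs x u v = f x * ricci S G x u v + 3 * f x * G x u v"
    and pos: "f x > 0" "sq x > 0"
    and N: "open N" "f x \<in> N" and h1: "\<And>t. t \<in> N \<Longrightarrow> (h has_real_derivative h1 t) (at t)"
    and h2: "(h1 has_real_derivative h2) (at (f x))"
    and T: "open T" "x \<in> T" "\<And>y. y \<in> T \<Longrightarrow> sq y - h (f y) \<le> sq x - h (f x)"
  shows "h1 (f x) * sq x / f x + (h1 (f x))\<^sup>2 / 2 + (3 * f x - h1 (f x) / 2)\<^sup>2
    \<le> 3 * f x * h1 (f x) + h2 * sq x"
proof -
  define a where "a = h1 (f x)"
  define F where "F y = sq y - h (f y)" for y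
  define dF where "dF y u = 2 * Hs y u (grad y) - h1 (f y) * df y u" for y u
  \<comment> \<open>Within \<open>T'\<close> the composite of \<open>h\<close> and \<open>f\<close>
    is differentiable and the maximum property holds.\<close>
  define T' where "T' = {y \<in> S. f y \<in> N} \<inter> T"
  have "open T'"
  proof -
    have "continuous_on S f" by (rule differentiable_imp_continuous_on[OF diff_f])
    then have "open (f -` N \<inter> S)" using open_S N continuous_on_open_vimage by blast
    moreover have "T' = (f -` N \<inter> S) \<inter> T" by (auto simp: T'_def)
    ultimately show ?thesis using T by auto
  qed
  have xT': "x \<in> T'" using x N T by (auto simp: T'_def)
  have fd: "(f has_derivative df y) (at y)" if "y \<in> S" for y
    using has_derivative_dd_open[OF diff_f open_S that] .
  have dFd: "(F has_derivative dF y) (at y)" if "y \<in> T'" for y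
  proof -
    have "(h has_derivative (*) (h1 (f y))) (at (f y))"
      using h1 that by (auto simp: T'_def has_field_derivative_def)
    then have "((\<lambda>y. h (f y)) has_derivative (\<lambda>u. h1 (f y) * df y u)) (at y)"
      using fd[of y] that by (auto simp: T'_def intro: has_derivative_compose)
    then show ?thesis
      unfolding F_def[abs_def] dF_def using that
      by (intro has_derivative_diff has_derivative_sq) (auto simp: T'_def)
  qed
  have "dF x = (\<lambda>u. 0)"
    by (rule differential_zero_maxmin[OF xT' \<open>open T'\<close> dFd[OF xT']])
      (use T in \<open>auto simp: F_def T'_def\<close>)
  then have crit: "2 * Hs x u (grad x) = a * df x u" for u
    by (simp add: dF_def fun_eq_iff a_def)
  \<comment> \<open>The second derivative of \<open>F\<close> along the line through
    \<open>x\<close> in direction \<open>e\<close>. Its two terms with \<open>\<Gamma> x e e\<close>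
    cancel by the first-order condition \<open>crit\<close>.\<close>
  have second: "2 * nabla_hess x e e (grad x) + 2 * Hs x e (dd S grad x e + \<Gamma> x e (grad x))
    - h2 * (df x e)\<^sup>2 - a * Hs x e e \<le> 0" for e
  proof -
    let ?p' = "\<lambda>s. dF (x + s *\<^sub>R e) e"
    have lin: "((\<lambda>s. x + s *\<^sub>R e) has_derivative (\<lambda>s. s *\<^sub>R e)) (at s)" for s
      by (auto intro!: derivative_eq_intros)
    have "isCont (\<lambda>s. x + s *\<^sub>R e) 0" by (intro continuous_intros)
    then have "\<forall>\<^sub>F s in at 0. x + s *\<^sub>R e \<in> T'"
      using \<open>open T'\<close> xT' by (auto simp: isCont_def intro: topological_tendstoD)
    then obtain d where d: "d > 0" "\<And>s. \<bar>s\<bar> < d \<Longrightarrow> x + s *\<^sub>R e \<in> T'"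
      using xT' unfolding eventually_at by (auto simp: dist_real_def) (metis abs_zero add.right_neutral scaleR_zero_left)
    define c where "c = 2 * (nabla_hess x e e (grad x) + Hs x (\<Gamma> x e e) (grad x)
      + Hs x e (dd S grad x e + \<Gamma> x e (grad x)))
      - (a * dd S (\<lambda>y. df y e) x e + h2 * df x e * df x e)"
    have "c \<le> 0"
    proof (rule second_derivative_nonpos_at_max[OF d(1)])
      fix s :: real assume s: "\<bar>s\<bar> < d"
      have "((\<lambda>s. F (x + s *\<^sub>R e)) has_derivative (\<lambda>t. dF (x + s *\<^sub>R e) (t *\<^sub>R e))) (at s)"
        by (rule has_derivative_compose[OF lin dFd[OF d(2)[OF s]]])
      moreover have "dF (x + s *\<^sub>R e) (t *\<^sub>R e) = ?p' s * t" for t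
        using has_derivative_linear[OF dFd[OF d(2)[OF s]]] by (simp add: linear_scale)
      ultimately show "((\<lambda>s. F (x + s *\<^sub>R e)) has_real_derivative ?p' s) (at s)"
        by (simp add: has_field_derivative_def)
      show "F (x + s *\<^sub>R e) \<le> F (x + 0 *\<^sub>R e)"
        using T(3) d(2)[OF s] by (simp add: F_def T'_def)
    next
      have hd: "(h1 has_derivative (*) h2) (at (f x))"
        using h2 by (auto simp: has_field_derivative_def)
      have "((\<lambda>y. h1 (f y)) has_derivative (\<lambda>w. h2 * df x w)) (at x)"
        by (rule has_derivative_compose[OF fd[OF x] hd])
      moreover have "((\<lambda>y. df y e) has_derivative dd S (\<lambda>y. df y e) x) (at x)"
        by (rule has_derivative_dd_open[OF diff_df open_S x])
      ultimately have "((\<lambda>y. dF y e) has_derivative (\<lambda>w.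
         2 * (nabla_hess x w e (grad x) + Hs x (\<Gamma> x w e) (grad x) + Hs x e (dd S grad x w + \<Gamma> x w (grad x)))
         - (h1 (f x) * dd S (\<lambda>y. df y e) x w + h2 * df x w * df x e))) (at x)"
        (is "(_ has_derivative ?L) _")
        unfolding dF_def
        by (intro has_derivative_diff has_derivative_mult_right has_derivative_mult dd_hess_grad[OF x])
      then have d0: "((\<lambda>y. dF y e) has_derivative ?L) (at (x + 0 *\<^sub>R e))" by simp
      have "(?p' has_derivative (\<lambda>t. ?L (t *\<^sub>R e))) (at 0)"
        by (rule has_derivative_compose[OF lin d0])
      moreover have "?L (t *\<^sub>R e) = c * t" for t
        using linear_scale[OF has_derivative_linear[OF d0], of t e] by (simp add: c_def a_def)
      ultimately show "(?p' has_real_derivative c) (at 0)"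
        by (simp add: has_field_derivative_def)
    qed
    moreover have "dd S (\<lambda>y. df y e) x e = Hs x e e + df x (\<Gamma> x e e)"
      by (simp add: hess_eq)
    ultimately show ?thesis
      using crit[of "\<Gamma> x e e"] by (simp add: c_def power2_eq_square algebra_simps)
  qed
  define e0 where "e0 = (1 / sqrt (sq x)) *\<^sub>R grad x"
  have Ggg: "G x (grad x) (grad x) = sq x" using G_grad[OF x] by (simp add: sq_def)
  have "G x e0 e0 = 1"
    using pos by (simp add: e0_def linear_scale[OF G_lin1[OF x]] linear_scale[OF G_lin2[OF x]] Ggg
      field_simps flip: real_sqrt_mult)
  then obtain e where e: "frame (G x) e" "e 0 = e0" using ex_frame[OF inner_G[OF x]] by blast
  have grad: "grad x = sqrt (sq x) *\<^sub>R e 0" using pos e by (simp add: e0_def)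
  have dfe: "df x (e i) = (if i = 0 then sqrt (sq x) else 0)" if "i < 3" for i
  proof -
    have "df x (e i) = G x (sqrt (sq x) *\<^sub>R e 0) (e i)" using G_grad[OF x, of "e i"] grad by simp
    also have "\<dots> = sqrt (sq x) * G x (e 0) (e i)" by (simp add: linear_scale[OF G_lin1[OF x]])
    finally show ?thesis using e(1) that unfolding frame_def by auto
  qed
  have H0: "Hs x (e i) (e 0) = (if i = 0 then a / 2 else 0)" if "i < 3" for i
  proof -
    have "2 * (sqrt (sq x) * Hs x (e i) (e 0)) = a * df x (e i)"
      using crit[of "e i"] grad by (simp add: linear_scale[OF hess_lin2[OF x]])
    then show ?thesis using dfe[OF that] pos by (auto split: if_splits)
  qed
  have three: "(\<Sum>i<3. t i) = t 0 + t 1 + t 2" for t :: "nat \<Rightarrow> real"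
    by (simp add: eval_nat_numeral)
  have tr: "Hs x (e 0) (e 0) + Hs x (e 1) (e 1) + Hs x (e 2) (e 2) = 3 * f x"
    using trace_hess[OF x e(1)] lap[OF x] by (simp add: three)
  define p q where "p = Hs x (e 1) (e 1)" and "q = Hs x (e 2) (e 2)"
  have norm_ge: "(\<Sum>i<3. \<Sum>j<3. (Hs x (e i) (e j))\<^sup>2) \<ge> (a / 2)\<^sup>2 + p\<^sup>2 + q\<^sup>2"
  proof -
    have "Hs x (e 0) (e 0) = a / 2" using H0[of 0] by simp
    then show ?thesis
      unfolding three p_def q_def by (simp only:) (simp add: add_nonneg_nonneg)
  qed
  \<comment> \<open>The only loss besides the off-diagonal entries; it vanishes when the two
    transverse eigenvalues agree.\<close>
  have "2 * (p\<^sup>2 + q\<^sup>2) \<ge> (p + q)\<^sup>2"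
    using zero_le_power2[of "p - q"] by (simp add: power2_eq_square algebra_simps)
  moreover have "p + q = 3 * f x - a / 2" using tr H0[of 0] by (simp add: p_def q_def)
  ultimately have norm_ge': "2 * (\<Sum>i<3. \<Sum>j<3. (Hs x (e i) (e j))\<^sup>2) \<ge> a\<^sup>2 / 2 + (3 * f x - a / 2)\<^sup>2"
    using norm_ge by (simp add: power_divide)
  \<comment> \<open>The static equation in the gradient direction, where the Hessian is known from
    \<open>crit\<close>, eliminates the curvature from Bochner's formula.\<close>
  have "f x * ricci S G x (grad x) (grad x) = a / 2 * sq x - 3 * f x * sq x"
    using static[of "grad x" "grad x"] crit[of "grad x"] Ggg by (simp add: sq_def algebra_simps)
  then have ric: "ricci S G x (grad x) (grad x) = a * sq x / (2 * f x) - 3 * sq x"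
    using pos by (simp add: field_simps)
  have "(\<Sum>i<3. 2 * nabla_hess x (e i) (e i) (grad x) + 2 * Hs x (e i) (dd S grad x (e i) + \<Gamma> x (e i) (grad x))
    - h2 * (df x (e i))\<^sup>2 - a * Hs x (e i) (e i)) \<le> 0"
    by (intro sum_nonpos second)
  also have "(\<Sum>i<3. 2 * nabla_hess x (e i) (e i) (grad x) + 2 * Hs x (e i) (dd S grad x (e i) + \<Gamma> x (e i) (grad x))
    - h2 * (df x (e i))\<^sup>2 - a * Hs x (e i) (e i)) =
    2 * (\<Sum>i<3. nabla_hess x (e i) (e i) (grad x)) +
    2 * (\<Sum>i<3. Hs x (e i) (dd S grad x (e i) + \<Gamma> x (e i) (grad x)))
    - h2 * (\<Sum>i<3. (df x (e i))\<^sup>2) - a * (\<Sum>i<3. Hs x (e i) (e i))"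
    by (simp add: sum.distrib sum_subtractf sum_distrib_left)
  also have "(\<Sum>i<3. (df x (e i))\<^sup>2) = sq x"
    using pos by (simp add: three dfe)
  also have "(\<Sum>i<3. Hs x (e i) (e i)) = 3 * f x" using tr by (simp add: three)
  finally have "2 * (3 * sq x + ricci S G x (grad x) (grad x)) +
    2 * (\<Sum>i<3. \<Sum>j<3. (Hs x (e i) (e j))\<^sup>2) - h2 * sq x - a * (3 * f x) \<le> 0"
    by (simp only: divergence_hess[OF x e(1) lap] hess_norm_frame[OF x e(1)])
  then have "a * sq x / f x + a\<^sup>2 / 2 + (3 * f x - a / 2)\<^sup>2 - h2 * sq x - a * (3 * f x) \<le> 0"
    using norm_ge' unfolding ric by (simp add: algebra_simps)
  then show ?thesis by (simp add: a_def algebra_simps)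
qed

end

section \<open>The Kottler family\<close>

text \<open>The radius \<open>r\<close> of the Kottler space as a function of \<open>y = V\<^sup>2 - k\<close>.\<close>

definition kottler_radius :: "real \<Rightarrow> real \<Rightarrow> real" where
  "kottler_radius m y = (THE r. 0 < r \<and> r\<^sup>2 - 2 * m / r = y)"

context
  fixes m :: real
  assumes m: "m > 0"
begin

lemma kottler_mono: "0 < r \<Longrightarrow> r < s \<Longrightarrow> r\<^sup>2 - 2 * m / r < s\<^sup>2 - 2 * m / s"
proof -
  assume "0 < r" "r < s"
  then have "r\<^sup>2 < s\<^sup>2" "2 * m / s < 2 * m / r"
    using m by (auto simp: power_strict_mono frac_less2)
  then show ?thesis by linarith
qed

lemma kottler_radius_eq:
  assumes "0 < r"
  shows "kottler_radius m (r\<^sup>2 - 2 * m / r) = r"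
  unfolding kottler_radius_def
proof (rule the_equality)
  fix s assume "0 < s \<and> s\<^sup>2 - 2 * m / s = r\<^sup>2 - 2 * m / r"
  then show "s = r" using kottler_mono[of r s] kottler_mono[of s r] assms
    by (metis less_irrefl linorder_neqE_linordered_idom)
qed (use assms in auto)

lemma kottler_surj: "\<exists>r>0. r\<^sup>2 - 2 * m / r = y"
proof -
  let ?f = "\<lambda>r. r\<^sup>2 - 2 * m / r"
  \<comment> \<open>At \<open>a\<close> the term \<open>2 * m / a\<close> is at least
    \<open>\<bar>y\<bar> + 1\<close> while the square is at most 1; at \<open>b\<close> the square
    is at least \<open>b\<close> and the other term at most \<open>2 * m\<close>. So the endpoint
    values enclose \<open>y\<close>.\<close>
  define a where "a = min 1 (2 * m / (\<bar>y\<bar> + 1))"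
  define b where "b = \<bar>y\<bar> + 2 * m + 1"
  have a: "0 < a" "a \<le> 1" using m by (auto simp: a_def)
  have b: "1 \<le> b" using m by (auto simp: b_def)
  have "\<bar>y\<bar> + 1 \<le> 2 * m / a"
  proof -
    have "a \<le> 2 * m / (\<bar>y\<bar> + 1)" by (simp add: a_def)
    then have "a * (\<bar>y\<bar> + 1) \<le> 2 * m" by (simp add: pos_le_divide_eq)
    then show ?thesis using a by (simp add: pos_le_divide_eq mult.commute)
  qed
  moreover have "a\<^sup>2 \<le> 1" using a by (simp add: power_le_one)
  ultimately have lo: "?f a \<le> y" by linarith
  have "b \<le> b\<^sup>2" using b by (simp add: power2_eq_square)
  moreover have "2 * m / b \<le> 2 * m" using b m by (simp add: divide_le_eq)
  ultimately have hi: "y \<le> ?f b" by (simp add: b_def)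
  have "\<exists>r. a \<le> r \<and> r \<le> b \<and> ?f r = y"
    using a b lo hi by (intro IVT') (auto intro!: continuous_intros)
  then obtain r where "a \<le> r" "?f r = y" by blast
  then show ?thesis using a(1) by (intro exI[of _ r]) linarith
qed

lemma kottler_radius: "0 < kottler_radius m y" "(kottler_radius m y)\<^sup>2 - 2 * m / kottler_radius m y = y"
  using kottler_surj[of y] kottler_radius_eq by auto

lemma DERIV_kottler_radius:
  "(kottler_radius m has_real_derivative 1 / (2 * kottler_radius m y + 2 * m / (kottler_radius m y)\<^sup>2)) (at y)"
proof -
  let ?f = "\<lambda>r. r\<^sup>2 - 2 * m / r"
  define r where "r = kottler_radius m y"
  have r: "0 < r" "?f r = y" using kottler_radius[of y] by (auto simp: r_def)
  have D: "(?f has_real_derivative 2 * r + 2 * m / r\<^sup>2) (at r)"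
    using r by (auto intro!: derivative_eq_intros simp: power2_eq_square)
  have pos: "2 * r + 2 * m / r\<^sup>2 > 0" using r m by (simp add: add_pos_pos)
  have "isCont (kottler_radius m) (?f r)"
    by (rule isCont_inverse_function[where d = "r / 2"])
      (use r in \<open>auto intro!: kottler_radius_eq continuous_intros simp: abs_if split: if_splits\<close>)
  then have C: "isCont (kottler_radius m) y" using r by simp
  have "(kottler_radius m has_real_derivative inverse (2 * r + 2 * m / r\<^sup>2)) (at y)"
    by (rule DERIV_inverse_function[where f = ?f and a = "y - 1" and b = "y + 1"])
      (use D pos C kottler_radius in \<open>auto simp: r_def\<close>)
  then show ?thesis by (simp add: r_def inverse_eq_divide)
qed

text \<open>With V^2 = k + r^2 - 2 m / r and radial metric dr^2 / V^2, the squared gradient of V is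
  (V dV/dr)^2, and V dV/dr is half the derivative of V^2. As a function of y = V^2 - k it no longer
  involves k.\<close>

definition kottler :: "real \<Rightarrow> real" where
  "kottler y = (kottler_radius m y + m / (kottler_radius m y)\<^sup>2)\<^sup>2"

definition kottler1 :: "real \<Rightarrow> real" where
  "kottler1 y = 1 - 2 * m / (kottler_radius m y) ^ 3"

lemma DERIV_kottler: "(kottler has_real_derivative kottler1 y) (at y)"
proof -
  define r where "r = kottler_radius m y"
  have r: "0 < r" using kottler_radius(1)[of y] by (simp add: r_def)
  have q: "r + m / r\<^sup>2 > 0" using r m by (simp add: add_pos_pos)
  have D: "(kottler_radius m has_real_derivative 1 / (2 * (r + m / r\<^sup>2))) (at y)"
    using DERIV_kottler_radius[of y] by (simp add: r_def)
  have "((\<lambda>r. (r + m / r\<^sup>2)\<^sup>2) has_real_derivative 2 * (r + m / r\<^sup>2) * (1 - 2 * m / r ^ 3)) (at r)"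
  proof -
    have "((\<lambda>r. m / r\<^sup>2) has_real_derivative (0 * r\<^sup>2 - m * (2 * r)) / (r\<^sup>2 * r\<^sup>2)) (at r)"
      by (intro DERIV_divide) (use r in \<open>auto intro!: derivative_eq_intros\<close>)
    then have "((\<lambda>r. r + m / r\<^sup>2) has_real_derivative 1 - 2 * m / r ^ 3) (at r)"
      by (rule DERIV_cong[OF DERIV_add[OF DERIV_ident]])
        (use r in \<open>simp add: field_simps eval_nat_numeral\<close>)
    from DERIV_power[OF this, of 2] show ?thesis
      by (rule DERIV_cong) (simp add: mult.commute mult.assoc)
  qed
  from DERIV_chain2[OF this[unfolded r_def] D[unfolded r_def]] q
  show ?thesis
    unfolding kottler_def[abs_def] kottler1_def r_def[symmetric] by simp
qed

text \<open>The differential equation of the profile. For h t = w(t^2 - k) it is precisely equality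
  in \<open>contact_inequality\<close>.\<close>

lemma DERIV_kottler1:
  "(kottler1 has_real_derivative
    3 * (1 - kottler1 y) * (3 - kottler1 y) / (4 * kottler y)) (at y)"
proof -
  define r where "r = kottler_radius m y"
  have r: "0 < r" using kottler_radius(1)[of y] by (simp add: r_def)
  have q: "r + m / r\<^sup>2 > 0" using r m by (simp add: add_pos_pos)
  have D: "(kottler_radius m has_real_derivative 1 / (2 * (r + m / r\<^sup>2))) (at y)"
    using DERIV_kottler_radius[of y] by (simp add: r_def)
  have "((\<lambda>r. 1 - 2 * m / r ^ 3) has_real_derivative 6 * m / r ^ 4) (at r)"
    using r by (auto intro!: derivative_eq_intros simp: field_simps eval_nat_numeral)
  from DERIV_chain2[OF this[unfolded r_def] D[unfolded r_def]]
  have "(kottler1 has_real_derivative 6 * m / r ^ 4 * (1 / (2 * (r + m / r\<^sup>2)))) (at y)"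
    unfolding kottler1_def[abs_def] r_def[symmetric] by simp
  also have "6 * m / r ^ 4 * (1 / (2 * (r + m / r\<^sup>2))) = 3 * (2 * m / r ^ 3) * (2 + 2 * m / r ^ 3) / (4 * (r + m / r\<^sup>2)\<^sup>2)"
  proof -
    obtain P where P: "P = r + m / r\<^sup>2" "P > 0" using q by blast
    have "2 + 2 * m / r ^ 3 = 2 * P / r" using r by (simp add: P(1) field_simps eval_nat_numeral)
    then have "3 * (2 * m / r ^ 3) * (2 + 2 * m / r ^ 3) / (4 * P\<^sup>2) =
        3 * (2 * m / r ^ 3) * (2 * P / r) / (4 * P\<^sup>2)"
      by (simp only:)
    also have "\<dots> = 6 * m / r ^ 4 * (1 / (2 * P))"
      using r P(2) by (simp add: field_simps eval_nat_numeral)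
    finally show ?thesis by (simp add: P(1))
  qed
  finally show ?thesis
    by (simp add: kottler_def kottler1_def[abs_def] r_def[symmetric])
qed

lemma kottler1_less: "kottler1 y < 1"
  using kottler_radius(1)[of y] m by (simp add: kottler1_def)

lemma kottler_pos: "kottler y > 0"
proof -
  have "kottler_radius m y + m / (kottler_radius m y)\<^sup>2 > 0"
    using kottler_radius(1)[of y] m by (intro add_pos_pos divide_pos_pos) auto
  then show ?thesis by (simp add: kottler_def)
qed

end

section \<open>Bounds on the Kottler profile\<close>

lemma kottler_ge: "m > 0 \<Longrightarrow> y \<le> kottler m y"
proof -
  assume m: "m > 0"
  define r where "r = kottler_radius m y"
  have r: "0 < r" "r\<^sup>2 - 2 * m / r = y" using kottler_radius[OF m, of y] by (auto simp: r_def)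
  have "r\<^sup>2 \<le> (r + m / r\<^sup>2)\<^sup>2" using r m by (intro power_mono) auto
  moreover have "0 \<le> 2 * m / r" using r m by simp
  ultimately show ?thesis using r by (simp add: kottler_def[OF m] r_def)
qed

text \<open>The argument \<open>- k\<close> is V = 0. With horizon radius r the profile equals ((3
  r^2 + k) / (2 r))^2, and the inequality between arithmetic and geometric means bounds it by its
  value at 3 r^2 = k.\<close>

lemma kottler_ge_horizon:
  assumes m: "m > 0" and k: "k > 0"
  shows "3 * k \<le> kottler m (- k)"
proof -
  define r where "r = kottler_radius m (- k)"
  have r: "0 < r" "r\<^sup>2 - 2 * m / r = - k" using kottler_radius[OF m, of "- k"] by (auto simp: r_def)
  then have "2 * m = r * (r\<^sup>2 + k)" by (simp add: field_simps)
  then have "r + m / r\<^sup>2 = (3 * r\<^sup>2 + k) / (2 * r)"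
    using r(1) by (simp add: field_simps power2_eq_square)
  then have "kottler m (- k) = (3 * r\<^sup>2 + k)\<^sup>2 / (2 * r)\<^sup>2"
    by (simp add: kottler_def[OF m] r_def power_divide)
  moreover have "3 * k * (2 * r)\<^sup>2 \<le> (3 * r\<^sup>2 + k)\<^sup>2"
    using zero_le_power2[of "3 * r\<^sup>2 - k"] by (simp add: power2_eq_square algebra_simps)
  ultimately show ?thesis using r(1) by (simp add: pos_le_divide_eq)
qed

text \<open>For given P = sqrt w the mass is m = (P - r) r^2, which is largest at r = 2 P / 3, where
  27 m = 4 P^3; the claim is the square of this bound. It makes the profile large for large mass,
  whatever \<open>y\<close> is.\<close>

lemma kottler_lower:
  assumes m: "m > 0"
  shows "729 * m\<^sup>2 \<le> 16 * (kottler m y) ^ 3"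
proof -
  define r where "r = kottler_radius m y"
  have r: "0 < r" using kottler_radius(1)[OF m, of y] by (simp add: r_def)
  define P where "P = r + m / r\<^sup>2"
  have P: "P > 0" using r m by (simp add: P_def add_pos_pos)
  have "27 * m \<le> 4 * P ^ 3"
  proof -
    have "m = (P - r) * r\<^sup>2" using r by (simp add: P_def)
    moreover have "4 * P ^ 3 - 27 * ((P - r) * r\<^sup>2) = (2 * P - 3 * r)\<^sup>2 * (P + 3 * r)"
      by (simp add: power2_eq_square power3_eq_cube algebra_simps)
    moreover have "0 \<le> (2 * P - 3 * r)\<^sup>2 * (P + 3 * r)" using P r by simp
    ultimately show ?thesis by linarith
  qed
  then have "(27 * m)\<^sup>2 \<le> (4 * P ^ 3)\<^sup>2" using m by (intro power_mono) auto
  also have "(4 * P ^ 3)\<^sup>2 = 16 * (P\<^sup>2) ^ 3" by (simp add: power_mult_distrib flip: power_mult)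
  finally show ?thesis by (simp add: kottler_def[OF m] r_def P_def power_mult_distrib)
qed

text \<open>At V^2 = k the radius satisfies r^3 = 2 m, so the profile tends to 0 with the
  mass.\<close>

lemma kottler_zero: "r > 0 \<Longrightarrow> kottler (r ^ 3 / 2) 0 = 9 / 4 * r\<^sup>2"
proof -
  assume r: "r > 0"
  then have "kottler_radius (r ^ 3 / 2) (r\<^sup>2 - 2 * (r ^ 3 / 2) / r) = r"
    by (intro kottler_radius_eq) auto
  then have "kottler_radius (r ^ 3 / 2) 0 = r" using r by (simp add: eval_nat_numeral)
  then show ?thesis using r by (simp add: kottler_def eval_nat_numeral field_simps)
qed

text \<open>Comparison with the Kottler family by decreasing the mass parameter \<open>m\<close> from infinity: at the
  largest \<open>m\<close> for which the comparison fails there is a point of contact, which is excluded on the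
  boundary \<open>B\<close>, outside \<open>K\<close> and (by \<open>contact\<close>) everywhere else.\<close>

lemma kottler_comparison:
  fixes x w :: "'a \<Rightarrow> real"
  assumes K: "K \<subseteq> X" "compact ((\<lambda>p. (x p, w p)) ` K)"
    and B: "\<And>p. p \<in> B \<Longrightarrow> x p = 0 \<and> w p + c < 3 * k"
    and out: "\<And>p. p \<in> X - K \<Longrightarrow> w p < x p - k - c"
    and c: "0 < c" and k: "0 < k"
    and contact: "\<And>p m. p \<in> X - B \<Longrightarrow> m > 0 \<Longrightarrow> (\<And>q. q \<in> X \<Longrightarrow> w q \<le> kottler m (x q - k) - c) \<Longrightarrow>
      w p = kottler m (x p - k) - c \<Longrightarrow> w p \<le> 0"
    and m: "m > 0" "16 * c ^ 3 < 729 * m\<^sup>2" and p: "p \<in> X"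
  shows "w p \<le> kottler m (x p - k) - c"
proof (rule ccontr)
  assume neg: "\<not> w p \<le> kottler m (x p - k) - c"
  have outK: "w q < kottler n (x q - k) - c" if "q \<in> X - K" "n > 0" for q n
    using out[OF that(1)] kottler_ge[OF that(2), of "x q - k"] by linarith
  define Q where "Q = (\<lambda>p. (x p, w p)) ` K"
  have "p \<in> K" using neg outK[of p m] m p by force
  then have Qne: "Q \<noteq> {}" by (auto simp: Q_def)
  have "compact Q" using K by (simp add: Q_def)
  then have "bounded Q" by (rule compact_imp_bounded)
  then obtain b where b: "\<And>z. z \<in> Q \<Longrightarrow> norm z \<le> b" unfolding bounded_iff by blast
  define b' where "b' = max b 1 + c + k"
  have bb: "1 \<le> b'" "\<And>q. q \<in> K \<Longrightarrow> \<bar>x q\<bar> + k \<le> b' \<and> \<bar>w q\<bar> + c \<le> b'"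
  proof -
    show "1 \<le> b'" using c k by (simp add: b'_def)
    fix q assume "q \<in> K"
    then have "norm (x q, w q) \<le> b" using b by (simp add: Q_def)
    then have "\<bar>x q\<bar> \<le> b" "\<bar>w q\<bar> \<le> b"
      using norm_fst_le[of "x q" "w q"] norm_snd_le[of "w q" "x q"] unfolding real_norm_def by linarith+
    then show "\<bar>x q\<bar> + k \<le> b' \<and> \<bar>w q\<bar> + c \<le> b'" using c k by (auto simp: b'_def)
  qed
  \<comment> \<open>The masses \<open>n \<ge> m\<close> together with points where the strict
    comparison fails. The radius is kept as a separate coordinate and all conditions are polynomial,
    so closedness needs no continuity of the implicitly defined radius.\<close>
  define A where "A = {(n, r, z). m \<le> n \<and> n \<le> b' ^ 3 \<and> m / (b' ^ 3) \<le> r \<and> r \<le> b' \<and> z \<in> Q \<and>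
      r * (r\<^sup>2 - (fst z - k)) = 2 * n \<and> (r ^ 3 + n)\<^sup>2 \<le> (snd z + c) * r ^ 4}"
  \<comment> \<open>A failure bounds \<open>r + n / r\<^sup>2\<close> by \<open>b'\<close>, hence
    \<open>r\<close> and \<open>n\<close> from above; then \<open>n \<ge> m\<close> keeps
    \<open>r\<close> away from 0. So the box in \<open>A\<close> loses no failure.\<close>
  have in_A: "(n, kottler_radius n (x q - k), x q, w q) \<in> A"
    if q: "q \<in> K" and n: "m \<le> n" and le: "kottler n (x q - k) - c \<le> w q" for n q
  proof -
    define r where "r = kottler_radius n (x q - k)"
    have n0: "n > 0" using n m by simp
    have r: "0 < r" "r\<^sup>2 - 2 * n / r = x q - k" using kottler_radius[OF n0, of "x q - k"] by (auto simp: r_def)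
    have kr: "kottler n (x q - k) = (r + n / r\<^sup>2)\<^sup>2" by (simp add: kottler_def[OF n0] r_def)
    have b2: "(r + n / r\<^sup>2)\<^sup>2 \<le> b'" using le bb(2)[OF q] kr by linarith
    have b1: "b' \<le> b'\<^sup>2" using bb(1) by (simp add: power2_eq_square)
    have "(r + n / r\<^sup>2)\<^sup>2 \<le> b'\<^sup>2" using b1 b2 by linarith
    then have rb: "r + n / r\<^sup>2 \<le> b'" using bb(1) by (simp add: power2_le_iff_abs_le)
    have nr: "0 < n / r\<^sup>2" using r n0 by simp
    have r1: "r \<le> b'" using rb nr by linarith
    have "n / r\<^sup>2 \<le> b'" using rb r by linarith
    then have n_le: "n \<le> b' * r\<^sup>2" using r(1) by (simp add: pos_divide_le_eq)
    have r2: "r\<^sup>2 \<le> b' * r" using r r1 by (simp add: power2_eq_square)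
    have "n \<le> b' * (b' * r)" using n_le r2 bb(1) by (smt (verit) mult_left_mono)
    then have "m \<le> b'\<^sup>2 * r" using n by (simp add: power2_eq_square)
    also have "\<dots> \<le> b' ^ 3 * r" using bb(1) r(1) by (intro mult_right_mono power_increasing) auto
    finally have r_ge: "m / b' ^ 3 \<le> r" using bb(1) by (simp add: pos_divide_le_eq mult.commute)
    have "b' * r\<^sup>2 \<le> b' * b'\<^sup>2" using r r1 bb(1) by (intro mult_left_mono power_mono) auto
    then have n3: "n \<le> b' ^ 3" using n_le by (simp add: power2_eq_square power3_eq_cube)
    have "r * (r\<^sup>2 - (x q - k)) = 2 * n" using r by (simp add: field_simps)
    moreover have "(r ^ 3 + n)\<^sup>2 \<le> (w q + c) * r ^ 4"
    proof -
      have "(r ^ 3 + n)\<^sup>2 = (r + n / r\<^sup>2)\<^sup>2 * r ^ 4"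
      proof -
        have "r ^ 3 + n = (r + n / r\<^sup>2) * r\<^sup>2" using r by (simp add: field_simps eval_nat_numeral)
        then show ?thesis by (simp add: power_mult_distrib flip: power_mult)
      qed
      also have "\<dots> \<le> (w q + c) * r ^ 4" using le kr r by (intro mult_right_mono) auto
      finally show ?thesis .
    qed
    ultimately show ?thesis
      unfolding A_def using n n3 r_ge r1 q by (simp add: r_def[symmetric] Q_def)
  qed
  have "compact A"
  proof -
    have "A = ({m..b' ^ 3} \<times> {m / b' ^ 3..b'} \<times> Q) \<inter>
        {v. fst (snd v) * ((fst (snd v))\<^sup>2 - (fst (snd (snd v)) - k)) = 2 * fst v} \<inter>
        {v. (fst (snd v) ^ 3 + fst v)\<^sup>2 \<le> (snd (snd (snd v)) + c) * fst (snd v) ^ 4}"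
      by (auto simp: A_def)
    moreover have "closed {v::real\<times>real\<times>real\<times>real. fst (snd v) * ((fst (snd v))\<^sup>2 - (fst (snd (snd v)) - k)) = 2 * fst v}"
      by (intro closed_Collect_eq continuous_intros)
    moreover have "closed {v::real\<times>real\<times>real\<times>real. (fst (snd v) ^ 3 + fst v)\<^sup>2 \<le> (snd (snd (snd v)) + c) * fst (snd v) ^ 4}"
      by (intro closed_Collect_le continuous_intros)
    ultimately show ?thesis
      using \<open>compact Q\<close> by (auto intro!: compact_Int_closed compact_Times)
  qed
  moreover have "A \<noteq> {}" using in_A[OF \<open>p \<in> K\<close>, of m] neg by force
  \<comment> \<open>The largest mass with a failure in the weak sense.\<close>
  ultimately obtain a where a: "a \<in> A" "\<And>v. v \<in> A \<Longrightarrow> fst v \<le> fst a"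
    using continuous_attains_sup[of A fst] continuous_on_fst[OF continuous_on_id, of A] by blast
  obtain n r z where az: "a = (n, r, z)" by (metis prod.exhaust)
  have n0: "n > 0" using a az m by (auto simp: A_def)
  obtain q where q: "q \<in> K" "z = (x q, w q)" using a az by (auto simp: A_def Q_def)
  have b3: "0 < b' ^ 3" using bb(1) by simp
  have r0: "r > 0" using a(1) az m b3 by (auto simp: A_def) (smt (verit) divide_pos_pos)
  have eq: "r * (r\<^sup>2 - (x q - k)) = 2 * n" "(r ^ 3 + n)\<^sup>2 \<le> (w q + c) * r ^ 4"
    using a az q by (auto simp: A_def)
  have "r\<^sup>2 - 2 * n / r = x q - k" using eq(1) r0 by (simp add: field_simps)
  then have rat: "kottler_radius n (x q - k) = r" using kottler_radius_eq[OF n0 r0] by simp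
  have ge: "kottler n (x q - k) - c \<le> w q"
  proof -
    have "kottler n (x q - k) = (r + n / r\<^sup>2)\<^sup>2" by (simp add: kottler_def[OF n0] rat)
    moreover have "(r + n / r\<^sup>2)\<^sup>2 * r ^ 4 = (r ^ 3 + n)\<^sup>2"
    proof -
      have "r ^ 3 + n = (r + n / r\<^sup>2) * r\<^sup>2" using r0 by (simp add: field_simps eval_nat_numeral)
      then show ?thesis by (simp add: power_mult_distrib flip: power_mult)
    qed
    ultimately have "kottler n (x q - k) * r ^ 4 \<le> (w q + c) * r ^ 4" using eq(2) by simp
    then show ?thesis using r0 by (simp add: mult_le_cancel_right)
  qed
  have le: "w s \<le> kottler n (x s - k) - c" if "s \<in> X" for s
  proof (rule ccontr)
    assume "\<not> ?thesis"
    then have lt: "kottler n (x s - k) - c < w s" by simp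
    then have "s \<in> K" using outK[of s n] n0 that by force
    define t where "t = kottler_radius n (x s - k)"
    have t: "0 < t" "t\<^sup>2 - 2 * n / t = x s - k" using kottler_radius[OF n0, of "x s - k"] by (auto simp: t_def)
    have kt: "kottler n (x s - k) = (t + n / t\<^sup>2)\<^sup>2" by (simp add: kottler_def[OF n0] t_def)
    \<comment> \<open>The mass for which the radius at \<open>x s - k\<close> is \<open>u\<close>.
      Increasing \<open>u\<close> slightly beyond \<open>t\<close> raises the mass above
      \<open>n\<close> and keeps a strict failure, against the maximality of
      \<open>n\<close>.\<close>
    define N where "N u = u * (u\<^sup>2 - (x s - k)) / 2" for u
    have Nt: "N t = n" using t by (simp add: N_def field_simps)
    have "((\<lambda>u. (u + N u / u\<^sup>2)\<^sup>2 - c) \<longlongrightarrow> (t + N t / t\<^sup>2)\<^sup>2 - c) (at_right t)"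
      unfolding N_def using t by (intro tendsto_intros) auto
    then have "\<forall>\<^sub>F u in at_right t. (u + N u / u\<^sup>2)\<^sup>2 - c < w s"
      using lt by (intro order_tendstoD(2)) (auto simp: Nt kt)
    moreover have "\<forall>\<^sub>F u in at_right t. u > t" by (simp add: eventually_at_right_less)
    ultimately have "\<forall>\<^sub>F u in at_right t. u > t \<and> (u + N u / u\<^sup>2)\<^sup>2 - c < w s"
      by eventually_elim auto
    then obtain u where u: "u > t" "(u + N u / u\<^sup>2)\<^sup>2 - c < w s"
      by (metis (no_types, lifting) eventually_happens trivial_limit_at_right_real)
    have u0: "u > 0" using u t by simp
    have "t\<^sup>2 - (x s - k) > 0" using t n0 by (smt (verit) divide_pos_pos)
    moreover have "t\<^sup>2 \<le> u\<^sup>2" using u t by (intro power_mono) auto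
    ultimately have "t * (t\<^sup>2 - (x s - k)) < u * (u\<^sup>2 - (x s - k))"
      using u t by (intro mult_less_le_imp_less) auto
    then have Nn: "n < N u" using Nt by (simp add: N_def)
    have N0: "0 < N u" using Nn n0 by simp
    have "u\<^sup>2 - 2 * N u / u = x s - k" using u0 by (simp add: N_def field_simps)
    then have ru: "kottler_radius (N u) (x s - k) = u" using kottler_radius_eq[OF N0 u0] by simp
    have "kottler (N u) (x s - k) - c \<le> w s"
      using u(2) by (simp add: kottler_def[OF N0] ru)
    then have "(N u, kottler_radius (N u) (x s - k), x s, w s) \<in> A"
      using \<open>s \<in> K\<close> Nn a az by (intro in_A) (auto simp: A_def)
    from a(2)[OF this] Nn show False by (simp add: az)
  qed
  have qX: "q \<in> X" using q K by blast
  have weq: "w q = kottler n (x q - k) - c" using ge le[OF qX] by simp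
  have "q \<notin> B"
  proof
    assume "q \<in> B"
    then have "x q = 0" "w q + c < 3 * k" using B by auto
    then show False using kottler_ge_horizon[OF n0 k] weq by simp
  qed
  \<comment> \<open>What remains is contact at a point with vanishing gradient: there the profile is
    at most \<open>c\<close>, while the bound by the mass, \<open>n \<ge> m\<close> and the choice
    of \<open>m\<close> forbid this.\<close>
  then have "w q \<le> 0" using contact[of q n] qX n0 le weq by blast
  then have "kottler n (x q - k) \<le> c" using weq by simp
  then have "(kottler n (x q - k)) ^ 3 \<le> c ^ 3"
    using kottler_pos[OF n0, of "x q - k"] by (intro power_mono) auto
  then have "729 * n\<^sup>2 \<le> 16 * c ^ 3" using kottler_lower[OF n0, of "x q - k"] by linarith
  moreover have "m\<^sup>2 \<le> n\<^sup>2" using a az m by (intro power_mono) (auto simp: A_def)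
  ultimately show False using m by linarith
qed

section \<open>Charts\<close>

text \<open>The part of \<open>is_chart\<close> that passes to arbitrary subspaces and to products.
  The shape of the image is kept apart, in \<open>chart_set\<close>.\<close>

definition chart_map :: "'a topology \<Rightarrow> 'a set \<Rightarrow> ('a \<Rightarrow> 'e::euclidean_space) \<Rightarrow> bool" where
  "chart_map T U \<phi> \<longleftrightarrow>
     openin T U \<and> homeomorphic_map (subtopology T U) (top_of_set (\<phi> ` U)) \<phi>"

lemma chart_mapD:
  assumes "chart_map T U \<phi>"
  shows "openin T U" "inj_on \<phi> U" "continuous_map (subtopology T U) euclidean \<phi>"
    "A \<subseteq> U \<Longrightarrow> openin T A \<Longrightarrow> openin (top_of_set (\<phi> ` U)) (\<phi> ` A)"
    "continuous_map (top_of_set (\<phi> ` U)) T (inv_into U \<phi>)"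
proof -
  have U: "openin T U" and h: "homeomorphic_map (subtopology T U) (top_of_set (\<phi> ` U)) \<phi>"
    using assms by (auto simp: chart_map_def)
  have sU: "U \<subseteq> topspace T" "topspace (subtopology T U) = U"
    using U openin_subset by (auto simp: topspace_subtopology)
  show "openin T U" by fact
  show inj: "inj_on \<phi> U"
    using homeomorphic_imp_injective_map[OF h] sU by simp
  have "continuous_map (subtopology T U) (top_of_set (\<phi> ` U)) \<phi>"
    using h homeomorphic_imp_continuous_map by blast
  then show "continuous_map (subtopology T U) euclidean \<phi>"
    by (simp add: continuous_map_in_subtopology)
  show "openin (top_of_set (\<phi> ` U)) (\<phi> ` A)" if "A \<subseteq> U" "openin T A"
  proof -
    have "openin (subtopology T U) A" using that U by (simp add: openin_open_subtopology)
    then show ?thesis using homeomorphic_imp_open_map[OF h] unfolding open_map_def by blast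
  qed
  obtain k where k: "homeomorphic_maps (subtopology T U) (top_of_set (\<phi> ` U)) \<phi> k"
    using h homeomorphic_map_maps by blast
  have "k x = inv_into U \<phi> x" if x: "x \<in> \<phi> ` U" for x
  proof -
    obtain p where p: "p \<in> U" "x = \<phi> p" using x by blast
    then have "k x = p" using k sU unfolding homeomorphic_maps_def by auto
    then show ?thesis using p inj by simp
  qed
  moreover have "continuous_map (top_of_set (\<phi> ` U)) (subtopology T U) k"
    using k unfolding homeomorphic_maps_def by blast
  ultimately have "continuous_map (top_of_set (\<phi> ` U)) (subtopology T U) (inv_into U \<phi>)"
    by (metis (no_types, lifting) continuous_map_eq topspace_euclidean_subtopology)
  then show "continuous_map (top_of_set (\<phi> ` U)) T (inv_into U \<phi>)"
    using continuous_map_in_subtopology by blast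
qed

definition chart_set :: "'e::euclidean_space set \<Rightarrow> bool" where
  "chart_set S \<longleftrightarrow> open S \<or> (\<exists>b\<in>Basis. openin (top_of_set {x. 0 \<le> x \<bullet> b}) S)"

lemma smooth_manifold_chart:
  assumes "smooth_manifold M" "(U, \<phi>) \<in> atlas M"
  shows "chart_map (mtop M) U \<phi>" "chart_set (\<phi> ` U)"
proof -
  have "is_chart (mtop M) U \<phi>" using assms unfolding smooth_manifold_def by blast
  then show "chart_map (mtop M) U \<phi>" "chart_set (\<phi> ` U)"
    by (auto simp: is_chart_def chart_map_def chart_set_def)
qed

text \<open>Steps in positive basis directions never leave a half-space, since the inner product of
  two basis vectors is 0 or 1. This makes derivatives within a chart image unique, also at the
  boundary.\<close>

lemma chart_set_line:
  assumes "chart_set S" "x \<in> S" "i \<in> Basis" "e > 0"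
  shows "\<exists>d>0. d < e \<and> x + d *\<^sub>R i \<in> S"
proof -
  obtain T where T: "open T" "x \<in> T" "\<And>d. d > 0 \<Longrightarrow> x + d *\<^sub>R i \<in> T \<Longrightarrow> x + d *\<^sub>R i \<in> S"
  proof (cases "open S")
    case False
    then obtain b T where b: "b \<in> Basis" "open T" "S = {x. 0 \<le> x \<bullet> b} \<inter> T"
      using assms(1) unfolding chart_set_def openin_open by blast
    have "0 \<le> (x + d *\<^sub>R i) \<bullet> b" if "d > 0" for d
      using assms(2,3) b that by (auto simp: inner_add_left inner_Basis)
    then show thesis using that[of T] assms(2) b by auto
  qed (use assms in blast)
  obtain r where r: "r > 0" "ball x r \<subseteq> T" using T open_contains_ball by blast
  define d where "d = min e r / 2"
  have d: "d > 0" "d < e" "d < r" using r assms by (auto simp: d_def)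
  have "x + d *\<^sub>R i \<in> ball x r" using d assms(3) by (simp add: dist_norm)
  then show ?thesis using T(3)[of d] r d by blast
qed

lemma dd_unique_chart:
  assumes "chart_set S" "x \<in> S" "(f has_derivative F) (at x within S)"
  shows "dd S f x = F"
proof (rule frechet_derivative_unique_within[OF _ assms(3)])
  show "(f has_derivative dd S f x) (at x within S)"
    unfolding dd_def using assms(3) frechet_derivative_works differentiable_def by blast
  show "\<exists>d. 0 < \<bar>d\<bar> \<and> \<bar>d\<bar> < e \<and> x + d *\<^sub>R i \<in> S" if ie: "i \<in> Basis" "0 < e" for i e
  proof -
    obtain d where "d > 0" "d < e" "x + d *\<^sub>R i \<in> S"
      using chart_set_line[OF assms(1,2) ie] by blast
    then show ?thesis by (intro exI[of _ d]) auto
  qed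
qed

lemma at_within_openin:
  assumes "openin (top_of_set S) A" "x \<in> A"
  shows "at x within S = at x within A"
proof -
  obtain T where "open T" "A = S \<inter> T" using assms(1) openin_open by metis
  then show ?thesis using assms(2) by (intro at_within_nhd[of x T]) auto
qed

lemma openin_preimage_chart:
  assumes "continuous_map TN TM F" "openin TM W" "openin TN U"
  shows "openin TN {q \<in> U. F q \<in> W}"
proof -
  have "{q \<in> U. F q \<in> W} = {q \<in> topspace TN. F q \<in> W} \<inter> U"
    using openin_subset[OF assms(3)] by auto
  then show ?thesis
    using openin_Int[OF openin_continuous_map_preimage[OF assms(1,2)] assms(3)] by simp
qed

text \<open>\<open>tmap\<close> differentiates within the whole chart image, whereas smoothness is
  known only on the part sent into \<open>W\<close>. Both filters agree, as this part is relatively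
  open.\<close>

lemma has_derivative_tmap_open:
  assumes o: "openin (top_of_set (\<phi> ` U)) (\<phi> ` {q \<in> U. F q \<in> W})"
    and sm: "smooth_on (\<phi> ` {q \<in> U. F q \<in> W}) (\<psi> \<circ> F \<circ> inv_into U \<phi>)"
    and p: "p \<in> U" "F p \<in> W"
  shows "(\<psi> \<circ> F \<circ> inv_into U \<phi> has_derivative tmap U \<phi> \<psi> F p) (at (\<phi> p) within \<phi> ` U)"
proof -
  have eq: "at (\<phi> p) within \<phi> ` U = at (\<phi> p) within \<phi> ` {q \<in> U. F q \<in> W}"
    using p by (intro at_within_openin[OF o]) auto
  have "(\<psi> \<circ> F \<circ> inv_into U \<phi>) differentiable (at (\<phi> p) within \<phi> ` U)"
    using smooth_on_differentiable[OF sm] p unfolding eq differentiable_on_def by auto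
  then show ?thesis
    unfolding tmap_def dd_def using frechet_derivative_works by blast
qed

lemma has_derivative_tmap:
  assumes ch: "chart_map TN U \<phi>" and F: "continuous_map TN TM F" "openin TM W"
    and sm: "smooth_on (\<phi> ` {q \<in> U. F q \<in> W}) (\<psi> \<circ> F \<circ> inv_into U \<phi>)"
    and p: "p \<in> U" "F p \<in> W"
  shows "(\<psi> \<circ> F \<circ> inv_into U \<phi> has_derivative tmap U \<phi> \<psi> F p) (at (\<phi> p) within \<phi> ` U)"
proof (rule has_derivative_tmap_open[OF _ sm p])
  show "openin (top_of_set (\<phi> ` U)) (\<phi> ` {q \<in> U. F q \<in> W})"
    using chart_mapD[OF ch] F by (intro chart_mapD(4)[OF ch] openin_preimage_chart) auto
qed

lemma has_derivative_chart_compose: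
  assumes ch: "chart_map TN U \<phi>" and F: "continuous_map TN TM F" "openin TM W"
    and inj: "inj_on \<psi> W" and p: "p \<in> U" "F p \<in> W"
    and T: "(\<psi> \<circ> F \<circ> inv_into U \<phi> has_derivative T) (at (\<phi> p) within \<phi> ` U)"
    and D: "(v \<circ> inv_into W \<psi> has_derivative D) (at (\<psi> (F p)) within \<psi> ` W)"
  shows "(v \<circ> F \<circ> inv_into U \<phi> has_derivative D \<circ> T) (at (\<phi> p) within \<phi> ` U)"
proof -
  let ?A = "{q \<in> U. F q \<in> W}" and ?h = "\<psi> \<circ> F \<circ> inv_into U \<phi>"
  have "openin (top_of_set (\<phi> ` U)) (\<phi> ` ?A)"
    using chart_mapD[OF ch] F by (intro chart_mapD(4)[OF ch] openin_preimage_chart) auto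
  then have eq: "at (\<phi> p) within \<phi> ` U = at (\<phi> p) within \<phi> ` ?A"
    using p by (intro at_within_openin) auto
  have inv: "inv_into U \<phi> (\<phi> q) = q" if "q \<in> U" for q
    using chart_mapD(2)[OF ch] that by simp
  have hp: "?h (\<phi> p) = \<psi> (F p)" using p inv by simp
  have "?h ` \<phi> ` ?A \<subseteq> \<psi> ` W" using inv by auto
  then have "(v \<circ> inv_into W \<psi> has_derivative D) (at (?h (\<phi> p)) within ?h ` \<phi> ` ?A)"
    unfolding hp using D has_derivative_subset by blast
  then have "(v \<circ> inv_into W \<psi> \<circ> ?h has_derivative D \<circ> T) (at (\<phi> p) within \<phi> ` ?A)"
    using T unfolding eq by (intro diff_chain_within)
  then have "(v \<circ> F \<circ> inv_into U \<phi> has_derivative D \<circ> T) (at (\<phi> p) within \<phi> ` ?A)"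
    by (rule has_derivative_transform[rotated 2]) (use p inv inj in auto)
  then show ?thesis unfolding eq .
qed

lemma is_pullbackD:
  assumes "is_pullback M N F h g" "(U, \<phi>) \<in> atlas M" "(W, \<psi>) \<in> atlas N" "p \<in> U" "F p \<in> W"
  shows "g \<phi> p u v = h \<psi> (F p) (tmap U \<phi> \<psi> F p u) (tmap U \<phi> \<psi> F p v)"
proof -
  from bspec[OF assms(1)[unfolded is_pullback_def] assms(2)]
  have "\<forall>(W, \<psi>)\<in>atlas N. \<forall>p\<in>U. F p \<in> W \<longrightarrow>
        (\<forall>u v. g \<phi> p u v = h \<psi> (F p) (tmap U \<phi> \<psi> F p u) (tmap U \<phi> \<psi> F p v))" by simp
  from bspec[OF this assms(3)] show ?thesis using assms(4,5) by simp
qed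

text \<open>This and the following localisations carry the static equations, stated within chart
  images, to the interiors where the coordinate calculus applies.\<close>

lemma christoffel_local:
  assumes "open T" "x \<in> T" "T \<subseteq> S"
  shows "christoffel S G x u v = christoffel T G x u v"
proof -
  have "dd S f x = dd T f x" for f :: "'a \<Rightarrow> real" by (rule dd_local[OF assms refl])
  then show ?thesis by (simp add: christoffel_def)
qed

lemma riem_local:
  assumes "open T" "x \<in> T" "T \<subseteq> S"
  shows "riem S G x u v w = riem T G x u v w"
proof -
  have "dd S (\<lambda>y. christoffel S G y v w) x = dd T (\<lambda>y. christoffel T G y v w) x" for v w
    by (rule dd_local[OF assms]) (rule christoffel_local[OF assms(1) _ assms(3)])
  then show ?thesis
    unfolding riem_def using christoffel_local[OF assms, of G] by simp
qed

lemma ricci_local: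
  assumes "open T" "x \<in> T" "T \<subseteq> S"
  shows "ricci S G x v w = ricci T G x v w"
  unfolding ricci_def using riem_local[OF assms, of G] by simp

lemma hess_local:
  assumes "open T" "x \<in> T" "T \<subseteq> S"
  shows "hess S G f x u v = hess T G f x u v"
proof -
  have "dd S (\<lambda>y. dd S f y v) x = dd T (\<lambda>y. dd T f y v) x"
  proof (rule dd_local[OF assms])
    fix y assume "y \<in> T"
    then show "dd S f y v = dd T f y v" using dd_local[OF assms(1) _ assms(3) refl, of y f] by simp
  qed
  moreover have "dd S f x = dd T f x" by (rule dd_local[OF assms refl])
  ultimately show ?thesis
    unfolding hess_eq using christoffel_local[OF assms, of G] by simp
qed

lemma laplacian_local:
  assumes "open T" "x \<in> T" "T \<subseteq> S"
  shows "laplacian S G f x = laplacian T G f x"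
  unfolding laplacian_def using hess_local[OF assms, of G f] by simp

lemma chart_map_open_inter:
  assumes "chart_map T U \<phi>" "openin T X"
  shows "chart_map T (U \<inter> X) \<phi>" "openin (top_of_set (\<phi> ` U)) (\<phi> ` (U \<inter> X))"
proof -
  have U: "openin T U" and h: "homeomorphic_map (subtopology T U) (top_of_set (\<phi> ` U)) \<phi>"
    using assms(1) by (auto simp: chart_map_def)
  have o: "openin T (U \<inter> X)" using U assms(2) by (rule openin_Int)
  show "openin (top_of_set (\<phi> ` U)) (\<phi> ` (U \<inter> X))"
    by (rule chart_mapD(4)[OF assms(1) _ o]) simp
  have "homeomorphic_map (subtopology (subtopology T U) (U \<inter> X))
      (subtopology (top_of_set (\<phi> ` U)) (\<phi> ` (U \<inter> X))) \<phi>"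
  proof (rule homeomorphic_map_subtopologies[OF h])
    have "topspace (subtopology T U) = U" using openin_subset[OF U] by auto
    then show "\<phi> ` (topspace (subtopology T U) \<inter> (U \<inter> X)) = topspace (top_of_set (\<phi> ` U)) \<inter> \<phi> ` (U \<inter> X)"
      by auto
  qed
  then have "homeomorphic_map (subtopology T (U \<inter> X)) (top_of_set (\<phi> ` (U \<inter> X))) \<phi>"
    by (simp add: subtopology_subtopology Int_absorb1 image_mono)
  then show "chart_map T (U \<inter> X) \<phi>" using o by (simp add: chart_map_def)
qed

lemma chart_map_subtopology:
  assumes "chart_map T U \<phi>"
  shows "chart_map (subtopology T X) (U \<inter> X) \<phi>"
proof -
  have U: "openin T U" and h: "homeomorphic_map (subtopology T U) (top_of_set (\<phi> ` U)) \<phi>"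
    using assms(1) by (auto simp: chart_map_def)
  have "homeomorphic_map (subtopology (subtopology T U) (U \<inter> X))
      (subtopology (top_of_set (\<phi> ` U)) (\<phi> ` (U \<inter> X))) \<phi>"
  proof (rule homeomorphic_map_subtopologies[OF h])
    have "topspace (subtopology T U) = U" using openin_subset[OF U] by auto
    then show "\<phi> ` (topspace (subtopology T U) \<inter> (U \<inter> X)) = topspace (top_of_set (\<phi> ` U)) \<inter> \<phi> ` (U \<inter> X)"
      by auto
  qed
  then have "homeomorphic_map (subtopology T (U \<inter> X)) (top_of_set (\<phi> ` (U \<inter> X))) \<phi>"
    by (simp add: subtopology_subtopology Int_absorb1 image_mono)
  moreover have "openin (subtopology T X) (U \<inter> X)" using U by (auto simp: openin_subtopology)
  ultimately show ?thesis
    by (simp add: chart_map_def subtopology_subtopology inf_commute inf_left_commute)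
qed

lemma chart_map_Times:
  assumes "chart_map T U \<phi>" "chart_map T' W \<psi>"
  shows "chart_map (prod_topology T T') (U \<times> W) (map_prod \<phi> \<psi>)"
proof -
  obtain k where k: "homeomorphic_maps (subtopology T U) (top_of_set (\<phi> ` U)) \<phi> k"
    using assms(1) unfolding chart_map_def homeomorphic_map_maps by blast
  obtain l where l: "homeomorphic_maps (subtopology T' W) (top_of_set (\<psi> ` W)) \<psi> l"
    using assms(2) unfolding chart_map_def homeomorphic_map_maps by blast
  have "homeomorphic_maps (prod_topology (subtopology T U) (subtopology T' W))
      (prod_topology (top_of_set (\<phi> ` U)) (top_of_set (\<psi> ` W)))
      (\<lambda>(x, y). (\<phi> x, \<psi> y)) (\<lambda>(x, y). (k x, l y))"
    using homeomorphic_maps_prod k l by blast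
  moreover have "(\<lambda>(x, y). (\<phi> x, \<psi> y)) = map_prod \<phi> \<psi>" by auto
  moreover have "prod_topology (top_of_set (\<phi> ` U)) (top_of_set (\<psi> ` W)) =
      top_of_set (map_prod \<phi> \<psi> ` (U \<times> W))"
  proof -
    have "map_prod \<phi> \<psi> ` (U \<times> W) = \<phi> ` U \<times> \<psi> ` W" by force
    then show ?thesis by (simp only: prod_topology_subtopology_eu)
  qed
  moreover have "prod_topology (subtopology T U) (subtopology T' W) =
      subtopology (prod_topology T T') (U \<times> W)"
    by (simp add: subtopology_Times)
  ultimately have "homeomorphic_map (subtopology (prod_topology T T') (U \<times> W))
      (top_of_set (map_prod \<phi> \<psi> ` (U \<times> W))) (map_prod \<phi> \<psi>)"
    unfolding homeomorphic_map_maps by metis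
  then show ?thesis
    using assms by (simp add: chart_map_def openin_prod_Times_iff)
qed

section \<open>The squared gradient of the potential\<close>

locale riemannian_potential =
  fixes M :: "('a, real^3) mfd" and g :: "('a, real^3) metric_field" and V :: "'a \<Rightarrow> real"
  assumes manifold: "smooth_manifold M"
    and metric: "riemannian_metric M g"
    and smooth_V: "smooth_fun M V"
begin

lemma chart: "(U, \<phi>) \<in> atlas M \<Longrightarrow> chart_map (mtop M) U \<phi>"
  by (rule smooth_manifold_chart[OF manifold])

lemma chart_inv: "(U, \<phi>) \<in> atlas M \<Longrightarrow> p \<in> U \<Longrightarrow> inv_into U \<phi> (\<phi> p) = p"
  using chart_mapD(2)[OF chart] by simp

lemma chart_at: "p \<in> topspace (mtop M) \<Longrightarrow> \<exists>(U, \<phi>)\<in>atlas M. p \<in> U"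
  using manifold unfolding smooth_manifold_def by blast

lemma chart_subset: "(U, \<phi>) \<in> atlas M \<Longrightarrow> U \<subseteq> topspace (mtop M)"
  using chart_mapD(1)[OF chart] openin_subset by blast

lemma inner_g: "(U, \<phi>) \<in> atlas M \<Longrightarrow> p \<in> U \<Longrightarrow> inner_form (g \<phi> p)"
  using metric unfolding riemannian_metric_def Ck_metric_def inner_form_def by blast

lemma g_pullback:
  "(U, \<phi>) \<in> atlas M \<Longrightarrow> (W, \<psi>) \<in> atlas M \<Longrightarrow> p \<in> U \<Longrightarrow> p \<in> W \<Longrightarrow>
    g \<phi> p u v = g \<psi> p (tmap U \<phi> \<psi> id p u) (tmap U \<phi> \<psi> id p v)"
  using is_pullbackD[of M M id g g U \<phi> W \<psi> p u v] metric
  unfolding riemannian_metric_def Ck_metric_def by simp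

lemma smooth_loc: "(U, \<phi>) \<in> atlas M \<Longrightarrow> smooth_on (\<phi> ` U) (\<lambda>x. loc U \<phi> g x u v)"
  using metric unfolding riemannian_metric_def Ck_metric_def smooth_on_def by blast

lemma smooth_pot: "(U, \<phi>) \<in> atlas M \<Longrightarrow> smooth_on (\<phi> ` U) (V \<circ> inv_into U \<phi>)"
  using smooth_V unfolding smooth_fun_def by blast

definition dV :: "'a set \<Rightarrow> ('a \<Rightarrow> real^3) \<Rightarrow> 'a \<Rightarrow> real^3 \<Rightarrow> real" where
  "dV U \<phi> p = dd (\<phi> ` U) (V \<circ> inv_into U \<phi>) (\<phi> p)"

lemma has_derivative_pot:
  "(U, \<phi>) \<in> atlas M \<Longrightarrow> p \<in> U \<Longrightarrow>
    (V \<circ> inv_into U \<phi> has_derivative dV U \<phi> p) (at (\<phi> p) within \<phi> ` U)"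
  unfolding dV_def by (intro has_derivative_dd smooth_on_differentiable smooth_pot) auto

lemma linear_dV: "(U, \<phi>) \<in> atlas M \<Longrightarrow> p \<in> U \<Longrightarrow> linear (dV U \<phi> p)"
  using has_derivative_pot has_derivative_linear by blast

lemma has_derivative_transition:
  assumes "(U, \<phi>) \<in> atlas M" "(W, \<psi>) \<in> atlas M" "p \<in> U" "p \<in> W"
  shows "(\<psi> \<circ> id \<circ> inv_into U \<phi> has_derivative tmap U \<phi> \<psi> id p) (at (\<phi> p) within \<phi> ` U)"
proof (rule has_derivative_tmap[OF chart[OF assms(1)] continuous_map_id chart_mapD(1)[OF chart[OF assms(2)]]])
  have "smooth_on (\<phi> ` (U \<inter> W)) (\<psi> \<circ> inv_into U \<phi>)"
    using manifold assms unfolding smooth_manifold_def by blast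
  moreover have "{q \<in> U. id q \<in> W} = U \<inter> W" by auto
  ultimately show "smooth_on (\<phi> ` {q \<in> U. id q \<in> W}) (\<psi> \<circ> id \<circ> inv_into U \<phi>)" by simp
qed (use assms in auto)

lemma dV_transition:
  assumes "(U, \<phi>) \<in> atlas M" "(W, \<psi>) \<in> atlas M" "p \<in> U" "p \<in> W"
  shows "dV U \<phi> p u = dV W \<psi> p (tmap U \<phi> \<psi> id p u)"
proof -
  have "(V \<circ> inv_into W \<psi> has_derivative dV W \<psi> p) (at (\<psi> (id p)) within \<psi> ` W)"
    using has_derivative_pot[OF assms(2,4)] by simp
  then have "(V \<circ> id \<circ> inv_into U \<phi> has_derivative dV W \<psi> p \<circ> tmap U \<phi> \<psi> id p) (at (\<phi> p) within \<phi> ` U)"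
    using assms(4)
    by (intro has_derivative_chart_compose[OF chart[OF assms(1)] continuous_map_id
          chart_mapD(1,2)[OF chart[OF assms(2)]] assms(3) _ has_derivative_transition[OF assms]]) simp_all
  then have "dV U \<phi> p = dV W \<psi> p \<circ> tmap U \<phi> \<psi> id p"
    unfolding dV_def[of U] using smooth_manifold_chart(2)[OF manifold assms(1)] assms(3)
    by (intro dd_unique_chart) auto
  then show ?thesis by simp
qed

definition grd :: "'a set \<Rightarrow> ('a \<Rightarrow> real^3) \<Rightarrow> 'a \<Rightarrow> real^3" where
  "grd U \<phi> p = sharp (g \<phi> p) (dV U \<phi> p)"

lemma g_grd: "(U, \<phi>) \<in> atlas M \<Longrightarrow> p \<in> U \<Longrightarrow> g \<phi> p (grd U \<phi> p) w = dV U \<phi> p w"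
  unfolding grd_def by (intro sharp_works inner_g linear_dV)

text \<open>Choosing a chart at each point makes the squared gradient a global function; that the
  choice is irrelevant is \<open>sqV_chart\<close>.\<close>

definition sqV :: "'a \<Rightarrow> real" where
  "sqV p = (case SOME c. c \<in> atlas M \<and> p \<in> fst c of (U, \<phi>) \<Rightarrow> dV U \<phi> p (grd U \<phi> p))"

text \<open>The differential of a chart transition preserves the metric, so it is injective, hence
  onto, and it carries one coordinate gradient to the other.\<close>

lemma sqV_chart:
  assumes "(U, \<phi>) \<in> atlas M" "p \<in> U"
  shows "sqV p = dV U \<phi> p (grd U \<phi> p)"
proof -
  define c where "c = (SOME c. c \<in> atlas M \<and> p \<in> fst c)"
  have "\<exists>c. c \<in> atlas M \<and> p \<in> fst c" using assms by (intro exI[of _ "(U, \<phi>)"]) simp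
  then have c: "c \<in> atlas M \<and> p \<in> fst c" unfolding c_def by (rule someI_ex)
  obtain W \<psi> where W: "c = (W, \<psi>)" by (metis prod.exhaust)
  then have W': "(W, \<psi>) \<in> atlas M" "p \<in> W" using c by auto
  let ?T = "tmap U \<phi> \<psi> id p"
  have lin: "linear ?T"
    using has_derivative_transition[OF assms(1) W'(1) assms(2) W'(2)] has_derivative_linear by blast
  have "inj ?T"
  proof -
    have "u = 0" if "?T u = 0" for u
    proof (rule ccontr)
      assume "u \<noteq> 0"
      then have "0 < g \<phi> p u u" using inner_formD(4)[OF inner_g[OF assms]] by blast
      then show False
        using g_pullback[OF assms(1) W'(1) assms(2) W'(2), of u u] that
          linear_0[OF inner_formD(2)[OF inner_g[OF W']]] by simp
    qed
    then show ?thesis using linear_injective_0[OF lin] by blast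
  qed
  then have "surj ?T" by (rule linear_injective_imp_surjective[OF lin]) simp
  have "grd W \<psi> p = ?T (grd U \<phi> p)"
  proof (rule inner_form_eqI[OF inner_g[OF W']])
    fix w
    obtain u where u: "w = ?T u" using \<open>surj ?T\<close> by (metis surjD)
    show "g \<psi> p (grd W \<psi> p) w = g \<psi> p (?T (grd U \<phi> p)) w"
      unfolding u using g_pullback[OF assms(1) W'(1) assms(2) W'(2)]
        g_grd[OF W'] g_grd[OF assms] dV_transition[OF assms(1) W'(1) assms(2) W'(2)] by metis
  qed
  then have "dV W \<psi> p (grd W \<psi> p) = dV U \<phi> p (grd U \<phi> p)"
    using dV_transition[OF assms(1) W'(1) assms(2) W'(2)] by simp
  then show ?thesis unfolding sqV_def c_def[symmetric] W by simp
qed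

lemma sqV_eq_g: "(U, \<phi>) \<in> atlas M \<Longrightarrow> p \<in> U \<Longrightarrow> sqV p = g \<phi> p (grd U \<phi> p) (grd U \<phi> p)"
  by (simp add: sqV_chart g_grd)

lemma sqV_nonneg: "p \<in> topspace (mtop M) \<Longrightarrow> 0 \<le> sqV p"
  using chart_at[of p] sqV_eq_g inner_form_nonneg[OF inner_g] by force

lemma sqV_eq_0D:
  assumes "(U, \<phi>) \<in> atlas M" "p \<in> U" "sqV p = 0"
  shows "dV U \<phi> p = (\<lambda>u. 0)"
proof -
  have "grd U \<phi> p = 0"
    using sqV_eq_g[OF assms(1,2)] assms(3) inner_formD(4)[OF inner_g[OF assms(1,2)]] by (metis less_irrefl)
  then show ?thesis
    using g_grd[OF assms(1,2)] linear_0[OF inner_formD(2)[OF inner_g[OF assms(1,2)]]] by (metis ext)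
qed

text \<open>Inserting the gradient itself gives that the square of \<open>sqV p\<close> is at most
  \<open>B\<close> times \<open>sqV p\<close>.\<close>

lemma sqV_le:
  assumes c: "(U, \<phi>) \<in> atlas M" "p \<in> U" and le: "\<And>u. (dV U \<phi> p u)\<^sup>2 \<le> B * g \<phi> p u u" and B: "0 \<le> B"
  shows "sqV p \<le> B"
proof (rule ccontr)
  assume "\<not> sqV p \<le> B"
  then have "sqV p > B" by simp
  moreover have "(sqV p)\<^sup>2 \<le> B * sqV p"
    using le[of "grd U \<phi> p"] sqV_chart[OF c] sqV_eq_g[OF c] by simp
  ultimately show False using B by (simp add: power2_eq_square mult_le_cancel_right)
qed

lemma continuous_map_chartwise:
  fixes f :: "'a \<Rightarrow> real"
  assumes "\<And>U \<phi>. (U, \<phi>) \<in> atlas M \<Longrightarrow> continuous_on (\<phi> ` U) (f \<circ> inv_into U \<phi>)"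
  shows "continuous_map (mtop M) euclidean f"
  unfolding continuous_map_def
proof (intro conjI allI impI)
  fix T :: "real set" assume "openin euclidean T"
  then have T: "open T" by simp
  show "openin (mtop M) {p \<in> topspace (mtop M). f p \<in> T}"
  proof (subst openin_subopen, intro ballI)
    fix p assume p: "p \<in> {p \<in> topspace (mtop M). f p \<in> T}"
    then obtain U \<phi> where c: "(U, \<phi>) \<in> atlas M" "p \<in> U" using chart_at by blast
    have "continuous_map (top_of_set (\<phi> ` U)) euclidean (f \<circ> inv_into U \<phi>)"
      using assms[OF c(1)] by simp
    moreover have "continuous_map (subtopology (mtop M) U) (top_of_set (\<phi> ` U)) \<phi>"
      using chart_mapD(1,3)[OF chart[OF c(1)]] openin_subset
      by (auto simp: continuous_map_in_subtopology topspace_subtopology)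
    ultimately have "continuous_map (subtopology (mtop M) U) euclidean (f \<circ> inv_into U \<phi> \<circ> \<phi>)"
      by (rule continuous_map_compose[rotated])
    then have "continuous_map (subtopology (mtop M) U) euclidean f"
      by (rule continuous_map_eq) (use chart_inv[OF c(1)] in \<open>auto simp: topspace_subtopology\<close>)
    then have "openin (subtopology (mtop M) U) {q \<in> topspace (subtopology (mtop M) U). f q \<in> T}"
      using T openin_continuous_map_preimage by (metis open_openin)
    then have "openin (mtop M) {q \<in> topspace (subtopology (mtop M) U). f q \<in> T}"
      using chart_mapD(1)[OF chart[OF c(1)]] openin_trans_full by blast
    then show "\<exists>T'. openin (mtop M) T' \<and> p \<in> T' \<and> T' \<subseteq> {p \<in> topspace (mtop M). f p \<in> T}"
      using p c(2) by (intro exI[of _ "{q \<in> topspace (subtopology (mtop M) U). f q \<in> T}"])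
        (auto simp: topspace_subtopology)
  qed
qed auto

lemma continuous_V: "continuous_map (mtop M) euclidean V"
proof (rule continuous_map_chartwise)
  fix U \<phi> assume "(U, \<phi>) \<in> atlas M"
  then show "continuous_on (\<phi> ` U) (V \<circ> inv_into U \<phi>)"
    using smooth_on_differentiable[OF smooth_pot] differentiable_imp_continuous_on by blast
qed

text \<open>Compactness arguments involve the horizons, so continuity is shown in full chart images
  with one-sided derivatives instead of in interiors.\<close>

lemma continuous_sqV: "continuous_map (mtop M) euclidean sqV"
proof (rule continuous_map_chartwise)
  fix U \<phi> assume c: "(U, \<phi>) \<in> atlas M"
  let ?S = "\<phi> ` U" and ?f = "V \<circ> inv_into U \<phi>"
  have inv: "inv_into U \<phi> x \<in> U" "\<phi> (inv_into U \<phi> x) = x" if "x \<in> ?S" for x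
    using that by (auto intro: inv_into_into f_inv_into_f)
  have C1: "Ck_on (Suc 0) ?S ?f" and C0: "continuous_on ?S (\<lambda>x. loc U \<phi> g x u v)" for u v
    using smooth_pot[OF c] smooth_loc[OF c] unfolding smooth_on_def by (blast, metis Ck_on.simps(1))
  have fd: "?f differentiable_on ?S" using C1 by simp
  have "continuous_on ?S (\<lambda>x. sharp (loc U \<phi> g x) (dd ?S ?f x))"
    using inner_g[OF c] inv by (intro sharp_continuous_on continuous_on_dd C1 C0 linear_dd fd) (auto simp: loc_def)
  then have "continuous_on ?S (\<lambda>x. \<Sum>b\<in>Basis. (sharp (loc U \<phi> g x) (dd ?S ?f x) \<bullet> b) *\<^sub>R dd ?S ?f x b)"
    by (intro continuous_intros continuous_on_dd C1)
  then show "continuous_on ?S (sqV \<circ> inv_into U \<phi>)"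
  proof (rule continuous_on_eq)
    fix x assume x: "x \<in> ?S"
    show "(\<Sum>b\<in>Basis. (sharp (loc U \<phi> g x) (dd ?S ?f x) \<bullet> b) *\<^sub>R dd ?S ?f x b) = (sqV \<circ> inv_into U \<phi>) x"
      unfolding dd_expand[OF fd x, symmetric]
      using sqV_chart[OF c inv(1)[OF x]] inv[OF x]
      by (simp add: dV_def grd_def loc_def)
  qed
qed

lemma interior_chart:
  assumes "(U, \<phi>) \<in> atlas M" "p \<in> U" "p \<notin> bdry M"
  shows "\<phi> p \<in> interior (\<phi> ` U)"
  using assms unfolding bdry_def by blast

lemma coordinate_potential_interior:
  assumes c: "(U, \<phi>) \<in> atlas M"
  shows "coordinate_potential (interior (\<phi> ` U)) (loc U \<phi> g) (V \<circ> inv_into U \<phi>)"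
proof
  show "inner_form (loc U \<phi> g x)" if "x \<in> interior (\<phi> ` U)" for x
    using that interior_subset[of "\<phi> ` U"] inner_g[OF c] by (auto simp: loc_def intro: inv_into_into)
qed (intro open_interior smooth_on_open_subset[OF smooth_loc[OF c] open_interior interior_subset]
    smooth_on_open_subset[OF smooth_pot[OF c] open_interior interior_subset])+

lemma sq_eq_sqV:
  assumes c: "(U, \<phi>) \<in> atlas M" and x: "x \<in> interior (\<phi> ` U)"
  shows "coordinate_potential.sq (interior (\<phi> ` U)) (loc U \<phi> g) (V \<circ> inv_into U \<phi>) x = sqV (inv_into U \<phi> x)"
proof -
  interpret coordinate_potential "interior (\<phi> ` U)" "loc U \<phi> g" "V \<circ> inv_into U \<phi>"
    by (rule coordinate_potential_interior[OF c])
  have xS: "x \<in> \<phi> ` U" using x interior_subset by blast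
  then have inv: "inv_into U \<phi> x \<in> U" "\<phi> (inv_into U \<phi> x) = x"
    by (auto intro: inv_into_into f_inv_into_f)
  have "dd (\<phi> ` U) (V \<circ> inv_into U \<phi>) x = dd (interior (\<phi> ` U)) (V \<circ> inv_into U \<phi>) x"
    by (rule dd_local[OF open_interior x interior_subset refl])
  then show ?thesis
    using sqV_chart[OF c inv(1)] inv(2) by (simp add: sq_def grad_def dV_def grd_def loc_def)
qed

end

locale static_potential = riemannian_potential +
  assumes static_hess: "\<forall>(U, \<phi>)\<in>atlas M. \<forall>p\<in>U. \<forall>u v.
      hess (\<phi> ` U) (loc U \<phi> g) (V \<circ> inv_into U \<phi>) (\<phi> p) u v =
      V p * ricci (\<phi> ` U) (loc U \<phi> g) (\<phi> p) u v + 3 * V p * g \<phi> p u v"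
    and static_laplacian: "\<forall>(U, \<phi>)\<in>atlas M. \<forall>p\<in>U.
      laplacian (\<phi> ` U) (loc U \<phi> g) (V \<circ> inv_into U \<phi>) (\<phi> p) = 3 * V p"
begin

text \<open>With P = w' the contact inequality reduces to 3 (1 - P) (3 - P) \<le> 4 W w''. The
  equation of the profile would give equality for W = w, but contact means W = w - c, and the left
  side is positive because P < 1.\<close>

lemma no_interior_contact:
  assumes p: "p \<in> topspace (mtop M)" "p \<notin> bdry M" "V p > 0" and m: "m > 0" and c: "c > 0"
    and le: "\<And>q. q \<in> topspace (mtop M) \<Longrightarrow> sqV q \<le> kottler m ((V q)\<^sup>2 - k) - c"
    and eq: "sqV p = kottler m ((V p)\<^sup>2 - k) - c"
  shows "sqV p \<le> 0"
proof (rule ccontr)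
  assume "\<not> sqV p \<le> 0"
  then have Wpos: "sqV p > 0" by simp
  obtain U \<phi> where ch: "(U, \<phi>) \<in> atlas M" "p \<in> U" using chart_at[OF p(1)] by blast
  define S f x where "S = interior (\<phi> ` U)" and "f = V \<circ> inv_into U \<phi>" and "x = \<phi> p"
  interpret coordinate_potential S "loc U \<phi> g" f
    unfolding S_def f_def by (rule coordinate_potential_interior[OF ch(1)])
  have x: "x \<in> S" using interior_chart[OF ch p(2)] by (simp add: S_def x_def)
  have inv: "inv_into U \<phi> y \<in> U" "\<phi> (inv_into U \<phi> y) = y" if "y \<in> S" for y
    using that interior_subset[of "\<phi> ` U"] by (auto simp: S_def intro: inv_into_into f_inv_into_f)
  have fx: "f x = V p" by (simp add: f_def x_def chart_inv[OF ch])
  have sq_eq: "sq y = sqV (inv_into U \<phi> y)" if "y \<in> S" for y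
    using sq_eq_sqV[OF ch(1)] that by (simp add: S_def f_def)
  have sqx: "sq x = sqV p" using sq_eq[OF x] by (simp add: x_def chart_inv[OF ch])
  have lap: "laplacian S (loc U \<phi> g) f y = 3 * f y" if "y \<in> S" for y
  proof -
    have "laplacian (\<phi> ` U) (loc U \<phi> g) f (\<phi> (inv_into U \<phi> y)) = 3 * V (inv_into U \<phi> y)"
      using bspec[OF static_laplacian ch(1)] inv(1)[OF that] by (simp add: f_def)
    then have "laplacian (\<phi> ` U) (loc U \<phi> g) f y = 3 * f y"
      by (simp add: inv(2)[OF that] f_def)
    then show ?thesis
      using laplacian_local[OF open_S that, of "\<phi> ` U"] by (simp add: S_def interior_subset)
  qed
  have static: "Hs x u v = f x * ricci S (loc U \<phi> g) x u v + 3 * f x * loc U \<phi> g x u v" for u v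
  proof -
    have "hess (\<phi> ` U) (loc U \<phi> g) f x u v =
        V p * ricci (\<phi> ` U) (loc U \<phi> g) x u v + 3 * V p * g \<phi> p u v"
      using bspec[OF static_hess ch(1)] ch(2) by (simp add: f_def x_def)
    moreover have "loc U \<phi> g x u v = g \<phi> p u v"
      by (simp add: loc_def x_def chart_inv[OF ch])
    ultimately show ?thesis
      using hess_local[OF open_S x, of "\<phi> ` U" "loc U \<phi> g" f] ricci_local[OF open_S x, of "\<phi> ` U" "loc U \<phi> g"] fx
      by (simp add: S_def interior_subset)
  qed
  define P \<omega> where "P = kottler1 m ((V p)\<^sup>2 - k)" and "\<omega> = kottler m ((V p)\<^sup>2 - k)"
  \<comment> \<open>The second derivative of the profile, expressed by its differential
    equation.\<close>
  define dP where "dP = 3 * (1 - P) * (3 - P) / (4 * \<omega>)"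
  define h h1 where "h t = kottler m (t\<^sup>2 - k) - c" and "h1 t = kottler1 m (t\<^sup>2 - k) * (2 * t)" for t
  have sqd: "((\<lambda>t. t\<^sup>2 - k) has_real_derivative 2 * t) (at t)" for t
    by (auto intro!: derivative_eq_intros)
  have Dh: "(h has_real_derivative h1 t) (at t)" for t
    unfolding h_def[abs_def] h1_def
    using DERIV_diff[OF DERIV_chain2[OF DERIV_kottler[OF m] sqd] DERIV_const] by simp
  have "((\<lambda>t. kottler1 m (t\<^sup>2 - k)) has_real_derivative dP * (2 * V p)) (at (V p))"
    unfolding dP_def P_def \<omega>_def by (rule DERIV_chain2[OF DERIV_kottler1[OF m] sqd])
  then have Dh1: "(h1 has_real_derivative dP * (2 * V p) * (2 * V p) + P * 2) (at (f x))"
    unfolding h1_def[abs_def] fx P_def by (auto intro!: derivative_eq_intros)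
  have "h1 (f x) * sq x / f x + (h1 (f x))\<^sup>2 / 2 + (3 * f x - h1 (f x) / 2)\<^sup>2
    \<le> 3 * f x * h1 (f x) + (dP * (2 * V p) * (2 * V p) + P * 2) * sq x"
  proof (rule contact_inequality[OF x lap static _ _ open_UNIV UNIV_I Dh Dh1 open_S x])
    show "0 < f x" "0 < sq x" using fx sqx Wpos p by auto
    fix y assume y: "y \<in> S"
    have "inv_into U \<phi> y \<in> topspace (mtop M)" using inv(1)[OF y] chart_subset[OF ch(1)] by blast
    moreover have "f y = V (inv_into U \<phi> y)" by (simp add: f_def)
    ultimately have "sq y \<le> h (f y)" using le by (simp add: sq_eq[OF y] h_def)
    moreover have "sq x = h (f x)" using eq by (simp add: sqx h_def fx)
    ultimately show "sq y - h (f y) \<le> sq x - h (f x)" by simp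
  qed
  moreover have h1x: "h1 (f x) = 2 * P * V p" by (simp add: h1_def fx P_def)
  ultimately have "2 * P * sqV p + 2 * P\<^sup>2 * (V p)\<^sup>2 + (3 - P)\<^sup>2 * (V p)\<^sup>2 \<le>
      6 * P * (V p)\<^sup>2 + 4 * dP * (V p)\<^sup>2 * sqV p + 2 * P * sqV p"
    using p(3) unfolding h1x fx sqx by (simp add: power2_eq_square algebra_simps)
  then have "(V p)\<^sup>2 * (2 * P\<^sup>2 + (3 - P)\<^sup>2 - 6 * P) \<le> (V p)\<^sup>2 * (4 * dP * sqV p)"
    by (simp add: algebra_simps)
  then have "2 * P\<^sup>2 + (3 - P)\<^sup>2 - 6 * P \<le> 4 * dP * sqV p"
    using p(3) by (simp add: mult_le_cancel_left)
  moreover have "2 * P\<^sup>2 + (3 - P)\<^sup>2 - 6 * P = 3 * (1 - P) * (3 - P)"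
    by (simp add: power2_eq_square algebra_simps)
  moreover have "4 * dP * sqV p < 3 * (1 - P) * (3 - P)"
  proof -
    have "P < 1" unfolding P_def by (rule kottler1_less[OF m])
    then have q: "3 * (1 - P) * (3 - P) > 0" by simp
    have w: "\<omega> > 0" unfolding \<omega>_def by (rule kottler_pos[OF m])
    have "sqV p < \<omega>" using eq c by (simp add: \<omega>_def)
    then have "3 * (1 - P) * (3 - P) * sqV p < 3 * (1 - P) * (3 - P) * \<omega>" using q by (rule mult_strict_left_mono)
    moreover have "4 * dP * sqV p = 3 * (1 - P) * (3 - P) * sqV p / \<omega>" by (simp add: dP_def)
    ultimately show ?thesis using w by (simp add: pos_divide_less_eq)
  qed
  ultimately show False by simp
qed

end

section \<open>The boundary\<close>

lemma half_space_interior: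
  assumes "b \<in> Basis" "openin (top_of_set {x. 0 \<le> x \<bullet> b}) S" "x \<in> S"
  shows "x \<in> interior S \<longleftrightarrow> x \<bullet> b \<noteq> 0"
proof -
  obtain T where T: "open T" "S = {x. 0 \<le> x \<bullet> b} \<inter> T" using assms(2) openin_open by blast
  show ?thesis
  proof
    assume "x \<in> interior S"
    then obtain r where r: "r > 0" "ball x r \<subseteq> S" by (meson mem_interior)
    have "x - (r / 2) *\<^sub>R b \<in> ball x r" using r assms(1) by (simp add: dist_norm)
    then have "0 \<le> (x - (r / 2) *\<^sub>R b) \<bullet> b" using r T by blast
    then show "x \<bullet> b \<noteq> 0" using r assms(1) by (simp add: inner_diff_left)
  next
    assume "x \<bullet> b \<noteq> 0"
    then have "x \<in> {x. 0 < x \<bullet> b} \<inter> T" using assms(3) T by auto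
    moreover have "open ({x. 0 < x \<bullet> b} \<inter> T)"
      using T(1) open_halfspace_gt[of 0 b] by (simp add: open_Int inner_commute)
    moreover have "{x. 0 < x \<bullet> b} \<inter> T \<subseteq> S" using T by auto
    ultimately show "x \<in> interior S" by (meson interiorI)
  qed
qed

text \<open>\<open>bdry\<close> refers to one chart in which the point is not interior. The image of
  that chart is not open, so it is of half-space type, and its points on the face are boundary
  points by the same definition.\<close>

lemma bdry_chart:
  assumes "smooth_manifold M" "p \<in> bdry M"
  obtains U \<phi> b where "(U, \<phi>) \<in> atlas M" "p \<in> U" "b \<in> Basis"
    "openin (top_of_set {x. 0 \<le> x \<bullet> b}) (\<phi> ` U)" "\<phi> p \<bullet> b = 0"
    "\<And>q. q \<in> U \<Longrightarrow> \<phi> q \<bullet> b = 0 \<Longrightarrow> q \<in> bdry M"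
proof -
  obtain U \<phi> where c: "(U, \<phi>) \<in> atlas M" "p \<in> U" "\<phi> p \<notin> interior (\<phi> ` U)"
    using assms(2) unfolding bdry_def by blast
  have "is_chart (mtop M) U \<phi>" using assms(1) c(1) unfolding smooth_manifold_def by blast
  moreover have "\<not> open (\<phi> ` U)" using c interior_open by blast
  ultimately obtain b where b: "b \<in> Basis" "openin (top_of_set {x. 0 \<le> x \<bullet> b}) (\<phi> ` U)"
    unfolding is_chart_def by blast
  have "\<phi> q \<in> interior (\<phi> ` U) \<longleftrightarrow> \<phi> q \<bullet> b \<noteq> 0" if "q \<in> U" for q
    using half_space_interior[OF b] that by blast
  then show thesis
    using that[OF c(1,2) b] c unfolding bdry_def by blast
qed

lemma at_within_atLeastLessThan:
  fixes r :: real
  assumes "r > 0"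
  shows "at 0 within {0..<r} = at_right 0"
proof -
  have "at 0 within {0..<r} = at 0 within {0..}"
    using assms by (intro at_within_nhd[of 0 "{..<r}"]) auto
  then show ?thesis by (simp add: at_within_Ici_at_right)
qed

lemma nonneg_right_derivative:
  fixes f :: "real \<Rightarrow> real"
  assumes "(f has_real_derivative D) (at 0 within {0..<r})" "r > 0" "f 0 = 0"
    "\<And>s. s \<in> {0..<r} \<Longrightarrow> 0 \<le> f s"
  shows "0 \<le> D"
proof (rule tendsto_lowerbound)
  show "((\<lambda>y. (f y - f 0) / (y - 0)) \<longlongrightarrow> D) (at 0 within {0..<r})"
    using assms(1) by (simp add: has_field_derivative_iff)
  show "\<forall>\<^sub>F y in at 0 within {0..<r}. 0 \<le> (f y - f 0) / (y - 0)"
    unfolding eventually_at_filter using assms by (auto intro!: always_eventually)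
  show "at 0 within {0..<r} \<noteq> bot"
    using at_within_atLeastLessThan[OF assms(2)] by simp
qed

lemma has_vector_derivative_along:
  assumes "(f has_derivative F) (at (c t) within S)" "(c has_vector_derivative w) (at t within I)"
    "c ` I \<subseteq> S"
  shows "((\<lambda>t. f (c t)) has_vector_derivative F w) (at t within I)"
  using vector_derivative_diff_chain_within[OF assms(2) has_derivative_subset[OF assms(1,3)]]
  by (simp add: o_def)

context riemannian_potential
begin

text \<open>\<open>V\<close> is constant on the face, so its differential kills tangential
  directions and the gradient is a multiple of the normal, the factor being the surface
  gravity.\<close>

lemma boundary_gradient:
  assumes def: "defines_bdry M V" and p: "p \<in> bdry M"
    and sg: "has_surface_gravity M g V C \<kappa>" and pC: "p \<in> C"
  shows "sqV p = \<kappa>\<^sup>2" "0 \<le> \<kappa>"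
proof -
  obtain U \<phi> b where ch: "(U, \<phi>) \<in> atlas M" "p \<in> U" and b: "b \<in> Basis"
    "openin (top_of_set {x. 0 \<le> x \<bullet> b}) (\<phi> ` U)" "\<phi> p \<bullet> b = 0"
    and face: "\<And>q. q \<in> U \<Longrightarrow> \<phi> q \<bullet> b = 0 \<Longrightarrow> q \<in> bdry M"
    using bdry_chart[OF manifold p] by blast
  define f where "f = V \<circ> inv_into U \<phi>"
  obtain T where T: "open T" "\<phi> ` U = {x. 0 \<le> x \<bullet> b} \<inter> T" using b(2) openin_open by blast
  have "\<phi> p \<in> T" using T ch(2) by auto
  then obtain r where r: "r > 0" "ball (\<phi> p) r \<subseteq> T" using T(1) open_contains_ball by blast
  have V0: "V q = 0" if "q \<in> bdry M" for q using def that unfolding defines_bdry_def by blast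
  have Vnn: "0 \<le> V q" if "q \<in> topspace (mtop M)" for q
    using def that unfolding defines_bdry_def by (cases "q \<in> bdry M") (auto simp: less_imp_le)
  have fd: "(f has_derivative dV U \<phi> p) (at (\<phi> p) within \<phi> ` U)"
    unfolding f_def by (rule has_derivative_pot[OF ch])
  have line: "((\<lambda>s. \<phi> p + s *\<^sub>R w) has_vector_derivative w) (at 0 within I)" for w I
    by (auto intro!: derivative_eq_intros)
  have in_T: "\<phi> p + s *\<^sub>R w \<in> T" if "\<bar>s\<bar> < r / (norm w + 1)" for s w
  proof -
    have "\<bar>s\<bar> * (norm w + 1) < r" using that by (simp add: pos_less_divide_eq add_nonneg_pos)
    moreover have "\<bar>s\<bar> * norm w \<le> \<bar>s\<bar> * (norm w + 1)" by (intro mult_left_mono) auto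
    ultimately have "\<phi> p + s *\<^sub>R w \<in> ball (\<phi> p) r" by (simp add: dist_norm)
    then show ?thesis using r by blast
  qed
  have rw: "r / (norm w + 1) > 0" for w :: "real^3" using r by (simp add: add_nonneg_pos)
  have dV0: "dV U \<phi> p w = 0" if w: "w \<bullet> b = 0" for w
  proof -
    define I where "I = {- (r / (norm w + 1)) <..< r / (norm w + 1)}"
    have I: "open I" "0 \<in> I" using rw[of w] by (auto simp: I_def)
    have sub: "(\<lambda>s. \<phi> p + s *\<^sub>R w) ` I \<subseteq> \<phi> ` U"
      using in_T[of _ w] b(3) w by (auto simp: T(2) I_def inner_add_left)
    have "((\<lambda>s. f (\<phi> p + s *\<^sub>R w)) has_vector_derivative dV U \<phi> p w) (at 0 within I)"
      by (rule has_vector_derivative_along[where c = "\<lambda>s. \<phi> p + s *\<^sub>R w", OF _ line sub]) (simp add: fd)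
    moreover have "f (\<phi> p + s *\<^sub>R w) = 0" if "s \<in> I" for s
    proof -
      obtain q where q: "q \<in> U" "\<phi> p + s *\<^sub>R w = \<phi> q" using sub \<open>s \<in> I\<close> by blast
      have "\<phi> q \<bullet> b = 0" unfolding q(2)[symmetric] using b(3) w by (simp add: inner_add_left)
      then show ?thesis using V0[OF face[OF q(1)]] chart_inv[OF ch(1) q(1)] q(2) by (simp add: f_def)
    qed
    ultimately have "((\<lambda>s. 0) has_vector_derivative dV U \<phi> p w) (at 0 within I)"
      using I(2) has_vector_derivative_transform[of 0 I "\<lambda>s. 0" "\<lambda>s. f (\<phi> p + s *\<^sub>R w)"] by simp
    then have "((\<lambda>s. 0) has_vector_derivative dV U \<phi> p w) (at 0)"
      by (simp only: at_within_open[OF I(2,1)])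
    then show ?thesis
      using vector_derivative_unique_at[OF has_vector_derivative_const] by metis
  qed
  \<comment> \<open>The metric dual of the coordinate transverse to the face is orthogonal to the
    face; its squared length is \<open>s \<bullet> b\<close>.\<close>
  define s where "s = sharp (g \<phi> p) (\<lambda>w. w \<bullet> b)"
  have gs: "g \<phi> p s w = w \<bullet> b" for w
    unfolding s_def by (rule sharp_works[OF inner_g[OF ch]])
      (rule bounded_linear.linear[OF bounded_linear_inner_left])
  have "s \<noteq> 0" using gs[of b] b(1) linear_0[OF inner_formD(2)[OF inner_g[OF ch]]] by auto
  then have ss: "0 < g \<phi> p s s" using inner_formD(4)[OF inner_g[OF ch]] by blast
  define \<nu> where "\<nu> = (1 / sqrt (s \<bullet> b)) *\<^sub>R s"
  have sb: "s \<bullet> b > 0" using ss gs[of s] by simp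
  note lin = linear_scale[OF inner_formD(1)[OF inner_g[OF ch]]] linear_scale[OF inner_formD(2)[OF inner_g[OF ch]]]
  have \<nu>: "g \<phi> p \<nu> w = (w \<bullet> b) / sqrt (s \<bullet> b)" "\<nu> \<bullet> b = sqrt (s \<bullet> b)" for w
    using sb by (simp_all add: \<nu>_def lin gs real_div_sqrt)
  have "g \<phi> p \<nu> \<nu> = 1" using \<nu> sb by simp
  then have "inward_unit_normal g U \<phi> p \<nu>"
    unfolding inward_unit_normal_def using b \<nu> sb by (intro bexI[of _ b]) auto
  then have k: "dV U \<phi> p \<nu> = \<kappa>"
    using bspec[OF bspec[OF sg[unfolded has_surface_gravity_def] pC] ch(1)] ch(2) by (simp add: dV_def)
  have dVw: "dV U \<phi> p w = (w \<bullet> b) / sqrt (s \<bullet> b) * \<kappa>" for w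
  proof -
    define t where "t = (w \<bullet> b) / sqrt (s \<bullet> b)"
    have "(w - t *\<^sub>R \<nu>) \<bullet> b = 0" using sb by (simp add: t_def \<nu> inner_diff_left)
    then have "dV U \<phi> p (w - t *\<^sub>R \<nu>) = 0" by (rule dV0)
    then show ?thesis
      by (simp add: linear_diff[OF linear_dV[OF ch]] linear_scale[OF linear_dV[OF ch]] k t_def)
  qed
  have "grd U \<phi> p = \<kappa> *\<^sub>R \<nu>"
    by (rule inner_form_eqI[OF inner_g[OF ch]]) (simp add: g_grd[OF ch] lin \<nu> dVw)
  then show "sqV p = \<kappa>\<^sup>2"
    using sqV_chart[OF ch] k by (simp add: linear_scale[OF linear_dV[OF ch]] power2_eq_square)
  \<comment> \<open>Along the normal line \<open>V\<close> starts at 0 and stays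
    nonnegative.\<close>
  show "0 \<le> \<kappa>"
  proof -
    define e where "e = r / (norm \<nu> + 1)"
    have e: "e > 0" unfolding e_def by (rule rw)
    have sub: "(\<lambda>t. \<phi> p + t *\<^sub>R \<nu>) ` {0..<e} \<subseteq> \<phi> ` U"
      using in_T[of _ \<nu>] b(3) \<nu>(2) sb by (auto simp: T(2) e_def inner_add_left)
    have "((\<lambda>t. f (\<phi> p + t *\<^sub>R \<nu>)) has_vector_derivative dV U \<phi> p \<nu>) (at 0 within {0..<e})"
      by (rule has_vector_derivative_along[where c = "\<lambda>t. \<phi> p + t *\<^sub>R \<nu>", OF _ line sub]) (simp add: fd)
    then have "((\<lambda>t. f (\<phi> p + t *\<^sub>R \<nu>)) has_real_derivative \<kappa>) (at 0 within {0..<e})"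
      by (simp add: k has_real_derivative_iff_has_vector_derivative)
    then show ?thesis
    proof (rule nonneg_right_derivative[OF _ e])
      show "f (\<phi> p + 0 *\<^sub>R \<nu>) = 0" using V0[OF p] chart_inv[OF ch] by (simp add: f_def)
      fix t assume "t \<in> {0..<e}"
      then obtain q where "q \<in> U" "\<phi> p + t *\<^sub>R \<nu> = \<phi> q" using sub by blast
      then show "0 \<le> f (\<phi> p + t *\<^sub>R \<nu>)"
        using Vnn[of q] chart_subset[OF ch(1)] chart_inv[OF ch(1)] by (auto simp: f_def)
    qed
  qed
qed

end

section \<open>Norms of tensors with respect to a diagonal metric\<close>

text \<open>\<open>round_metric\<close> is a multiple of the Euclidean inner product, so the model
  metric \<open>gbar\<close> has this form in the charts of the end.\<close>

definition diag_form :: "('e::euclidean_space \<Rightarrow> real) \<Rightarrow> 'e \<Rightarrow> 'e \<Rightarrow> real" where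
  "diag_form \<beta> u v = (\<Sum>i\<in>Basis. \<beta> i * (u \<bullet> i) * (v \<bullet> i))"

lemma inner_form_diag:
  assumes "\<And>i. i \<in> Basis \<Longrightarrow> \<beta> i > 0"
  shows "inner_form (diag_form \<beta>)"
  unfolding inner_form_def
proof (intro conjI allI impI)
  show "bilinear (diag_form \<beta>)"
    unfolding bilinear_def diag_form_def
    by (auto intro!: linearI simp: inner_add_left algebra_simps sum.distrib sum_distrib_left)
  show "diag_form \<beta> u v = diag_form \<beta> v u" for u v
    by (simp add: diag_form_def mult_ac)
  fix u :: 'a assume "u \<noteq> 0"
  then obtain i where i: "i \<in> Basis" "u \<bullet> i \<noteq> 0" using euclidean_all_zero_iff by blast
  have "0 < \<beta> i * (u \<bullet> i) * (u \<bullet> i)"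
    using i assms[OF i(1)] by (auto simp: mult.assoc zero_less_mult_iff linorder_neq_iff)
  moreover have "0 \<le> \<beta> j * (u \<bullet> j) * (u \<bullet> j)" if "j \<in> Basis" for j
    using assms[OF that] by (simp add: mult.assoc)
  ultimately show "0 < diag_form \<beta> u u"
    unfolding diag_form_def using i(1) by (intro sum_pos2[of _ i]) auto
qed

lemma ginv_diag:
  assumes \<beta>: "\<And>i. i \<in> Basis \<Longrightarrow> \<beta> i > 0" and kl: "k \<in> Basis" "l \<in> Basis"
  shows "ginv (diag_form \<beta>) k l = (if k = l then 1 / \<beta> k else 0)"
proof -
  have "sharp (diag_form \<beta>) (\<lambda>w. w \<bullet> k) = (1 / \<beta> k) *\<^sub>R k"
  proof (rule sharp_unique[OF inner_form_diag[OF \<beta>]])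
    show "linear (\<lambda>w. w \<bullet> k)" by (rule bounded_linear.linear[OF bounded_linear_inner_left])
    fix w
    have "diag_form \<beta> ((1 / \<beta> k) *\<^sub>R k) w = (\<Sum>i\<in>Basis. if i = k then w \<bullet> k else 0)"
      unfolding diag_form_def
      by (rule sum.cong[OF refl]) (use \<beta> kl in \<open>auto simp: inner_Basis\<close>, metis less_irrefl)
    then show "diag_form \<beta> ((1 / \<beta> k) *\<^sub>R k) w = w \<bullet> k" using kl by simp
  qed
  then show ?thesis using kl by (simp add: ginv_def inner_Basis)
qed

text \<open>For a diagonal metric the double sum in \<open>tnorm\<close> has only nonnegative terms,
  so it dominates the single term belonging to \<open>I\<close>, which is the squared component
  divided by its weights.\<close>

lemma le_tnorm_diag:
  assumes \<beta>: "\<And>i. i \<in> Basis \<Longrightarrow> \<beta> i > 0" and I: "set I \<subseteq> Basis" "length I = k"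
  shows "\<bar>T I\<bar> \<le> tnorm (diag_form \<beta>) k T * (\<Prod>m<k. sqrt (\<beta> (I ! m)))"
proof -
  let ?L = "{I. set I \<subseteq> Basis \<and> length I = k}"
  define t where "t I J = (\<Prod>m<k. ginv (diag_form \<beta>) (I ! m) (J ! m)) * T I * T J" for I J
  have mem: "I ! m \<in> Basis" if "I \<in> ?L" "m < k" for I m
    using that nth_mem by blast
  have gi: "ginv (diag_form \<beta>) (I ! m) (J ! m) = (if I ! m = J ! m then 1 / \<beta> (I ! m) else 0)"
    if "I \<in> ?L" "J \<in> ?L" "m < k" for I J m
    by (rule ginv_diag[OF \<beta>]) (use mem that in blast)+
  have t0: "0 \<le> t I J" if IJ: "I \<in> ?L" "J \<in> ?L" for I J
  proof (cases "I = J")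
    case True
    have "0 \<le> (\<Prod>m<k. ginv (diag_form \<beta>) (I ! m) (I ! m))"
      using gi[OF IJ(1) IJ(1)] \<beta> mem[OF IJ(1)] by (intro prod_nonneg) (auto simp: less_imp_le)
    then show ?thesis using True by (simp add: t_def mult.assoc)
  next
    case False
    then obtain m where "m < k" "I ! m \<noteq> J ! m" using IJ nth_equalityI[of I J] by auto
    then have 0: "(\<Prod>m<k. ginv (diag_form \<beta>) (I ! m) (J ! m)) = 0"
      using gi[OF IJ] by (intro prod_zero) auto
    show ?thesis by (simp only: t_def 0 mult_zero_left order_refl)
  qed
  have IL: "I \<in> ?L" using I by simp
  have fin: "finite ?L" by (rule finite_lists_length_eq) simp
  have "t I I \<le> (\<Sum>J\<in>?L. t I J)"
    using t0 IL by (intro member_le_sum fin) auto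
  also have "\<dots> \<le> (\<Sum>I\<in>?L. \<Sum>J\<in>?L. t I J)"
    by (rule member_le_sum[OF IL _ fin]) (intro sum_nonneg t0, auto)
  finally have "sqrt (t I I) \<le> tnorm (diag_form \<beta>) k T"
    unfolding tnorm_def t_def by (rule real_sqrt_le_mono)
  moreover have "(\<Prod>m<k. ginv (diag_form \<beta>) (I ! m) (I ! m)) = 1 / (\<Prod>m<k. sqrt (\<beta> (I ! m)))\<^sup>2"
  proof -
    have "(\<Prod>m<k. ginv (diag_form \<beta>) (I ! m) (I ! m)) = (\<Prod>m<k. 1 / (sqrt (\<beta> (I ! m)))\<^sup>2)"
      using gi[OF IL IL] \<beta> mem[OF IL] by (intro prod.cong) (auto simp: less_imp_le)
    then show ?thesis by (simp add: prod_dividef prod_power_distrib)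
  qed
  moreover have P: "(\<Prod>m<k. sqrt (\<beta> (I ! m))) > 0"
    using \<beta> mem[OF IL] by (intro prod_pos) auto
  ultimately have "\<bar>T I\<bar> / (\<Prod>m<k. sqrt (\<beta> (I ! m))) \<le> tnorm (diag_form \<beta>) k T"
    by (simp add: t_def real_sqrt_divide real_sqrt_mult)
  then show ?thesis using P by (simp add: pos_divide_le_eq)
qed

lemma sum_sqrt_diag_le:
  assumes \<beta>: "\<And>i. i \<in> Basis \<Longrightarrow> \<beta> i > 0"
  shows "((\<Sum>i\<in>Basis. sqrt (\<beta> i) * \<bar>u \<bullet> i\<bar>) :: real)\<^sup>2 \<le> DIM('e) * diag_form \<beta> (u :: 'e::euclidean_space) u"
proof -
  have "(\<Sum>i\<in>Basis. sqrt (\<beta> i) * \<bar>u \<bullet> i\<bar>)\<^sup>2 \<le> (\<Sum>i\<in>Basis. (sqrt (\<beta> i) * \<bar>u \<bullet> i\<bar>)\<^sup>2) * of_nat (card (Basis :: 'e set))"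
    by (rule sum_squared_le_sum_of_squares)
  also have "(\<Sum>i\<in>Basis. (sqrt (\<beta> i) * \<bar>u \<bullet> i\<bar>)\<^sup>2) = diag_form \<beta> u u"
    unfolding diag_form_def using \<beta>
    by (intro sum.cong) (auto simp: power_mult_distrib less_imp_le, simp add: power2_eq_square)
  finally show ?thesis by (simp add: mult.commute)
qed

lemma tnorm_1_bound:
  fixes a :: "'e::euclidean_space \<Rightarrow> real"
  assumes \<beta>: "\<And>i. i \<in> Basis \<Longrightarrow> \<beta> i > 0" and a: "linear a"
    and t: "tnorm (diag_form \<beta>) 1 (\<lambda>vs. a (vs ! 0)) \<le> \<tau>"
  shows "\<bar>a u\<bar> \<le> \<tau> * sqrt (DIM('e) * diag_form \<beta> u u)"
proof -
  have ai: "\<bar>a i\<bar> \<le> \<tau> * sqrt (\<beta> i)" if "i \<in> Basis" for i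
  proof -
    have "\<bar>a i\<bar> \<le> tnorm (diag_form \<beta>) 1 (\<lambda>vs. a (vs ! 0)) * sqrt (\<beta> i)"
      using le_tnorm_diag[OF \<beta>, where I = "[i]" and k = 1 and T = "\<lambda>vs. a (vs ! 0)"] that by simp
    also have "\<dots> \<le> \<tau> * sqrt (\<beta> i)" using t \<beta>[OF that] by (intro mult_right_mono) auto
    finally show ?thesis .
  qed
  obtain i :: 'e where i: "i \<in> Basis" using nonempty_Basis by blast
  have "0 \<le> \<tau> * sqrt (\<beta> i)" using ai[OF i] by linarith
  then have \<tau>: "0 \<le> \<tau>" using \<beta>[OF i] by (simp add: zero_le_mult_iff)
  have "a u = (\<Sum>i\<in>Basis. (u \<bullet> i) * a i)"
  proof -
    have "a u = a (\<Sum>i\<in>Basis. (u \<bullet> i) *\<^sub>R i)" by (simp add: euclidean_representation)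
    then show ?thesis by (simp add: linear_sum[OF a] linear_scale[OF a])
  qed
  then have "\<bar>a u\<bar> \<le> (\<Sum>i\<in>Basis. \<bar>u \<bullet> i\<bar> * \<bar>a i\<bar>)"
    by (simp add: sum_abs flip: abs_mult)
  also have "\<dots> \<le> (\<Sum>i\<in>Basis. \<bar>u \<bullet> i\<bar> * (\<tau> * sqrt (\<beta> i)))"
    by (intro sum_mono mult_left_mono ai) auto
  also have "\<dots> = \<tau> * (\<Sum>i\<in>Basis. sqrt (\<beta> i) * \<bar>u \<bullet> i\<bar>)"
    by (simp add: sum_distrib_left mult_ac)
  also have "\<dots> \<le> \<tau> * sqrt (DIM('e) * diag_form \<beta> u u)"
    using sum_sqrt_diag_le[OF \<beta>, where u = u] \<tau> by (intro mult_left_mono real_le_rsqrt)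
  finally show ?thesis .
qed

text \<open>Summing the componentwise bounds gives the square of a weighted sum of coordinates; the
  dimension enters through the Cauchy-Schwarz inequality.\<close>

lemma tnorm_2_bound:
  fixes q :: "'e::euclidean_space \<Rightarrow> 'e \<Rightarrow> real"
  assumes \<beta>: "\<And>i. i \<in> Basis \<Longrightarrow> \<beta> i > 0" and q: "bilinear q"
    and t: "tnorm (diag_form \<beta>) 2 (\<lambda>vs. q (vs ! 0) (vs ! 1)) \<le> \<tau>"
  shows "\<bar>q u u\<bar> \<le> \<tau> * (DIM('e) * diag_form \<beta> u u)"
proof -
  have qij: "\<bar>q i j\<bar> \<le> \<tau> * (sqrt (\<beta> i) * sqrt (\<beta> j))" if "i \<in> Basis" "j \<in> Basis" for i j
  proof -
    have "\<bar>q i j\<bar> \<le> tnorm (diag_form \<beta>) 2 (\<lambda>vs. q (vs ! 0) (vs ! 1)) * (sqrt (\<beta> i) * sqrt (\<beta> j))"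
      using le_tnorm_diag[OF \<beta>, where I = "[i, j]" and k = 2 and T = "\<lambda>vs. q (vs ! 0) (vs ! 1)"] that
      by (simp add: numeral_2_eq_2)
    also have "\<dots> \<le> \<tau> * (sqrt (\<beta> i) * sqrt (\<beta> j))"
      using t \<beta>[OF that(1)] \<beta>[OF that(2)] by (intro mult_right_mono) auto
    finally show ?thesis .
  qed
  obtain i :: 'e where i: "i \<in> Basis" using nonempty_Basis by blast
  have "0 \<le> \<tau> * (sqrt (\<beta> i) * sqrt (\<beta> i))" using qij[OF i i] by linarith
  then have \<tau>: "0 \<le> \<tau>" using \<beta>[OF i] by (simp add: zero_le_mult_iff)
  have "q u u = q (\<Sum>i\<in>Basis. (u \<bullet> i) *\<^sub>R i) (\<Sum>j\<in>Basis. (u \<bullet> j) *\<^sub>R j)"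
    by (simp add: euclidean_representation)
  also have "\<dots> = (\<Sum>(i, j)\<in>Basis \<times> Basis. (u \<bullet> i) * ((u \<bullet> j) * q i j))"
    by (simp add: bilinear_sum[OF q] bilinear_lmul[OF q] bilinear_rmul[OF q] mult.left_commute)
  also have "\<dots> = (\<Sum>i\<in>Basis. \<Sum>j\<in>Basis. (u \<bullet> i) * ((u \<bullet> j) * q i j))"
    by (simp add: sum.cartesian_product)
  finally have "\<bar>q u u\<bar> = \<bar>\<Sum>i\<in>Basis. \<Sum>j\<in>Basis. (u \<bullet> i) * ((u \<bullet> j) * q i j)\<bar>" by simp
  also have "\<dots> \<le> (\<Sum>i\<in>Basis. \<bar>\<Sum>j\<in>Basis. (u \<bullet> i) * ((u \<bullet> j) * q i j)\<bar>)"
    by (rule sum_abs)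
  also have "\<dots> \<le> (\<Sum>i\<in>Basis. \<Sum>j\<in>Basis. \<bar>(u \<bullet> i) * ((u \<bullet> j) * q i j)\<bar>)"
    by (rule sum_mono) (rule sum_abs)
  also have "\<dots> \<le> (\<Sum>i\<in>Basis. \<Sum>j\<in>Basis. \<bar>u \<bullet> i\<bar> * (\<bar>u \<bullet> j\<bar> * (\<tau> * (sqrt (\<beta> i) * sqrt (\<beta> j)))))"
    unfolding abs_mult by (intro sum_mono mult_left_mono qij) auto
  also have "\<dots> = \<tau> * (\<Sum>i\<in>Basis. sqrt (\<beta> i) * \<bar>u \<bullet> i\<bar>)\<^sup>2"
    by (simp add: power2_eq_square sum_product sum_distrib_left mult_ac)
  also have "\<dots> \<le> \<tau> * (DIM('e) * diag_form \<beta> u u)"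
    using sum_sqrt_diag_le[OF \<beta>, where u = u] \<tau> by (intro mult_left_mono)
  finally show ?thesis .
qed

lemma gbar_round_diag:
  fixes e :: "'s \<times> real" and \<phi> :: "'s \<Rightarrow> real^2"
  defines "\<beta> \<equiv> \<lambda>i :: (real^2) \<times> real. if snd i = 0
      then (snd e)\<^sup>2 * (4 / (1 + (norm (\<phi> (fst e)))\<^sup>2)\<^sup>2) else 1 / (1 + (snd e)\<^sup>2)"
  shows "gbar round_metric 1 (map_prod \<phi> (\<lambda>x. x)) e = diag_form \<beta>"
    and "snd e > 0 \<Longrightarrow> \<beta> i > 0"
    and "(snd u)\<^sup>2 / (1 + (snd e)\<^sup>2) \<le> diag_form \<beta> u u"
proof -
  have "1 + (norm (\<phi> (fst e)))\<^sup>2 > 0" by (simp add: add_pos_nonneg)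
  then have pos: "(1 + (norm (\<phi> (fst e)))\<^sup>2)\<^sup>2 > 0" "1 + (snd e)\<^sup>2 > 0"
    by (rule zero_less_power) (simp add: add_pos_nonneg)
  define A where "A = (snd e)\<^sup>2 * (4 / (1 + (norm (\<phi> (fst e)))\<^sup>2)\<^sup>2)"
  have A0: "A \<ge> 0" unfolding A_def using pos by (intro mult_nonneg_nonneg divide_nonneg_pos) auto
  have d: "diag_form \<beta> u v = A * (fst u \<bullet> fst v) + 1 / (1 + (snd e)\<^sup>2) * (snd u * snd v)" for u v
  proof -
    have "diag_form \<beta> u v = (\<Sum>i\<in>Basis. A * (fst u \<bullet> i) * (fst v \<bullet> i))
        + 1 / (1 + (snd e)\<^sup>2) * snd u * snd v"
    proof -
      have "sum F Basis = (\<Sum>i\<in>Basis. F (i, 0)) + F (0, 1)" for F :: "(real^2) \<times> real \<Rightarrow> real"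
      proof -
        have "(Basis :: ((real^2) \<times> real) set) = insert (0, 1) ((\<lambda>i. (i, 0)) ` Basis)"
          by (auto simp: Basis_prod_def)
        from arg_cong[OF this, of "sum F"]
        have "sum F Basis = F (0, 1) + sum F ((\<lambda>i. (i, 0)) ` Basis)"
          by (subst (asm) sum.insert) auto
        then show ?thesis
          by (simp add: sum.reindex inj_on_def)
      qed
      then show ?thesis by (simp add: diag_form_def \<beta>_def A_def inner_prod_def)
    qed
    also have "(\<Sum>i\<in>Basis. A * (fst u \<bullet> i) * (fst v \<bullet> i)) = A * (fst u \<bullet> fst v)"
      by (simp add: euclidean_inner[of "fst u" "fst v"] sum_distrib_left mult.assoc)
    finally show ?thesis by (simp add: mult.assoc)
  qed
  show "gbar round_metric 1 (map_prod \<phi> (\<lambda>x. x)) e = diag_form \<beta>"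
    by (intro ext) (simp add: d A_def gbar_def product_metric_def round_metric_def flat_metric_def)
  show "snd e > 0 \<Longrightarrow> \<beta> i > 0" using pos by (simp add: \<beta>_def)
  show "(snd u)\<^sup>2 / (1 + (snd e)\<^sup>2) \<le> diag_form \<beta> u u"
    using A0 by (simp add: d power2_eq_square)
qed

section \<open>The asymptotic region\<close>

lemma closed_manifold_chart_open:
  assumes "closed_manifold M" "(U, \<phi>) \<in> atlas M"
  shows "open (\<phi> ` U)"
proof -
  have "\<phi> ` U \<subseteq> interior (\<phi> ` U)"
    using assms unfolding closed_manifold_def bdry_def by blast
  then show ?thesis using interior_subset by (metis open_interior subset_antisym)
qed

lemma closed_manifold_chart_at:
  "closed_manifold M \<Longrightarrow> p \<in> topspace (mtop M) \<Longrightarrow> \<exists>(U, \<phi>)\<in>atlas M. p \<in> U"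
  unfolding closed_manifold_def smooth_manifold_def by blast

lemma end_chart:
  assumes Sig: "closed_manifold Sig" and c: "(U, \<phi>) \<in> atlas Sig"
  shows "(U \<times> {\<rho>\<^sub>0<..}, map_prod \<phi> (\<lambda>x. x)) \<in> atlas (end_mfd Sig \<rho>\<^sub>0)"
    "chart_map (mtop (end_mfd Sig \<rho>\<^sub>0)) (U \<times> {\<rho>\<^sub>0<..}) (map_prod \<phi> (\<lambda>x. x))"
    "open (map_prod \<phi> (\<lambda>x. x) ` (U \<times> {\<rho>\<^sub>0<..}))"
proof -
  show "(U \<times> {\<rho>\<^sub>0<..}, map_prod \<phi> (\<lambda>x. x)) \<in> atlas (end_mfd Sig \<rho>\<^sub>0)"
    using c by (auto simp: end_mfd_def prod_mfd_def euclidean_mfd_def)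
  have 1: "chart_map (mtop Sig) U \<phi>"
    using Sig c smooth_manifold_chart(1) unfolding closed_manifold_def by blast
  have "homeomorphic_map (top_of_set {\<rho>\<^sub>0<..}) (top_of_set {\<rho>\<^sub>0<..}) (\<lambda>x::real. x)"
    using homeomorphic_map_id[of "top_of_set {\<rho>\<^sub>0<..}" "top_of_set {\<rho>\<^sub>0<..}"] by (simp add: id_def)
  then have "chart_map (top_of_set {\<rho>\<^sub>0<..}) {\<rho>\<^sub>0<..} (\<lambda>x::real. x)"
    by (simp add: chart_map_def subtopology_subtopology)
  from chart_map_Times[OF 1 this]
  show "chart_map (mtop (end_mfd Sig \<rho>\<^sub>0)) (U \<times> {\<rho>\<^sub>0<..}) (map_prod \<phi> (\<lambda>x. x))"
    by (simp add: end_mfd_def prod_mfd_def euclidean_mfd_def)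
  have "map_prod \<phi> (\<lambda>x. x) ` (U \<times> {\<rho>\<^sub>0<..}) = \<phi> ` U \<times> {\<rho>\<^sub>0<..}" by force
  then show "open (map_prod \<phi> (\<lambda>x. x) ` (U \<times> {\<rho>\<^sub>0<..}))"
    using closed_manifold_chart_open[OF Sig c] by (simp add: open_Times)
qed

text \<open>The constant is 18 = 14 + 4. With y = \<epsilon> / \<rho>^2, the bound of the quotient
  by \<rho>^2 + 14 \<epsilon> amounts to 46 y \<le> 7, which y \<le> 1 / 12 ensures. The other 4
  \<epsilon> are lost in v^2 \<ge> 1 + \<rho>^2 - 4 \<epsilon>, as sqrt (1 + \<rho>^2) \<le> 2
  \<rho>.\<close>

lemma asymptotic_arith:
  fixes \<rho> :: real
  assumes \<rho>: "\<rho> \<ge> 1" and \<epsilon>: "0 < \<epsilon>" "\<epsilon> \<le> 1 / 12"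
    and v: "\<bar>v - sqrt (1 + \<rho>\<^sup>2)\<bar> \<le> \<epsilon> / \<rho>"
  shows "(\<rho> + 2 * (\<epsilon> / \<rho>))\<^sup>2 / (1 - 3 * (\<epsilon> / \<rho>\<^sup>2)) \<le> v\<^sup>2 - 1 + 18 * \<epsilon>"
proof -
  define y where "y = \<epsilon> / \<rho>\<^sup>2"
  have r2: "1 \<le> \<rho>\<^sup>2" using \<rho> by (simp add: power2_eq_square mult_ge1_I)
  have y: "0 < y" "y \<le> \<epsilon>" "\<rho>\<^sup>2 * y = \<epsilon>"
    using \<rho> \<epsilon> r2 by (auto simp: y_def divide_le_eq)
  have e: "(\<rho> + 2 * (\<epsilon> / \<rho>))\<^sup>2 = \<rho>\<^sup>2 * (1 + 2 * y)\<^sup>2"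
  proof -
    have "\<rho> + 2 * (\<epsilon> / \<rho>) = \<rho> * (1 + 2 * y)" using \<rho> by (simp add: y_def field_simps power2_eq_square)
    then show ?thesis by (simp add: power_mult_distrib)
  qed
  have "(1 + 2 * y)\<^sup>2 \<le> (1 + 14 * y) * (1 - 3 * y)"
  proof -
    have "46 * y * y \<le> 7 * y" using y \<epsilon> by (intro mult_right_mono) auto
    then show ?thesis using y by (simp add: power2_eq_square algebra_simps)
  qed
  then have "(1 + 2 * y)\<^sup>2 / (1 - 3 * y) \<le> 1 + 14 * y" using y \<epsilon> by (simp add: pos_divide_le_eq)
  then have "\<rho>\<^sup>2 * ((1 + 2 * y)\<^sup>2 / (1 - 3 * y)) \<le> \<rho>\<^sup>2 * (1 + 14 * y)" by (intro mult_left_mono) auto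
  also have "\<dots> = \<rho>\<^sup>2 + 14 * \<epsilon>" using y(3) by (simp add: algebra_simps)
  finally have 1: "(\<rho> + 2 * (\<epsilon> / \<rho>))\<^sup>2 / (1 - 3 * (\<epsilon> / \<rho>\<^sup>2)) \<le> \<rho>\<^sup>2 + 14 * \<epsilon>"
    unfolding e y_def[symmetric] by (simp only: times_divide_eq_right)
  define s where "s = sqrt (1 + \<rho>\<^sup>2)"
  have s2: "s\<^sup>2 = 1 + \<rho>\<^sup>2" by (simp add: s_def add_nonneg_nonneg)
  have s: "0 \<le> s" "s \<le> 2 * \<rho>" unfolding s_def
    using \<rho> r2 by (auto intro!: real_le_lsqrt simp: power2_eq_square)
  have er: "\<epsilon> / \<rho> \<le> \<epsilon>" using \<rho> \<epsilon> by (simp add: divide_le_eq)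
  have "1 \<le> s" unfolding s_def using \<rho> by simp
  then have "0 \<le> s - \<epsilon> / \<rho>" using er \<epsilon> by linarith
  moreover have "s - \<epsilon> / \<rho> \<le> v" using v by (simp add: s_def abs_le_iff)
  ultimately have "(s - \<epsilon> / \<rho>)\<^sup>2 \<le> v\<^sup>2" by (intro power_mono)
  moreover have "(s - \<epsilon> / \<rho>)\<^sup>2 \<ge> s\<^sup>2 - 2 * s * (\<epsilon> / \<rho>)" by (simp add: power2_diff)
  moreover have "2 * s * (\<epsilon> / \<rho>) \<le> 2 * (2 * \<rho>) * (\<epsilon> / \<rho>)" using s \<rho> \<epsilon> by (intro mult_right_mono) auto
  moreover have "2 * (2 * \<rho>) * (\<epsilon> / \<rho>) = 4 * \<epsilon>" using \<rho> by simp
  ultimately show ?thesis using 1 s2 by linarith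
qed

context riemannian_potential
begin

text \<open>In the model the differential of sqrt (1 + \<rho>^2) has length \<rho>, because that of
  \<rho> has length sqrt (1 + \<rho>^2). The error of \<open>V\<close> changes this by at most 2
  \<epsilon> / \<rho>, and the actual metric is at least 1 - 3 \<epsilon> / \<rho>^2 times the
  model, 3 being the dimension.\<close>

lemma sqV_end_bound:
  fixes \<Phi> :: "'s \<times> real \<Rightarrow> 'a"
  assumes Sig: "closed_manifold Sig"
    and \<Phi>: "diffeo (end_mfd Sig \<rho>\<^sub>0) (open_submfd M X) \<Phi>"
    and pull: "is_pullback (end_mfd Sig \<rho>\<^sub>0) M \<Phi> g gE"
    and c: "(U1, \<phi>1) \<in> atlas Sig" and e: "e \<in> U1 \<times> {\<rho>\<^sub>0<..}" "\<rho> = snd e" "\<rho> \<ge> 1"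
    and U: "U = U1 \<times> {\<rho>\<^sub>0<..}" "\<phi> = map_prod \<phi>1 (\<lambda>x. x)"
    and \<epsilon>: "0 < \<epsilon>" "\<epsilon> \<le> 1 / 12"
    and q: "gbar_norm round_metric 1 U \<phi> 0 2
             (\<lambda>x vs. loc U \<phi> gE x (vs ! 0) (vs ! 1) - loc U \<phi> (gbar round_metric 1) x (vs ! 0) (vs ! 1)) e
           \<le> \<epsilon> / \<rho>\<^sup>2"
    and v0: "gbar_norm round_metric 1 U \<phi> 0 0
             (\<lambda>x _. V (\<Phi> (inv_into U \<phi> x)) - sqrt (1 + (snd (inv_into U \<phi> x))\<^sup>2)) e \<le> \<epsilon> / \<rho>"
    and v1: "gbar_norm round_metric 1 U \<phi> 1 0
             (\<lambda>x _. V (\<Phi> (inv_into U \<phi> x)) - sqrt (1 + (snd (inv_into U \<phi> x))\<^sup>2)) e \<le> \<epsilon> / \<rho>"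
  shows "sqV (\<Phi> e) \<le> (V (\<Phi> e))\<^sup>2 - 1 + 18 * \<epsilon>" "\<bar>V (\<Phi> e) - sqrt (1 + \<rho>\<^sup>2)\<bar> \<le> \<epsilon> / \<rho>"
proof -
  have ch: "(U, \<phi>) \<in> atlas (end_mfd Sig \<rho>\<^sub>0)" "chart_map (mtop (end_mfd Sig \<rho>\<^sub>0)) U \<phi>" "open (\<phi> ` U)"
    using end_chart[OF Sig c] by (auto simp: U)
  have eU: "e \<in> U" using e U by simp
  have inv: "inv_into U \<phi> (\<phi> p) = p" if "p \<in> U" for p
    using chart_mapD(2)[OF ch(2)] that by simp
  define \<beta> :: "(real^2) \<times> real \<Rightarrow> real" where "\<beta> = (\<lambda>i. if snd i = 0
      then (snd e)\<^sup>2 * (4 / (1 + (norm (\<phi>1 (fst e)))\<^sup>2)\<^sup>2) else 1 / (1 + (snd e)\<^sup>2))"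
  have gb: "gbar round_metric 1 \<phi> e = diag_form \<beta>"
    unfolding \<beta>_def U(2) by (rule gbar_round_diag(1))
  have \<beta>: "\<beta> i > 0" for i
    unfolding \<beta>_def using gbar_round_diag(2)[where e = e and \<phi> = \<phi>1 and i = i] e by simp
  have snd_le: "(snd u)\<^sup>2 / (1 + \<rho>\<^sup>2) \<le> diag_form \<beta> u u" for u
    unfolding \<beta>_def e(2) by (rule gbar_round_diag(3))
  note lin = inner_form_diag[of \<beta>, OF \<beta>]
  define E where "E x = V (\<Phi> (inv_into U \<phi> x)) - sqrt (1 + (snd (inv_into U \<phi> x))\<^sup>2)" for x
  have "tnorm (diag_form \<beta>) 0 (\<lambda>_. E (\<phi> e)) \<le> \<epsilon> / \<rho>"
    using v0 by (simp add: gbar_norm_def gb E_def)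
  then have "\<bar>E (\<phi> e)\<bar> \<le> \<epsilon> / \<rho>"
    using le_tnorm_diag[where \<beta> = \<beta> and I = "[]" and k = 0 and T = "\<lambda>_. E (\<phi> e)"] \<beta> by simp
  then show V_est: "\<bar>V (\<Phi> e) - sqrt (1 + \<rho>\<^sup>2)\<bar> \<le> \<epsilon> / \<rho>"
    by (simp add: E_def inv[OF eU] e(2))
  have cont: "continuous_map (mtop (end_mfd Sig \<rho>\<^sub>0)) (mtop M) \<Phi>"
    and into: "\<Phi> ` topspace (mtop (end_mfd Sig \<rho>\<^sub>0)) \<subseteq> X"
    using \<Phi> unfolding diffeo_def smooth_map_def open_submfd_def
    by (auto simp: continuous_map_in_subtopology)
  have UT: "U \<subseteq> topspace (mtop (end_mfd Sig \<rho>\<^sub>0))"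
    using chart_mapD(1)[OF ch(2)] openin_subset by blast
  have "\<Phi> e \<in> topspace (mtop M)" using cont eU UT by (auto simp: continuous_map_def)
  then obtain W \<psi> where W: "(W, \<psi>) \<in> atlas M" "\<Phi> e \<in> W" using chart_at by blast
  define T where "T = tmap U \<phi> \<psi> \<Phi> e"
  have sm: "smooth_on (\<phi> ` {q \<in> U. \<Phi> q \<in> W}) (\<psi> \<circ> \<Phi> \<circ> inv_into U \<phi>)"
  proof -
    have "(W \<inter> X, \<psi>) \<in> atlas (open_submfd M X)" using W(1) by (force simp: open_submfd_def)
    then have "smooth_on (\<phi> ` {q \<in> U. \<Phi> q \<in> W \<inter> X}) (\<psi> \<circ> \<Phi> \<circ> inv_into U \<phi>)"
      using \<Phi> ch(1) unfolding diffeo_def smooth_map_def by blast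
    moreover have "{q \<in> U. \<Phi> q \<in> W \<inter> X} = {q \<in> U. \<Phi> q \<in> W}" using into UT by auto
    ultimately show ?thesis by simp
  qed
  have hT: "(\<psi> \<circ> \<Phi> \<circ> inv_into U \<phi> has_derivative T) (at (\<phi> e) within \<phi> ` U)"
    unfolding T_def by (rule has_derivative_tmap[OF ch(2) cont chart_mapD(1)[OF chart[OF W(1)]] sm eU W(2)])
  have linT: "linear T" using hT has_derivative_linear by blast
  have hV: "(V \<circ> \<Phi> \<circ> inv_into U \<phi> has_derivative dV W \<psi> (\<Phi> e) \<circ> T) (at (\<phi> e) within \<phi> ` U)"
    by (rule has_derivative_chart_compose[OF ch(2) cont chart_mapD(1,2)[OF chart[OF W(1)]] eU W(2) hT
          has_derivative_pot[OF W]])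
  have pulle: "gE \<phi> e u v = g \<psi> (\<Phi> e) (T u) (T v)" for u v
    unfolding T_def by (rule is_pullbackD[OF pull ch(1) W(1) eU W(2)])
  note glin = inner_formD(1,2)[OF inner_g[OF W]]
  have bil: "bilinear (\<lambda>u v. gE \<phi> e u v - diag_form \<beta> u v)"
    unfolding bilinear_def
    by (intro conjI allI linearI) (simp_all add: pulle linear_add[OF linT] linear_scale[OF linT]
      linear_add[OF glin(1)] linear_scale[OF glin(1)] linear_add[OF glin(2)] linear_scale[OF glin(2)]
      linear_add[OF inner_formD(1)[OF lin]] linear_scale[OF inner_formD(1)[OF lin]]
      linear_add[OF inner_formD(2)[OF lin]] linear_scale[OF inner_formD(2)[OF lin]] algebra_simps)
  have "tnorm (diag_form \<beta>) 2 (\<lambda>vs. gE \<phi> e (vs ! 0) (vs ! 1) - diag_form \<beta> (vs ! 0) (vs ! 1)) \<le> \<epsilon> / \<rho>\<^sup>2"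
    using q by (simp add: gbar_norm_def gb loc_def inv[OF eU] numeral_2_eq_2)
  from tnorm_2_bound[OF \<beta> bil this]
  have gE_ge: "(1 - 3 * (\<epsilon> / \<rho>\<^sup>2)) * diag_form \<beta> u u \<le> gE \<phi> e u u" for u
    by (simp add: abs_le_iff algebra_simps)
  have der_E: "dd (\<phi> ` U) E (\<phi> e) u = dV W \<psi> (\<Phi> e) (T u) - \<rho> / sqrt (1 + \<rho>\<^sup>2) * snd u" for u
  proof -
    have "((\<lambda>x. sqrt (1 + (snd x)\<^sup>2)) has_derivative (\<lambda>u. \<rho> / sqrt (1 + \<rho>\<^sup>2) * snd u)) (at (\<phi> e))"
    proof -
      have se: "snd (\<phi> e) = \<rho>" using e by (simp add: U)
      have "((\<lambda>r. sqrt (1 + r\<^sup>2)) has_real_derivative \<rho> / sqrt (1 + \<rho>\<^sup>2)) (at \<rho>)"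
      proof -
        have "1 + \<rho>\<^sup>2 > 0" by (simp add: add_pos_nonneg)
        then show ?thesis by (auto intro!: derivative_eq_intros simp: field_simps)
      qed
      then have "((\<lambda>r. sqrt (1 + r\<^sup>2)) has_derivative (*) (\<rho> / sqrt (1 + \<rho>\<^sup>2))) (at (snd (\<phi> e)))"
        by (simp add: se has_field_derivative_def)
      from has_derivative_compose[OF has_derivative_snd[OF has_derivative_ident] this]
      show ?thesis by simp
    qed
    then have "((\<lambda>x. (V \<circ> \<Phi> \<circ> inv_into U \<phi>) x - sqrt (1 + (snd x)\<^sup>2)) has_derivative
        (\<lambda>u. (dV W \<psi> (\<Phi> e) \<circ> T) u - \<rho> / sqrt (1 + \<rho>\<^sup>2) * snd u)) (at (\<phi> e) within \<phi> ` U)"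
      by (rule has_derivative_diff[OF hV has_derivative_at_withinI])
    then have "(E has_derivative
        (\<lambda>u. (dV W \<psi> (\<Phi> e) \<circ> T) u - \<rho> / sqrt (1 + \<rho>\<^sup>2) * snd u)) (at (\<phi> e) within \<phi> ` U)"
    proof (rule has_derivative_transform[rotated 2])
      fix x assume "x \<in> \<phi> ` U"
      then obtain p where "p \<in> U" "x = \<phi> p" by blast
      then show "E x = (V \<circ> \<Phi> \<circ> inv_into U \<phi>) x - sqrt (1 + (snd x)\<^sup>2)"
        using inv by (simp add: E_def) (simp add: U)
    qed (use eU in auto)
    then have "(E has_derivative
        (\<lambda>u. (dV W \<psi> (\<Phi> e) \<circ> T) u - \<rho> / sqrt (1 + \<rho>\<^sup>2) * snd u)) (at (\<phi> e))"
      using at_within_open[OF _ ch(3), of "\<phi> e"] eU by simp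
    from dd_unique[OF ch(3) imageI[OF eU] this] show ?thesis by simp
  qed
  have tn1: "tnorm (diag_form \<beta>) 1 (\<lambda>vs. dd (\<phi> ` U) E (\<phi> e) (vs ! 0)) \<le> \<epsilon> / \<rho>"
  proof -
    have "nabla (\<phi> ` U) G (\<lambda>x _. E x) (\<phi> e) vs = dd (\<phi> ` U) E (\<phi> e) (vs ! 0)" if "length vs = 1" for vs G
      using that by (cases vs) auto
    then have "tnorm (diag_form \<beta>) 1 (nabla (\<phi> ` U) (loc U \<phi> (gbar round_metric 1)) (\<lambda>x _. E x) (\<phi> e)) =
        tnorm (diag_form \<beta>) 1 (\<lambda>vs. dd (\<phi> ` U) E (\<phi> e) (vs ! 0))"
      unfolding tnorm_def by (intro arg_cong[where f = sqrt] sum.cong refl) auto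
    then show ?thesis
      using v1 by (simp add: gbar_norm_def gb E_def)
  qed
  have linE: "linear (dd (\<phi> ` U) E (\<phi> e))"
    unfolding der_E using linT linear_dV[OF W]
    by (intro linearI) (simp_all add: linear_add[OF linT] linear_add[OF linear_dV[OF W]]
      linear_scale[OF linT] linear_scale[OF linear_dV[OF W]] algebra_simps add_divide_distrib)
  have dE_le: "\<bar>dd (\<phi> ` U) E (\<phi> e) u\<bar> \<le> \<epsilon> / \<rho> * (2 * sqrt (diag_form \<beta> u u))" for u
  proof -
    have "\<bar>dd (\<phi> ` U) E (\<phi> e) u\<bar> \<le> \<epsilon> / \<rho> * sqrt (3 * diag_form \<beta> u u)"
      using tnorm_1_bound[OF \<beta> linE tn1, of u] by simp
    \<comment> \<open>The dimension 3 is rounded up to 4 to obtain the factor 2.\<close>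
    also have "\<dots> \<le> \<epsilon> / \<rho> * sqrt (4 * diag_form \<beta> u u)"
      using \<epsilon> e inner_form_nonneg[OF lin, of u] by (intro mult_left_mono) auto
    finally show ?thesis by (simp add: real_sqrt_mult)
  qed
  have dVT: "\<bar>dV W \<psi> (\<Phi> e) (T u)\<bar> \<le> (\<rho> + 2 * (\<epsilon> / \<rho>)) * sqrt (diag_form \<beta> u u)" for u
  proof -
    have p: "1 + \<rho>\<^sup>2 > 0" by (simp add: add_pos_nonneg)
    have "(snd u)\<^sup>2 \<le> (1 + \<rho>\<^sup>2) * diag_form \<beta> u u"
      using snd_le[of u] p by (simp add: pos_divide_le_eq mult.commute)
    then have "\<bar>snd u\<bar> \<le> sqrt (1 + \<rho>\<^sup>2) * sqrt (diag_form \<beta> u u)"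
      by (metis real_sqrt_abs real_sqrt_le_mono real_sqrt_mult)
    then have "\<rho> / sqrt (1 + \<rho>\<^sup>2) * \<bar>snd u\<bar> \<le> \<rho> / sqrt (1 + \<rho>\<^sup>2) * (sqrt (1 + \<rho>\<^sup>2) * sqrt (diag_form \<beta> u u))"
      using e p by (intro mult_left_mono) auto
    also have "\<dots> = \<rho> * sqrt (diag_form \<beta> u u)" using p by simp
    finally have "\<bar>\<rho> / sqrt (1 + \<rho>\<^sup>2) * snd u\<bar> \<le> \<rho> * sqrt (diag_form \<beta> u u)"
      using e p by (simp add: abs_mult)
    moreover have "dV W \<psi> (\<Phi> e) (T u) = dd (\<phi> ` U) E (\<phi> e) u + \<rho> / sqrt (1 + \<rho>\<^sup>2) * snd u"
      by (simp add: der_E)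
    moreover have "(\<rho> + 2 * (\<epsilon> / \<rho>)) * sqrt (diag_form \<beta> u u) =
        \<rho> * sqrt (diag_form \<beta> u u) + \<epsilon> / \<rho> * (2 * sqrt (diag_form \<beta> u u))"
      by (simp add: algebra_simps)
    ultimately show ?thesis
      using dE_le[of u] abs_triangle_ineq[of "dd (\<phi> ` U) E (\<phi> e) u" "\<rho> / sqrt (1 + \<rho>\<^sup>2) * snd u"]
      by linarith
  qed
  have r2: "1 \<le> \<rho>\<^sup>2" using e by (simp add: power2_eq_square mult_ge1_I)
  then have "\<epsilon> / \<rho>\<^sup>2 \<le> \<epsilon>" using \<epsilon> by (simp add: divide_le_eq)
  then have D: "1 - 3 * (\<epsilon> / \<rho>\<^sup>2) > 0" using \<epsilon> by linarith
  define B where "B = (\<rho> + 2 * (\<epsilon> / \<rho>))\<^sup>2 / (1 - 3 * (\<epsilon> / \<rho>\<^sup>2))"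
  \<comment> \<open>The pulled back metric is bounded below by a positive multiple of the model; so
    every tangent vector of \<open>M\<close> at the point comes from the end, and the estimates for
    \<open>T u\<close> cover all of them.\<close>
  have "inj T"
  proof -
    have "u = 0" if "T u = 0" for u
    proof (rule ccontr)
      assume "u \<noteq> 0"
      then have "0 < diag_form \<beta> u u" using inner_formD(4)[OF lin] by blast
      then have "0 < gE \<phi> e u u" using gE_ge[of u] D by (smt (verit) mult_pos_pos)
      then show False using that linear_0[OF glin(2)] by (simp add: pulle)
    qed
    then show ?thesis using linear_injective_0[OF linT] by blast
  qed
  then have "surj T" by (rule linear_injective_imp_surjective[OF linT]) simp
  have "sqV (\<Phi> e) \<le> B"
  proof (rule sqV_le[OF W])
    show "0 \<le> B" unfolding B_def using D by simp
    fix w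
    obtain u where u: "w = T u" using \<open>surj T\<close> by (metis surjD)
    have "(dV W \<psi> (\<Phi> e) w)\<^sup>2 \<le> ((\<rho> + 2 * (\<epsilon> / \<rho>)) * sqrt (diag_form \<beta> u u))\<^sup>2"
      unfolding u using dVT[of u] by (metis abs_ge_zero power2_abs power_mono)
    also have "\<dots> = (\<rho> + 2 * (\<epsilon> / \<rho>))\<^sup>2 * diag_form \<beta> u u"
      using inner_form_nonneg[OF lin, of u] by (simp add: power_mult_distrib)
    also have "\<dots> = B * ((1 - 3 * (\<epsilon> / \<rho>\<^sup>2)) * diag_form \<beta> u u)"
    proof -
      have "N / d * (d * t) = N * t" if "d > 0" for N d t :: real using that by simp
      from this[OF D] show ?thesis unfolding B_def by simp
    qed
    also have "\<dots> \<le> B * gE \<phi> e u u"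
      using gE_ge[of u] \<open>0 \<le> B\<close> by (intro mult_left_mono)
    finally show "(dV W \<psi> (\<Phi> e) w)\<^sup>2 \<le> B * g \<psi> (\<Phi> e) w w" by (simp add: pulle u)
  qed
  also have "B \<le> (V (\<Phi> e))\<^sup>2 - 1 + 18 * \<epsilon>"
    unfolding B_def by (rule asymptotic_arith[OF e(3) \<epsilon> V_est])
  finally show "sqV (\<Phi> e) \<le> (V (\<Phi> e))\<^sup>2 - 1 + 18 * \<epsilon>" .
qed

text \<open>Decay faster than \<rho>^(-2) of the metric error is what the estimate in the end
  requires. The second conclusion records that \<open>V\<close> tends to infinity along the
  end.\<close>

lemma end_asymptotics:
  fixes \<Phi> :: "'s \<times> real \<Rightarrow> 'a"
  assumes Sig: "closed_manifold Sig"
    and \<Phi>: "diffeo (end_mfd Sig \<rho>\<^sub>0) (open_submfd M X) \<Phi>"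
    and pull: "is_pullback (end_mfd Sig \<rho>\<^sub>0) M \<Phi> g gE" and \<alpha>: "2 < \<alpha>"
    and Q: "\<exists>C \<rho>\<^sub>1. \<forall>(U, \<phi>)\<in>atlas (end_mfd Sig \<rho>\<^sub>0). \<forall>p\<in>U. \<rho>\<^sub>1 \<le> snd p \<longrightarrow>
           gbar_norm round_metric 1 U \<phi> 0 2
             (\<lambda>x vs. loc U \<phi> gE x (vs ! 0) (vs ! 1) - loc U \<phi> (gbar round_metric 1) x (vs ! 0) (vs ! 1)) p
           \<le> C * snd p powr (- \<alpha>)"
    and E: "\<forall>m\<le>1. \<forall>\<epsilon>>0. \<exists>\<rho>\<^sub>1. \<forall>(U, \<phi>)\<in>atlas (end_mfd Sig \<rho>\<^sub>0). \<forall>p\<in>U. \<rho>\<^sub>1 \<le> snd p \<longrightarrow>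
           gbar_norm round_metric 1 U \<phi> m 0
             (\<lambda>x _. V (\<Phi> (inv_into U \<phi> x)) - sqrt (1 + (snd (inv_into U \<phi> x))\<^sup>2)) p
           \<le> \<epsilon> / snd p"
    and \<eta>: "\<eta> > 0"
  obtains R where "\<And>e. e \<in> topspace (mtop (end_mfd Sig \<rho>\<^sub>0)) \<Longrightarrow> R \<le> snd e \<Longrightarrow>
    sqV (\<Phi> e) \<le> (V (\<Phi> e))\<^sup>2 - 1 + \<eta> \<and> snd e \<le> V (\<Phi> e) + 1"
proof -
  define \<epsilon> where "\<epsilon> = min (1 / 12) (\<eta> / 18)"
  have \<epsilon>: "0 < \<epsilon>" "\<epsilon> \<le> 1 / 12" "18 * \<epsilon> \<le> \<eta>" using \<eta> by (auto simp: \<epsilon>_def)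
  obtain C \<rho>\<^sub>1 where C: "\<And>U \<phi> p. (U, \<phi>) \<in> atlas (end_mfd Sig \<rho>\<^sub>0) \<Longrightarrow> p \<in> U \<Longrightarrow> \<rho>\<^sub>1 \<le> snd p \<Longrightarrow>
           gbar_norm round_metric 1 U \<phi> 0 2
             (\<lambda>x vs. loc U \<phi> gE x (vs ! 0) (vs ! 1) - loc U \<phi> (gbar round_metric 1) x (vs ! 0) (vs ! 1)) p
           \<le> C * snd p powr (- \<alpha>)"
    using Q by fast
  have E': "\<exists>\<rho>\<^sub>2. \<forall>U \<phi> p. (U, \<phi>) \<in> atlas (end_mfd Sig \<rho>\<^sub>0) \<longrightarrow> p \<in> U \<longrightarrow> \<rho>\<^sub>2 \<le> snd p \<longrightarrow>
           gbar_norm round_metric 1 U \<phi> m 0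
             (\<lambda>x _. V (\<Phi> (inv_into U \<phi> x)) - sqrt (1 + (snd (inv_into U \<phi> x))\<^sup>2)) p
           \<le> \<epsilon> / snd p" if "m \<le> 1" for m
    using E[rule_format, OF that \<epsilon>(1)] by fast
  obtain \<rho>\<^sub>2 where E0: "\<And>U \<phi> p. (U, \<phi>) \<in> atlas (end_mfd Sig \<rho>\<^sub>0) \<Longrightarrow> p \<in> U \<Longrightarrow> \<rho>\<^sub>2 \<le> snd p \<Longrightarrow>
           gbar_norm round_metric 1 U \<phi> 0 0
             (\<lambda>x _. V (\<Phi> (inv_into U \<phi> x)) - sqrt (1 + (snd (inv_into U \<phi> x))\<^sup>2)) p
           \<le> \<epsilon> / snd p"
    using E'[OF zero_le_one] by blast
  obtain \<rho>\<^sub>3 where E1: "\<And>U \<phi> p. (U, \<phi>) \<in> atlas (end_mfd Sig \<rho>\<^sub>0) \<Longrightarrow> p \<in> U \<Longrightarrow> \<rho>\<^sub>3 \<le> snd p \<Longrightarrow>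
           gbar_norm round_metric 1 U \<phi> 1 0
             (\<lambda>x _. V (\<Phi> (inv_into U \<phi> x)) - sqrt (1 + (snd (inv_into U \<phi> x))\<^sup>2)) p
           \<le> \<epsilon> / snd p"
    using E'[OF order_refl] by blast
  \<comment> \<open>Here \<alpha> > 2 enters: C \<rho>^(-\<alpha>) falls below \<epsilon> /
    \<rho>^2.\<close>
  have "((\<lambda>r. C * r powr (2 - \<alpha>)) \<longlongrightarrow> C * 0) at_top"
    using \<alpha> by (intro tendsto_mult tendsto_const tendsto_neg_powr filterlim_ident) auto
  then have "\<forall>\<^sub>F r in at_top. C * r powr (2 - \<alpha>) < \<epsilon>"
    using \<epsilon>(1) by (intro order_tendstoD(2)[where y = "C * 0"]) auto
  then obtain \<rho>\<^sub>4 where \<rho>\<^sub>4: "\<And>r. \<rho>\<^sub>4 \<le> r \<Longrightarrow> C * r powr (2 - \<alpha>) < \<epsilon>"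
    unfolding eventually_at_top_linorder by blast
  show thesis
  proof (rule that[of "Max {1, \<rho>\<^sub>1, \<rho>\<^sub>2, \<rho>\<^sub>3, \<rho>\<^sub>4}"])
    fix e assume e: "e \<in> topspace (mtop (end_mfd Sig \<rho>\<^sub>0))" and "Max {1, \<rho>\<^sub>1, \<rho>\<^sub>2, \<rho>\<^sub>3, \<rho>\<^sub>4} \<le> snd e"
    then have r: "1 \<le> snd e" "\<rho>\<^sub>1 \<le> snd e" "\<rho>\<^sub>2 \<le> snd e" "\<rho>\<^sub>3 \<le> snd e" "\<rho>\<^sub>4 \<le> snd e" by auto
    have "fst e \<in> topspace (mtop Sig)" "snd e \<in> {\<rho>\<^sub>0<..}"
      using e by (auto simp: end_mfd_def prod_mfd_def euclidean_mfd_def)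
    then obtain U1 \<phi>1 where c: "(U1, \<phi>1) \<in> atlas Sig" and "fst e \<in> U1"
      using closed_manifold_chart_at[OF Sig] by blast
    then have eU: "e \<in> U1 \<times> {\<rho>\<^sub>0<..}" using \<open>snd e \<in> {\<rho>\<^sub>0<..}\<close> by (cases e) simp
    let ?U = "U1 \<times> {\<rho>\<^sub>0<..}" and ?\<phi> = "map_prod \<phi>1 (\<lambda>x. x)"
    have ch: "(?U, ?\<phi>) \<in> atlas (end_mfd Sig \<rho>\<^sub>0)" by (rule end_chart(1)[OF Sig c])
    have "C * snd e powr (- \<alpha>) \<le> \<epsilon> / (snd e)\<^sup>2"
    proof -
      have eq: "C * snd e powr (2 - \<alpha>) = C * snd e powr (- \<alpha>) * (snd e)\<^sup>2"
        using r(1) by (simp add: powr_diff powr_minus powr_numeral field_simps)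
      have "C * snd e powr (- \<alpha>) * (snd e)\<^sup>2 \<le> \<epsilon>"
        using less_imp_le[OF \<rho>\<^sub>4[OF r(5)]] unfolding eq .
      moreover have "0 < (snd e)\<^sup>2" using r(1) by simp
      ultimately show ?thesis by (simp only: pos_le_divide_eq)
    qed
    with C[OF ch eU r(2)] have q: "gbar_norm round_metric 1 ?U ?\<phi> 0 2
             (\<lambda>x vs. loc ?U ?\<phi> gE x (vs ! 0) (vs ! 1) - loc ?U ?\<phi> (gbar round_metric 1) x (vs ! 0) (vs ! 1)) e
           \<le> \<epsilon> / (snd e)\<^sup>2"
      by (rule order_trans)
    note b = sqV_end_bound[OF Sig \<Phi> pull c eU refl r(1) refl refl \<epsilon>(1,2) q E0[OF ch eU r(3)] E1[OF ch eU r(4)]]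
    have "\<epsilon> / snd e \<le> 1" using r(1) \<epsilon> by (simp add: divide_le_eq)
    moreover have "snd e \<le> sqrt (1 + (snd e)\<^sup>2)" by (rule real_le_rsqrt) simp
    ultimately show "sqV (\<Phi> e) \<le> (V (\<Phi> e))\<^sup>2 - 1 + \<eta> \<and> snd e \<le> V (\<Phi> e) + 1"
      using b \<epsilon>(3) by (simp add: abs_le_iff)
  qed
qed

section \<open>Position of the end in the manifold\<close>

lemma locally_compact_manifold: "locally_compact_space (mtop M)"
  unfolding locally_compact_space_def
proof
  fix p assume "p \<in> topspace (mtop M)"
  then obtain U \<phi> where c: "(U, \<phi>) \<in> atlas M" "p \<in> U" using chart_at by blast
  obtain H where H: "closed H" "openin (top_of_set H) (\<phi> ` U)"
  proof -
    have "chart_set (\<phi> ` U)" by (rule smooth_manifold_chart(2)[OF manifold c(1)])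
    then consider "open (\<phi> ` U)" | b where "openin (top_of_set {x. 0 \<le> x \<bullet> b}) (\<phi> ` U)"
      unfolding chart_set_def by blast
    then show thesis
    proof cases
      case 1
      then show thesis using that[of UNIV] by simp
    next
      case 2
      have "closed {x. 0 \<le> x \<bullet> b}" using closed_halfspace_ge[of 0 b] by (simp add: inner_commute)
      then show thesis using that 2 by blast
    qed
  qed
  obtain T where T: "open T" "\<phi> ` U = H \<inter> T" using H(2) openin_open by blast
  have "\<phi> p \<in> T" using T c(2) by blast
  then obtain r where r: "r > 0" "cball (\<phi> p) r \<subseteq> T" using T(1) open_contains_cball by blast
  have K: "H \<inter> cball (\<phi> p) r \<subseteq> \<phi> ` U" using r T by blast
  let ?i = "inv_into U \<phi>"
  have "compactin (top_of_set (\<phi> ` U)) (H \<inter> cball (\<phi> p) r)"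
    using K H(1) by (simp add: compactin_subtopology closed_Int_compact)
  then have cK: "compactin (mtop M) (?i ` (H \<inter> cball (\<phi> p) r))"
    by (rule image_compactin[OF _ chart_mapD(5)[OF chart[OF c(1)]]])
  have "openin (subtopology (mtop M) U) {q \<in> topspace (subtopology (mtop M) U). \<phi> q \<in> ball (\<phi> p) r}"
    using openin_continuous_map_preimage[OF chart_mapD(3)[OF chart[OF c(1)]], of "ball (\<phi> p) r"] by simp
  moreover have "topspace (subtopology (mtop M) U) = U" using chart_subset[OF c(1)] by auto
  ultimately have oU: "openin (mtop M) {q \<in> U. \<phi> q \<in> ball (\<phi> p) r}"
    using chart_mapD(1)[OF chart[OF c(1)]] openin_trans_full by fastforce
  have "{q \<in> U. \<phi> q \<in> ball (\<phi> p) r} \<subseteq> ?i ` (H \<inter> cball (\<phi> p) r)"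
  proof
    fix q assume "q \<in> {q \<in> U. \<phi> q \<in> ball (\<phi> p) r}"
    then have "q \<in> U" "\<phi> q \<in> H \<inter> cball (\<phi> p) r" using T by auto
    then show "q \<in> ?i ` (H \<inter> cball (\<phi> p) r)" using chart_inv[OF c(1)] by (metis imageI)
  qed
  then show "\<exists>U K. openin (mtop M) U \<and> compactin (mtop M) K \<and> p \<in> U \<and> U \<subseteq> K"
    using oU cK c(2) r(1) by (intro exI[of _ "{q \<in> U. \<phi> q \<in> ball (\<phi> p) r}"] exI[of _ "?i ` (H \<inter> cball (\<phi> p) r)"]) auto
qed

text \<open>The charts of the end have open images, and at a horizon point \<open>V\<close> is
  minimal; seen from the end, its differential therefore vanishes there. Carried back through the
  smooth inverse of \<Phi>, this contradicts that the horizons form a regular level set.\<close>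

lemma bdry_subset_compact_part:
  fixes \<Phi> :: "'s \<times> real \<Rightarrow> 'a"
  assumes Sig: "closed_manifold Sig"
    and \<Phi>: "diffeo (end_mfd Sig \<rho>\<^sub>0) (open_submfd M X) \<Phi>"
    and def: "defines_bdry M V" and Xo: "openin (mtop M) X"
  shows "bdry M \<inter> X = {}"
proof (rule ccontr)
  let ?E = "end_mfd Sig \<rho>\<^sub>0"
  have X: "X \<subseteq> topspace (mtop M)" by (rule openin_subset[OF Xo])
  assume "bdry M \<inter> X \<noteq> {}"
  then obtain p where p: "p \<in> bdry M" "p \<in> X" by blast
  have bij: "bij_betw \<Phi> (topspace (mtop ?E)) X"
    using \<Phi> X unfolding diffeo_def open_submfd_def by (simp add: Int_absorb1)
  define \<Psi> where "\<Psi> = inv_into (topspace (mtop ?E)) \<Phi>"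
  have \<Psi>: "smooth_map (open_submfd M X) ?E \<Psi>" and \<Phi>s: "smooth_map ?E (open_submfd M X) \<Phi>"
    using \<Phi> unfolding diffeo_def \<Psi>_def by blast+
  have \<Phi>\<Psi>: "\<Phi> (\<Psi> q) = q" if "q \<in> X" for q
    unfolding \<Psi>_def using bij that by (simp add: bij_betw_inv_into_right)
  have V0: "V q = 0" if "q \<in> bdry M" for q using def that unfolding defines_bdry_def by blast
  have Vnn: "0 \<le> V q" if "q \<in> topspace (mtop M)" for q
    using def that unfolding defines_bdry_def by (cases "q \<in> bdry M") (auto simp: less_imp_le)
  obtain W \<psi> where W: "(W, \<psi>) \<in> atlas M" "p \<in> W" using p unfolding bdry_def by blast
  define e where "e = \<Psi> p"
  have eT: "e \<in> topspace (mtop ?E)"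
    unfolding e_def \<Psi>_def using bij p(2) by (metis bij_betw_imp_surj_on inv_into_into)
  have \<Phi>e: "\<Phi> e = p" using \<Phi>\<Psi>[OF p(2)] by (simp add: e_def)
  have "fst e \<in> topspace (mtop Sig)" "snd e \<in> {\<rho>\<^sub>0<..}"
    using eT by (auto simp: end_mfd_def prod_mfd_def euclidean_mfd_def)
  then obtain U1 \<phi>1 where c: "(U1, \<phi>1) \<in> atlas Sig" and "fst e \<in> U1"
    using closed_manifold_chart_at[OF Sig] by blast
  then have eU: "e \<in> U1 \<times> {\<rho>\<^sub>0<..}" using \<open>snd e \<in> {\<rho>\<^sub>0<..}\<close> by (cases e) simp
  define U \<phi> where "U = U1 \<times> {\<rho>\<^sub>0<..}" and "\<phi> = map_prod \<phi>1 (\<lambda>x::real. x)"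
  have ch: "(U, \<phi>) \<in> atlas ?E" "chart_map (mtop ?E) U \<phi>" "open (\<phi> ` U)"
    unfolding U_def \<phi>_def by (rule end_chart[OF Sig c])+
  have eU: "e \<in> U" using eU by (simp add: U_def)
  have cont: "continuous_map (mtop ?E) (mtop M) \<Phi>"
    using \<Phi>s unfolding smooth_map_def open_submfd_def by (auto simp: continuous_map_in_subtopology)
  have UT: "U \<subseteq> topspace (mtop ?E)" using chart_mapD(1)[OF ch(2)] openin_subset by blast
  have WX: "(W \<inter> X, \<psi>) \<in> atlas (open_submfd M X)" using W(1) by (force simp: open_submfd_def)
  have into: "\<Phi> q \<in> X" if "q \<in> U" for q using bij UT that by (auto simp: bij_betw_def)
  have "smooth_on (\<phi> ` {q \<in> U. \<Phi> q \<in> W}) (\<psi> \<circ> \<Phi> \<circ> inv_into U \<phi>)"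
  proof -
    have "smooth_on (\<phi> ` {q \<in> U. \<Phi> q \<in> W \<inter> X}) (\<psi> \<circ> \<Phi> \<circ> inv_into U \<phi>)"
      using \<Phi>s ch(1) WX unfolding smooth_map_def by blast
    moreover have "{q \<in> U. \<Phi> q \<in> W \<inter> X} = {q \<in> U. \<Phi> q \<in> W}" using into by auto
    ultimately show ?thesis by simp
  qed
  from has_derivative_tmap[OF ch(2) cont chart_mapD(1)[OF chart[OF W(1)]] this eU] \<Phi>e W(2)
  have hT: "(\<psi> \<circ> \<Phi> \<circ> inv_into U \<phi> has_derivative tmap U \<phi> \<psi> \<Phi> e) (at (\<phi> e) within \<phi> ` U)" by simp
  define D where "D = dV W \<psi> p \<circ> tmap U \<phi> \<psi> \<Phi> e"
  have hV: "(V \<circ> \<Phi> \<circ> inv_into U \<phi> has_derivative D) (at (\<phi> e) within \<phi> ` U)"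
    unfolding D_def
    by (rule has_derivative_chart_compose[OF ch(2) cont chart_mapD(1,2)[OF chart[OF W(1)]] eU _ hT])
      (use \<Phi>e W(2) has_derivative_pot[OF W] in simp_all)
  have inv: "inv_into U \<phi> (\<phi> q) = q" if "q \<in> U" for q
    using chart_mapD(2)[OF ch(2)] that by simp
  have D0: "D = (\<lambda>v. 0)"
  proof (rule differential_zero_maxmin)
    show "\<phi> e \<in> \<phi> ` U" using eU by blast
    show "open (\<phi> ` U)" by (rule ch(3))
    show "((V \<circ> \<Phi> \<circ> inv_into U \<phi>) has_derivative D) (at (\<phi> e))"
      using hV at_within_open[OF _ ch(3), of "\<phi> e"] eU by simp
    show "(\<forall>y\<in>\<phi> ` U. (V \<circ> \<Phi> \<circ> inv_into U \<phi>) y \<le> (V \<circ> \<Phi> \<circ> inv_into U \<phi>) (\<phi> e)) \<or>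
      (\<forall>y\<in>\<phi> ` U. (V \<circ> \<Phi> \<circ> inv_into U \<phi>) (\<phi> e) \<le> (V \<circ> \<Phi> \<circ> inv_into U \<phi>) y)"
      using V0[OF p(1)] Vnn into X by (auto simp: inv eU \<Phi>e)
  qed
  have chW: "chart_map (mtop (open_submfd M X)) (W \<inter> X) \<psi>"
    unfolding open_submfd_def using chart_map_subtopology[OF chart[OF W(1)]] by simp
  have pWX: "p \<in> W \<inter> X" "\<Psi> p \<in> U" using p W eU by (auto simp: e_def)
  have c\<Psi>: "continuous_map (mtop (open_submfd M X)) (mtop ?E) \<Psi>" using \<Psi> unfolding smooth_map_def by blast
  have sm\<Psi>: "smooth_on (\<psi> ` {q \<in> W \<inter> X. \<Psi> q \<in> U}) (\<phi> \<circ> \<Psi> \<circ> inv_into (W \<inter> X) \<psi>)"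
    using \<Psi> WX ch(1) unfolding smooth_map_def by blast
  have "(V \<circ> \<Phi> \<circ> \<Psi> \<circ> inv_into (W \<inter> X) \<psi> has_derivative D \<circ> tmap (W \<inter> X) \<psi> \<phi> \<Psi> p) (at (\<psi> p) within \<psi> ` (W \<inter> X))"
    by (rule has_derivative_chart_compose[OF chW c\<Psi> chart_mapD(1,2)[OF ch(2)] pWX
          has_derivative_tmap[OF chW c\<Psi> chart_mapD(1)[OF ch(2)] sm\<Psi> pWX]])
      (use hV in \<open>simp add: e_def\<close>)
  then have "(V \<circ> \<Phi> \<circ> \<Psi> \<circ> inv_into (W \<inter> X) \<psi> has_derivative (\<lambda>v. 0)) (at (\<psi> p) within \<psi> ` (W \<inter> X))"
    by (simp add: D0 o_def)
  then have "(V \<circ> inv_into W \<psi> has_derivative (\<lambda>v. 0)) (at (\<psi> p) within \<psi> ` (W \<inter> X))"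
  proof (rule has_derivative_transform[rotated 2])
    fix x assume "x \<in> \<psi> ` (W \<inter> X)"
    then obtain q where q: "q \<in> W \<inter> X" "x = \<psi> q" by blast
    then have "inv_into (W \<inter> X) \<psi> x = q" using chart_mapD(2)[OF chW] by simp
    then show "(V \<circ> inv_into W \<psi>) x = (V \<circ> \<Phi> \<circ> \<Psi> \<circ> inv_into (W \<inter> X) \<psi>) x"
      using q chart_inv[OF W(1)] \<Phi>\<Psi> by simp
  qed (use pWX in auto)
  moreover have "at (\<psi> p) within \<psi> ` W = at (\<psi> p) within \<psi> ` (W \<inter> X)"
  proof (rule at_within_openin)
    show "openin (top_of_set (\<psi> ` W)) (\<psi> ` (W \<inter> X))"
      by (rule chart_map_open_inter(2)[OF chart[OF W(1)] Xo])
  qed (use pWX in auto)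
  ultimately have "(V \<circ> inv_into W \<psi> has_derivative (\<lambda>v. 0)) (at (\<psi> p) within \<psi> ` W)" by simp
  then have "dd (\<psi> ` W) (V \<circ> inv_into W \<psi>) (\<psi> p) = (\<lambda>v. 0)"
    using smooth_manifold_chart(2)[OF manifold W(1)] W(2) by (intro dd_unique_chart) auto
  moreover have "\<exists>u. dd (\<psi> ` W) (V \<circ> inv_into W \<psi>) (\<psi> p) u \<noteq> 0"
    using def W p(1) unfolding defines_bdry_def by blast
  ultimately show False by simp
qed

text \<open>The end cannot leave every compact set towards its inner side \<open>\<rho> \<rightarrow> \<rho>\<^sub>0\<close>: there it must accumulate
  at the compact part \<open>K\<^sub>0\<close>, since otherwise \<open>K\<^sub>0\<close> would be open and closed.\<close>

lemma compact_complement_of_end: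
  fixes \<Phi> :: "'s \<times> real \<Rightarrow> 'a"
  assumes Sig: "closed_manifold Sig"
    and \<Phi>: "diffeo (end_mfd Sig \<rho>\<^sub>0) (open_submfd M (topspace (mtop M) - K\<^sub>0)) \<Phi>"
    and K\<^sub>0: "compactin (mtop M) K\<^sub>0" "K\<^sub>0 \<noteq> {}"
    and M: "connected_space (mtop M)" "\<not> compact_space (mtop M)"
    and V: "\<And>e. e \<in> topspace (mtop (end_mfd Sig \<rho>\<^sub>0)) \<Longrightarrow> R\<^sub>0 \<le> snd e \<Longrightarrow> snd e \<le> V (\<Phi> e) + 1"
  shows "compactin (mtop M)
    (topspace (mtop M) - \<Phi> ` {e \<in> topspace (mtop (end_mfd Sig \<rho>\<^sub>0)). R < snd e})"
proof -
  let ?M = "mtop M" and ?E = "mtop (end_mfd Sig \<rho>\<^sub>0)"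
  define X where "X = topspace ?M - K\<^sub>0"
  define \<Psi> where "\<Psi> = inv_into (topspace ?E) \<Phi>"
  have haus: "Hausdorff_space ?M" using manifold by (simp add: smooth_manifold_def)
  have Xo: "openin ?M X" unfolding X_def using compactin_imp_closedin[OF haus K\<^sub>0(1)] by blast
  then have tX: "X \<subseteq> topspace ?M" by (rule openin_subset)
  have bij: "bij_betw \<Phi> (topspace ?E) X"
    using \<Phi> tX unfolding diffeo_def open_submfd_def X_def by (simp add: Int_absorb1)
  have c\<Phi>: "continuous_map ?E ?M \<Phi>"
    using \<Phi> unfolding diffeo_def smooth_map_def open_submfd_def by (auto simp: continuous_map_in_subtopology)
  have c\<Psi>: "continuous_map (subtopology ?M X) ?E \<Psi>"
    using \<Phi> unfolding diffeo_def smooth_map_def open_submfd_def X_def \<Psi>_def by simp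
  have \<Psi>: "\<Phi> (\<Psi> q) = q" "\<Psi> q \<in> topspace ?E" if "q \<in> X" for q
    unfolding \<Psi>_def using bij that by (auto simp: bij_betw_inv_into_right bij_betw_def intro: inv_into_into)
  have \<Psi>\<Phi>: "\<Psi> (\<Phi> e) = e" "\<Phi> e \<in> X" if "e \<in> topspace ?E" for e
    unfolding \<Psi>_def using bij that by (auto simp: bij_betw_inv_into_left bij_betw_def)
  have E: "?E = prod_topology (mtop Sig) (top_of_set {\<rho>\<^sub>0<..})"
    by (simp add: end_mfd_def prod_mfd_def euclidean_mfd_def)
  have tE: "topspace ?E = topspace (mtop Sig) \<times> {\<rho>\<^sub>0<..}" by (simp add: E)
  have csnd: "continuous_map ?E euclideanreal snd"
    unfolding E using continuous_map_snd[of "mtop Sig" "top_of_set {\<rho>\<^sub>0<..}"]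
    by (simp add: continuous_map_in_subtopology)
  have Sigc: "compact_space (mtop Sig)" "connected_space (mtop Sig)"
    using Sig by (auto simp: closed_manifold_def)
  have cpt: "compactin ?M (\<Phi> ` (topspace (mtop Sig) \<times> {a..b}))" if "\<rho>\<^sub>0 < a" for a b
  proof -
    have "compactin ?E (topspace (mtop Sig) \<times> {a..b})"
      unfolding E compactin_Times using Sigc that
      by (auto simp: compact_space_def compactin_subtopology)
    then show ?thesis by (rule image_compactin[OF _ c\<Phi>])
  qed
  obtain N L where NL: "openin ?M N" "compactin ?M L" "closedin ?M L" "K\<^sub>0 \<subseteq> N" "N \<subseteq> L"
    using locally_compact_manifold locally_compact_space_compact_closed_compact[of ?M] haus K\<^sub>0(1) by meson
  have LN: "compactin ?M (L - N)"
    using NL by (intro closed_compactin[OF NL(2)]) auto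
  have "L - N \<subseteq> X" using NL(4) compactin_subset_topspace[OF NL(2)] by (auto simp: X_def)
  then have "compactin (subtopology ?M X) (L - N)" using LN by (simp add: compactin_subtopology)
  then have "compactin ?E (\<Psi> ` (L - N))" by (rule image_compactin[OF _ c\<Psi>])
  then have "compactin euclideanreal (snd ` \<Psi> ` (L - N))" by (rule image_compactin[OF _ csnd])
  then have cs: "compact (snd ` \<Psi> ` (L - N))" by simp
  \<comment> \<open>The compact shell \<open>L - N\<close> around \<open>K\<^sub>0\<close> lies in
    the end, so the coordinate \<rho> has a minimum on it, above
    \<open>\<rho>\<^sub>0\<close>.\<close>
  obtain a where a: "\<rho>\<^sub>0 < a" "\<And>q. q \<in> L - N \<Longrightarrow> a \<le> snd (\<Psi> q)"
  proof (cases "L - N = {}")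
    case True
    then show thesis using that[of "\<rho>\<^sub>0 + 1"] by auto
  next
    case False
    then obtain q where q: "q \<in> L - N" "\<And>q'. q' \<in> L - N \<Longrightarrow> snd (\<Psi> q) \<le> snd (\<Psi> q')"
      using compact_attains_inf[OF cs] by auto
    have "\<rho>\<^sub>0 < snd (\<Psi> q)" using \<Psi>(2)[of q] q(1) \<open>L - N \<subseteq> X\<close> tE by (auto simp: mem_Times_iff)
    then show thesis using that q by blast
  qed
  define A where "A = \<Phi> ` (topspace (mtop Sig) \<times> {\<rho>\<^sub>0<..<a})"
  have AX: "A \<subseteq> X" unfolding A_def using \<Psi>\<Phi>(2) tE by force
  have "connectedin ?E (topspace (mtop Sig) \<times> {\<rho>\<^sub>0<..<a})"
    unfolding E connectedin_Times using Sigc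
    by (auto simp: connectedin_topspace connectedin_subtopology)
  then have Ac: "connectedin ?M A" unfolding A_def by (rule connectedin_continuous_map_image[OF c\<Phi>])
  have A_LN: "A \<inter> (L - N) = {}"
  proof -
    have "snd (\<Psi> q) < a" if "q \<in> A" for q
      using that \<Psi>\<Phi>(1) tE unfolding A_def by force
    then show ?thesis using a(2) by force
  qed
  \<comment> \<open>The inner part \<open>A\<close> of the end is connected and misses
    \<open>L - N\<close>, so it lies in \<open>N\<close> or is disjoint from it. In the second case
    the points of \<open>N\<close> outside \<open>K\<^sub>0\<close> have \<rho> at least
    \<open>a\<close>, which will make \<open>K\<^sub>0\<close> open.\<close>
  have "A \<subseteq> N"
  proof (rule ccontr)
    assume nA: "\<not> A \<subseteq> N"
    have "A \<inter> N = {}"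
    proof (rule ccontr)
      assume "A \<inter> N \<noteq> {}"
      moreover have "A \<inter> (topspace ?M - L) \<noteq> {}" using nA A_LN AX tX by blast
      moreover have "openin ?M (topspace ?M - L)" using NL(3) by blast
      moreover have "A \<subseteq> N \<union> (topspace ?M - L)" using A_LN AX tX by blast
      ultimately show False
        using connectedinD[OF Ac NL(1), of "topspace ?M - L"] NL(5) by blast
    qed
    have "compact (V ` K\<^sub>0)"
      using image_compactin[OF K\<^sub>0(1) continuous_V] by simp
    then obtain v where v: "\<And>q. q \<in> K\<^sub>0 \<Longrightarrow> V q \<le> v"
      using compact_imp_bounded bounded_imp_bdd_above by (metis bdd_above_def imageI)
    \<comment> \<open>Beyond \<open>R\<^sub>1\<close> the potential exceeds \<open>v + 1\<close>,
      where \<open>v\<close> bounds it on \<open>K\<^sub>0\<close>. So cutting by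
      \<open>V < v + 1\<close> and removing the compact piece up to \<open>R\<^sub>1\<close> leaves
      just \<open>K\<^sub>0\<close> in \<open>N\<close>.\<close>
    define R\<^sub>1 where "R\<^sub>1 = max R\<^sub>0 (v + 2)"
    have cl: "closedin ?M (\<Phi> ` (topspace (mtop Sig) \<times> {a..R\<^sub>1}))"
      by (rule compactin_imp_closedin[OF haus cpt[OF a(1)]])
    have oV: "openin ?M {q \<in> topspace ?M. V q \<in> {..<v + 1}}"
      by (rule openin_continuous_map_preimage[OF continuous_V]) simp
    define O1 where "O1 = (N \<inter> {q \<in> topspace ?M. V q \<in> {..<v + 1}}) - \<Phi> ` (topspace (mtop Sig) \<times> {a..R\<^sub>1})"
    have "openin ?M O1" unfolding O1_def by (intro openin_diff openin_Int NL(1) oV cl)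
    moreover have "O1 = K\<^sub>0"
    proof
      show "K\<^sub>0 \<subseteq> O1"
      proof
        fix q assume q: "q \<in> K\<^sub>0"
        have "q \<notin> \<Phi> ` (topspace (mtop Sig) \<times> {a..R\<^sub>1})"
          using q \<Psi>\<Phi>(2) tE a(1) by (force simp: X_def)
        then show "q \<in> O1"
          using q NL(4) v[OF q] compactin_subset_topspace[OF K\<^sub>0(1)] by (auto simp: O1_def)
      qed
      show "O1 \<subseteq> K\<^sub>0"
      proof
        fix q assume q: "q \<in> O1"
        show "q \<in> K\<^sub>0"
        proof (rule ccontr)
          assume "q \<notin> K\<^sub>0"
          then have qX: "q \<in> X" using q by (auto simp: O1_def X_def)
          define e where "e = \<Psi> q"
          have e: "e \<in> topspace ?E" "\<Phi> e = q" using \<Psi>[OF qX] by (auto simp: e_def)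
          have eT: "fst e \<in> topspace (mtop Sig)" "\<rho>\<^sub>0 < snd e" using e(1) tE by (auto simp: mem_Times_iff)
          have "\<not> snd e < a"
          proof
            assume "snd e < a"
            then have "q \<in> A" unfolding A_def e(2)[symmetric] using eT by (intro imageI) (auto simp: mem_Times_iff)
            then show False using \<open>A \<inter> N = {}\<close> q by (auto simp: O1_def)
          qed
          moreover have "\<not> (a \<le> snd e \<and> snd e \<le> R\<^sub>1)"
          proof
            assume "a \<le> snd e \<and> snd e \<le> R\<^sub>1"
            then have "q \<in> \<Phi> ` (topspace (mtop Sig) \<times> {a..R\<^sub>1})"
              unfolding e(2)[symmetric] using eT by (intro imageI) (auto simp: mem_Times_iff)
            then show False using q by (auto simp: O1_def)
          qed
          ultimately have "R\<^sub>1 < snd e" by auto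
          then have "v + 1 < V q" using V[OF e(1)] e(2) by (auto simp: R\<^sub>1_def)
          then show False using q by (auto simp: O1_def)
        qed
      qed
    qed
    ultimately have "openin ?M K\<^sub>0" by simp
    moreover have "closedin ?M K\<^sub>0" by (rule compactin_imp_closedin[OF haus K\<^sub>0(1)])
    ultimately have "K\<^sub>0 = topspace ?M" using M(1) K\<^sub>0(2) unfolding connected_space_clopen_in by blast
    then show False using K\<^sub>0(1) M(2) by (simp add: compact_space_def)
  qed
  let ?C = "topspace ?M - \<Phi> ` {e \<in> topspace ?E. R < snd e}"
  have img: "\<Phi> ` {e \<in> topspace ?E. R < snd e} = {q \<in> topspace (subtopology ?M X). snd (\<Psi> q) \<in> {R<..}}"
  proof (rule subset_antisym; rule subsetI)
    fix q assume "q \<in> \<Phi> ` {e \<in> topspace ?E. R < snd e}"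
    then obtain e where "e \<in> topspace ?E" "R < snd e" "q = \<Phi> e" by blast
    then show "q \<in> {q \<in> topspace (subtopology ?M X). snd (\<Psi> q) \<in> {R<..}}"
      using \<Psi>\<Phi>[of e] tX by auto
  next
    fix q assume "q \<in> {q \<in> topspace (subtopology ?M X). snd (\<Psi> q) \<in> {R<..}}"
    then have "q \<in> X" "R < snd (\<Psi> q)" by auto
    then show "q \<in> \<Phi> ` {e \<in> topspace ?E. R < snd e}"
      using \<Psi>[of q] by (metis (mono_tags, lifting) imageI mem_Collect_eq)
  qed
  have "continuous_map (subtopology ?M X) euclideanreal (snd \<circ> \<Psi>)"
    by (rule continuous_map_compose[OF c\<Psi> csnd])
  then have "openin (subtopology ?M X) {q \<in> topspace (subtopology ?M X). (snd \<circ> \<Psi>) q \<in> {R<..}}"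
    by (rule openin_continuous_map_preimage) simp
  then have "openin ?M (\<Phi> ` {e \<in> topspace ?E. R < snd e})"
    unfolding img using Xo openin_trans_full by (simp add: o_def) blast
  then have cC: "closedin ?M ?C" by blast
  have "?C \<subseteq> L \<union> \<Phi> ` (topspace (mtop Sig) \<times> {a..R})"
  proof
    fix q assume q: "q \<in> ?C"
    show "q \<in> L \<union> \<Phi> ` (topspace (mtop Sig) \<times> {a..R})"
    proof (cases "q \<in> X")
      case False
      then show ?thesis using q NL by (auto simp: X_def)
    next
      case True
      define e where "e = \<Psi> q"
      have e: "e \<in> topspace ?E" "\<Phi> e = q" using \<Psi>[OF True] by (auto simp: e_def)
      have eT: "fst e \<in> topspace (mtop Sig)" "\<rho>\<^sub>0 < snd e" using e(1) tE by (auto simp: mem_Times_iff)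
      have "\<not> R < snd e" using q e by blast
      show ?thesis
      proof (cases "snd e < a")
        case True
        then have "q \<in> A" unfolding A_def e(2)[symmetric] using eT by (intro imageI) (auto simp: mem_Times_iff)
        then show ?thesis using \<open>A \<subseteq> N\<close> NL(5) by blast
      next
        case False
        then have "q \<in> \<Phi> ` (topspace (mtop Sig) \<times> {a..R})"
          unfolding e(2)[symmetric] using eT \<open>\<not> R < snd e\<close> by (intro imageI) (auto simp: mem_Times_iff)
        then show ?thesis by blast
      qed
    qed
  qed
  then show ?thesis
    by (rule closed_compactin[OF compactin_Un[OF NL(2) cpt[OF a(1)]] _ cC])
qed

text \<open>In a coordinate ball on which \<open>V\<close> stays in \<open>I\<close> its
  differential vanishes, so convexity of the ball makes \<open>V\<close> constant.\<close>

lemma constant_on_region: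
  assumes crit: "\<And>p. p \<in> topspace (mtop M) \<Longrightarrow> p \<notin> bdry M \<Longrightarrow> V p \<in> I \<Longrightarrow> sqV p = 0"
    and bd: "\<And>p. p \<in> bdry M \<Longrightarrow> V p \<notin> I"
    and I: "open I" "t \<in> I" and p: "p \<in> topspace (mtop M)" "V p = t"
  shows "\<exists>T. openin (mtop M) T \<and> p \<in> T \<and> (\<forall>q\<in>T. V q = t)"
proof -
  obtain U \<phi> where c: "(U, \<phi>) \<in> atlas M" "p \<in> U" using chart_at p by blast
  have pb: "p \<notin> bdry M" using bd p I by blast
  let ?S = "interior (\<phi> ` U)" and ?f = "V \<circ> inv_into U \<phi>"
  interpret coordinate_potential ?S "loc U \<phi> g" ?f by (rule coordinate_potential_interior[OF c(1)])
  have x: "\<phi> p \<in> ?S" by (rule interior_chart[OF c pb])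
  have "open {x \<in> ?S. ?f x \<in> I}"
  proof -
    have "open (?f -` I \<inter> ?S)"
      using differentiable_imp_continuous_on[OF diff_f] I(1) open_S continuous_on_open_vimage by blast
    moreover have "{x \<in> ?S. ?f x \<in> I} = ?f -` I \<inter> ?S" by auto
    ultimately show ?thesis by simp
  qed
  moreover have "\<phi> p \<in> {x \<in> ?S. ?f x \<in> I}" using x p I chart_inv[OF c] by simp
  ultimately obtain r where r: "r > 0" "ball (\<phi> p) r \<subseteq> {x \<in> ?S. ?f x \<in> I}"
    using open_contains_ball by blast
  have inv: "inv_into U \<phi> y \<in> U" "\<phi> (inv_into U \<phi> y) = y" if "y \<in> ?S" for y
    using that interior_subset[of "\<phi> ` U"] by (auto intro: inv_into_into f_inv_into_f)
  have d0: "(?f has_derivative (\<lambda>u. 0)) (at y within ball (\<phi> p) r)" if y: "y \<in> ball (\<phi> p) r" for y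
  proof -
    have yS: "y \<in> ?S" "?f y \<in> I" using r y by auto
    let ?q = "inv_into U \<phi> y"
    have "?q \<notin> bdry M" using bd[of ?q] yS(2) by auto
    then have "sqV ?q = 0" using crit[of ?q] inv[OF yS(1)] chart_subset[OF c(1)] yS(2) by auto
    then have "dV U \<phi> ?q = (\<lambda>u. 0)" using sqV_eq_0D[OF c(1)] inv[OF yS(1)] by blast
    moreover have "(?f has_derivative df y) (at y)"
      by (rule has_derivative_dd_open[OF diff_f open_S yS(1)])
    moreover have "dV U \<phi> ?q = df y"
      unfolding dV_def inv(2)[OF yS(1)] by (rule dd_local[OF open_S yS(1) interior_subset refl])
    ultimately show ?thesis by (auto intro: has_derivative_at_withinI)
  qed
  obtain k where k: "\<And>y. y \<in> ball (\<phi> p) r \<Longrightarrow> ?f y = k"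
    using has_derivative_zero_constant[OF convex_ball d0] by blast
  have "k = t" using k[of "\<phi> p"] r(1) p chart_inv[OF c] by simp
  have "openin (subtopology (mtop M) U) {q \<in> topspace (subtopology (mtop M) U). \<phi> q \<in> ball (\<phi> p) r}"
    using openin_continuous_map_preimage[OF chart_mapD(3)[OF chart[OF c(1)]], of "ball (\<phi> p) r"] by simp
  moreover have "topspace (subtopology (mtop M) U) = U" using chart_subset[OF c(1)] by auto
  ultimately have oU: "openin (mtop M) {q \<in> U. \<phi> q \<in> ball (\<phi> p) r}"
    using chart_mapD(1)[OF chart[OF c(1)]] openin_trans_full by fastforce
  show ?thesis
    using oU c(2) r(1) k \<open>k = t\<close> chart_inv[OF c(1)]
    by (intro exI[of _ "{q \<in> U. \<phi> q \<in> ball (\<phi> p) r}"]) force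
qed

end

section \<open>The lower bound for the surface gravity\<close>

text \<open>The parameter k is the value of V^2 at \<open>p\<close>, so the comparison is evaluated
  where the profile is 9/4 r^2 with r^3 = 2 m. A suitably small mass brings it below the assumed
  positive squared gradient.\<close>

lemma critical_band:
  fixes M :: "('a, real^3) mfd" and \<Phi> :: "'s \<times> real \<Rightarrow> 'a"
  assumes sp: "static_potential M g V" and def: "defines_bdry M V"
    and W: "\<And>p. p \<in> bdry M \<Longrightarrow> riemannian_potential.sqV M g V p = \<kappa>\<^sup>2"
    and compact_out: "\<And>\<eta>. \<eta> > 0 \<Longrightarrow> \<exists>K. compactin (mtop M) K \<and>
      (\<forall>p\<in>topspace (mtop M) - K. riemannian_potential.sqV M g V p \<le> (V p)\<^sup>2 - 1 + \<eta>)"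
    and p: "p \<in> topspace (mtop M)" "\<kappa>\<^sup>2 < 3 * (V p)\<^sup>2" "(V p)\<^sup>2 < 1"
  shows "riemannian_potential.sqV M g V p = 0"
proof -
  interpret static_potential M g V by (rule sp)
  define k where "k = (V p)\<^sup>2"
  have "0 \<le> \<kappa>\<^sup>2" by simp
  then have k: "0 < k" "\<kappa>\<^sup>2 < 3 * k" "k < 1" using p unfolding k_def by linarith+
  have "sqV p \<le> 0"
  proof (rule ccontr)
    assume "\<not> sqV p \<le> 0"
    then have pos: "0 < sqV p" by simp
    \<comment> \<open>With this radius the profile at \<open>p\<close> is a quarter of
      \<open>sqV p\<close>.\<close>
    define r where "r = sqrt (sqV p) / 3"
    have r: "r > 0" "9 / 4 * r\<^sup>2 < sqV p" using pos by (auto simp: r_def power_divide)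
    define m where "m = r ^ 3 / 2"
    have m: "m > 0" using r by (simp add: m_def)
    \<comment> \<open>The bounds 1 and \<open>m\<^sup>2\<close> give 16 c^3 \<le> 16 m^2 < 729 m^2;
      the other two fit the margin into the room left at infinity and on the horizons.\<close>
    define c where "c = min (min 1 (m\<^sup>2)) (min ((1 - k) / 4) ((3 * k - \<kappa>\<^sup>2) / 2))"
    have c: "0 < c" "c \<le> 1" "c \<le> m\<^sup>2" "c \<le> (1 - k) / 4" "c \<le> (3 * k - \<kappa>\<^sup>2) / 2"
    proof -
      show "0 < c" using m k by (simp add: c_def)
      show "c \<le> 1" "c \<le> m\<^sup>2" "c \<le> (1 - k) / 4" "c \<le> (3 * k - \<kappa>\<^sup>2) / 2"
        unfolding c_def by linarith+
    qed
    obtain K where K: "compactin (mtop M) K"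
      "\<And>q. q \<in> topspace (mtop M) - K \<Longrightarrow> sqV q \<le> (V q)\<^sup>2 - 1 + (1 - k) / 2"
      using compact_out[of "(1 - k) / 2"] k by auto
    have "sqV p \<le> kottler m ((V p)\<^sup>2 - k) - c"
    proof (rule kottler_comparison[where X = "topspace (mtop M)" and K = K and B = "bdry M"])
      show "K \<subseteq> topspace (mtop M)" by (rule compactin_subset_topspace[OF K(1)])
      have "continuous_map (mtop M) euclidean (\<lambda>q. ((V q)\<^sup>2, sqV q))"
      proof -
        have "continuous_map (mtop M) euclideanreal (\<lambda>q. (V q)\<^sup>2)"
          by (rule continuous_map_real_pow[OF continuous_V])
        from continuous_map_pairedI[OF this continuous_sqV] show ?thesis by simp
      qed
      from image_compactin[OF K(1) this] show "compact ((\<lambda>q. ((V q)\<^sup>2, sqV q)) ` K)" by simp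
      show "(V q)\<^sup>2 = 0 \<and> sqV q + c < 3 * k" if "q \<in> bdry M" for q
      proof -
        have "V q = 0" using def that unfolding defines_bdry_def by blast
        then show ?thesis using W[OF that] c(5) k by simp
      qed
      show "sqV q < (V q)\<^sup>2 - k - c" if "q \<in> topspace (mtop M) - K" for q
      proof -
        have "c < (1 - k) / 2" using c(4) k(3) by simp
        moreover have "(1 - k) / 2 = 1 - k - (1 - k) / 2" by (simp add: field_simps)
        ultimately show ?thesis using K(2)[OF that] by linarith
      qed
      show "sqV q \<le> 0" if q: "q \<in> topspace (mtop M) - bdry M" and "0 < n"
        and le: "\<And>q'. q' \<in> topspace (mtop M) \<Longrightarrow> sqV q' \<le> kottler n ((V q')\<^sup>2 - k) - c"
        and eq: "sqV q = kottler n ((V q)\<^sup>2 - k) - c" for q n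
      proof (rule no_interior_contact[OF _ _ _ \<open>0 < n\<close> c(1) le eq])
        show "0 < V q" using def q unfolding defines_bdry_def by blast
      qed (use q in auto)
      show "16 * c ^ 3 < 729 * m\<^sup>2"
      proof -
        have "c ^ 3 \<le> c" using c power_decreasing[of 1 3 c] by simp
        then show ?thesis using c m zero_less_power[OF m, of 2] by linarith
      qed
    qed (use c k m p in auto)
    also have "\<dots> = 9 / 4 * r\<^sup>2 - c" using kottler_zero[OF r(1)] by (simp add: k_def m_def)
    finally show False using r c by linarith
  qed
  then show ?thesis using sqV_nonneg[OF p(1)] by simp
qed

theorem surface_gravity_ge:
  fixes M :: "('a, real^3) mfd"
  assumes ALH: "ALH_static_system M g V Sig round_metric 1 J H"
    and sg: "\<And>j. j \<in> {1..J} \<Longrightarrow> has_surface_gravity M g V (H j) \<kappa>"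
  shows "sqrt 3 \<le> \<kappa>"
proof -
  interpret A: ALH_static_system M g V Sig round_metric 1 J H by (rule ALH)
  have smV: "smooth_fun M V" using A.potential unfolding defines_bdry_def by blast
  interpret static_potential M g V
    by unfold_locales (use A.manifold A.metric smV A.static_hess A.static_laplacian in auto)
  have btop: "bdry M \<subseteq> topspace (mtop M)" by (rule compactin_subset_topspace[OF A.bdry_compact])
  have Hun: "\<Union> (H ` {1..J}) = bdry M"
    using A.horizons(2) Union_connected_components_of[of "subtopology (mtop M) (bdry M)"] btop
    by (auto simp: bij_betw_def)
  have bd: "sqV p = \<kappa>\<^sup>2" "0 \<le> \<kappa>" if p: "p \<in> bdry M" for p
  proof -
    obtain j where j: "j \<in> {1..J}" "p \<in> H j" using p Hun by blast
    show "sqV p = \<kappa>\<^sup>2" "0 \<le> \<kappa>"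
      by (rule boundary_gradient[OF A.potential p sg[OF j(1)] j(2)])+
  qed
  have "H 1 \<in> connected_components_of (subtopology (mtop M) (bdry M))"
    using A.horizons by (auto simp: bij_betw_def)
  then have "H 1 \<noteq> {}" using nonempty_connected_components_of by blast
  then obtain p\<^sub>0 where p0: "p\<^sub>0 \<in> bdry M" using Hun A.horizons(1) by fastforce
  have V0: "V p = 0" if "p \<in> bdry M" for p
    using A.potential that unfolding defines_bdry_def by blast
  obtain K\<^sub>0 \<rho>\<^sub>0 \<Phi> gE \<alpha> where
    K0: "compactin (mtop M) K\<^sub>0" and rho: "0 \<le> \<rho>\<^sub>0" and \<alpha>: "2 < \<alpha>" and
    \<Phi>: "diffeo (end_mfd Sig \<rho>\<^sub>0) (open_submfd M (topspace (mtop M) - K\<^sub>0)) \<Phi>" and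
    pull: "is_pullback (end_mfd Sig \<rho>\<^sub>0) M \<Phi> g gE" and
    Q: "\<forall>m\<le>3. \<exists>C \<rho>\<^sub>1. \<forall>(U, \<phi>)\<in>atlas (end_mfd Sig \<rho>\<^sub>0). \<forall>p\<in>U. \<rho>\<^sub>1 \<le> snd p \<longrightarrow>
           gbar_norm round_metric 1 U \<phi> m 2
             (\<lambda>x vs. loc U \<phi> gE x (vs ! 0) (vs ! 1) - loc U \<phi> (gbar round_metric 1) x (vs ! 0) (vs ! 1)) p
           \<le> C * snd p powr (- \<alpha>)" and
    E: "\<forall>m\<le>1. \<forall>\<epsilon>>0. \<exists>\<rho>\<^sub>1. \<forall>(U, \<phi>)\<in>atlas (end_mfd Sig \<rho>\<^sub>0). \<forall>p\<in>U. \<rho>\<^sub>1 \<le> snd p \<longrightarrow>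
           gbar_norm round_metric 1 U \<phi> m 0
             (\<lambda>x _. V (\<Phi> (inv_into U \<phi> x)) - sqrt (1 + (snd (inv_into U \<phi> x))\<^sup>2)) p
           \<le> \<epsilon> / snd p"
    using A.asymptotics unfolding ALH_end_def by (elim exE conjE) (rule that; assumption)
  let ?E = "end_mfd Sig \<rho>\<^sub>0"
  note as = end_asymptotics[OF A.infinity(1) \<Phi> pull \<alpha> Q[rule_format, of 0, OF le0] E]
  obtain R\<^sub>0 where R0: "\<And>e. e \<in> topspace (mtop ?E) \<Longrightarrow> R\<^sub>0 \<le> snd e \<Longrightarrow>
    sqV (\<Phi> e) \<le> (V (\<Phi> e))\<^sup>2 - 1 + 1 \<and> snd e \<le> V (\<Phi> e) + 1"
    using as[of 1] by auto
  have haus: "Hausdorff_space (mtop M)" using manifold by (simp add: smooth_manifold_def)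
  have Xo: "openin (mtop M) (topspace (mtop M) - K\<^sub>0)"
    using compactin_imp_closedin[OF haus K0] by blast
  \<comment> \<open>Provides a point of \<open>K\<^sub>0\<close>; for empty \<open>K\<^sub>0\<close>
    the inner side of the end would not be controlled.\<close>
  have "p\<^sub>0 \<in> K\<^sub>0" using bdry_subset_compact_part[OF A.infinity(1) \<Phi> A.potential Xo] p0 btop by blast
  then have K0ne: "K\<^sub>0 \<noteq> {}" by blast
  have cpt: "compactin (mtop M) (topspace (mtop M) - \<Phi> ` {e \<in> topspace (mtop ?E). R < snd e})" for R
    using compact_complement_of_end[OF A.infinity(1) \<Phi> K0 K0ne A.connected A.noncompact] R0 by blast
  have compact_out: "\<exists>K. compactin (mtop M) K \<and>
      (\<forall>p\<in>topspace (mtop M) - K. sqV p \<le> (V p)\<^sup>2 - 1 + \<eta>)" if \<eta>: "\<eta> > 0" for \<eta>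
  proof -
    obtain R where R: "\<And>e. e \<in> topspace (mtop ?E) \<Longrightarrow> R \<le> snd e \<Longrightarrow>
      sqV (\<Phi> e) \<le> (V (\<Phi> e))\<^sup>2 - 1 + \<eta> \<and> snd e \<le> V (\<Phi> e) + 1"
      using as[OF \<eta>] by blast
    show ?thesis
      by (intro exI[of _ "topspace (mtop M) - \<Phi> ` {e \<in> topspace (mtop ?E). R < snd e}"] conjI cpt)
        (use R in \<open>auto simp: less_imp_le\<close>)
  qed
  show ?thesis
  proof (rule ccontr)
    assume "\<not> sqrt 3 \<le> \<kappa>"
    then have "\<kappa> < sqrt 3" by simp
    then have "\<kappa>\<^sup>2 < 3" using bd(2)[OF p0] by (metis real_sqrt_less_iff real_sqrt_abs abs_of_nonneg)
    \<comment> \<open>The midpoint of the interval of values of V^2 on which all points are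
      critical.\<close>
    define s where "s = (\<kappa>\<^sup>2 / 3 + 1) / 2"
    define t where "t = sqrt s"
    have s: "\<kappa>\<^sup>2 / 3 < s" "s < 1" "0 < s" using \<open>\<kappa>\<^sup>2 < 3\<close> by (auto simp: s_def add_nonneg_pos)
    define I where "I = {u::real. \<kappa>\<^sup>2 < 3 * u\<^sup>2} \<inter> {u. u\<^sup>2 < 1}"
    have "open I"
      unfolding I_def by (intro open_Int open_Collect_less continuous_intros)
    have tI: "t \<in> I" using s by (simp add: I_def t_def)
    have t01: "0 < t" "t < 1" using s by (auto simp: t_def)
    have I0: "V p \<notin> I" if "p \<in> bdry M" for p
      using V0[OF that] by (simp add: I_def)
    have crit: "sqV p = 0" if "p \<in> topspace (mtop M)" "V p \<in> I" for p
      by (rule critical_band[OF static_potential_axioms A.potential bd(1) compact_out])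
        (use that in \<open>auto simp: I_def\<close>)
    define L where "L = {p \<in> topspace (mtop M). V p = t}"
    have "openin (mtop M) L"
    proof (subst openin_subopen, intro ballI)
      fix p assume p: "p \<in> L"
      then obtain T where "openin (mtop M) T" "p \<in> T" "\<forall>q\<in>T. V q = t"
        using constant_on_region[OF crit I0 \<open>open I\<close> tI] by (auto simp: L_def)
      then show "\<exists>T. openin (mtop M) T \<and> p \<in> T \<and> T \<subseteq> L"
        using openin_subset by (intro exI[of _ T]) (auto simp: L_def)
    qed
    moreover have "closedin (mtop M) L"
    proof -
      have "closedin (mtop M) {p \<in> topspace (mtop M). V p \<in> {t}}"
        by (rule closedin_continuous_map_preimage[OF continuous_V]) simp
      then show ?thesis by (simp add: L_def)
    qed
    moreover have "L \<noteq> {}"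
    proof -
      have conn: "connected (V ` topspace (mtop M))"
        using connectedin_continuous_map_image[OF continuous_V, of "topspace (mtop M)"] A.connected
        by (simp add: connectedin_topspace)
      \<comment> \<open>\<open>closed_manifold\<close> admits the empty space, but an empty end
        would make \<open>M\<close> compact.\<close>
      have "topspace (mtop Sig) \<noteq> {}"
      proof
        assume "topspace (mtop Sig) = {}"
        then have "topspace (mtop ?E) = {}" by (simp add: end_mfd_def prod_mfd_def)
        then have "compactin (mtop M) (topspace (mtop M))" using cpt[of 0] by simp
        then show False using A.noncompact by (simp add: compact_space_def)
      qed
      then obtain \<sigma> where "\<sigma> \<in> topspace (mtop Sig)" by blast
      \<comment> \<open>A point so far out that \<open>V \<ge> \<rho> - 1 \<ge> 1\<close> holds
        there; with \<open>V = 0\<close> at the horizon point, connectedness yields the value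
        \<open>t\<close> in between.\<close>
      then have e: "(\<sigma>, max (\<rho>\<^sub>0 + 1) (max R\<^sub>0 2)) \<in> topspace (mtop ?E)"
        by (simp add: end_mfd_def prod_mfd_def euclidean_mfd_def)
      let ?e = "(\<sigma>, max (\<rho>\<^sub>0 + 1) (max R\<^sub>0 2))"
      have "1 \<le> V (\<Phi> ?e)" using R0[OF e] by simp
      moreover have "\<Phi> ?e \<in> topspace (mtop M)"
        using \<Phi> e unfolding diffeo_def open_submfd_def by (auto simp: bij_betw_def)
      moreover have "V p\<^sub>0 = 0" "p\<^sub>0 \<in> topspace (mtop M)" using V0 p0 btop by auto
      ultimately have "t \<in> V ` topspace (mtop M)"
        using connectedD_interval[OF conn, of "V p\<^sub>0" "V (\<Phi> ?e)" t] t01 by force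
      then show ?thesis by (auto simp: L_def)
    qed
    ultimately have "L = topspace (mtop M)"
      using A.connected unfolding connected_space_clopen_in by blast
    then have "p\<^sub>0 \<in> L" using p0 btop by blast
    then show False using V0[OF p0] t01 by (simp add: L_def)
  qed
qed

section \<open>Smoothness at the horizon\<close>

lemma circle_pt_inj:
  assumes "lam > 0"
  shows "inj_on (circle_pt lam) {a<..<a + 2 * pi * lam}"
proof (rule inj_onI)
  fix x y assume xy: "x \<in> {a<..<a + 2 * pi * lam}" "y \<in> {a<..<a + 2 * pi * lam}"
    and "circle_pt lam x = circle_pt lam y"
  then have "cis (x / lam) = cis (y / lam)" using assms by (simp add: circle_pt_def)
  then have "cis (x / lam) / cis (y / lam) = 1" by simp
  then have "cis (x / lam - y / lam) = 1" by (simp add: cis_divide)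
  then have "cos (x / lam - y / lam) = 1" by (metis cis.simps(1) one_complex.simps(1))
  then obtain n :: int where n: "x / lam - y / lam = of_int n * 2 * pi" using cos_one_2pi_int by blast
  then have "x - y = of_int n * (2 * pi * lam)" using assms by (simp add: field_simps)
  moreover have "\<bar>x - y\<bar> < 2 * pi * lam" using xy by auto
  ultimately have "\<bar>of_int n :: real\<bar> * (2 * pi * lam) < 1 * (2 * pi * lam)"
    using assms by (simp add: abs_mult)
  then have "\<bar>of_int n :: real\<bar> < 1" using assms by (simp add: mult_less_cancel_right)
  then have "n = 0" by linarith
  then show "x = y" using \<open>x - y = of_int n * (2 * pi * lam)\<close> by simp
qed

lemma circle_pt_image:
  assumes lam: "lam > 0"
  shows "circle_pt lam ` {a<..<a + 2 * pi * lam} = sphere 0 lam - {circle_pt lam a}"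
proof (rule subset_antisym; rule subsetI)
  fix s assume "s \<in> circle_pt lam ` {a<..<a + 2 * pi * lam}"
  then obtain x where x: "a < x" "x < a + 2 * pi * lam" "s = circle_pt lam x" by auto
  have "circle_pt lam x \<noteq> circle_pt lam a"
  proof
    assume eq: "circle_pt lam x = circle_pt lam a"
    \<comment> \<open>Shifting the interval to the left by \<open>d\<close> brings both
      \<open>a\<close> and \<open>x\<close> inside, where injectivity is known.\<close>
    define d where "d = min (x - a) (a + 2 * pi * lam - x) / 2"
    have d: "0 < d" "a - d < a" "x < a - d + 2 * pi * lam"
      using x by (auto simp: d_def min_def field_simps)
    then have "x = a"
      using inj_onD[OF circle_pt_inj[OF lam, of "a - d"] eq] x lam by auto
    then show False using x by simp
  qed
  then show "s \<in> sphere 0 lam - {circle_pt lam a}"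
    using x lam by (simp add: circle_pt_def norm_mult)
next
  fix s assume s: "s \<in> sphere 0 lam - {circle_pt lam a}"
  define z where "z = s / circle_pt lam a"
  have cn: "norm (circle_pt lam a) = lam" using lam by (simp add: circle_pt_def norm_mult)
  then have c0: "circle_pt lam a \<noteq> 0" using lam by auto
  have nz: "norm z = 1" using s cn lam by (simp add: z_def norm_divide)
  define u where "u = Arg2pi z"
  have zu: "z = cis u" using Arg2pi_eq[of z] nz by (simp add: u_def cis_conv_exp mult.commute)
  have u: "0 \<le> u" "u < 2 * pi" using Arg2pi[of z] by (auto simp: u_def)
  have "u \<noteq> 0"
  proof
    assume "u = 0"
    then have "z = 1" using zu by simp
    then show False using s c0 by (simp add: z_def)
  qed
  have "s = circle_pt lam (a + lam * u)"
  proof -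
    have "s = circle_pt lam a * z" using c0 by (simp add: z_def)
    also have "\<dots> = circle_pt lam a * cis u" by (simp only: zu)
    also have "\<dots> = of_real lam * cis (a / lam + u)" by (simp add: circle_pt_def cis_mult mult.assoc)
    also have "a / lam + u = (a + lam * u) / lam" using lam by (simp add: add_divide_distrib)
    finally show ?thesis by (simp add: circle_pt_def)
  qed
  then show "s \<in> circle_pt lam ` {a<..<a + 2 * pi * lam}"
    using u \<open>u \<noteq> 0\<close> lam by (intro image_eqI[of _ _ "a + lam * u"]) auto
qed

text \<open>The chain rule is used through curves: if one curve has two descriptions, the
  differentials agree on the velocities. Maps given in unrelated coordinates can then be compared
  without a transition map.\<close>

lemma curve_derivatives_agree:
  assumes J: "open J" "t \<in> J"
    and F: "(F has_derivative F') (at (c t) within S)" "(c has_vector_derivative u) (at t)" "c ` J \<subseteq> S"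
    and H: "(H has_derivative H') (at (d t) within R)" "(d has_vector_derivative w) (at t)" "d ` J \<subseteq> R"
    and eq: "\<And>s. s \<in> J \<Longrightarrow> F (c s) = H (d s)"
  shows "F' u = H' w"
proof -
  have "((\<lambda>s. F (c s)) has_vector_derivative F' u) (at t within J)"
    by (rule has_vector_derivative_along[OF F(1) has_vector_derivative_at_within[OF F(2)] F(3)])
  moreover have "((\<lambda>s. H (d s)) has_vector_derivative H' w) (at t within J)"
    by (rule has_vector_derivative_along[OF H(1) has_vector_derivative_at_within[OF H(2)] H(3)])
  ultimately have "((\<lambda>s. F (c s)) has_vector_derivative H' w) (at t within J)"
    "((\<lambda>s. F (c s)) has_vector_derivative F' u) (at t within J)"
    using has_vector_derivative_transform[OF J(2), of "\<lambda>s. F (c s)" "\<lambda>s. H (d s)"] eq by auto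
  then show ?thesis
    using vector_derivative_unique_at at_within_open[OF J(2,1)] by metis
qed

lemma open_preimage_curve:
  assumes "continuous_map (top_of_set J) T h" "open J" "openin T W"
  shows "open {t \<in> J. h t \<in> W}"
proof -
  have "openin (top_of_set J) {t \<in> topspace (top_of_set J). h t \<in> W}"
    by (rule openin_continuous_map_preimage[OF assms(1,3)])
  then show ?thesis using assms(2) openin_open_eq[OF assms(2)] by simp
qed

section \<open>The collapsed manifold near a point of a horizon\<close>

lemma open_embeddingD:
  assumes "open_embedding M N F"
  shows "continuous_map (mtop M) (mtop N) F" "inj_on F (topspace (mtop M))"
    "(U, \<phi>) \<in> atlas M \<Longrightarrow> (W, \<psi>) \<in> atlas N \<Longrightarrow> U \<subseteq> topspace (mtop M) \<Longrightarrow>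
      smooth_on (\<phi> ` {q \<in> U. F q \<in> W}) (\<psi> \<circ> F \<circ> inv_into U \<phi>)"
    "(U, \<phi>) \<in> atlas M \<Longrightarrow> (W, \<psi>) \<in> atlas N \<Longrightarrow>
      smooth_on (\<psi> ` {q \<in> W \<inter> F ` topspace (mtop M). inv_into (topspace (mtop M)) F q \<in> U})
        (\<phi> \<circ> inv_into (topspace (mtop M)) F \<circ> inv_into (W \<inter> F ` topspace (mtop M)) \<psi>)"
proof -
  let ?I = "F ` topspace (mtop M)"
  have d: "bij_betw F (topspace (mtop M)) (topspace (mtop (open_submfd N ?I)))"
    "smooth_map M (open_submfd N ?I) F" "smooth_map (open_submfd N ?I) M (inv_into (topspace (mtop M)) F)"
    using assms unfolding open_embedding_def diffeo_def by auto
  show "continuous_map (mtop M) (mtop N) F"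
    using d(2) unfolding smooth_map_def open_submfd_def by (auto simp: continuous_map_in_subtopology)
  show "inj_on F (topspace (mtop M))" using d(1) by (simp add: bij_betw_def)
  have at: "(W \<inter> ?I, \<psi>) \<in> atlas (open_submfd N ?I)" if "(W, \<psi>) \<in> atlas N" for W \<psi>
    using that by (force simp: open_submfd_def)
  show "smooth_on (\<phi> ` {q \<in> U. F q \<in> W}) (\<psi> \<circ> F \<circ> inv_into U \<phi>)"
    if "(U, \<phi>) \<in> atlas M" "(W, \<psi>) \<in> atlas N" and U: "U \<subseteq> topspace (mtop M)"
  proof -
    have "smooth_on (\<phi> ` {q \<in> U. F q \<in> W \<inter> ?I}) (\<psi> \<circ> F \<circ> inv_into U \<phi>)"
      using d(2) that(1) at[OF that(2)] unfolding smooth_map_def by blast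
    moreover have "{q \<in> U. F q \<in> W \<inter> ?I} = {q \<in> U. F q \<in> W}" using U by auto
    ultimately show ?thesis by simp
  qed
  show "smooth_on (\<psi> ` {q \<in> W \<inter> ?I. inv_into (topspace (mtop M)) F q \<in> U})
        (\<phi> \<circ> inv_into (topspace (mtop M)) F \<circ> inv_into (W \<inter> ?I) \<psi>)"
    if "(U, \<phi>) \<in> atlas M" "(W, \<psi>) \<in> atlas N"
    using d(3) that(1) at[OF that(2)] unfolding smooth_map_def by blast
qed

text \<open>Fixes everything around one point \<open>p\<close> of one horizon \<open>C\<close>: a
  boundary chart of \<open>M\<close> with an identification \<open>L\<close> of its face, the
  collar, the disc map, the extended metric \<open>G\<close>, and a chart of \<open>X\<close> at the
  centre of the disc over \<open>p\<close>.\<close>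

locale horizon_collapse = riemannian_potential M g V
  for M :: "('a, real^3) mfd" and g V +
  fixes lam \<epsilon> :: real and C :: "'a set" and p :: 'a and U :: "'a set" and \<phi> :: "'a \<Rightarrow> real^3"
    and b :: "real^3" and L :: "real^3 \<Rightarrow> real^2" and X :: "('x, real^4) mfd"
    and \<pi> :: "complex \<times> 'a \<Rightarrow> 'x" and c :: "real \<times> 'a \<Rightarrow> 'a" and \<Psi> :: "complex \<times> 'a \<Rightarrow> 'x"
    and G :: "('x, real^4) metric_field" and W :: "'x set" and \<xi> :: "'x \<Rightarrow> real^4"
  assumes V_bdry: "defines_bdry M V"
    and pos: "lam > 0" "\<epsilon> > 0"
    and comp: "C \<in> connected_components_of (subtopology (mtop M) (bdry M))" "p \<in> C"
    and ch: "(U, \<phi>) \<in> atlas M" "p \<in> U" "b \<in> Basis" "openin (top_of_set {x. 0 \<le> x \<bullet> b}) (\<phi> ` U)"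
    and face: "\<And>q. q \<in> U \<Longrightarrow> \<phi> q \<bullet> b = 0 \<Longrightarrow> q \<in> bdry M"
    and L: "linear L" "bij_betw L {x. x \<bullet> b = 0} UNIV"
    and X: "smooth_manifold X"
    and \<pi>_cont: "continuous_map (prod_topology (mtop (circle lam)) (mtop M)) (mtop X) \<pi>"
    and \<pi>_bdry: "\<And>s t q. s \<in> sphere 0 lam \<Longrightarrow> t \<in> sphere 0 lam \<Longrightarrow> q \<in> bdry M \<Longrightarrow>
      q \<in> topspace (mtop M) \<Longrightarrow> \<pi> (s, q) = \<pi> (t, q)"
    and \<pi>_emb: "open_embedding (prod_mfd (circle lam) (inner_mfd M)) X \<pi>"
    and c_emb: "open_embedding
      (prod_mfd (euclidean_mfd {0..<\<epsilon>}) (open_submfd (bdry_mfd M :: ('a, real^2) mfd) C)) M c"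
    and c0: "\<And>q. q \<in> C \<Longrightarrow> c (0, q) = q"
    and \<Psi>_emb: "open_embedding
      (prod_mfd (euclidean_mfd (ball (0::complex) \<epsilon>)) (open_submfd (bdry_mfd M :: ('a, real^2) mfd) C)) X \<Psi>"
    and polar: "\<And>r t q. r \<in> {0..<\<epsilon>} \<Longrightarrow> q \<in> C \<Longrightarrow>
      \<Psi> (of_real r * cis t, q) = \<pi> (of_real lam * cis t, c (r, q))"
    and G: "riemannian_metric X G" "is_static_metric lam M g V X \<pi> G"
    and W: "(W, \<xi>) \<in> atlas X" "\<Psi> (0, p) \<in> W"
begin

lemma component_subset: "C \<subseteq> bdry M" "C \<subseteq> topspace (mtop M)"
  using connected_components_of_subset[OF comp(1)] by auto

lemma V_nonneg: "q \<in> topspace (mtop M) \<Longrightarrow> 0 \<le> V q"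
  using V_bdry unfolding defines_bdry_def by (cases "q \<in> bdry M") (auto simp: less_imp_le)

lemma V_zero: "q \<in> bdry M \<Longrightarrow> V q = 0"
  using V_bdry unfolding defines_bdry_def by blast

text \<open>A boundary point is a boundary point in every chart, as \<open>V\<close> has a minimum with nonzero
  differential there.\<close>

lemma bdry_face:
  assumes "q \<in> U" "q \<in> bdry M"
  shows "\<phi> q \<bullet> b = 0"
proof (rule ccontr)
  let ?f = "V \<circ> inv_into U \<phi>" and ?S = "interior (\<phi> ` U)"
  assume "\<phi> q \<bullet> b \<noteq> 0"
  then have x: "\<phi> q \<in> ?S" using half_space_interior[OF ch(3,4)] assms(1) by blast
  have fd: "(?f has_derivative dd (\<phi> ` U) ?f (\<phi> q)) (at (\<phi> q))"
    using has_derivative_pot[OF ch(1) assms(1)] at_within_interior[OF x] by (simp add: dV_def)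
  have "dd (\<phi> ` U) ?f (\<phi> q) = (\<lambda>v. 0)"
  proof (rule differential_zero_maxmin[OF x open_interior fd])
    have "?f (\<phi> q) \<le> ?f y" if "y \<in> ?S" for y
    proof -
      have "y \<in> \<phi> ` U" using that interior_subset by blast
      then have "inv_into U \<phi> y \<in> topspace (mtop M)"
        using chart_subset[OF ch(1)] by (meson inv_into_into subsetD)
      then show ?thesis using V_nonneg V_zero[OF assms(2)] chart_inv[OF ch(1) assms(1)] by simp
    qed
    then show "(\<forall>y\<in>?S. ?f y \<le> ?f (\<phi> q)) \<or> (\<forall>y\<in>?S. ?f (\<phi> q) \<le> ?f y)" by blast
  qed
  moreover have "\<exists>u. dd (\<phi> ` U) ?f (\<phi> q) u \<noteq> 0"
    using V_bdry ch(1) assms unfolding defines_bdry_def by blast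
  ultimately show False by simp
qed

abbreviation "Cm \<equiv> open_submfd (bdry_mfd M :: ('a, real^2) mfd) C"
abbreviation "N1 \<equiv> prod_mfd (euclidean_mfd {0..<\<epsilon>}) Cm"
abbreviation "N2 \<equiv> prod_mfd (euclidean_mfd (ball (0::complex) \<epsilon>)) Cm"
abbreviation "N3 \<equiv> prod_mfd (circle lam) (inner_mfd M)"

definition "Ub = U \<inter> bdry M \<inter> C"
definition "\<zeta> = L \<circ> \<phi>"

lemma mtop_Cm: "mtop Cm = subtopology (mtop M) C"
  using component_subset by (simp add: open_submfd_def bdry_mfd_def subtopology_subtopology Int_absorb1)

lemma tops: "topspace (mtop N1) = {0..<\<epsilon>} \<times> C" "topspace (mtop N2) = ball 0 \<epsilon> \<times> C"
  "topspace (mtop N3) = sphere 0 lam \<times> (topspace (mtop M) - bdry M)"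
  using component_subset unfolding prod_mfd_def euclidean_mfd_def circle_def inner_mfd_def
  by (auto simp: mtop_Cm[simplified] open_submfd_def bdry_mfd_def)

lemma chart_Cm: "(Ub, \<zeta>) \<in> atlas Cm"
proof -
  have "(U \<inter> bdry M, L \<circ> \<phi>) \<in> atlas (bdry_mfd M :: ('a, real^2) mfd)"
    unfolding bdry_mfd_def using ch L by auto
  then show ?thesis unfolding Ub_def \<zeta>_def open_submfd_def by force
qed

lemma charts: "({0..<\<epsilon>} \<times> Ub, map_prod (\<lambda>x. x) \<zeta>) \<in> atlas N1"
  "(ball 0 \<epsilon> \<times> Ub, map_prod (\<lambda>x. x) \<zeta>) \<in> atlas N2"
  using chart_Cm by (auto simp: prod_mfd_def euclidean_mfd_def)

lemma inj_\<zeta>: "inj_on \<zeta> Ub"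
proof (rule inj_onI)
  fix q q' assume q: "q \<in> Ub" "q' \<in> Ub" "\<zeta> q = \<zeta> q'"
  then have "\<phi> q = \<phi> q'"
    using bdry_face inj_onD[OF bij_betw_imp_inj_on[OF L(2)]] by (simp add: \<zeta>_def Ub_def)
  then show "q = q'" using q chart_inv[OF ch(1)] unfolding Ub_def by (metis IntD1)
qed

lemma inv_chart: "q \<in> Ub \<Longrightarrow> x \<in> A \<Longrightarrow> inv_into (A \<times> Ub) (map_prod (\<lambda>x. x) \<zeta>) (x, \<zeta> q) = (x, q)"
proof -
  assume "q \<in> Ub" "x \<in> A"
  moreover have "inj_on (map_prod (\<lambda>x. x) \<zeta>) (A \<times> Ub)"
    using inj_\<zeta> by (auto simp: inj_on_def)
  ultimately show ?thesis
    using inv_into_f_f[of "map_prod (\<lambda>x. x) \<zeta>" "A \<times> Ub" "(x, q)"] by simp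
qed

lemma pUb: "p \<in> Ub" using ch comp component_subset by (auto simp: Ub_def)

text \<open>\<open>ch1\<close> and \<open>ch2\<close> are the collar and the disc map in
  coordinates, on the domains \<open>D1\<close> and \<open>D2\<close> of points whose images lie in
  the chosen target charts.\<close>

definition "D1 = map_prod (\<lambda>x. x) \<zeta> ` {x \<in> {0..<\<epsilon>} \<times> Ub. c x \<in> U}"
definition "ch1 = \<phi> \<circ> c \<circ> inv_into ({0..<\<epsilon>} \<times> Ub) (map_prod (\<lambda>x. x) \<zeta>)"
definition "D2 = map_prod (\<lambda>x. x) \<zeta> ` {x \<in> ball 0 \<epsilon> \<times> Ub. \<Psi> x \<in> W}"
definition "ch2 = \<xi> \<circ> \<Psi> \<circ> inv_into (ball 0 \<epsilon> \<times> Ub) (map_prod (\<lambda>x. x) \<zeta>)"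

lemma smooth_ch1: "smooth_on D1 ch1"
  unfolding D1_def ch1_def
  by (rule open_embeddingD(3)[OF c_emb charts(1) ch(1)]) (auto simp: tops Ub_def)

lemma smooth_ch2: "smooth_on D2 ch2"
  unfolding D2_def ch2_def
  by (rule open_embeddingD(3)[OF \<Psi>_emb charts(2) W(1)]) (auto simp: tops Ub_def)

lemma ch1_eq: "q \<in> Ub \<Longrightarrow> r \<in> {0..<\<epsilon>} \<Longrightarrow> ch1 (r, \<zeta> q) = \<phi> (c (r, q))"
  by (simp add: ch1_def inv_chart)

lemma ch2_eq: "q \<in> Ub \<Longrightarrow> z \<in> ball 0 \<epsilon> \<Longrightarrow> ch2 (z, \<zeta> q) = \<xi> (\<Psi> (z, q))"
  by (simp only: ch2_def inv_chart o_apply)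

lemma in_D1: "q \<in> Ub \<Longrightarrow> r \<in> {0..<\<epsilon>} \<Longrightarrow> c (r, q) \<in> U \<Longrightarrow> (r, \<zeta> q) \<in> D1"
  unfolding D1_def by (rule image_eqI[of _ _ "(r, q)"]) auto

lemma in_D2: "q \<in> Ub \<Longrightarrow> z \<in> ball 0 \<epsilon> \<Longrightarrow> \<Psi> (z, q) \<in> W \<Longrightarrow> (z, \<zeta> q) \<in> D2"
  unfolding D2_def by (rule image_eqI[of _ _ "(z, q)"]) auto

lemma cont_c: "continuous_map (prod_topology (top_of_set {0..<\<epsilon>}) (subtopology (mtop M) C)) (mtop M) c"
  using open_embeddingD(1)[OF c_emb] unfolding prod_mfd_def euclidean_mfd_def
  by (simp add: mtop_Cm[simplified])

lemma cont_\<Psi>: "continuous_map (prod_topology (top_of_set (ball 0 \<epsilon>)) (subtopology (mtop M) C)) (mtop X) \<Psi>"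
  using open_embeddingD(1)[OF \<Psi>_emb] unfolding prod_mfd_def euclidean_mfd_def
  by (simp add: mtop_Cm[simplified])

text \<open>Over a boundary point the circle is collapsed, so \<open>\<Psi>\<close> would send the
  distinct disc points r and -r over \<open>q\<close> to the same point.\<close>

lemma c_interior:
  assumes "q \<in> C" "0 < r" "r < \<epsilon>"
  shows "c (r, q) \<in> topspace (mtop M) - bdry M"
proof -
  have cM: "c (r, q) \<in> topspace (mtop M)"
    using cont_c assms component_subset by (auto simp: continuous_map_def Pi_iff)
  moreover have "c (r, q) \<notin> bdry M"
  proof
    assume b: "c (r, q) \<in> bdry M"
    have r: "r \<in> {0..<\<epsilon>}" using assms by simp
    have "\<Psi> (of_real r * cis 0, q) = \<Psi> (of_real r * cis pi, q)"
      unfolding polar[OF r assms(1)]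
      by (rule \<pi>_bdry[OF _ _ b cM]) (use pos in \<open>simp_all add: norm_mult\<close>)
    then have "(of_real r * cis 0, q) = (of_real r * cis pi, q)"
      using assms by (intro inj_onD[OF open_embeddingD(2)[OF \<Psi>_emb]]) (auto simp: tops norm_mult)
    then show False using assms by simp
  qed
  ultimately show ?thesis by simp
qed

text \<open>A straight segment in the face consists of boundary points; being connected and
  containing \<open>p\<close>, it stays in the component \<open>C\<close>.\<close>

lemma face_curve:
  assumes w: "w \<bullet> b = 0"
  obtains d q where "d > 0" "\<And>s. s \<in> {-d<..<d} \<Longrightarrow> q s \<in> Ub \<and> \<phi> (q s) = \<phi> p + s *\<^sub>R w" "q 0 = p"
    "continuous_map (top_of_set {-d<..<d}) (subtopology (mtop M) C) q"
proof -
  obtain T where T: "open T" "\<phi> ` U = {x. 0 \<le> x \<bullet> b} \<inter> T" using ch(4) openin_open by blast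
  have pb: "\<phi> p \<bullet> b = 0" using bdry_face ch(2) comp(2) component_subset by blast
  have "open ((\<lambda>s. \<phi> p + s *\<^sub>R w) -` T)"
    by (intro open_vimage T(1) continuous_intros)
  moreover have "0 \<in> (\<lambda>s. \<phi> p + s *\<^sub>R w) -` T" using T ch(2) by auto
  ultimately obtain d where d: "d > 0" "ball 0 d \<subseteq> (\<lambda>s. \<phi> p + s *\<^sub>R w) -` T"
    using open_contains_ball by blast
  define q where "q s = inv_into U \<phi> (\<phi> p + s *\<^sub>R w)" for s
  have inS: "\<phi> p + s *\<^sub>R w \<in> \<phi> ` U" if "s \<in> {-d<..<d}" for s
    using subsetD[OF d(2), of s] that pb w by (auto simp: T(2) inner_add_left)
  have q: "q s \<in> U" "\<phi> (q s) = \<phi> p + s *\<^sub>R w" if "s \<in> {-d<..<d}" for s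
    using inS[OF that] by (auto simp: q_def intro: inv_into_into f_inv_into_f)
  have qb: "q s \<in> bdry M" if "s \<in> {-d<..<d}" for s
    using face[OF q(1)[OF that]] q(2)[OF that] pb w by (simp add: inner_add_left)
  have "continuous_map (top_of_set {-d<..<d}) (top_of_set (\<phi> ` U)) (\<lambda>s. \<phi> p + s *\<^sub>R w)"
    using inS by (auto simp: continuous_map_in_subtopology intro!: continuous_intros)
  from continuous_map_compose[OF this chart_mapD(5)[OF chart[OF ch(1)]]]
  have qc: "continuous_map (top_of_set {-d<..<d}) (mtop M) q" by (simp add: q_def[abs_def] o_def)
  then have "continuous_map (top_of_set {-d<..<d}) (subtopology (mtop M) (bdry M)) q"
    using qb by (auto simp: continuous_map_in_subtopology)
  moreover have "connectedin (top_of_set {-d<..<d}) {-d<..<d}"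
    by (simp add: connectedin_subtopology)
  ultimately have "connectedin (subtopology (mtop M) (bdry M)) (q ` {-d<..<d})"
    using connectedin_continuous_map_image by blast
  moreover have q0: "q 0 = p" using chart_inv[OF ch(1,2)] by (simp add: q_def)
  moreover have "p \<in> q ` {-d<..<d}" using q0 d(1) by (metis greaterThanLessThan_iff image_eqI neg_less_0_iff_less)
  ultimately have "q ` {-d<..<d} \<subseteq> C"
    using connected_components_of_maximal[OF comp(1)] comp(2) by (metis disjnt_iff)
  then have "q s \<in> Ub \<and> \<phi> (q s) = \<phi> p + s *\<^sub>R w" if "s \<in> {-d<..<d}" for s
    using q[OF that] qb[OF that] that by (auto simp: Ub_def)
  moreover have "continuous_map (top_of_set {-d<..<d}) (subtopology (mtop M) C) q"
    using qc \<open>q ` {-d<..<d} \<subseteq> C\<close> by (auto simp: continuous_map_in_subtopology)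
  ultimately show thesis using that d(1) q0 by blast
qed

end

lemma continuous_on_bilinear_form:
  fixes B :: "'t::topological_space \<Rightarrow> 'e::euclidean_space \<Rightarrow> 'e \<Rightarrow> real"
  assumes "\<And>i j. continuous_on S (\<lambda>x. B x i j)" "\<And>x. x \<in> S \<Longrightarrow> bilinear (B x)"
    "continuous_on S u" "continuous_on S v"
  shows "continuous_on S (\<lambda>x. B x (u x) (v x))"
proof (rule continuous_on_eq)
  show "continuous_on S (\<lambda>x. \<Sum>(i, j)\<in>Basis \<times> Basis. (u x \<bullet> i) * ((v x \<bullet> j) * B x i j))"
    unfolding split_beta by (intro continuous_intros assms)
  fix x assume "x \<in> S"
  note bl = assms(2)[OF this]
  have "B x (u x) (v x) = B x (\<Sum>i\<in>Basis. (u x \<bullet> i) *\<^sub>R i) (\<Sum>j\<in>Basis. (v x \<bullet> j) *\<^sub>R j)"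
    by (simp add: euclidean_representation)
  then show "(\<Sum>(i, j)\<in>Basis \<times> Basis. (u x \<bullet> i) * ((v x \<bullet> j) * B x i j)) = B x (u x) (v x)"
    by (simp add: bilinear_sum[OF bl] bilinear_lmul[OF bl] bilinear_rmul[OF bl] mult.left_commute)
qed

text \<open>The identities near the horizon are known only for positive radius; the side
  \<open>f\<close> is continuous up to 0, while \<open>h\<close>, for instance with \<open>V\<close>
  divided by the radius, only has a limit.\<close>

lemma eq_at_left_endpoint:
  fixes f h :: "real \<Rightarrow> real"
  assumes "r > 0" "continuous_on {0..<r} f" "(h \<longlongrightarrow> l) (at_right 0)"
    "\<And>x. 0 < x \<Longrightarrow> x < r \<Longrightarrow> f x = h x"
  shows "f 0 = l"
proof (rule tendsto_unique)
  have "(f \<longlongrightarrow> f 0) (at 0 within {0..<r})"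
    using assms(1,2) by (auto simp: continuous_on_def)
  then show "(f \<longlongrightarrow> f 0) (at_right 0)" by (simp add: at_within_atLeastLessThan[OF assms(1)])
  have "\<forall>\<^sub>F x in at_right 0. h x = f x"
    using eventually_at_right[of 0 r] assms(1,4) by (auto simp: eventually_at_right_field)
  then show "(f \<longlongrightarrow> l) (at_right 0)"
    using assms(3) by (rule Lim_transform_eventually[rotated])
qed simp

section \<open>Comparison of the extended metric with the static metric near the centre\<close>

context horizon_collapse
begin

lemma small_radius:
  obtains r\<^sub>1 where "r\<^sub>1 > 0" "r\<^sub>1 \<le> \<epsilon>" "\<And>z. norm z < r\<^sub>1 \<Longrightarrow> \<Psi> (z, p) \<in> W"
    "\<And>r. r \<in> {0..<r\<^sub>1} \<Longrightarrow> c (r, p) \<in> U"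
proof -
  have pC: "p \<in> topspace (subtopology (mtop M) C)" using comp component_subset by auto
  have "continuous_map (top_of_set (ball 0 \<epsilon>)) (prod_topology (top_of_set (ball 0 \<epsilon>)) (subtopology (mtop M) C))
      (\<lambda>z. (z, p))"
    using pC by (intro continuous_map_pairedI) auto
  from continuous_map_compose[OF this cont_\<Psi>]
  have "continuous_map (top_of_set (ball 0 \<epsilon>)) (mtop X) (\<lambda>z. \<Psi> (z, p))" by (simp add: o_def)
  moreover have "openin (mtop X) W" by (rule chart_mapD(1)[OF smooth_manifold_chart(1)[OF X W(1)]])
  ultimately have "open {z \<in> ball 0 \<epsilon>. \<Psi> (z, p) \<in> W}"
    by (intro open_preimage_curve) auto
  moreover have "0 \<in> {z \<in> ball 0 \<epsilon>. \<Psi> (z, p) \<in> W}" using W pos by simp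
  ultimately obtain d1 where d1: "d1 > 0" "ball 0 d1 \<subseteq> {z \<in> ball 0 \<epsilon>. \<Psi> (z, p) \<in> W}"
    using open_contains_ball by blast
  have "continuous_map (top_of_set {0..<\<epsilon>}) (prod_topology (top_of_set {0..<\<epsilon>}) (subtopology (mtop M) C))
      (\<lambda>z. (z, p))"
    using pC by (intro continuous_map_pairedI) auto
  from continuous_map_compose[OF this cont_c]
  have "continuous_map (top_of_set {0..<\<epsilon>}) (mtop M) (\<lambda>r. c (r, p))" by (simp add: o_def)
  from openin_continuous_map_preimage[OF this chart_mapD(1)[OF chart[OF ch(1)]]]
  have "openin (top_of_set {0..<\<epsilon>}) {r \<in> {0..<\<epsilon>}. c (r, p) \<in> U}" by simp
  then obtain T where T: "open T" "{r \<in> {0..<\<epsilon>}. c (r, p) \<in> U} = {0..<\<epsilon>} \<inter> T"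
    using openin_open by blast
  have "0 \<in> {r \<in> {0..<\<epsilon>}. c (r, p) \<in> U}" using c0 comp ch pos by simp
  then have "0 \<in> T" using T by blast
  then obtain d2 where d2: "d2 > 0" "ball 0 d2 \<subseteq> T" using T open_contains_ball by blast
  show thesis
  proof (rule that[of "min \<epsilon> (min d1 d2)"])
    show "min \<epsilon> (min d1 d2) > 0" using d1 d2 pos by simp
    show "\<Psi> (z, p) \<in> W" if "norm z < min \<epsilon> (min d1 d2)" for z
      using subsetD[OF d1(2), of z] that by simp
    show "c (r, p) \<in> U" if "r \<in> {0..<min \<epsilon> (min d1 d2)}" for r
    proof -
      have "r \<in> ball 0 d2" using that by (auto simp: dist_real_def)
      then have "r \<in> {0..<\<epsilon>} \<inter> T" using that d2 by auto
      then show ?thesis using T(2) by blast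
    qed
  qed simp
qed

text \<open>\<open>K\<close> and \<open>dc\<close> are the differentials of \<open>\<Psi>\<close> and of the collar \<open>c\<close> over \<open>p\<close>, in charts.\<close>

definition "K z = dd D2 ch2 (z, \<zeta> p)"
definition "dc r = dd D1 ch1 (r, \<zeta> p)"
definition "pulled_metric z \<alpha> \<beta> = G \<xi> (\<Psi> (z, p)) (K z \<alpha>) (K z \<beta>)"

lemma K_derivative: "(z, \<zeta> p) \<in> D2 \<Longrightarrow> (ch2 has_derivative K z) (at (z, \<zeta> p) within D2)"
  unfolding K_def by (rule has_derivative_dd[OF smooth_on_differentiable[OF smooth_ch2]])

lemma dc_derivative: "(r, \<zeta> p) \<in> D1 \<Longrightarrow> (ch1 has_derivative dc r) (at (r, \<zeta> p) within D1)"
  unfolding dc_def by (rule has_derivative_dd[OF smooth_on_differentiable[OF smooth_ch1]])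

lemma inner_GX: "Q \<in> W \<Longrightarrow> inner_form (G \<xi> Q)"
  using G(1) W(1) unfolding riemannian_metric_def Ck_metric_def inner_form_def by blast

text \<open>The omitted point of the circle chart has angle \<open>t\<^sub>0 - pi\<close>, so
  \<open>lam * t\<^sub>0\<close> lies in the middle of \<open>I\<close>. In these coordinates
  \<open>h\<close> represents \<open>\<pi>\<close>, and its differential \<open>T\<close> pulls
  \<open>G\<close> back to the static metric.\<close>

lemma quotient_chart:
  fixes t\<^sub>0 :: real
  defines "a \<equiv> lam * (t\<^sub>0 - pi)"
  defines "I \<equiv> {a<..<a + 2 * pi * lam}"
  defines "Ui \<equiv> U \<inter> (topspace (mtop M) - bdry M)"
  obtains h T R where
    "\<forall>t\<in>I. \<forall>q\<in>Ui. h (t, \<phi> q) = \<xi> (\<pi> (circle_pt lam t, q)) \<and> (t, \<phi> q) \<in> R"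
    "\<forall>t\<in>I. \<forall>q\<in>Ui. \<pi> (circle_pt lam t, q) \<in> W \<longrightarrow>
      (h has_derivative T t q) (at (t, \<phi> q) within R)"
    "\<forall>t\<in>I. \<forall>q\<in>Ui. \<forall>u v. \<pi> (circle_pt lam t, q) \<in> W \<longrightarrow>
      G \<xi> (\<pi> (circle_pt lam t, q)) (T t q u) (T t q v) = (V q)\<^sup>2 * (fst u * fst v) + g \<phi> q (snd u) (snd v)"
proof -
  define \<theta> where "\<theta> = inv_into I (circle_pt lam)"
  define A where "A = sphere 0 lam - {circle_pt lam a}"
  have img: "circle_pt lam ` I = A" unfolding I_def A_def by (rule circle_pt_image[OF pos(1)])
  have inj: "inj_on (circle_pt lam) I" unfolding I_def by (rule circle_pt_inj[OF pos(1)])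
  have \<theta>: "\<theta> (circle_pt lam t) = t" if "t \<in> I" for t unfolding \<theta>_def using inj that by simp
  have inj\<theta>: "inj_on \<theta> A" unfolding \<theta>_def using inj_on_inv_into[of A "circle_pt lam" I] img by simp
  have \<theta>A: "\<theta> ` A = I" using img \<theta> by force
  have cA: "(A, \<theta>) \<in> atlas (circle lam)" by (auto simp: circle_def A_def \<theta>_def I_def)
  have cU: "(Ui, \<phi>) \<in> atlas (inner_mfd M)"
    using ch(1) unfolding inner_mfd_def open_submfd_def Ui_def by force
  let ?U3 = "A \<times> Ui" and ?f = "map_prod \<theta> \<phi>"
  have c3: "(?U3, ?f) \<in> atlas N3" using cA cU by (auto simp: prod_mfd_def)
  have injU: "inj_on \<phi> Ui" using chart_mapD(2)[OF chart[OF ch(1)]] by (auto simp: Ui_def inj_on_def)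
  define R where "R = ?f ` ?U3"
  have RI: "R = I \<times> \<phi> ` Ui" unfolding R_def map_prod_surj_on[OF \<theta>A refl] ..
  define h where "h = \<xi> \<circ> \<pi> \<circ> inv_into ?U3 ?f"
  have inv3: "inv_into ?U3 ?f (t, \<phi> q) = (circle_pt lam t, q)" if "t \<in> I" "q \<in> Ui" for t q
  proof -
    have tA: "circle_pt lam t \<in> A" using img that(1) by blast
    have "inj_on ?f ?U3" using inj\<theta> injU by (auto simp: inj_on_def)
    then have "inv_into ?U3 ?f (?f (circle_pt lam t, q)) = (circle_pt lam t, q)"
      using tA that(2) by (intro inv_into_f_f) auto
    then show ?thesis using \<theta>[OF that(1)] by simp
  qed
  \<comment> \<open>An expression for \<open>\<pi>\<close> in coordinates that uses
    \<open>circle_pt\<close> directly, hence is visibly continuous. It shows that the preimage of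
    \<open>W\<close> is relatively open.\<close>
  define k where "k y = \<pi> (circle_pt lam (fst y), inv_into U \<phi> (snd y))" for y
  have kR: "k (?f x) = \<pi> x" if x: "x \<in> ?U3" for x
  proof -
    obtain t where t: "t \<in> I" "fst x = circle_pt lam t" using img x by (metis imageE mem_Sigma_iff prod.collapse)
    then show ?thesis
      using x \<theta>[OF t(1)] chart_inv[OF ch(1), of "snd x"] by (cases x) (auto simp: k_def Ui_def)
  qed
  have ck: "continuous_map (top_of_set R) (mtop X) k"
  proof -
    have 1: "continuous_map (top_of_set R) (mtop (circle lam)) (\<lambda>y. circle_pt lam (fst y))"
    proof -
      have "continuous_on R (\<lambda>y. circle_pt lam (fst y))"
        unfolding circle_pt_def cis_conv_exp using pos(1) by (intro continuous_intros) auto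
      moreover have "circle_pt lam (fst y) \<in> sphere 0 lam" for y :: "real \<times> (real^3)"
        using pos(1) by (simp add: circle_pt_def norm_mult)
      ultimately show ?thesis by (auto simp: circle_def continuous_map_in_subtopology)
    qed
    have "continuous_map (top_of_set R) (top_of_set (\<phi> ` U)) snd"
      using RI by (auto simp: continuous_map_in_subtopology Ui_def intro!: continuous_intros)
    from continuous_map_compose[OF this chart_mapD(5)[OF chart[OF ch(1)]]]
    have 2: "continuous_map (top_of_set R) (mtop M) (\<lambda>y. inv_into U \<phi> (snd y))" by (simp add: o_def)
    from continuous_map_compose[OF continuous_map_pairedI[OF 1 2] \<pi>_cont]
    show ?thesis by (simp add: k_def[abs_def] o_def)
  qed
  have oW: "openin (mtop X) W" by (rule chart_mapD(1)[OF smooth_manifold_chart(1)[OF X W(1)]])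
  have "?f ` {x \<in> ?U3. \<pi> x \<in> W} = {y \<in> topspace (top_of_set R). k y \<in> W}"
    using kR by (auto simp: R_def)
  then have o: "openin (top_of_set (?f ` ?U3)) (?f ` {x \<in> ?U3. \<pi> x \<in> W})"
    using openin_continuous_map_preimage[OF ck oW] by (simp add: R_def)
  have U3: "?U3 \<subseteq> topspace (mtop N3)" by (auto simp: tops A_def Ui_def)
  have sm: "smooth_on (?f ` {x \<in> ?U3. \<pi> x \<in> W}) h"
    unfolding h_def by (rule open_embeddingD(3)[OF \<pi>_emb c3 W(1) U3])
  define T where "T t q = tmap ?U3 ?f \<xi> \<pi> (circle_pt lam t, q)" for t q
  have mem: "(circle_pt lam t, q) \<in> ?U3" if "t \<in> I" "q \<in> Ui" for t q using that img by auto
  show thesis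
  proof (rule that[of h R T]; intro ballI allI impI)
    fix t q assume tq: "t \<in> I" "q \<in> Ui"
    show "h (t, \<phi> q) = \<xi> (\<pi> (circle_pt lam t, q)) \<and> (t, \<phi> q) \<in> R"
      using tq by (simp add: h_def inv3 RI)
  next
    fix t q assume tq: "t \<in> I" "q \<in> Ui" and w: "\<pi> (circle_pt lam t, q) \<in> W"
    show "(h has_derivative T t q) (at (t, \<phi> q) within R)"
      using has_derivative_tmap_open[OF o sm[unfolded h_def] mem[OF tq] w] \<theta>[OF tq(1)]
      by (simp add: h_def T_def R_def)
  next
    fix t q u v assume tq: "t \<in> I" "q \<in> Ui" and w: "\<pi> (circle_pt lam t, q) \<in> W"
    have "product_metric (\<lambda>x. (V (snd x))\<^sup>2) flat_metric (\<lambda>_. 1) g ?f (circle_pt lam t, q) u v =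
        G \<xi> (\<pi> (circle_pt lam t, q)) (T t q u) (T t q v)"
      unfolding T_def by (rule is_pullbackD[OF G(2)[unfolded is_static_metric_def] c3 W(1) mem[OF tq] w])
    then show "G \<xi> (\<pi> (circle_pt lam t, q)) (T t q u) (T t q v) = (V q)\<^sup>2 * (fst u * fst v) + g \<phi> q (snd u) (snd v)"
      by (simp add: product_metric_def flat_metric_def)
  qed
qed

text \<open>By the polar relation between \<open>\<Psi>\<close> and \<open>\<pi>\<close>, the
  angular, radial and tangential curves through a point off the centre are curves of the product as
  well, where the static metric gives their lengths and products.\<close>

lemma pullback_identities:
  fixes t\<^sub>0 r r\<^sub>1 :: real
  assumes r: "0 < r" "r < r\<^sub>1" and r\<^sub>1: "r\<^sub>1 \<le> \<epsilon>" "\<And>z. norm z < r\<^sub>1 \<Longrightarrow> \<Psi> (z, p) \<in> W"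
    "\<And>r. r \<in> {0..<r\<^sub>1} \<Longrightarrow> c (r, p) \<in> U"
  defines "z \<equiv> of_real r * cis t\<^sub>0"
  shows "pulled_metric z (\<i> * cis t\<^sub>0, 0) (\<i> * cis t\<^sub>0, 0) = lam\<^sup>2 * (V (c (r, p)) / r)\<^sup>2" (is ?A)
    and "pulled_metric z (cis t\<^sub>0, 0) (cis t\<^sub>0, 0) = g \<phi> (c (r, p)) (dc r (1, 0)) (dc r (1, 0))" (is ?B)
    and "w \<bullet> b = 0 \<Longrightarrow> pulled_metric z (cis t\<^sub>0, 0) (0, L w) = g \<phi> (c (r, p)) (dc r (1, 0)) (dc r (0, L w))" (is "_ \<Longrightarrow> ?C")
proof -
  define a where "a = lam * (t\<^sub>0 - pi)"
  define I where "I = {a<..<a + 2 * pi * lam}"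
  define Ui where "Ui = U \<inter> (topspace (mtop M) - bdry M)"
  obtain h T R where
    h': "\<forall>t\<in>I. \<forall>q\<in>Ui. h (t, \<phi> q) = \<xi> (\<pi> (circle_pt lam t, q)) \<and> (t, \<phi> q) \<in> R" and
    T': "\<forall>t\<in>I. \<forall>q\<in>Ui. \<pi> (circle_pt lam t, q) \<in> W \<longrightarrow>
      (h has_derivative T t q) (at (t, \<phi> q) within R)" and
    GT': "\<forall>t\<in>I. \<forall>q\<in>Ui. \<forall>u v. \<pi> (circle_pt lam t, q) \<in> W \<longrightarrow>
      G \<xi> (\<pi> (circle_pt lam t, q)) (T t q u) (T t q v) = (V q)\<^sup>2 * (fst u * fst v) + g \<phi> q (snd u) (snd v)"
    unfolding a_def I_def Ui_def by (rule quotient_chart[of t\<^sub>0])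
  have h: "h (t, \<phi> q) = \<xi> (\<pi> (circle_pt lam t, q)) \<and> (t, \<phi> q) \<in> R" if "t \<in> I" "q \<in> Ui" for t q
    using h' that by blast
  have T: "(h has_derivative T t q) (at (t, \<phi> q) within R)"
    if "t \<in> I" "q \<in> Ui" "\<pi> (circle_pt lam t, q) \<in> W" for t q
    using T' that by blast
  have GT: "G \<xi> (\<pi> (circle_pt lam t, q)) (T t q u) (T t q v) = (V q)\<^sup>2 * (fst u * fst v) + g \<phi> q (snd u) (snd v)"
    if "t \<in> I" "q \<in> Ui" "\<pi> (circle_pt lam t, q) \<in> W" for t q u v
    using GT' that by blast
  have pC: "p \<in> C" by (rule comp(2))
  have rball: "of_real s * cis t \<in> ball 0 \<epsilon>" "norm (of_real s * cis t) < r\<^sub>1" if "0 \<le> s" "s < r\<^sub>1" for s t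
    using that r\<^sub>1(1) by (auto simp: norm_mult)
  have pol: "\<Psi> (of_real s * cis t, q) = \<pi> (circle_pt lam (lam * t), c (s, q))" if "0 \<le> s" "s < r\<^sub>1" "q \<in> C" for s t q
    using polar[of s q t] that r\<^sub>1(1) pos by (simp add: circle_pt_def)
  have lt: "lam * t \<in> I" if "t \<in> {t\<^sub>0 - pi<..<t\<^sub>0 + pi}" for t
  proof -
    have "lam * (t\<^sub>0 - pi) < lam * t" "lam * t < lam * (t\<^sub>0 + pi)"
      using that pos(1) by (auto intro: mult_strict_left_mono)
    moreover have "lam * (t\<^sub>0 + pi) = a + 2 * pi * lam" by (simp add: a_def algebra_simps)
    ultimately show ?thesis by (simp add: I_def a_def)
  qed
  have t0: "t\<^sub>0 \<in> {t\<^sub>0 - pi<..<t\<^sub>0 + pi}" by simp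
  have cUi: "c (s, p) \<in> Ui" if "0 < s" "s < r\<^sub>1" for s
    using c_interior[OF pC, of s] r\<^sub>1(3)[of s] that r\<^sub>1(1) by (auto simp: Ui_def)
  define m where "m = c (r, p)"
  have m: "m \<in> Ui" unfolding m_def by (rule cUi[OF r])
  have zW: "\<Psi> (z, p) \<in> W" "z \<in> ball 0 \<epsilon>" unfolding z_def using rball[of r t\<^sub>0] r r\<^sub>1(2) by auto
  have zD: "(z, \<zeta> p) \<in> D2" by (rule in_D2[OF pUb zW(2,1)])
  have z\<pi>: "\<Psi> (z, p) = \<pi> (circle_pt lam (lam * t\<^sub>0), m)"
    unfolding z_def m_def using pol[of r p t\<^sub>0] r pC by simp
  have \<pi>W: "\<pi> (circle_pt lam (lam * t\<^sub>0), m) \<in> W" using zW(1) z\<pi> by simp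
  note Tm = T[OF lt[OF t0] m \<pi>W]
  note GTm = GT[OF lt[OF t0] m \<pi>W]
  have pulled_metric_eq: "pulled_metric z \<alpha> \<beta> = (V m)\<^sup>2 * (fst u * fst v) + g \<phi> m (snd u) (snd v)"
    if "K z \<alpha> = T (lam * t\<^sub>0) m u" "K z \<beta> = T (lam * t\<^sub>0) m v" for \<alpha> \<beta> u v
    unfolding pulled_metric_def that using GTm z\<pi> by simp
  have g0: "g \<phi> m 0 0 = 0"
    using linear_0[OF inner_formD(1)[OF inner_g[OF ch(1), of m]]] m by (simp add: Ui_def)
  have rD1: "(r, \<zeta> p) \<in> D1" using r r\<^sub>1 by (intro in_D1[OF pUb]) auto
  \<comment> \<open>As the angle t varies, the disc point has velocity \<open>\<i> * z\<close>, and
    the arc length coordinate of the circle moves with speed \<open>lam\<close>.\<close>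
  have angular: "K z (\<i> * z, 0) = T (lam * t\<^sub>0) m (lam, 0)"
  proof (rule curve_derivatives_agree[where J = "{t\<^sub>0 - pi<..<t\<^sub>0 + pi}" and t = t\<^sub>0
        and c = "\<lambda>t. (of_real r * cis t, \<zeta> p)" and d = "\<lambda>t. (lam * t, \<phi> m)"])
    show "(ch2 has_derivative K z) (at (of_real r * cis t\<^sub>0, \<zeta> p) within D2)"
      using K_derivative[OF zD] by (simp add: z_def)
    show "((\<lambda>t. (of_real r * cis t, \<zeta> p)) has_vector_derivative (\<i> * z, 0)) (at t\<^sub>0)"
      unfolding z_def has_vector_derivative_def
      by (auto intro!: derivative_eq_intros simp: scaleR_conv_of_real algebra_simps)
    show "(\<lambda>t. (of_real r * cis t, \<zeta> p)) ` {t\<^sub>0 - pi<..<t\<^sub>0 + pi} \<subseteq> D2"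
      using rball[of r] r r\<^sub>1(2) by (auto intro!: in_D2[OF pUb])
    show "(h has_derivative T (lam * t\<^sub>0) m) (at (lam * t\<^sub>0, \<phi> m) within R)" by (rule Tm)
    show "((\<lambda>t. (lam * t, \<phi> m)) has_vector_derivative (lam, 0)) (at t\<^sub>0)"
      unfolding has_vector_derivative_def by (auto intro!: derivative_eq_intros)
    show "(\<lambda>t. (lam * t, \<phi> m)) ` {t\<^sub>0 - pi<..<t\<^sub>0 + pi} \<subseteq> R"
      using h lt m by blast
    fix s assume s: "s \<in> {t\<^sub>0 - pi<..<t\<^sub>0 + pi}"
    show "ch2 (of_real r * cis s, \<zeta> p) = h (lam * s, \<phi> m)"
      using ch2_eq[OF pUb rball(1)[of r s]] h[OF lt[OF s] m] pol[of r p s] r pC by (simp add: m_def)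
  qed auto
  have radial: "K z (cis t\<^sub>0, 0) = T (lam * t\<^sub>0) m (0, dc r (1, 0))"
  proof (rule curve_derivatives_agree[where J = "{0<..<r\<^sub>1}" and t = r
        and c = "\<lambda>s. (of_real s * cis t\<^sub>0, \<zeta> p)" and d = "\<lambda>s. (lam * t\<^sub>0, ch1 (s, \<zeta> p))"])
    have ch1s: "ch1 (s, \<zeta> p) = \<phi> (c (s, p))" if "0 \<le> s" "s < r\<^sub>1" for s
      using ch1_eq[OF pUb, of s] that r\<^sub>1(1) by simp
    show "(ch2 has_derivative K z) (at (of_real r * cis t\<^sub>0, \<zeta> p) within D2)"
      using K_derivative[OF zD] by (simp add: z_def)
    show "((\<lambda>s. (of_real s * cis t\<^sub>0, \<zeta> p)) has_vector_derivative (cis t\<^sub>0, 0)) (at r)"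
      unfolding has_vector_derivative_def
      by (auto intro!: derivative_eq_intros simp: scaleR_conv_of_real)
    show "(\<lambda>s. (of_real s * cis t\<^sub>0, \<zeta> p)) ` {0<..<r\<^sub>1} \<subseteq> D2"
      using rball r\<^sub>1(2) by (auto intro!: in_D2[OF pUb])
    show "(h has_derivative T (lam * t\<^sub>0) m) (at (lam * t\<^sub>0, ch1 (r, \<zeta> p)) within R)"
      using Tm ch1s[of r] r by (simp add: m_def)
    have "((\<lambda>s. (s, \<zeta> p)) has_vector_derivative (1, 0)) (at r within {0<..<r\<^sub>1})"
      unfolding has_vector_derivative_def by (auto intro!: derivative_eq_intros)
    then have "((\<lambda>s. ch1 (s, \<zeta> p)) has_vector_derivative dc r (1, 0)) (at r within {0<..<r\<^sub>1})"
      by (rule has_vector_derivative_along[where c = "\<lambda>s. (s, \<zeta> p)", OF dc_derivative[OF rD1]])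
        (use r\<^sub>1 in \<open>auto intro!: in_D1[OF pUb]\<close>)
    then have "((\<lambda>s. ch1 (s, \<zeta> p)) has_vector_derivative dc r (1, 0)) (at r)"
      using at_within_open[of r "{0<..<r\<^sub>1}"] r by simp
    then show "((\<lambda>s. (lam * t\<^sub>0, ch1 (s, \<zeta> p))) has_vector_derivative (0, dc r (1, 0))) (at r)"
      unfolding has_vector_derivative_def by (auto intro!: derivative_eq_intros)
    show "(\<lambda>s. (lam * t\<^sub>0, ch1 (s, \<zeta> p))) ` {0<..<r\<^sub>1} \<subseteq> R"
      using h[OF lt[OF t0] cUi] ch1s by auto
    fix s assume s: "s \<in> {0<..<r\<^sub>1}"
    show "ch2 (of_real s * cis t\<^sub>0, \<zeta> p) = h (lam * t\<^sub>0, ch1 (s, \<zeta> p))"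
      using ch2_eq[OF pUb rball(1)[of s t\<^sub>0]] h[OF lt[OF t0] cUi[of s]] pol[of s p t\<^sub>0] s pC ch1s[of s] by simp
  qed (use r in auto)
  show ?B
    using pulled_metric_eq[OF radial radial] by (simp add: m_def)
  show ?A
  proof -
    have linK: "linear (K z)" using K_derivative[OF zD] has_derivative_linear by blast
    \<comment> \<open>Rescaling the angular velocity to a unit vector of the disc produces the
      factor 1 / r for each argument.\<close>
    have "K z (\<i> * cis t\<^sub>0, 0) = K z ((1 / r) *\<^sub>R (\<i> * z, 0))"
      using r by (simp add: z_def scaleR_conv_of_real)
    also have "\<dots> = (1 / r) *\<^sub>R K z (\<i> * z, 0)" by (rule linear_scale[OF linK])
    finally have k: "K z (\<i> * cis t\<^sub>0, 0) = (1 / r) *\<^sub>R K z (\<i> * z, 0)" .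
    note lin = inner_formD(1,2)[OF inner_GX[OF zW(1)]]
    have "pulled_metric z (\<i> * cis t\<^sub>0, 0) (\<i> * cis t\<^sub>0, 0) = 1 / r * (1 / r * pulled_metric z (\<i> * z, 0) (\<i> * z, 0))"
      unfolding pulled_metric_def k by (simp add: linear_scale[OF lin(1)] linear_scale[OF lin(2)])
    also have "pulled_metric z (\<i> * z, 0) (\<i> * z, 0) = (V m)\<^sup>2 * (lam * lam)"
      using pulled_metric_eq[OF angular angular] g0 by simp
    finally show ?thesis using r by (simp add: m_def power2_eq_square)
  qed
  show ?C if w: "w \<bullet> b = 0"
  proof -
    obtain d q where d: "d > 0" and q: "\<And>s. s \<in> {-d<..<d} \<Longrightarrow> q s \<in> Ub \<and> \<phi> (q s) = \<phi> p + s *\<^sub>R w" "q 0 = p"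
      and qc: "continuous_map (top_of_set {-d<..<d}) (subtopology (mtop M) C) q"
      using face_curve[OF w] by blast
    \<comment> \<open>The times at which the tangential curve is covered by the charts
      \<open>W\<close> of \<open>X\<close> and \<open>U\<close> of \<open>M\<close>
      simultaneously.\<close>
    define J where "J = {s \<in> {-d<..<d}. \<Psi> (z, q s) \<in> W} \<inter> {s \<in> {-d<..<d}. c (r, q s) \<in> U}"
    have r\<epsilon>: "r \<in> {0..<\<epsilon>}" using r r\<^sub>1(1) by simp
    have "open J"
      unfolding J_def
    proof (intro open_Int open_preimage_curve)
      have "continuous_map (top_of_set {-d<..<d}) (prod_topology (top_of_set (ball 0 \<epsilon>)) (subtopology (mtop M) C)) (\<lambda>s. (z, q s))"
        using zW(2) by (intro continuous_map_pairedI qc) auto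
      from continuous_map_compose[OF this cont_\<Psi>]
      show "continuous_map (top_of_set {-d<..<d}) (mtop X) (\<lambda>s. \<Psi> (z, q s))" by (simp add: o_def)
      have "continuous_map (top_of_set {-d<..<d}) (prod_topology (top_of_set {0..<\<epsilon>}) (subtopology (mtop M) C)) (\<lambda>s. (r, q s))"
        using r\<epsilon> by (intro continuous_map_pairedI qc) auto
      from continuous_map_compose[OF this cont_c]
      show "continuous_map (top_of_set {-d<..<d}) (mtop M) (\<lambda>s. c (r, q s))" by (simp add: o_def)
      show "openin (mtop X) W" by (rule chart_mapD(1)[OF smooth_manifold_chart(1)[OF X W(1)]])
      show "openin (mtop M) U" by (rule chart_mapD(1)[OF chart[OF ch(1)]])
    qed auto
    have J0: "0 \<in> J" using d q(2) zW(1) r\<^sub>1(3)[of r] r by (simp add: J_def)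
    have Jq: "q s \<in> Ub" "q s \<in> C" "\<zeta> (q s) = \<zeta> p + s *\<^sub>R L w" "\<Psi> (z, q s) \<in> W" "c (r, q s) \<in> Ui" if "s \<in> J" for s
    proof -
      show "q s \<in> Ub" "\<Psi> (z, q s) \<in> W" using that q(1) by (auto simp: J_def)
      then show "q s \<in> C" by (simp add: Ub_def)
      have "\<phi> (q s) = \<phi> p + s *\<^sub>R w" using that q(1) by (auto simp: J_def)
      then show "\<zeta> (q s) = \<zeta> p + s *\<^sub>R L w"
        by (simp add: \<zeta>_def linear_add[OF L(1)] linear_scale[OF L(1)])
      show "c (r, q s) \<in> Ui"
        using that c_interior[OF \<open>q s \<in> C\<close>, of r] r r\<^sub>1(1) by (auto simp: J_def Ui_def)
    qed
    have "K z (0, L w) = T (lam * t\<^sub>0) m (0, dc r (0, L w))"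
    proof (rule curve_derivatives_agree[where J = J and t = 0
          and c = "\<lambda>s. (z, \<zeta> p + s *\<^sub>R L w)" and d = "\<lambda>s. (lam * t\<^sub>0, ch1 (r, \<zeta> p + s *\<^sub>R L w))"])
      have ch1s: "ch1 (r, \<zeta> p + s *\<^sub>R L w) = \<phi> (c (r, q s))" if "s \<in> J" for s
        using ch1_eq[OF Jq(1)[OF that] r\<epsilon>] Jq(3)[OF that] by simp
      show "(ch2 has_derivative K z) (at (z, \<zeta> p + 0 *\<^sub>R L w) within D2)"
        using K_derivative[OF zD] by simp
      show "((\<lambda>s. (z, \<zeta> p + s *\<^sub>R L w)) has_vector_derivative (0, L w)) (at 0)"
        unfolding has_vector_derivative_def by (auto intro!: derivative_eq_intros)
      show "(\<lambda>s. (z, \<zeta> p + s *\<^sub>R L w)) ` J \<subseteq> D2"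
        using in_D2[OF Jq(1) zW(2) Jq(4)] Jq(3) by auto
      show "(h has_derivative T (lam * t\<^sub>0) m) (at (lam * t\<^sub>0, ch1 (r, \<zeta> p + 0 *\<^sub>R L w)) within R)"
        using Tm ch1s[OF J0] by (simp add: m_def q(2))
      have "((\<lambda>s. (r, \<zeta> p + s *\<^sub>R L w)) has_vector_derivative (0, L w)) (at 0 within J)"
        unfolding has_vector_derivative_def by (auto intro!: derivative_eq_intros)
      then have "((\<lambda>s. ch1 (r, \<zeta> p + s *\<^sub>R L w)) has_vector_derivative dc r (0, L w)) (at 0 within J)"
      proof (rule has_vector_derivative_along[where c = "\<lambda>s. (r, \<zeta> p + s *\<^sub>R L w)", rotated])
        show "(\<lambda>s. (r, \<zeta> p + s *\<^sub>R L w)) ` J \<subseteq> D1"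
          using in_D1[OF Jq(1) r\<epsilon>] Jq(3,5) by (auto simp: Ui_def)
        show "(ch1 has_derivative dc r) (at (r, \<zeta> p + 0 *\<^sub>R L w) within D1)"
          using dc_derivative[OF rD1] by simp
      qed
      then have "((\<lambda>s. ch1 (r, \<zeta> p + s *\<^sub>R L w)) has_vector_derivative dc r (0, L w)) (at 0)"
        by (simp only: at_within_open[OF J0 \<open>open J\<close>])
      then show "((\<lambda>s. (lam * t\<^sub>0, ch1 (r, \<zeta> p + s *\<^sub>R L w))) has_vector_derivative (0, dc r (0, L w))) (at 0)"
        unfolding has_vector_derivative_def by (auto intro!: derivative_eq_intros)
      show "(\<lambda>s. (lam * t\<^sub>0, ch1 (r, \<zeta> p + s *\<^sub>R L w))) ` J \<subseteq> R"
        using h[OF lt[OF t0] Jq(5)] ch1s by auto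
      fix s assume s: "s \<in> J"
      show "ch2 (z, \<zeta> p + s *\<^sub>R L w) = h (lam * t\<^sub>0, ch1 (r, \<zeta> p + s *\<^sub>R L w))"
        using ch2_eq[OF Jq(1)[OF s] zW(2)] h[OF lt[OF t0] Jq(5)[OF s]] pol[of r "q s" t\<^sub>0] r Jq(2,3)[OF s] ch1s[OF s]
        by (simp add: z_def)
    qed (use \<open>open J\<close> J0 in auto)
    then show ?thesis
      using pulled_metric_eq[OF radial] by (simp add: m_def)
  qed
qed

text \<open>\<open>\<Psi>\<close> has a smooth inverse on its image. Composed with it, the real
  diameter of the disc over \<open>p\<close> returns to itself, with velocity \<open>(1, 0)\<close>;
  a vanishing image velocity would make this 0.\<close>

lemma K_nonzero: "K 0 (1, 0) \<noteq> 0"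
proof
  assume K0: "K 0 (1, 0) = 0"
  obtain r\<^sub>1 where r\<^sub>1: "r\<^sub>1 > 0" "r\<^sub>1 \<le> \<epsilon>" "\<And>z. norm z < r\<^sub>1 \<Longrightarrow> \<Psi> (z, p) \<in> W"
    using small_radius by metis
  define Im where "Im = \<Psi> ` topspace (mtop N2)"
  define \<Psi>' where "\<Psi>' = inv_into (topspace (mtop N2)) \<Psi>"
  let ?m = "map_prod (\<lambda>x. x) \<zeta> :: complex \<times> 'a \<Rightarrow> complex \<times> (real^2)"
  define Z where "Z = \<xi> ` {q \<in> W \<inter> Im. \<Psi>' q \<in> ball 0 \<epsilon> \<times> Ub}"
  define hh where "hh = ?m \<circ> \<Psi>' \<circ> inv_into (W \<inter> Im) \<xi>"
  have sm: "smooth_on Z hh"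
    unfolding Z_def hh_def Im_def \<Psi>'_def by (rule open_embeddingD(4)[OF \<Psi>_emb charts(2) W(1)])
  have inj: "inj_on \<xi> (W \<inter> Im)"
    using chart_mapD(2)[OF smooth_manifold_chart(1)[OF X W(1)]] by (auto simp: inj_on_def)
  let ?J = "{-r\<^sub>1<..<r\<^sub>1}"
  let ?c = "\<lambda>s. (of_real s :: complex, \<zeta> p)"
  have ball: "(of_real s :: complex) \<in> ball 0 \<epsilon>" "\<Psi> (of_real s, p) \<in> W" if "s \<in> ?J" for s
    using that r\<^sub>1(2) r\<^sub>1(3)[of "of_real s"] by auto
  have pT: "(of_real s :: complex, p) \<in> topspace (mtop N2)" if "s \<in> ?J" for s
    using ball(1)[OF that] comp(2) by (simp add: tops)
  have \<Psi>': "\<Psi>' (\<Psi> (of_real s, p)) = (of_real s, p)" if "s \<in> ?J" for s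
    unfolding \<Psi>'_def by (rule inv_into_f_f[OF open_embeddingD(2)[OF \<Psi>_emb] pT[OF that]])
  have Q: "\<Psi> (of_real s, p) \<in> {q \<in> W \<inter> Im. \<Psi>' q \<in> ball 0 \<epsilon> \<times> Ub}" if "s \<in> ?J" for s
    using ball[OF that] pT[OF that] \<Psi>'[OF that] pUb by (auto simp: Im_def)
  have c2: "ch2 (?c s) = \<xi> (\<Psi> (of_real s, p))" if "s \<in> ?J" for s
    by (rule ch2_eq[OF pUb ball(1)[OF that]])
  have Zc: "ch2 (?c s) \<in> Z" if "s \<in> ?J" for s
    unfolding c2[OF that] Z_def using Q[OF that] by (rule imageI)
  have hc: "hh (ch2 (?c s)) = ?c s" if "s \<in> ?J" for s
  proof -
    have "inv_into (W \<inter> Im) \<xi> (ch2 (?c s)) = \<Psi> (of_real s, p)"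
      unfolding c2[OF that] using Q[OF that] by (intro inv_into_f_f[OF inj]) blast
    then show ?thesis by (simp add: hh_def \<Psi>'[OF that])
  qed
  have J0: "0 \<in> ?J" using r\<^sub>1 by simp
  have D2: "?c ` ?J \<subseteq> D2" using in_D2[OF pUb ball] by blast
  have cd: "(?c has_vector_derivative (1, 0)) (at 0)"
    unfolding has_vector_derivative_def by (auto intro!: derivative_eq_intros simp: scaleR_conv_of_real)
  have "(ch2 has_derivative K 0) (at (?c 0) within D2)"
  proof -
    have "?c 0 \<in> D2" using D2 J0 by blast
    then show ?thesis using K_derivative[of 0] by simp
  qed
  from has_vector_derivative_along[OF this has_vector_derivative_at_within[OF cd] D2]
  have "((\<lambda>s. ch2 (?c s)) has_vector_derivative 0) (at 0 within ?J)" by (simp add: K0)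
  then have d: "((\<lambda>s. ch2 (?c s)) has_vector_derivative 0) (at 0)"
    using at_within_open[OF J0] by simp
  have "(\<lambda>v. v) (1, 0) = dd Z hh (ch2 (?c 0)) 0"
  proof (rule curve_derivatives_agree[OF _ J0 _ cd _ _ d])
    show "((\<lambda>v. v) has_derivative (\<lambda>v. v)) (at (?c 0) within UNIV)" by (rule has_derivative_ident)
    show "(hh has_derivative dd Z hh (ch2 (?c 0))) (at (ch2 (?c 0)) within Z)"
      by (rule has_derivative_dd[OF smooth_on_differentiable[OF sm] Zc[OF J0]])
    show "(\<lambda>s. ch2 (?c s)) ` ?J \<subseteq> Z" using Zc by blast
  qed (use hc in auto)
  moreover have "dd Z hh (ch2 (?c 0)) 0 = 0"
    using linear_0[OF linear_dd[OF smooth_on_differentiable[OF sm] Zc[OF J0]]] .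
  ultimately show False by (simp add: zero_prod_def)
qed

text \<open>The collar is the identity at radius 0, so in coordinates it undoes the identification
  \<open>L\<close> of the face.\<close>

lemma dc_tangential:
  assumes w: "w \<bullet> b = 0"
  shows "dc 0 (0, L w) = w"
proof -
  obtain d q where d: "d > 0" and q: "\<And>s. s \<in> {-d<..<d} \<Longrightarrow> q s \<in> Ub \<and> \<phi> (q s) = \<phi> p + s *\<^sub>R w" "q 0 = p"
    using face_curve[OF w] by metis
  let ?J = "{-d<..<d}"
  have J0: "0 \<in> ?J" using d by simp
  have \<zeta>q: "\<zeta> (q s) = \<zeta> p + s *\<^sub>R L w" if "s \<in> ?J" for s
    using q(1)[OF that] by (simp add: \<zeta>_def linear_add[OF L(1)] linear_scale[OF L(1)])
  have e: "(0::real) \<in> {0..<\<epsilon>}" using pos by simp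
  have qC: "q s \<in> C" "q s \<in> U" if "s \<in> ?J" for s using q(1)[OF that] by (auto simp: Ub_def)
  show ?thesis
  proof (rule curve_derivatives_agree[where J = ?J and t = 0 and F = ch1 and S = D1
        and c = "\<lambda>s. (0, \<zeta> p + s *\<^sub>R L w)" and u = "(0, L w)" and H = "\<lambda>v. v" and H' = "\<lambda>v. v"
        and R = UNIV and d = "\<lambda>s. \<phi> p + s *\<^sub>R w" and w = w])
    show sub: "(\<lambda>s. (0, \<zeta> p + s *\<^sub>R L w)) ` ?J \<subseteq> D1"
      using in_D1[OF _ e] q(1) c0[OF qC(1)] qC(2) \<zeta>q by (force simp flip: \<zeta>q)
    have "(0, \<zeta> p) \<in> D1" using in_D1[OF pUb e] c0[OF comp(2)] ch(2) by simp
    then show "(ch1 has_derivative dc 0) (at (0, \<zeta> p + 0 *\<^sub>R L w) within D1)"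
      using dc_derivative by simp
    show "((\<lambda>s. (0, \<zeta> p + s *\<^sub>R L w)) has_vector_derivative (0, L w)) (at 0)"
      unfolding has_vector_derivative_def by (auto intro!: derivative_eq_intros)
    show "((\<lambda>s. \<phi> p + s *\<^sub>R w) has_vector_derivative w) (at 0)"
      unfolding has_vector_derivative_def by (auto intro!: derivative_eq_intros)
    show "((\<lambda>v. v) has_derivative (\<lambda>v. v)) (at (\<phi> p + 0 *\<^sub>R w) within UNIV)" by (rule has_derivative_ident)
    fix s assume s: "s \<in> ?J"
    show "ch1 (0, \<zeta> p + s *\<^sub>R L w) = \<phi> p + s *\<^sub>R w"
      unfolding \<zeta>q[OF s, symmetric] using ch1_eq[OF conjunct1[OF q(1)[OF s]] e] c0[OF qC(1)[OF s]] q(1)[OF s] by simp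
  qed (use d in auto)
qed

text \<open>The limits of the three pullback identities as \<open>r \<rightarrow> 0\<close>. The value of the form at the centre on
  \<open>(cis t, 0)\<close> and \<open>(0, L w)\<close> does not depend on \<open>t\<close>, yet it changes sign under \<open>t \<mapsto> t + pi\<close>; so the radial
  vector \<open>n\<close> of the collar is normal to the horizon.\<close>

lemma surface_gravity_eq:
  assumes sg: "has_surface_gravity M g V C \<kappa>"
  shows "lam * \<kappa> = 1"
proof -
  have pb: "p \<in> bdry M" using comp component_subset by blast
  have \<kappa>0: "0 \<le> \<kappa>" by (rule boundary_gradient(2)[OF V_bdry pb sg comp(2)])
  obtain r\<^sub>1 where r\<^sub>1: "r\<^sub>1 > 0" "r\<^sub>1 \<le> \<epsilon>" "\<And>z. norm z < r\<^sub>1 \<Longrightarrow> \<Psi> (z, p) \<in> W"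
    "\<And>r. r \<in> {0..<r\<^sub>1} \<Longrightarrow> c (r, p) \<in> U"
    using small_radius by metis
  have rz: "of_real r * cis t \<in> ball 0 \<epsilon>" "\<Psi> (of_real r * cis t, p) \<in> W" if "r \<in> {0..<r\<^sub>1}" for r t
    using that r\<^sub>1(2) r\<^sub>1(3)[of "of_real r * cis t"] by (auto simp: norm_mult)
  have D2: "(of_real r * cis t, \<zeta> p) \<in> D2" if "r \<in> {0..<r\<^sub>1}" for r t
    by (rule in_D2[OF pUb rz[OF that]])
  have re: "r \<in> {0..<\<epsilon>}" if "r \<in> {0..<r\<^sub>1}" for r using that r\<^sub>1(2) by auto
  have D1: "(r, \<zeta> p) \<in> D1" if "r \<in> {0..<r\<^sub>1}" for r
    by (rule in_D1[OF pUb re[OF that] r\<^sub>1(4)[OF that]])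
  have C1: "Ck_on (Suc 0) D2 ch2" "Ck_on (Suc 0) D1 ch1"
    using smooth_ch1 smooth_ch2 unfolding smooth_on_def by blast+
  have cont_pulled: "continuous_on {0..<r\<^sub>1} (\<lambda>r. pulled_metric (of_real r * cis t) \<alpha> \<beta>)" for t \<alpha> \<beta>
  proof -
    let ?k = "\<lambda>r. (of_real r * cis t, \<zeta> p)"
    have k: "continuous_on {0..<r\<^sub>1} ?k" "?k ` {0..<r\<^sub>1} \<subseteq> D2"
      using D2 by (auto intro!: continuous_intros)
    have cK: "continuous_on {0..<r\<^sub>1} (\<lambda>r. K (of_real r * cis t) \<alpha>)" for \<alpha>
      unfolding K_def by (rule continuous_on_compose2[OF continuous_on_dd[OF C1(1)] k])
    have c2: "continuous_on {0..<r\<^sub>1} (\<lambda>r. ch2 (?k r))"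
      by (rule continuous_on_compose2[OF differentiable_imp_continuous_on[OF smooth_on_differentiable[OF smooth_ch2]] k])
    have c2W: "ch2 (?k r) = \<xi> (\<Psi> (of_real r * cis t, p))" if "r \<in> {0..<r\<^sub>1}" for r
      by (rule ch2_eq[OF pUb rz(1)[OF that]])
    have cG: "continuous_on {0..<r\<^sub>1} (\<lambda>r. G \<xi> (\<Psi> (of_real r * cis t, p)) i j)" for i j
    proof (rule continuous_on_eq)
      have "Ck_on 0 (\<xi> ` W) (\<lambda>x. loc W \<xi> G x i j)"
        using G(1) W(1) unfolding riemannian_metric_def Ck_metric_def by blast
      then have "continuous_on (\<xi> ` W) (\<lambda>x. loc W \<xi> G x i j)" by simp
      then show "continuous_on {0..<r\<^sub>1} (\<lambda>r. loc W \<xi> G (ch2 (?k r)) i j)"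
        by (rule continuous_on_compose2[OF _ c2]) (use c2W rz(2) in blast)
      fix r assume r: "r \<in> {0..<r\<^sub>1}"
      have "inv_into W \<xi> (\<xi> (\<Psi> (of_real r * cis t, p))) = \<Psi> (of_real r * cis t, p)"
        by (rule inv_into_f_f[OF chart_mapD(2)[OF smooth_manifold_chart(1)[OF X W(1)]] rz(2)[OF r]])
      then show "loc W \<xi> G (ch2 (?k r)) i j = G \<xi> (\<Psi> (of_real r * cis t, p)) i j"
        unfolding c2W[OF r] by (simp add: loc_def)
    qed
    show ?thesis
      unfolding pulled_metric_def
      by (rule continuous_on_bilinear_form[OF cG _ cK cK])
        (use inner_GX[OF rz(2)] in \<open>simp add: inner_form_def\<close>)
  qed
  have cont_ch1: "continuous_on {0..<r\<^sub>1} (\<lambda>r. (r, \<zeta> p))" "(\<lambda>r. (r, \<zeta> p)) ` {0..<r\<^sub>1} \<subseteq> D1"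
    using D1 by (auto intro!: continuous_intros)
  have ch1c: "ch1 (r, \<zeta> p) = \<phi> (c (r, p))" if "r \<in> {0..<r\<^sub>1}" for r
    by (rule ch1_eq[OF pUb re[OF that]])
  have cont_g: "continuous_on {0..<r\<^sub>1} (\<lambda>r. g \<phi> (c (r, p)) (dc r u) (dc r v))" for u v
  proof -
    have cd: "continuous_on {0..<r\<^sub>1} (\<lambda>r. dc r u)" for u
      unfolding dc_def by (rule continuous_on_compose2[OF continuous_on_dd[OF C1(2)] cont_ch1])
    have c1: "continuous_on {0..<r\<^sub>1} (\<lambda>r. ch1 (r, \<zeta> p))"
      by (rule continuous_on_compose2[OF differentiable_imp_continuous_on[OF smooth_on_differentiable[OF smooth_ch1]] cont_ch1])
    have cg: "continuous_on {0..<r\<^sub>1} (\<lambda>r. g \<phi> (c (r, p)) i j)" for i j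
    proof (rule continuous_on_eq)
      have "continuous_on (\<phi> ` U) (\<lambda>x. loc U \<phi> g x i j)"
        by (rule differentiable_imp_continuous_on[OF smooth_on_differentiable[OF smooth_loc[OF ch(1)]]])
      then show "continuous_on {0..<r\<^sub>1} (\<lambda>r. loc U \<phi> g (ch1 (r, \<zeta> p)) i j)"
        by (rule continuous_on_compose2[OF _ c1]) (use ch1c r\<^sub>1(4) in blast)
      fix r assume r: "r \<in> {0..<r\<^sub>1}"
      show "loc U \<phi> g (ch1 (r, \<zeta> p)) i j = g \<phi> (c (r, p)) i j"
        unfolding ch1c[OF r] loc_def using chart_inv[OF ch(1) r\<^sub>1(4)[OF r]] by simp
    qed
    show ?thesis
      by (rule continuous_on_bilinear_form[OF cg _ cd cd])
        (use inner_g[OF ch(1) r\<^sub>1(4)] in \<open>simp add: inner_form_def\<close>)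
  qed
  define n where "n = dc 0 (1, 0)"
  have I0: "0 \<in> {0..<r\<^sub>1}" using r\<^sub>1 by simp
  have cp0: "c (0, p) = p" by (rule c0[OF comp(2)])
  note at0 = at_within_atLeastLessThan[OF r\<^sub>1(1), symmetric]
  have n_deriv: "((\<lambda>r. ch1 (r, \<zeta> p)) has_vector_derivative n) (at 0 within {0..<r\<^sub>1})"
  proof -
    have "((\<lambda>r. (r, \<zeta> p)) has_vector_derivative (1, 0)) (at 0 within {0..<r\<^sub>1})"
      unfolding has_vector_derivative_def by (auto intro!: derivative_eq_intros)
    from has_vector_derivative_along[OF _ this cont_ch1(2)] dc_derivative[OF D1[OF I0]]
    show ?thesis unfolding n_def by blast
  qed
  \<comment> \<open>\<open>V\<close> vanishes at \<open>p\<close>, so the quotient is a difference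
    quotient along the collar curve with velocity \<open>n\<close>.\<close>
  have V_lim: "((\<lambda>r. V (c (r, p)) / r) \<longlongrightarrow> dV U \<phi> p n) (at_right 0)"
  proof -
    have fd: "(V \<circ> inv_into U \<phi> has_derivative dV U \<phi> p) (at (ch1 (0, \<zeta> p)) within \<phi> ` U)"
      using has_derivative_pot[OF ch(1,2)] ch1c[OF I0] cp0 by simp
    have "(\<lambda>r. ch1 (r, \<zeta> p)) ` {0..<r\<^sub>1} \<subseteq> \<phi> ` U" using ch1c r\<^sub>1(4) by auto
    from has_vector_derivative_along[where c = "\<lambda>r. ch1 (r, \<zeta> p)", OF fd n_deriv this]
    have "((\<lambda>r. (V \<circ> inv_into U \<phi>) (ch1 (r, \<zeta> p))) has_vector_derivative dV U \<phi> p n) (at 0 within {0..<r\<^sub>1})" .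
    then have "((\<lambda>r. V (c (r, p))) has_vector_derivative dV U \<phi> p n) (at 0 within {0..<r\<^sub>1})"
      by (rule has_vector_derivative_transform[OF I0, rotated])
        (use ch1c chart_inv[OF ch(1) r\<^sub>1(4)] in simp)
    then have "((\<lambda>r. V (c (r, p))) has_real_derivative dV U \<phi> p n) (at 0 within {0..<r\<^sub>1})"
      by (simp add: has_real_derivative_iff_has_vector_derivative)
    then show ?thesis
      unfolding at0 has_field_derivative_iff using cp0 V_zero[OF pb] by simp
  qed
  have ids: "pulled_metric (of_real r * cis t) (\<i> * cis t, 0) (\<i> * cis t, 0) = lam\<^sup>2 * (V (c (r, p)) / r)\<^sup>2"
    "pulled_metric (of_real r * cis t) (cis t, 0) (cis t, 0) = g \<phi> (c (r, p)) (dc r (1, 0)) (dc r (1, 0))"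
    if "0 < r" "r < r\<^sub>1" for r t
    by (rule pullback_identities(1)[OF that r\<^sub>1(2)]; fact r\<^sub>1)
      (rule pullback_identities(2)[OF that r\<^sub>1(2)]; fact r\<^sub>1)
  have ids3: "pulled_metric (of_real r * cis t) (cis t, 0) (0, L w) = g \<phi> (c (r, p)) (dc r (1, 0)) (dc r (0, L w))"
    if "0 < r" "r < r\<^sub>1" "w \<bullet> b = 0" for r t w
    by (rule pullback_identities(3)[OF that(1,2) r\<^sub>1(2) _ _ that(3)]) (fact r\<^sub>1)+
  have lim_g: "((\<lambda>r. g \<phi> (c (r, p)) (dc r u) (dc r v)) \<longlongrightarrow> g \<phi> p (dc 0 u) (dc 0 v)) (at_right 0)" for u v
    unfolding at0 using cont_g[of u v] I0 cp0 by (force simp: continuous_on_def)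
  have A: "pulled_metric 0 (\<i> * cis t, 0) (\<i> * cis t, 0) = lam\<^sup>2 * (dV U \<phi> p n)\<^sup>2" for t
    using eq_at_left_endpoint[OF r\<^sub>1(1) cont_pulled tendsto_mult[OF tendsto_const tendsto_power[OF V_lim]], of t] ids(1)
    by simp
  have B: "pulled_metric 0 (cis t, 0) (cis t, 0) = g \<phi> p n n" for t
    using eq_at_left_endpoint[OF r\<^sub>1(1) cont_pulled lim_g, of t] ids(2) by (simp add: n_def)
  have Cc: "pulled_metric 0 (cis t, 0) (0, L w) = g \<phi> p n w" if w: "w \<bullet> b = 0" for t w
    using eq_at_left_endpoint[OF r\<^sub>1(1) cont_pulled lim_g, of t] ids3[OF _ _ w] dc_tangential[OF w]
    by (simp add: n_def)
  have lg: "linear (\<lambda>u. g \<phi> p u v)" "linear (g \<phi> p u)" for u v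
    using inner_formD(1,2)[OF inner_g[OF ch(1,2)]] by auto
  \<comment> \<open>The angular vector at angle 0 and the radial vector at angle pi / 2 are the same
    vector \<open>\<i>\<close> at the centre. This forces the angular and radial lengths to agree,
    which excludes a cone angle.\<close>
  have gn: "lam\<^sup>2 * (dV U \<phi> p n)\<^sup>2 = g \<phi> p n n"
    using A[of 0] B[of "pi / 2"] by simp
  have perp: "g \<phi> p n w = 0" if w: "w \<bullet> b = 0" for w
  proof -
    have W0: "\<Psi> (0, p) \<in> W" by (rule W(2))
    have linK: "linear (K 0)" using K_derivative[of 0] D2[OF I0, of 0] has_derivative_linear by auto
    have "K 0 (- 1, 0) = - K 0 (1, 0)" using linear_neg[OF linK, of "(1, 0)"] by simp
    then have "pulled_metric 0 (- 1, 0) (0, L w) = - pulled_metric 0 (1, 0) (0, L w)"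
      unfolding pulled_metric_def by (simp add: linear_neg[OF inner_formD(2)[OF inner_GX[OF W0]]])
    moreover have "pulled_metric 0 (- 1, 0) (0, L w) = g \<phi> p n w" "pulled_metric 0 (1, 0) (0, L w) = g \<phi> p n w"
      using Cc[OF w, of pi] Cc[OF w, of 0] by auto
    ultimately show ?thesis by simp
  qed
  have gpos: "0 < g \<phi> p n n"
    using B[of 0] inner_formD(4)[OF inner_GX[OF W(2)] K_nonzero] by (simp add: pulled_metric_def)
  have nb: "0 < n \<bullet> b"
  proof -
    \<comment> \<open>Otherwise \<open>n\<close> would be tangential and, by \<open>perp\<close>,
      orthogonal to itself.\<close>
    have "n \<bullet> b \<noteq> 0" using perp[of n] gpos by auto
    moreover have "0 \<le> n \<bullet> b"
    proof (rule nonneg_right_derivative[OF _ r\<^sub>1(1)])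
      have "bounded_linear (\<lambda>x. x \<bullet> b)" by (rule bounded_linear_inner_left)
      from bounded_linear.has_vector_derivative[OF this n_deriv]
      show "((\<lambda>r. ch1 (r, \<zeta> p) \<bullet> b) has_real_derivative n \<bullet> b) (at 0 within {0..<r\<^sub>1})"
        by (simp add: has_real_derivative_iff_has_vector_derivative)
      show "ch1 (0, \<zeta> p) \<bullet> b = 0" using ch1c[OF I0] cp0 bdry_face[OF ch(2) pb] by simp
      fix s assume s: "s \<in> {0..<r\<^sub>1}"
      have "\<phi> ` U \<subseteq> {x. 0 \<le> x \<bullet> b}" using ch(4) openin_imp_subset by blast
      then show "0 \<le> ch1 (s, \<zeta> p) \<bullet> b" unfolding ch1c[OF s] using r\<^sub>1(4)[OF s] by blast
    qed
    ultimately show ?thesis by simp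
  qed
  define \<nu> where "\<nu> = (1 / sqrt (g \<phi> p n n)) *\<^sub>R n"
  have "inward_unit_normal g U \<phi> p \<nu>"
    unfolding inward_unit_normal_def
  proof (intro bexI[of _ b] conjI allI impI)
    show "openin (top_of_set {x. 0 \<le> x \<bullet> b}) (\<phi> ` U)" "b \<in> Basis" by (rule ch)+
    show "\<phi> p \<bullet> b = 0" by (rule bdry_face[OF ch(2) pb])
    show "0 < \<nu> \<bullet> b" using nb gpos by (simp add: \<nu>_def)
    show "g \<phi> p \<nu> w = 0" if "w \<bullet> b = 0" for w using perp[OF that] by (simp add: \<nu>_def linear_scale[OF lg(1)])
    show "g \<phi> p \<nu> \<nu> = 1"
      using gpos by (simp add: \<nu>_def linear_scale[OF lg(1)] linear_scale[OF lg(2)] field_simps flip: real_sqrt_mult)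
  qed
  then have "dV U \<phi> p \<nu> = \<kappa>"
    using bspec[OF bspec[OF sg[unfolded has_surface_gravity_def] comp(2)] ch(1)] ch(2) by (simp add: dV_def)
  then have "dV U \<phi> p n = \<kappa> * sqrt (g \<phi> p n n)"
    using gpos by (simp add: \<nu>_def linear_scale[OF linear_dV[OF ch(1,2)]] field_simps)
  \<comment> \<open>The length of the collar vector cancels, so the result does not depend on the
    collar chosen in the collapse.\<close>
  then have "lam\<^sup>2 * \<kappa>\<^sup>2 * g \<phi> p n n = g \<phi> p n n"
    using gn gpos by (simp add: power_mult_distrib)
  then have "(lam * \<kappa>)\<^sup>2 = 1" using gpos by (simp add: power_mult_distrib)
  then show ?thesis using \<kappa>0 pos(1) by (simp add: power2_eq_1_iff) (smt (verit) mult_nonneg_nonneg)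
qed

end

text \<open>The atlas of \<open>bdry_mfd\<close> contains the boundary charts for every such
  \<open>L\<close>; one of them is needed to work with the boundary in coordinates.\<close>

lemma ex_face_isomorphism:
  assumes "b \<in> Basis"
  shows "\<exists>L :: real^3 \<Rightarrow> real^2. linear L \<and> bij_betw L {x. x \<bullet> b = 0} UNIV"
proof -
  let ?F = "{x :: real^3. x \<bullet> b = 0}"
  have "b \<noteq> 0" using assms nonzero_Basis by blast
  then have "dim {x. b \<bullet> x = 0} = 2" using dim_hyperplane[of b] by simp
  moreover have "{x. b \<bullet> x = 0} = ?F" by (simp add: inner_commute)
  ultimately have "dim ?F = dim (UNIV :: (real^2) set)" by simp
  moreover have "subspace ?F" by (auto simp: subspace_def inner_add_left)
  ultimately obtain L :: "real^3 \<Rightarrow> real^2" where "linear L" "L ` ?F = UNIV" "inj_on L ?F"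
    using subspace_isomorphism[of ?F "UNIV :: (real^2) set"] subspace_UNIV by blast
  then show ?thesis by (auto simp: bij_betw_def)
qed

section \<open>Conclusion\<close>

theorem surface_gravity_of_smooth_collapse:
  fixes M :: "('a, real^3) mfd" and X :: "('x, real^4) mfd"
  assumes M: "smooth_manifold M" "riemannian_metric M g" "defines_bdry M V"
    and C: "C \<in> connected_components_of (subtopology (mtop M) (bdry M))"
    and sg: "has_surface_gravity M g V C \<kappa>"
    and lam: "lam > 0" and col: "circle_collapse lam M X \<pi>" and G: "static_metric_smooth lam M g V X \<pi>"
  shows "lam * \<kappa> = 1"
proof -
  obtain G where G: "riemannian_metric X G" "is_static_metric lam M g V X \<pi> G"
    using G unfolding static_metric_smooth_def by blast
  \<comment> \<open>The claim is an identity between numbers, so it is read off at a single point of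
    the horizon.\<close>
  obtain p where p: "p \<in> C" using nonempty_connected_components_of[OF C] by blast
  then have pb: "p \<in> bdry M" using connected_components_of_subset[OF C] by auto
  obtain U \<phi> b where ch: "(U, \<phi>) \<in> atlas M" "p \<in> U" "b \<in> Basis"
    "openin (top_of_set {x. 0 \<le> x \<bullet> b}) (\<phi> ` U)" "\<phi> p \<bullet> b = 0"
    and face: "\<And>q. q \<in> U \<Longrightarrow> \<phi> q \<bullet> b = 0 \<Longrightarrow> q \<in> bdry M"
    by (rule bdry_chart[OF M(1) pb]) (rule that)
  obtain L :: "real^3 \<Rightarrow> real^2" where L: "linear L" "bij_betw L {x. x \<bullet> b = 0} UNIV"
    using ex_face_isomorphism[OF ch(3)] by blast
  have X: "smooth_manifold X"
    and q: "quotient_map (prod_topology (mtop (circle lam)) (mtop M)) (mtop X) \<pi>"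
    and id: "\<forall>s\<in>sphere 0 lam. \<forall>t\<in>sphere 0 lam. \<forall>p\<in>topspace (mtop M). \<forall>q\<in>topspace (mtop M).
        \<pi> (s, p) = \<pi> (t, q) \<longleftrightarrow> p = q \<and> (s = t \<or> p \<in> bdry M)"
    and \<pi>: "open_embedding (prod_mfd (circle lam) (inner_mfd M)) X \<pi>"
    and horizon: "\<forall>C\<in>connected_components_of (subtopology (mtop M) (bdry M)). \<exists>\<epsilon>>0. \<exists>c \<Psi>.
          open_embedding
            (prod_mfd (euclidean_mfd {0..<\<epsilon>}) (open_submfd (bdry_mfd M :: ('a, real^2) mfd) C)) M c \<and>
          (\<forall>p\<in>C. c (0, p) = p) \<and>
          open_embedding
            (prod_mfd (euclidean_mfd (ball (0::complex) \<epsilon>))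
              (open_submfd (bdry_mfd M :: ('a, real^2) mfd) C)) X \<Psi> \<and>
          (\<forall>r\<in>{0..<\<epsilon>}. \<forall>t. \<forall>p\<in>C. \<Psi> (of_real r * cis t, p) = \<pi> (of_real lam * cis t, c (r, p)))"
    using col unfolding circle_collapse_def by (iprover)+
  obtain \<epsilon> c \<Psi> where e: "\<epsilon> > 0" and
    c: "open_embedding
            (prod_mfd (euclidean_mfd {0..<\<epsilon>}) (open_submfd (bdry_mfd M :: ('a, real^2) mfd) C)) M c"
       "\<forall>p\<in>C. c (0, p) = p" and
    \<Psi>: "open_embedding
            (prod_mfd (euclidean_mfd (ball (0::complex) \<epsilon>))
              (open_submfd (bdry_mfd M :: ('a, real^2) mfd) C)) X \<Psi>" and
    polar: "\<forall>r\<in>{0..<\<epsilon>}. \<forall>t. \<forall>p\<in>C. \<Psi> (of_real r * cis t, p) = \<pi> (of_real lam * cis t, c (r, p))"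
    using bspec[OF horizon C] by (elim exE conjE) (rule that)
  have "continuous_map (prod_topology (mtop (circle lam)) (mtop M)) (mtop X) \<pi>"
    by (rule quotient_imp_continuous_map[OF q])
  interpret rp: riemannian_potential M g V
    by unfold_locales (use M in \<open>auto simp: defines_bdry_def\<close>)
  have "\<Psi> (0, p) \<in> topspace (mtop X)"
  proof -
    have "p \<in> topspace (mtop M)" using connected_components_of_subset[OF C] p by auto
    then have "(of_real lam * cis 0, c (0, p)) \<in> topspace (prod_topology (mtop (circle lam)) (mtop M))"
      using c(2) p lam by (simp add: circle_def)
    then have "\<pi> (of_real lam * cis 0, c (0, p)) \<in> topspace (mtop X)"
      using quotient_imp_continuous_map[OF q] by (auto simp: continuous_map_def)
    moreover have "\<Psi> (of_real 0 * cis 0, p) = \<pi> (of_real lam * cis 0, c (0, p))"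
      using polar e p by (metis atLeastLessThan_iff order_refl)
    ultimately show ?thesis by simp
  qed
  then obtain W \<xi> where W: "(W, \<xi>) \<in> atlas X" "\<Psi> (0, p) \<in> W"
    using X unfolding smooth_manifold_def by blast
  interpret horizon_collapse M g V lam \<epsilon> C p U \<phi> b L X \<pi> c \<Psi> G W \<xi>
  proof (intro horizon_collapse.intro horizon_collapse_axioms.intro)
    show "riemannian_potential M g V" ..
    show "\<pi> (s, q) = \<pi> (t, q)"
      if "s \<in> sphere 0 lam" "t \<in> sphere 0 lam" "q \<in> bdry M" "q \<in> topspace (mtop M)" for s t q
      using id that by blast
    show "\<Psi> (of_real r * cis t, q) = \<pi> (of_real lam * cis t, c (r, q))"
      if "r \<in> {0..<\<epsilon>}" "q \<in> C" for r t q using polar that by blast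
    show "c (0, q) = q" if "q \<in> C" for q using c(2) that by blast
    show "q \<in> bdry M" if "q \<in> U" "\<phi> q \<bullet> b = 0" for q using face that by blast
  qed fact+
  show ?thesis by (rule surface_gravity_eq[OF sg])
qed

theorem corollary1p7:
  fixes M :: "('a, real^3) mfd" and g :: "('a, real^3) metric_field" and V :: "'a \<Rightarrow> real"
    and J :: nat and H :: "nat \<Rightarrow> 'a set" and \<kappa> :: real
  assumes "ALH_static_system M g V sphere2 round_metric 1 J H"
    and "\<forall>j\<in>{2..J}. euler_characteristic (subtopology (mtop M) (H j)) \<le> 0"
    and "\<forall>j\<in>{1..J}. has_surface_gravity M g V (H j) \<kappa>"
  shows "(\<forall>lam>0. \<forall>(X :: ('x, real^4) mfd) \<pi>.
            circle_collapse lam M X \<pi> \<and> static_metric_smooth lam M g V X \<pi> \<longrightarrow>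
            lam = inverse \<kappa> \<and> inverse \<kappa> \<le> inverse (sqrt 3))
       \<and> (\<forall>lam > inverse (sqrt 3). \<not> (\<exists>(X :: ('x, real^4) mfd) \<pi> G.
            circle_collapse lam M X \<pi> \<and> is_static_metric lam M g V X \<pi> G \<and>
            poincare_einstein_filling X G (prod_mfd sphere2 (circle lam))
              (product_metric (\<lambda>_. 1) round_metric (\<lambda>_. 1) flat_metric)))"
proof -
  interpret A: ALH_static_system M g V sphere2 round_metric 1 J H by (rule assms(1))
  have "sqrt 3 \<le> \<kappa>" using surface_gravity_ge[OF assms(1)] assms(3) by blast
  then have le: "inverse \<kappa> \<le> inverse (sqrt 3)" by (intro le_imp_inverse_le) auto
  have H1: "H 1 \<in> connected_components_of (subtopology (mtop M) (bdry M))" "1 \<in> {1..J}"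
    using A.horizons by (auto simp: bij_betw_def)
  have smooth: "lam = inverse \<kappa> \<and> inverse \<kappa> \<le> inverse (sqrt 3)"
    if "lam > 0" "circle_collapse lam M X \<pi>" "static_metric_smooth lam M g V X \<pi>"
    for lam and X :: "('x, real^4) mfd" and \<pi>
  proof -
    have "lam * \<kappa> = 1"
      using surface_gravity_of_smooth_collapse[OF A.manifold A.metric A.potential H1(1) _ that]
        assms(3) H1(2) by blast
    then have "lam = inverse \<kappa>" by (metis inverse_unique mult.commute)
    then show ?thesis using le by blast
  qed
  show ?thesis
  proof (intro conjI allI impI)
    show "lam = inverse \<kappa>" "inverse \<kappa> \<le> inverse (sqrt 3)"
      if "lam > 0" "circle_collapse lam M X \<pi> \<and> static_metric_smooth lam M g V X \<pi>"
      for lam and X :: "('x, real^4) mfd" and \<pi>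
      using smooth[of lam X \<pi>] that by blast+
    fix lam :: real assume lam: "lam > inverse (sqrt 3)"
    show "\<not> (\<exists>(X :: ('x, real^4) mfd) \<pi> G.
            circle_collapse lam M X \<pi> \<and> is_static_metric lam M g V X \<pi> G \<and>
            poincare_einstein_filling X G (prod_mfd sphere2 (circle lam))
              (product_metric (\<lambda>_. 1) round_metric (\<lambda>_. 1) flat_metric))"
    proof
      assume "\<exists>(X :: ('x, real^4) mfd) \<pi> G.
            circle_collapse lam M X \<pi> \<and> is_static_metric lam M g V X \<pi> G \<and>
            poincare_einstein_filling X G (prod_mfd sphere2 (circle lam))
              (product_metric (\<lambda>_. 1) round_metric (\<lambda>_. 1) flat_metric)"
      then obtain X :: "('x, real^4) mfd" and \<pi> G where
        X: "circle_collapse lam M X \<pi>" "is_static_metric lam M g V X \<pi> G" "riemannian_metric X G"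
        unfolding poincare_einstein_filling_def by blast
      \<comment> \<open>A filling carries a smooth metric \<open>G\<close> on all of
        \<open>X\<close>, so a filling obtained from the static metric is in particular a smooth
        extension, and the first part bounds \<open>lam\<close>.\<close>
      have "static_metric_smooth lam M g V X \<pi>" unfolding static_metric_smooth_def using X by blast
      moreover have "0 < lam" using lam by (smt (verit) inverse_positive_iff_positive real_sqrt_gt_0_iff)
      ultimately have "lam \<le> inverse (sqrt 3)" using smooth[of lam X \<pi>] X(1) by simp
      then show False using lam by simp
    qed
  qed
qed

end
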